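(* Let $d\ge 1$ be an integer and let $\mathcal{M}$ be a $d$-cluster tilting subcategory of an abelian length category $\mathcal{A}$. Suppose that a subcategory $\mathcal{U}\subseteq\mathcal{M}$ is closed under $d$-extensions with indecomposable end terms and under all $d$-quotients. Then $\mathcal{U}$ is closed under all $d$-extensions.
   Context: Conventions: $\mathcal{A}$ is an essentially small abelian category in which every object has finite length. All subcategories are full and closed under isomorphisms, finite direct sums and direct summands. A subcategory $\mathcal{X}\subseteq\mathcal{A}$ is generating (cogenerating) if every object of $\mathcal{A}$ is a quotient of (a subobject of) an object of $\mathcal{X}$. A left $\mathcal{X}$-approximation of $Y\in\mathcal{A}$ is a morphism $Y\to X$ with $X\in\mathcal{X}$ through which every morphism from $Y$ to an object of $\mathcal{X}$ factors; right $\mathcal{X}$-approximations are dual. $\mathcal{X}$ is functorially finite if every object of $\mathcal{A}$ admits a left and a right $\mathcal{X}$-approximation. A functorially finite generating-cogenerating subcategory $\mathcal{M}\subseteq\mathcal{A}$ is $d$-cluster tilting if $$\mathcal{M}=\{X\in\mathcal{A}\mid \operatorname{Ext}^i_{\mathcal{A}}(X,M)=0 \ \forall M\in\mathcal{M},\ 1\le i\le d-1\}=\{Y\in\mathcal{A}\mid \operatorname{Ext}^i_{\mathcal{A}}(M,Y)=0\ \forall M\in\mathcal{M},\ 1\le i\le d-1\}.$$ A $d$-cokernel of a morphism $f_0\colon X_0\to X_1$ in $\mathcal{M}$ is a sequence $X_1\xrightarrow{f_1}X_2\to\cdots\xrightarrow{f_d}X_{d+1}\to 0$ in $\mathcal{M}$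 such that for every $M\in\mathcal{M}$ the sequence $0\to\operatorname{Hom}(X_{d+1},M)\to\cdots\to\operatorname{Hom}(X_1,M)\to\operatorname{Hom}(X_0,M)$ is exact. $d$-kernels are defined dually. A $d$-extension in $\mathcal{M}$ is a sequence $0\to X_0\xrightarrow{f_0}X_1\to\cdots\to X_d\xrightarrow{f_d}X_{d+1}\to0$ in $\mathcal{M}$ such that $(f_1,\dots,f_d)$ is a $d$-cokernel of $f_0$ and $(f_0,\dots,f_{d-1})$ is a $d$-kernel of $f_d$. Its end terms are $X_0$ and $X_{d+1}$. Two $d$-extensions with the same end terms are equivalent if there is a morphism of complexes from the first to the second that is the identity on both end terms (this is an equivalence relation for $d$-cluster tilting $\mathcal{M}$). A subcategory $\mathcal{U}\subseteq\mathcal{M}$ is closed under (all) $d$-extensions if every $d$-extension $0\to X\to E_1\to\cdots\to E_d\to Y\to0$ in $\mathcal{M}$ with $X,Y\in\mathcal{U}$ is equivalent to a $d$-extension $0\to X\to E_1'\to\cdots\to E_d'\to Y\to 0$ with all terms in $\mathcal{U}$; it is closed under $d$-extensions with indecomposable end terms if this holds whenever $X,Y\in\mathcal{U}$ are both indecomposable. It is closed under $d$-quotients if every morphism $f\colon M\to U$ in $\mathcal{M}$ with $U\in\mathcal{U}$ admits a $d$-cokernel $U\to E_1\to\cdots\to E_d\to0$ with $E_i\in\mathcal{U}$ for all $1\le i\le d$. *)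

theory Defs
  imports "HOL-Algebra.Coset"
begin

section \<open>Abelian length categories\<close>

text \<open>
  \<open>Plus\<close>, \<open>Zer\<close> are the addition and the zero morphisms of the hom-groups; \<open>g \<cdot> f\<close> is the
  composite "first \<open>f\<close>, then \<open>g\<close>".  All fields are meaningful only on objects, arrows, composable
  pairs and parallel pairs.  Objects and arrows form sets, so every such category is small.
\<close>

record ('o, 'm) acat =
  Obj :: "'o set"
  Arr :: "'m set"
  Dom :: "'m \<Rightarrow> 'o"
  Cod :: "'m \<Rightarrow> 'o"
  Ident :: "'o \<Rightarrow> 'm"
  Comp :: "'m \<Rightarrow> 'm \<Rightarrow> 'm"  (infixr "\<cdot>\<index>" 70)
  Plus :: "'m \<Rightarrow> 'm \<Rightarrow> 'm"  (infixl "\<boxplus>\<index>" 65)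
  Zer :: "'o \<Rightarrow> 'o \<Rightarrow> 'm"

definition Hom :: "('o, 'm, 'z) acat_scheme \<Rightarrow> 'o \<Rightarrow> 'o \<Rightarrow> 'm set"
  where "Hom C A B = {f \<in> Arr C. Dom C f = A \<and> Cod C f = B}"

definition hom_group :: "('o, 'm, 'z) acat_scheme \<Rightarrow> 'o \<Rightarrow> 'o \<Rightarrow> 'm monoid"
  where "hom_group C A B = \<lparr>carrier = Hom C A B, monoid.mult = Plus C, one = Zer C A B\<rparr>"

locale category =
  fixes C :: "('o, 'm, 'z) acat_scheme" (structure)
  assumes Dom_Obj: "f \<in> Arr C \<Longrightarrow> Dom C f \<in> Obj C"
    and Cod_Obj: "f \<in> Arr C \<Longrightarrow> Cod C f \<in> Obj C"
    and Ident_Hom: "A \<in> Obj C \<Longrightarrow> Ident C A \<in> Hom C A A"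
    and Comp_Hom: "\<lbrakk>f \<in> Hom C A B; g \<in> Hom C B D\<rbrakk> \<Longrightarrow> g \<cdot> f \<in> Hom C A D"
    and Comp_assoc: "\<lbrakk>f \<in> Hom C A B; g \<in> Hom C B D; h \<in> Hom C D E\<rbrakk>
      \<Longrightarrow> (h \<cdot> g) \<cdot> f = h \<cdot> (g \<cdot> f)"
    and Comp_Ident_right: "f \<in> Hom C A B \<Longrightarrow> f \<cdot> Ident C A = f"
    and Comp_Ident_left: "f \<in> Hom C A B \<Longrightarrow> Ident C B \<cdot> f = f"

locale preadditive_category = category +
  assumes hom_comm_group: "\<lbrakk>A \<in> Obj C; B \<in> Obj C\<rbrakk> \<Longrightarrow> comm_group (hom_group C A B)"
    and Comp_Plus_right: "\<lbrakk>f \<in> Hom C A B; f' \<in> Hom C A B; g \<in> Hom C B D\<rbrakk>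
      \<Longrightarrow> g \<cdot> (f \<boxplus> f') = (g \<cdot> f) \<boxplus> (g \<cdot> f')"
    and Comp_Plus_left: "\<lbrakk>f \<in> Hom C A B; g \<in> Hom C B D; g' \<in> Hom C B D\<rbrakk>
      \<Longrightarrow> (g \<boxplus> g') \<cdot> f = (g \<cdot> f) \<boxplus> (g' \<cdot> f)"

definition is_mono :: "('o, 'm, 'z) acat_scheme \<Rightarrow> 'm \<Rightarrow> bool"
  where "is_mono C f \<longleftrightarrow> f \<in> Arr C \<and>
    (\<forall>A. \<forall>g \<in> Hom C A (Dom C f). \<forall>h \<in> Hom C A (Dom C f). f \<cdot> g = f \<cdot> h \<longrightarrow> g = h)"
  for C (structure)

definition is_epi :: "('o, 'm, 'z) acat_scheme \<Rightarrow> 'm \<Rightarrow> bool"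
  where "is_epi C f \<longleftrightarrow> f \<in> Arr C \<and>
    (\<forall>A. \<forall>g \<in> Hom C (Cod C f) A. \<forall>h \<in> Hom C (Cod C f) A. g \<cdot> f = h \<cdot> f \<longrightarrow> g = h)"
  for C (structure)

definition is_iso :: "('o, 'm, 'z) acat_scheme \<Rightarrow> 'm \<Rightarrow> bool"
  where "is_iso C f \<longleftrightarrow> f \<in> Arr C \<and>
    (\<exists>g \<in> Hom C (Cod C f) (Dom C f). g \<cdot> f = Ident C (Dom C f) \<and> f \<cdot> g = Ident C (Cod C f))"
  for C (structure)

definition isomorphic :: "('o, 'm, 'z) acat_scheme \<Rightarrow> 'o \<Rightarrow> 'o \<Rightarrow> bool"
  where "isomorphic C A B \<longleftrightarrow> (\<exists>f \<in> Hom C A B. is_iso C f)"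

definition zero_object :: "('o, 'm, 'z) acat_scheme \<Rightarrow> 'o \<Rightarrow> bool"
  where "zero_object C Z \<longleftrightarrow> Z \<in> Obj C \<and>
    (\<forall>A \<in> Obj C. (\<exists>!f. f \<in> Hom C Z A) \<and> (\<exists>!f. f \<in> Hom C A Z))"

definition is_kernel :: "('o, 'm, 'z) acat_scheme \<Rightarrow> 'm \<Rightarrow> 'm \<Rightarrow> bool"
  where "is_kernel C f k \<longleftrightarrow> f \<in> Arr C \<and> k \<in> Arr C \<and> Cod C k = Dom C f \<and>
    f \<cdot> k = Zer C (Dom C k) (Cod C f) \<and>
    (\<forall>A. \<forall>g \<in> Hom C A (Dom C f). f \<cdot> g = Zer C A (Cod C f) \<longrightarrow>
      (\<exists>!h. h \<in> Hom C A (Dom C k) \<and> k \<cdot> h = g))"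
  for C (structure)

definition is_cokernel :: "('o, 'm, 'z) acat_scheme \<Rightarrow> 'm \<Rightarrow> 'm \<Rightarrow> bool"
  where "is_cokernel C f q \<longleftrightarrow> f \<in> Arr C \<and> q \<in> Arr C \<and> Dom C q = Cod C f \<and>
    q \<cdot> f = Zer C (Dom C f) (Cod C q) \<and>
    (\<forall>A. \<forall>g \<in> Hom C (Cod C f) A. g \<cdot> f = Zer C (Dom C f) A \<longrightarrow>
      (\<exists>!h. h \<in> Hom C (Cod C q) A \<and> h \<cdot> q = g))"
  for C (structure)

definition is_biproduct ::
    "('o, 'm, 'z) acat_scheme \<Rightarrow> 'o \<Rightarrow> 'o \<Rightarrow> 'o \<Rightarrow> 'm \<Rightarrow> 'm \<Rightarrow> 'm \<Rightarrow> 'm \<Rightarrow> bool"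
  where "is_biproduct C A B P i j p q \<longleftrightarrow>
    A \<in> Obj C \<and> B \<in> Obj C \<and> P \<in> Obj C \<and>
    i \<in> Hom C A P \<and> j \<in> Hom C B P \<and> p \<in> Hom C P A \<and> q \<in> Hom C P B \<and>
    p \<cdot> i = Ident C A \<and> q \<cdot> j = Ident C B \<and>
    q \<cdot> i = Zer C A B \<and> p \<cdot> j = Zer C B A \<and>
    (i \<cdot> p) \<boxplus> (j \<cdot> q) = Ident C P"
  for C (structure)

definition is_direct_sum :: "('o, 'm, 'z) acat_scheme \<Rightarrow> 'o \<Rightarrow> 'o \<Rightarrow> 'o \<Rightarrow> bool"
  where "is_direct_sum C A B P \<longleftrightarrow> (\<exists>i j p q. is_biproduct C A B P i j p q)"

locale abelian_category = preadditive_category +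
  assumes ex_zero_object: "\<exists>Z. zero_object C Z"
    and ex_direct_sum: "\<lbrakk>A \<in> Obj C; B \<in> Obj C\<rbrakk> \<Longrightarrow> \<exists>P. is_direct_sum C A B P"
    and ex_kernel: "f \<in> Arr C \<Longrightarrow> \<exists>k. is_kernel C f k"
    and ex_cokernel: "f \<in> Arr C \<Longrightarrow> \<exists>q. is_cokernel C f q"
    and mono_normal: "is_mono C f \<Longrightarrow> \<exists>g. is_kernel C g f"
    and epi_conormal: "is_epi C f \<Longrightarrow> \<exists>g. is_cokernel C g f"

definition simple_object :: "('o, 'm, 'z) acat_scheme \<Rightarrow> 'o \<Rightarrow> bool"
  where "simple_object C S \<longleftrightarrow> S \<in> Obj C \<and> \<not> zero_object C S \<and>
    (\<forall>m. is_mono C m \<and> Cod C m = S \<longrightarrow> zero_object C (Dom C m) \<or> is_iso C m)"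

text \<open>A composition series \<open>0 = Z 0 \<subseteq> Z 1 \<subseteq> \<dots> \<subseteq> Z n = X\<close> with simple factors.\<close>

definition finite_length :: "('o, 'm, 'z) acat_scheme \<Rightarrow> 'o \<Rightarrow> bool"
  where "finite_length C X \<longleftrightarrow>
    (\<exists>(n::nat) Z m. zero_object C (Z 0) \<and> Z n = X \<and>
      (\<forall>i<n. m i \<in> Hom C (Z i) (Z (Suc i)) \<and> is_mono C (m i) \<and>
        (\<exists>q. is_cokernel C (m i) q \<and> simple_object C (Cod C q))))"

locale abelian_length_category = abelian_category +
  assumes finite_length: "X \<in> Obj C \<Longrightarrow> finite_length C X"

definition indecomposable :: "('o, 'm, 'z) acat_scheme \<Rightarrow> 'o \<Rightarrow> bool"
  where "indecomposable C X \<longleftrightarrow> X \<in> Obj C \<and> \<not> zero_object C X \<and>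
    (\<forall>A B. is_direct_sum C A B X \<longrightarrow> zero_object C A \<or> zero_object C B)"


section \<open>Yoneda extensions\<close>

definition is_image :: "('o, 'm, 'z) acat_scheme \<Rightarrow> 'm \<Rightarrow> 'm \<Rightarrow> bool"
  where "is_image C f k \<longleftrightarrow> (\<exists>q. is_cokernel C f q \<and> is_kernel C q k)"

definition exact_at :: "('o, 'm, 'z) acat_scheme \<Rightarrow> 'm \<Rightarrow> 'm \<Rightarrow> bool"
  where "exact_at C f g \<longleftrightarrow> Cod C f = Dom C g \<and> (\<exists>k. is_image C f k \<and> is_kernel C g k)"

text \<open>
  A sequence \<open>X 0 \<rightarrow> X 1 \<rightarrow> \<dots> \<rightarrow> X (n + 1)\<close> with maps \<open>f i : X i \<rightarrow> X (i + 1)\<close> for \<open>i \<le> n\<close> is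
  given by functions \<open>X\<close>, \<open>f\<close> on the natural numbers, whose values at larger indices are irrelevant.
\<close>

type_synonym ('o, 'm) sequ = "(nat \<Rightarrow> 'o) \<times> (nat \<Rightarrow> 'm)"

definition is_sequ :: "('o, 'm, 'z) acat_scheme \<Rightarrow> nat \<Rightarrow> (nat \<Rightarrow> 'o) \<Rightarrow> (nat \<Rightarrow> 'm) \<Rightarrow> bool"
  where "is_sequ C n X f \<longleftrightarrow>
    (\<forall>i \<le> Suc n. X i \<in> Obj C) \<and> (\<forall>i \<le> n. f i \<in> Hom C (X i) (X (Suc i)))"

text \<open>A morphism of complexes which is the identity on both end terms.\<close>

definition end_fixing_map ::
    "('o, 'm, 'z) acat_scheme \<Rightarrow> nat \<Rightarrow> ('o, 'm) sequ \<Rightarrow> ('o, 'm) sequ \<Rightarrow> bool"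
  where "end_fixing_map C n = (\<lambda>(X, f) (Y, g).
    X 0 = Y 0 \<and> X (Suc n) = Y (Suc n) \<and>
    (\<exists>\<phi>. (\<forall>i \<le> Suc n. \<phi> i \<in> Hom C (X i) (Y i)) \<and>
      (\<forall>i \<le> n. \<phi> (Suc i) \<cdot> f i = g i \<cdot> \<phi> i) \<and>
      \<phi> 0 = Ident C (X 0) \<and> \<phi> (Suc n) = Ident C (X (Suc n))))"
  for C (structure)

text \<open>Exact sequences \<open>0 \<rightarrow> Y \<rightarrow> E 1 \<rightarrow> \<dots> \<rightarrow> E n \<rightarrow> X \<rightarrow> 0\<close>.\<close>

definition yoneda_exts :: "('o, 'm, 'z) acat_scheme \<Rightarrow> nat \<Rightarrow> 'o \<Rightarrow> 'o \<Rightarrow> ('o, 'm) sequ set"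
  where "yoneda_exts C n X Y = {(E, f). is_sequ C n E f \<and> E 0 = Y \<and> E (Suc n) = X \<and>
    is_mono C (f 0) \<and> is_epi C (f n) \<and> (\<forall>i<n. exact_at C (f i) (f (Suc i)))}"

definition yoneda_rel ::
    "('o, 'm, 'z) acat_scheme \<Rightarrow> nat \<Rightarrow> 'o \<Rightarrow> 'o \<Rightarrow> (('o, 'm) sequ \<times> ('o, 'm) sequ) set"
  where "yoneda_rel C n X Y = {(\<xi>, \<zeta>). \<xi> \<in> yoneda_exts C n X Y \<and> \<zeta> \<in> yoneda_exts C n X Y \<and>
    equivclp (\<lambda>\<alpha> \<beta>. \<alpha> \<in> yoneda_exts C n X Y \<and> \<beta> \<in> yoneda_exts C n X Y \<and>
      end_fixing_map C n \<alpha> \<beta>) \<xi> \<zeta>}"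

definition Ext :: "('o, 'm, 'z) acat_scheme \<Rightarrow> nat \<Rightarrow> 'o \<Rightarrow> 'o \<Rightarrow> ('o, 'm) sequ set set"
  where "Ext C n X Y = yoneda_exts C n X Y // yoneda_rel C n X Y"

text \<open>
  The neutral element for the Baer sum on \<open>Ext\<close> in degrees \<open>n \<ge> 1\<close> is the class of
  \<open>0 \<rightarrow> Y \<rightarrow> Y \<oplus> X \<rightarrow> X \<rightarrow> 0\<close> for \<open>n = 1\<close>, and of
  \<open>0 \<rightarrow> Y = Y \<rightarrow> 0 \<rightarrow> \<dots> \<rightarrow> 0 \<rightarrow> X = X \<rightarrow> 0\<close> for \<open>n \<ge> 2\<close>.
\<close>

definition trivial_ext ::
    "('o, 'm, 'z) acat_scheme \<Rightarrow> nat \<Rightarrow> 'o \<Rightarrow> 'o \<Rightarrow> ('o, 'm) sequ \<Rightarrow> bool"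
  where "trivial_ext C n X Y = (\<lambda>(E, f). (E, f) \<in> yoneda_exts C n X Y \<and>
    (if n = 1 then \<exists>j p. is_biproduct C Y X (E 1) (f 0) j p (f 1)
     else E 1 = Y \<and> f 0 = Ident C Y \<and> E n = X \<and> f n = Ident C X \<and>
       (\<forall>i. 1 < i \<and> i < n \<longrightarrow> zero_object C (E i)) \<and>
       (\<forall>i. 1 \<le> i \<and> i < n \<longrightarrow> f i = Zer C (E i) (E (Suc i)))))"

definition Ext_zero :: "('o, 'm, 'z) acat_scheme \<Rightarrow> nat \<Rightarrow> 'o \<Rightarrow> 'o \<Rightarrow> ('o, 'm) sequ set"
  where "Ext_zero C n X Y = yoneda_rel C n X Y `` {\<xi>. trivial_ext C n X Y \<xi>}"

abbreviation Ext_vanishes :: "('o, 'm, 'z) acat_scheme \<Rightarrow> nat \<Rightarrow> 'o \<Rightarrow> 'o \<Rightarrow> bool"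
  where "Ext_vanishes C n X Y \<equiv> Ext C n X Y = {Ext_zero C n X Y}"


section \<open>Cluster tilting subcategories\<close>

text \<open>
  A full subcategory is given by its set of objects.  Closure under finite direct sums includes the
  empty sum, i.e. zero objects.
\<close>

definition subcategory :: "('o, 'm, 'z) acat_scheme \<Rightarrow> 'o set \<Rightarrow> bool"
  where "subcategory C \<X> \<longleftrightarrow> \<X> \<subseteq> Obj C \<and>
    (\<forall>A \<in> \<X>. \<forall>B. isomorphic C A B \<longrightarrow> B \<in> \<X>) \<and>
    (\<forall>Z. zero_object C Z \<longrightarrow> Z \<in> \<X>) \<and>
    (\<forall>A \<in> \<X>. \<forall>B \<in> \<X>. \<forall>P. is_direct_sum C A B P \<longrightarrow> P \<in> \<X>) \<and>
    (\<forall>A B. \<forall>P \<in> \<X>. is_direct_sum C A B P \<longrightarrow> A \<in> \<X> \<and> B \<in> \<X>)"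

definition generating :: "('o, 'm, 'z) acat_scheme \<Rightarrow> 'o set \<Rightarrow> bool"
  where "generating C \<X> \<longleftrightarrow> (\<forall>A \<in> Obj C. \<exists>X \<in> \<X>. \<exists>e \<in> Hom C X A. is_epi C e)"

definition cogenerating :: "('o, 'm, 'z) acat_scheme \<Rightarrow> 'o set \<Rightarrow> bool"
  where "cogenerating C \<X> \<longleftrightarrow> (\<forall>A \<in> Obj C. \<exists>X \<in> \<X>. \<exists>m \<in> Hom C A X. is_mono C m)"

definition left_approximation :: "('o, 'm, 'z) acat_scheme \<Rightarrow> 'o set \<Rightarrow> 'o \<Rightarrow> 'm \<Rightarrow> bool"
  where "left_approximation C \<X> Y f \<longleftrightarrow> (\<exists>X \<in> \<X>. f \<in> Hom C Y X \<and>
    (\<forall>X' \<in> \<X>. \<forall>g \<in> Hom C Y X'. \<exists>h \<in> Hom C X X'. g = h \<cdot> f))"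
  for C (structure)

definition right_approximation :: "('o, 'm, 'z) acat_scheme \<Rightarrow> 'o set \<Rightarrow> 'o \<Rightarrow> 'm \<Rightarrow> bool"
  where "right_approximation C \<X> Y f \<longleftrightarrow> (\<exists>X \<in> \<X>. f \<in> Hom C X Y \<and>
    (\<forall>X' \<in> \<X>. \<forall>g \<in> Hom C X' Y. \<exists>h \<in> Hom C X' X. g = f \<cdot> h))"
  for C (structure)

definition functorially_finite :: "('o, 'm, 'z) acat_scheme \<Rightarrow> 'o set \<Rightarrow> bool"
  where "functorially_finite C \<X> \<longleftrightarrow>
    (\<forall>Y \<in> Obj C. (\<exists>f. left_approximation C \<X> Y f) \<and> (\<exists>f. right_approximation C \<X> Y f))"

definition cluster_tilting :: "('o, 'm, 'z) acat_scheme \<Rightarrow> nat \<Rightarrow> 'o set \<Rightarrow> bool"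
  where "cluster_tilting C d \<M> \<longleftrightarrow>
    subcategory C \<M> \<and> functorially_finite C \<M> \<and> generating C \<M> \<and> cogenerating C \<M> \<and>
    \<M> = {X \<in> Obj C. \<forall>M \<in> \<M>. \<forall>i. 1 \<le> i \<and> i \<le> d - 1 \<longrightarrow> Ext_vanishes C i X M} \<and>
    \<M> = {Y \<in> Obj C. \<forall>M \<in> \<M>. \<forall>i. 1 \<le> i \<and> i \<le> d - 1 \<longrightarrow> Ext_vanishes C i M Y}"


section \<open>Higher extensions\<close>

definition is_sequ_in ::
    "('o, 'm, 'z) acat_scheme \<Rightarrow> 'o set \<Rightarrow> nat \<Rightarrow> (nat \<Rightarrow> 'o) \<Rightarrow> (nat \<Rightarrow> 'm) \<Rightarrow> bool"
  where "is_sequ_in C \<M> n X f \<longleftrightarrow> is_sequ C n X f \<and> (\<forall>i \<le> Suc n. X i \<in> \<M>)"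

text \<open>
  \<open>(f 1, \<dots>, f d)\<close> is a \<open>d\<close>-cokernel of \<open>f 0\<close> in \<open>\<M>\<close>: exactness of
  \<open>0 \<rightarrow> Hom(X (d + 1), M) \<rightarrow> \<dots> \<rightarrow> Hom(X 1, M) \<rightarrow> Hom(X 0, M)\<close>, with \<^const>\<open>kernel\<close> the kernel of a
  group homomorphism.
\<close>

definition d_cokernel ::
    "('o, 'm, 'z) acat_scheme \<Rightarrow> 'o set \<Rightarrow> nat \<Rightarrow> (nat \<Rightarrow> 'o) \<Rightarrow> (nat \<Rightarrow> 'm) \<Rightarrow> bool"
  where "d_cokernel C \<M> d X f \<longleftrightarrow> is_sequ_in C \<M> d X f \<and>
    (\<forall>M \<in> \<M>. inj_on (\<lambda>g. g \<cdot> f d) (Hom C (X (Suc d)) M) \<and>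
      (\<forall>i<d. kernel (hom_group C (X (Suc i)) M) (hom_group C (X i) M) (\<lambda>g. g \<cdot> f i)
        = (\<lambda>g. g \<cdot> f (Suc i)) ` Hom C (X (Suc (Suc i))) M))"
  for C (structure)

text \<open>
  \<open>(f 0, \<dots>, f (d - 1))\<close> is a \<open>d\<close>-kernel of \<open>f d\<close> in \<open>\<M>\<close>: exactness of
  \<open>0 \<rightarrow> Hom(M, X 0) \<rightarrow> \<dots> \<rightarrow> Hom(M, X d) \<rightarrow> Hom(M, X (d + 1))\<close>.
\<close>

definition d_kernel ::
    "('o, 'm, 'z) acat_scheme \<Rightarrow> 'o set \<Rightarrow> nat \<Rightarrow> (nat \<Rightarrow> 'o) \<Rightarrow> (nat \<Rightarrow> 'm) \<Rightarrow> bool"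
  where "d_kernel C \<M> d X f \<longleftrightarrow> is_sequ_in C \<M> d X f \<and>
    (\<forall>M \<in> \<M>. inj_on (\<lambda>g. f 0 \<cdot> g) (Hom C M (X 0)) \<and>
      (\<forall>i<d. kernel (hom_group C M (X (Suc i))) (hom_group C M (X (Suc (Suc i))))
          (\<lambda>g. f (Suc i) \<cdot> g)
        = (\<lambda>g. f i \<cdot> g) ` Hom C M (X i)))"
  for C (structure)

definition d_extension ::
    "('o, 'm, 'z) acat_scheme \<Rightarrow> 'o set \<Rightarrow> nat \<Rightarrow> (nat \<Rightarrow> 'o) \<Rightarrow> (nat \<Rightarrow> 'm) \<Rightarrow> bool"
  where "d_extension C \<M> d X f \<longleftrightarrow> d_cokernel C \<M> d X f \<and> d_kernel C \<M> d X f"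

text \<open>
  The \<open>d\<close>-extension given by \<open>X\<close>, \<open>f\<close> is equivalent to one with all terms in \<open>\<U>\<close>; note that
  \<^const>\<open>end_fixing_map\<close> forces the end terms to agree.
\<close>

definition equiv_to_d_extension_with_terms_in ::
    "('o, 'm, 'z) acat_scheme \<Rightarrow> 'o set \<Rightarrow> nat \<Rightarrow> 'o set \<Rightarrow> (nat \<Rightarrow> 'o) \<Rightarrow> (nat \<Rightarrow> 'm) \<Rightarrow> bool"
  where "equiv_to_d_extension_with_terms_in C \<M> d \<U> X f \<longleftrightarrow>
    (\<exists>Y g. d_extension C \<M> d Y g \<and> (\<forall>i \<le> Suc d. Y i \<in> \<U>) \<and> end_fixing_map C d (X, f) (Y, g))"

definition closed_under_d_extensions ::
    "('o, 'm, 'z) acat_scheme \<Rightarrow> 'o set \<Rightarrow> nat \<Rightarrow> 'o set \<Rightarrow> bool"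
  where "closed_under_d_extensions C \<M> d \<U> \<longleftrightarrow>
    (\<forall>X f. d_extension C \<M> d X f \<and> X 0 \<in> \<U> \<and> X (Suc d) \<in> \<U> \<longrightarrow>
      equiv_to_d_extension_with_terms_in C \<M> d \<U> X f)"

definition closed_under_d_extensions_indec_ends ::
    "('o, 'm, 'z) acat_scheme \<Rightarrow> 'o set \<Rightarrow> nat \<Rightarrow> 'o set \<Rightarrow> bool"
  where "closed_under_d_extensions_indec_ends C \<M> d \<U> \<longleftrightarrow>
    (\<forall>X f. d_extension C \<M> d X f \<and> X 0 \<in> \<U> \<and> X (Suc d) \<in> \<U> \<and>
      indecomposable C (X 0) \<and> indecomposable C (X (Suc d)) \<longrightarrow>
      equiv_to_d_extension_with_terms_in C \<M> d \<U> X f)"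

definition closed_under_d_quotients ::
    "('o, 'm, 'z) acat_scheme \<Rightarrow> 'o set \<Rightarrow> nat \<Rightarrow> 'o set \<Rightarrow> bool"
  where "closed_under_d_quotients C \<M> d \<U> \<longleftrightarrow>
    (\<forall>M \<in> \<M>. \<forall>U \<in> \<U>. \<forall>f \<in> Hom C M U.
      \<exists>X g. X 0 = M \<and> X 1 = U \<and> g 0 = f \<and> d_cokernel C \<M> d X g \<and>
        (\<forall>i. 1 \<le> i \<and> i \<le> d \<longrightarrow> X (Suc i) \<in> \<U>))"

end

theory Submission
  imports Defs
begin

text \<open>
  The theorem rests on a criterion (\<open>equivalent_to_terms_in\<close>). Let \<open>D\<close> be a \<open>d\<close>-extension from \<open>X \<in> \<U>\<close>
  to \<open>Y \<in> \<U>\<close>. Suppose that some \<open>d\<close>-extension \<open>G\<close> with inner terms in \<open>\<U>\<close>, with the same right end \<open>Y\<close>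
  and with any left end \<open>G\<^sub>0\<close>, has a last map \<open>G\<^sub>d \<rightarrow> Y\<close> that factors through \<open>D\<^sub>d \<rightarrow> Y\<close>. Then the identity of
  \<open>Y\<close> extends to a morphism \<open>c\<close> from \<open>G\<close> to \<open>D\<close>, so \<open>D\<close> is, up to equivalence, the pushout of \<open>G\<close> along
  \<open>c\<^sub>0 : G\<^sub>0 \<rightarrow> X\<close>. Such a pushout can be formed with terms in \<open>\<U>\<close> (\<open>dext_pushout\<close>): its inner terms
  are left approximations of cokernels of morphisms from \<open>\<M>\<close> to \<open>\<U>\<close>, or at the last place such a cokernel
  that lies in \<open>\<M>\<close>, and closure under \<open>d\<close>-quotients puts these objects into \<open>\<U>\<close>.

  With the criterion, closure for the pair \<open>(X, Y)\<close> is additive in both variables. For \<open>Y = Y\<^sub>1 \<oplus> Y\<^sub>2\<close>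
  pull \<open>D\<close> back along the two inclusions, replace the results by extensions in \<open>\<U>\<close>, and let \<open>G\<close> be their
  direct sum (\<open>closed_at_sum_right\<close>). For \<open>X = X\<^sub>1 \<oplus> X\<^sub>2\<close> push \<open>D\<close> out along the two projections, to \<open>A\<close>
  and \<open>B\<close>, and replace \<open>B\<close> by \<open>E\<close> in \<open>\<U>\<close>. The map \<open>E\<^sub>d \<rightarrow> Y\<close> annihilates the class of \<open>B\<close>. Pull \<open>A\<close> back along it
  and replace the result by \<open>F\<close> in \<open>\<U>\<close>, an extension with right end \<open>E\<^sub>d\<close>. The composite \<open>F\<^sub>d \<rightarrow> E\<^sub>d \<rightarrow> Y\<close>
  annihilates both components of the class of \<open>D\<close>, hence factors through \<open>D\<^sub>d \<rightarrow> Y\<close>, and it is the last map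
  of a cone \<open>0 \<rightarrow> F\<^sub>0 \<oplus> E\<^sub>0 \<rightarrow> \<dots> \<rightarrow> F\<^sub>d\<^sub>-\<^sub>1 \<oplus> E\<^sub>d\<^sub>-\<^sub>1 \<rightarrow> F\<^sub>d \<rightarrow> Y \<rightarrow> 0\<close>, which serves as \<open>G\<close> (\<open>closed_at_sum_left\<close>).
  As all objects have finite length, the case of indecomposable end terms implies the general case by
  induction on decompositions.

  Classes in \<open>Ext\<close> are never computed. A morphism of \<open>d\<close>-extensions factors over the first map at the
  left end iff it factors over the last map at the right end (\<open>factor_right\<close>, \<open>factor_left\<close>), and this
  replaces the statement that pulling back one class and pushing out another give the same element. The
  vanishing of Yoneda extension groups that defines \<open>d\<close>-cluster tilting is translated once into the
  vanishing of \<open>Ext\<^sup>1\<close> between objects of \<open>\<M>\<close> and the cokernels and kernels at the ends of exact sequences in \<open>\<M>\<close>.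
  The result is the self-dual list of properties in the locale \<open>tilting\<close>, from which everything else is
  derived: \<open>d\<close>-extensions are the exact sequences with terms in \<open>\<M>\<close>, and these stay exact under
  \<open>Hom\<close> into and out of \<open>\<M>\<close>.
\<close>

section \<open>Arithmetic of morphisms\<close>

lemma hom_iff [simp]: "f \<in> Hom C A B \<longleftrightarrow> f \<in> Arr C \<and> Dom C f = A \<and> Cod C f = B"
  by (simp add: Hom_def)

context category
begin

lemma comp_arr [simp]:
  assumes "f \<in> Arr C" "g \<in> Arr C" "Cod C f = Dom C g"
  shows "g \<cdot> f \<in> Arr C" "Dom C (g \<cdot> f) = Dom C f" "Cod C (g \<cdot> f) = Cod C g"
  using Comp_Hom[of f "Dom C f" "Cod C f" g "Cod C g"] assms by auto

lemma comp_assoc [simp]: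
  assumes "f \<in> Arr C" "g \<in> Arr C" "h \<in> Arr C" "Cod C f = Dom C g" "Cod C g = Dom C h"
  shows "(h \<cdot> g) \<cdot> f = h \<cdot> (g \<cdot> f)"
  using Comp_assoc[of f _ _ g _ h] assms by simp

lemma ident_simps [simp]:
  assumes "A \<in> Obj C"
  shows "Ident C A \<in> Arr C" "Dom C (Ident C A) = A" "Cod C (Ident C A) = A"
  using Ident_Hom[OF assms] by auto

lemma comp_ident [simp]:
  "f \<in> Arr C \<Longrightarrow> Dom C f = A \<Longrightarrow> f \<cdot> Ident C A = f"
  "f \<in> Arr C \<Longrightarrow> Cod C f = A \<Longrightarrow> Ident C A \<cdot> f = f"
  using Comp_Ident_right Comp_Ident_left by auto

lemma dom_cod_obj [simp]: "f \<in> Arr C \<Longrightarrow> Dom C f \<in> Obj C" "f \<in> Arr C \<Longrightarrow> Cod C f \<in> Obj C"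
  by (simp_all add: Dom_Obj Cod_Obj)

lemma hom_obj: "f \<in> Hom C A B \<Longrightarrow> A \<in> Obj C \<and> B \<in> Obj C"
  by (auto simp: Dom_Obj Cod_Obj)

text \<open>Precomposition turns an equation between composites into one that the right-nested normal form
  of longer composites can use.\<close>

lemma comp_eq_ext:
  assumes "g \<cdot> f = h" "f \<in> Arr C" "g \<in> Arr C" "Cod C f = Dom C g" "x \<in> Arr C" "Cod C x = Dom C f"
  shows "g \<cdot> (f \<cdot> x) = h \<cdot> x"
  using assms(2-) by (simp flip: assms(1))

end

context preadditive_category
begin

definition neg :: "'b \<Rightarrow> 'b"
  where "neg f = m_inv (hom_group C (Dom C f) (Cod C f)) f"

lemma zer_simps [simp]:
  assumes "A \<in> Obj C" "B \<in> Obj C"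
  shows "Zer C A B \<in> Arr C" "Dom C (Zer C A B) = A" "Cod C (Zer C A B) = B"
proof -
  interpret comm_group "hom_group C A B" using hom_comm_group assms .
  have "Zer C A B \<in> Hom C A B" using one_closed by (simp add: hom_group_def del: hom_iff)
  then show "Zer C A B \<in> Arr C" "Dom C (Zer C A B) = A" "Cod C (Zer C A B) = B" by auto
qed

lemma plus_simps [simp]:
  assumes "f \<in> Arr C" "g \<in> Arr C" "Dom C f = Dom C g" "Cod C f = Cod C g"
  shows "f \<boxplus> g \<in> Arr C" "Dom C (f \<boxplus> g) = Dom C g" "Cod C (f \<boxplus> g) = Cod C g"
proof -
  interpret comm_group "hom_group C (Dom C g) (Cod C g)" by (rule hom_comm_group; intro dom_cod_obj assms)
  have "f \<boxplus> g \<in> Hom C (Dom C g) (Cod C g)"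
    using m_closed[of f g] assms by (simp add: hom_group_def)
  then show "f \<boxplus> g \<in> Arr C" "Dom C (f \<boxplus> g) = Dom C g" "Cod C (f \<boxplus> g) = Cod C g" by auto
qed

lemma neg_simps [simp]:
  assumes "f \<in> Arr C"
  shows "neg f \<in> Arr C" "Dom C (neg f) = Dom C f" "Cod C (neg f) = Cod C f"
proof -
  interpret comm_group "hom_group C (Dom C f) (Cod C f)" by (rule hom_comm_group; intro dom_cod_obj assms)
  have "neg f \<in> Hom C (Dom C f) (Cod C f)"
    using inv_closed[of f] assms by (simp add: hom_group_def neg_def)
  then show "neg f \<in> Arr C" "Dom C (neg f) = Dom C f" "Cod C (neg f) = Cod C f" by auto
qed

lemma plus_neg [simp]:
  assumes "f \<in> Arr C"
  shows "f \<boxplus> neg f = Zer C (Dom C f) (Cod C f)" "neg f \<boxplus> f = Zer C (Dom C f) (Cod C f)"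
proof -
  interpret comm_group "hom_group C (Dom C f) (Cod C f)" by (rule hom_comm_group; intro dom_cod_obj assms)
  show "f \<boxplus> neg f = Zer C (Dom C f) (Cod C f)" "neg f \<boxplus> f = Zer C (Dom C f) (Cod C f)"
    using r_inv[of f] l_inv[of f] assms by (simp_all add: hom_group_def neg_def)
qed

lemma plus_zer [simp]:
  assumes "f \<in> Arr C" "Dom C f = A" "Cod C f = B"
  shows "f \<boxplus> Zer C A B = f" "Zer C A B \<boxplus> f = f"
proof -
  interpret comm_group "hom_group C (Dom C f) (Cod C f)" by (rule hom_comm_group; intro dom_cod_obj assms)
  show "f \<boxplus> Zer C A B = f" "Zer C A B \<boxplus> f = f"
    using r_one[of f] l_one[of f] assms by (simp_all add: hom_group_def)
qed

lemma plus_comm: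
  assumes "f \<in> Arr C" "g \<in> Arr C" "Dom C f = Dom C g" "Cod C f = Cod C g"
  shows "f \<boxplus> g = g \<boxplus> f"
proof -
  interpret comm_group "hom_group C (Dom C g) (Cod C g)" by (rule hom_comm_group; intro dom_cod_obj assms)
  show ?thesis using m_comm[of f g] assms by (simp add: hom_group_def)
qed

lemma plus_assoc:
  assumes "f \<in> Arr C" "g \<in> Arr C" "h \<in> Arr C" "Dom C f = Dom C g" "Cod C f = Cod C g"
    "Dom C g = Dom C h" "Cod C g = Cod C h"
  shows "(f \<boxplus> g) \<boxplus> h = f \<boxplus> (g \<boxplus> h)"
proof -
  interpret comm_group "hom_group C (Dom C g) (Cod C g)" by (rule hom_comm_group; intro dom_cod_obj assms)
  show ?thesis using m_assoc[of f g h] assms by (simp add: hom_group_def)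
qed

lemma plus_lcomm:
  assumes "f \<in> Arr C" "g \<in> Arr C" "h \<in> Arr C" "Dom C f = Dom C g" "Cod C f = Cod C g"
    "Dom C g = Dom C h" "Cod C g = Cod C h"
  shows "f \<boxplus> (g \<boxplus> h) = g \<boxplus> (f \<boxplus> h)"
proof -
  have "f \<boxplus> (g \<boxplus> h) = (f \<boxplus> g) \<boxplus> h" by (rule plus_assoc[symmetric]) (use assms in simp_all)
  also have "\<dots> = (g \<boxplus> f) \<boxplus> h" by (rule arg_cong[OF plus_comm]) (use assms in simp_all)
  also have "\<dots> = g \<boxplus> (f \<boxplus> h)" by (rule plus_assoc) (use assms in simp_all)
  finally show ?thesis .
qed

lemma plus_neg_cancel [simp]:
  assumes "f \<in> Arr C" "g \<in> Arr C" "Dom C f = Dom C g" "Cod C f = Cod C g"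
  shows "f \<boxplus> (neg f \<boxplus> g) = g" "neg f \<boxplus> (f \<boxplus> g) = g"
  using assms by (simp_all flip: plus_assoc)

lemma plus_left_cancel:
  assumes "f \<boxplus> g = f \<boxplus> h" "f \<in> Arr C" "g \<in> Arr C" "h \<in> Arr C" "Dom C f = Dom C g"
    "Cod C f = Cod C g" "Dom C h = Dom C g" "Cod C h = Cod C g"
  shows "g = h"
proof -
  have "g = neg f \<boxplus> (f \<boxplus> g)" by (rule plus_neg_cancel(2)[symmetric]) (use assms(2-) in simp_all)
  also have "\<dots> = h" unfolding assms(1) by (rule plus_neg_cancel(2)) (use assms(2-) in simp_all)
  finally show ?thesis .
qed

lemma neg_unique:
  assumes "f \<boxplus> g = Zer C (Dom C f) (Cod C f)" "f \<in> Arr C" "g \<in> Arr C" "Dom C f = Dom C g"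
    "Cod C f = Cod C g"
  shows "g = neg f"
  by (rule plus_left_cancel[of f]) (use assms in simp_all)

lemma neg_neg [simp]: "f \<in> Arr C \<Longrightarrow> neg (neg f) = f"
  by (rule neg_unique[symmetric]) simp_all

lemma eq_iff_minus:
  assumes "f \<in> Arr C" "g \<in> Arr C" "Dom C f = Dom C g" "Cod C f = Cod C g"
  shows "f \<boxplus> neg g = Zer C (Dom C g) (Cod C g) \<longleftrightarrow> f = g"
proof
  assume "f \<boxplus> neg g = Zer C (Dom C g) (Cod C g)"
  then have "neg g = neg f" using neg_unique[of f "neg g"] assms by simp
  then show "f = g" using assms neg_neg by metis
qed (use assms in simp)

lemma comp_plus:
  assumes "f \<in> Arr C" "f' \<in> Arr C" "g \<in> Arr C" "Dom C f = Dom C f'" "Cod C f = Dom C g" "Cod C f' = Dom C g"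
  shows "g \<cdot> (f \<boxplus> f') = (g \<cdot> f) \<boxplus> (g \<cdot> f')"
  using Comp_Plus_right[of f _ _ f' g] assms by simp

lemma plus_comp:
  assumes "f \<in> Arr C" "g \<in> Arr C" "g' \<in> Arr C" "Cod C f = Dom C g" "Cod C f = Dom C g'" "Cod C g = Cod C g'"
  shows "(g \<boxplus> g') \<cdot> f = (g \<cdot> f) \<boxplus> (g' \<cdot> f)"
  using Comp_Plus_left[of f _ _ g _ g'] assms by simp

lemma comp_zer [simp]:
  assumes "g \<in> Arr C" "Dom C g = B" "A \<in> Obj C"
  shows "g \<cdot> Zer C A B = Zer C A (Cod C g)"
proof -
  have B: "B \<in> Obj C" using assms by auto
  have "g \<cdot> (Zer C A B \<boxplus> Zer C A B) = (g \<cdot> Zer C A B) \<boxplus> (g \<cdot> Zer C A B)"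
    by (rule comp_plus) (use assms B in simp_all)
  then have "(g \<cdot> Zer C A B) \<boxplus> (g \<cdot> Zer C A B) = (g \<cdot> Zer C A B) \<boxplus> Zer C A (Cod C g)"
    using assms B by simp
  then show ?thesis by (rule plus_left_cancel) (use assms B in simp_all)
qed

lemma zer_comp [simp]:
  assumes "f \<in> Arr C" "Cod C f = A" "B \<in> Obj C"
  shows "Zer C A B \<cdot> f = Zer C (Dom C f) B"
proof -
  have A: "A \<in> Obj C" using assms by auto
  have "(Zer C A B \<boxplus> Zer C A B) \<cdot> f = (Zer C A B \<cdot> f) \<boxplus> (Zer C A B \<cdot> f)"
    by (rule plus_comp) (use assms A in simp_all)
  then have "(Zer C A B \<cdot> f) \<boxplus> (Zer C A B \<cdot> f) = (Zer C A B \<cdot> f) \<boxplus> Zer C (Dom C f) B"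
    using assms A by simp
  then show ?thesis by (rule plus_left_cancel) (use assms A in simp_all)
qed

lemma comp_neg [simp]:
  assumes "f \<in> Arr C" "g \<in> Arr C" "Cod C f = Dom C g"
  shows "g \<cdot> neg f = neg (g \<cdot> f)"
proof (rule neg_unique)
  have "(g \<cdot> f) \<boxplus> (g \<cdot> neg f) = g \<cdot> (f \<boxplus> neg f)"
    by (rule comp_plus[symmetric]) (use assms in simp_all)
  then show "(g \<cdot> f) \<boxplus> (g \<cdot> neg f) = Zer C (Dom C (g \<cdot> f)) (Cod C (g \<cdot> f))"
    using assms by simp
qed (use assms in simp_all)

lemma neg_comp [simp]:
  assumes "f \<in> Arr C" "g \<in> Arr C" "Cod C f = Dom C g"
  shows "neg g \<cdot> f = neg (g \<cdot> f)"
proof (rule neg_unique)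
  have "(g \<cdot> f) \<boxplus> (neg g \<cdot> f) = (g \<boxplus> neg g) \<cdot> f"
    by (rule plus_comp[symmetric]) (use assms in simp_all)
  then show "(g \<cdot> f) \<boxplus> (neg g \<cdot> f) = Zer C (Dom C (g \<cdot> f)) (Cod C (g \<cdot> f))"
    using assms by simp
qed (use assms in simp_all)

lemma neg_zer [simp]: "A \<in> Obj C \<Longrightarrow> B \<in> Obj C \<Longrightarrow> neg (Zer C A B) = Zer C A B"
  by (rule neg_unique[symmetric]) simp_all

lemma mono_zeroI:
  assumes "f \<in> Arr C" "\<And>T x. x \<in> Hom C T (Dom C f) \<Longrightarrow> f \<cdot> x = Zer C T (Cod C f) \<Longrightarrow> x = Zer C T (Dom C f)"
  shows "is_mono C f"
  unfolding is_mono_def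
proof (intro conjI allI ballI impI)
  fix T g h assume g: "g \<in> Hom C T (Dom C f)" and h: "h \<in> Hom C T (Dom C f)" and e: "f \<cdot> g = f \<cdot> h"
  have "f \<cdot> (g \<boxplus> neg h) = (f \<cdot> g) \<boxplus> (f \<cdot> neg h)" by (rule comp_plus) (use g h assms in auto)
  then have "f \<cdot> (g \<boxplus> neg h) = Zer C T (Cod C f)" using g h assms(1) e by simp
  then have "g \<boxplus> neg h = Zer C T (Dom C f)" using assms(2)[of "g \<boxplus> neg h" T] g h by simp
  then show "g = h" using eq_iff_minus[of g h] g h by simp
qed (use assms in simp)

lemma mono_zeroD:
  assumes "is_mono C f" "x \<in> Hom C T (Dom C f)" "f \<cdot> x = Zer C T (Cod C f)"
  shows "x = Zer C T (Dom C f)"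
proof -
  have f: "f \<in> Arr C" and T: "T \<in> Obj C" using assms by (auto simp: is_mono_def)
  have z: "Zer C T (Dom C f) \<in> Hom C T (Dom C f)" "f \<cdot> Zer C T (Dom C f) = f \<cdot> x"
    using f T assms(3) by simp_all
  have "\<forall>g \<in> Hom C T (Dom C f). \<forall>h \<in> Hom C T (Dom C f). f \<cdot> g = f \<cdot> h \<longrightarrow> g = h"
    using assms(1) unfolding is_mono_def by blast
  then show ?thesis using z assms(2) by metis
qed

end

section \<open>The opposite category\<close>

text \<open>Most facts below come in dual pairs. One of them is proved and the other one is its instance in
  the opposite category.\<close>

definition op_cat :: "('o, 'm, 'z) acat_scheme \<Rightarrow> ('o, 'm) acat"
  where "op_cat C = \<lparr>Obj = Obj C, Arr = Arr C, Dom = Cod C, Cod = Dom C, Ident = Ident C,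
    Comp = (\<lambda>g f. Comp C f g), Plus = Plus C, Zer = (\<lambda>A B. Zer C B A)\<rparr>"

lemma op_simps [simp]:
  "Obj (op_cat C) = Obj C" "Arr (op_cat C) = Arr C" "Dom (op_cat C) = Cod C" "Cod (op_cat C) = Dom C"
  "Ident (op_cat C) = Ident C" "Comp (op_cat C) g f = Comp C f g" "Plus (op_cat C) = Plus C"
  "Zer (op_cat C) A B = Zer C B A"
  by (simp_all add: op_cat_def)

lemma op_hom: "Hom (op_cat C) A B = Hom C B A"
  by (auto simp: Hom_def)

lemma op_hom_group: "hom_group (op_cat C) A B = hom_group C B A"
  by (simp add: hom_group_def op_hom)

lemma op_mono [simp]: "is_mono (op_cat C) f \<longleftrightarrow> is_epi C f"
  by (simp add: is_mono_def is_epi_def op_hom)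

lemma op_epi [simp]: "is_epi (op_cat C) f \<longleftrightarrow> is_mono C f"
  by (simp add: is_mono_def is_epi_def op_hom)

lemma op_kernel [simp]: "is_kernel (op_cat C) f k \<longleftrightarrow> is_cokernel C f k"
  by (simp add: is_kernel_def is_cokernel_def op_hom)

lemma op_cokernel [simp]: "is_cokernel (op_cat C) f k \<longleftrightarrow> is_kernel C f k"
  by (simp add: is_kernel_def is_cokernel_def op_hom)

lemma op_zero_object [simp]: "zero_object (op_cat C) Z \<longleftrightarrow> zero_object C Z"
  by (auto simp: zero_object_def op_hom simp del: hom_iff)

lemma op_biproduct: "is_biproduct (op_cat C) A B P i j p q \<longleftrightarrow> is_biproduct C A B P p q i j"
  by (auto simp: is_biproduct_def op_hom)

lemma op_direct_sum [simp]: "is_direct_sum (op_cat C) A B P \<longleftrightarrow> is_direct_sum C A B P"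
  unfolding is_direct_sum_def op_biproduct by blast

lemma (in category) op_category: "category (op_cat C)"
proof
  fix f g h A B D E
  show "f \<in> Hom (op_cat C) A B \<Longrightarrow> g \<in> Hom (op_cat C) B D \<Longrightarrow> Comp (op_cat C) g f \<in> Hom (op_cat C) A D"
    by (auto simp: op_hom)
  show "f \<in> Hom (op_cat C) A B \<Longrightarrow> g \<in> Hom (op_cat C) B D \<Longrightarrow> h \<in> Hom (op_cat C) D E \<Longrightarrow>
    Comp (op_cat C) (Comp (op_cat C) h g) f = Comp (op_cat C) h (Comp (op_cat C) g f)"
    by (auto simp: op_hom)
qed (auto simp: op_hom)

lemma (in preadditive_category) op_preadditive: "preadditive_category (op_cat C)"
  by (intro preadditive_category.intro preadditive_category_axioms.intro op_category)
    (auto simp: op_hom_group hom_comm_group plus_comp comp_plus)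

lemma (in abelian_category) op_abelian: "abelian_category (op_cat C)"
  by (intro abelian_category.intro abelian_category_axioms.intro op_preadditive)
    (use ex_zero_object ex_direct_sum ex_kernel ex_cokernel mono_normal epi_conormal in simp_all)

section \<open>Short exact sequences in an abelian category\<close>

definition ses :: "('o, 'm, 'z) acat_scheme \<Rightarrow> 'm \<Rightarrow> 'm \<Rightarrow> bool"
  where "ses C i p \<longleftrightarrow> is_kernel C p i \<and> is_cokernel C i p"

lemma op_ses [simp]: "ses (op_cat C) i p \<longleftrightarrow> ses C p i"
  by (auto simp: ses_def)

lemmas op_unfold = op_hom op_simps op_mono op_epi op_kernel op_cokernel op_zero_object op_direct_sum op_ses

lemma mono_arr: "is_mono C f \<Longrightarrow> f \<in> Arr C"
  by (simp add: is_mono_def)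

lemma epi_arr: "is_epi C f \<Longrightarrow> f \<in> Arr C"
  by (simp add: is_epi_def)

context category
begin

lemma mono_cancel:
  assumes "is_mono C f" "f \<cdot> g = f \<cdot> h" "g \<in> Hom C T (Dom C f)" "h \<in> Hom C T (Dom C f)"
  shows "g = h"
  using assms unfolding is_mono_def by blast

lemma epi_cancel:
  assumes "is_epi C f" "g \<cdot> f = h \<cdot> f" "g \<in> Hom C (Cod C f) T" "h \<in> Hom C (Cod C f) T"
  shows "g = h"
  using assms unfolding is_epi_def by blast

lemma mono_comp:
  assumes "is_mono C f" "is_mono C g" "Cod C f = Dom C g"
  shows "is_mono C (g \<cdot> f)"
  unfolding is_mono_def
proof (intro conjI allI ballI impI)
  note [simp] = mono_arr[OF assms(1)] mono_arr[OF assms(2)] assms(3)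
  show "g \<cdot> f \<in> Arr C" by simp
  fix T a b assume ab: "a \<in> Hom C T (Dom C (g \<cdot> f))" "b \<in> Hom C T (Dom C (g \<cdot> f))"
    and "(g \<cdot> f) \<cdot> a = (g \<cdot> f) \<cdot> b"
  then have "g \<cdot> (f \<cdot> a) = g \<cdot> (f \<cdot> b)" by simp
  then have "f \<cdot> a = f \<cdot> b" by (rule mono_cancel[OF assms(2)]) (use ab in auto)
  then show "a = b" by (rule mono_cancel[OF assms(1)]) (use ab in auto)
qed

lemma mono_of_comp:
  assumes "is_mono C (g \<cdot> f)" "f \<in> Arr C" "g \<in> Arr C" "Cod C f = Dom C g"
  shows "is_mono C f"
  unfolding is_mono_def
proof (intro conjI allI ballI impI)
  fix T a b assume ab: "a \<in> Hom C T (Dom C f)" "b \<in> Hom C T (Dom C f)" and e: "f \<cdot> a = f \<cdot> b"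
  have "(g \<cdot> f) \<cdot> a = (g \<cdot> f) \<cdot> b" using ab e assms(2-) by simp
  then show "a = b" by (rule mono_cancel[OF assms(1)]) (use ab assms(2-) in auto)
qed (use assms in simp)

lemma ident_mono [simp]: "A \<in> Obj C \<Longrightarrow> is_mono C (Ident C A)"
  by (auto simp: is_mono_def)

lemma ident_epi [simp]: "A \<in> Obj C \<Longrightarrow> is_epi C (Ident C A)"
  by (auto simp: is_epi_def)

end

lemma (in category) epi_comp:
  assumes "is_epi C f" "is_epi C g" "Cod C f = Dom C g"
  shows "is_epi C (g \<cdot> f)"
  using category.mono_comp[OF op_category, of g f] assms by simp

lemma (in category) epi_of_comp:
  assumes "is_epi C (g \<cdot> f)" "f \<in> Arr C" "g \<in> Arr C" "Cod C f = Dom C g"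
  shows "is_epi C g"
  using category.mono_of_comp[OF op_category, of f g] assms by simp

context preadditive_category
begin

lemma kernelD:
  assumes "is_kernel C f k"
  shows "f \<in> Arr C" "k \<in> Arr C" "Cod C k = Dom C f" "f \<cdot> k = Zer C (Dom C k) (Cod C f)" "is_mono C k"
proof -
  show k: "f \<in> Arr C" "k \<in> Arr C" "Cod C k = Dom C f" "f \<cdot> k = Zer C (Dom C k) (Cod C f)"
    using assms by (simp_all add: is_kernel_def)
  show "is_mono C k"
  proof (rule mono_zeroI)
    fix T x assume x: "x \<in> Hom C T (Dom C k)" and z: "k \<cdot> x = Zer C T (Cod C k)"
    have T: "T \<in> Obj C" using hom_obj x by blast
    have "\<exists>!h. h \<in> Hom C T (Dom C k) \<and> k \<cdot> h = Zer C T (Dom C f)"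
      using assms T k unfolding is_kernel_def by simp
    moreover have "k \<cdot> Zer C T (Dom C k) = Zer C T (Dom C f)" using k T by simp
    ultimately show "x = Zer C T (Dom C k)" using x z k T by (metis zer_simps dom_cod_obj(1) hom_iff)
  qed (rule k)
qed

lemma kernel_lift:
  assumes "is_kernel C f k" "y \<in> Hom C T (Dom C f)" "f \<cdot> y = Zer C T (Cod C f)"
  obtains x where "x \<in> Hom C T (Dom C k)" "k \<cdot> x = y"
  using assms unfolding is_kernel_def by blast

lemma kernelI:
  assumes "is_mono C k" "f \<in> Arr C" "Cod C k = Dom C f" "f \<cdot> k = Zer C (Dom C k) (Cod C f)"
    "\<And>T y. y \<in> Hom C T (Dom C f) \<Longrightarrow> f \<cdot> y = Zer C T (Cod C f) \<Longrightarrow> \<exists>x \<in> Hom C T (Dom C k). k \<cdot> x = y"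
  shows "is_kernel C f k"
  unfolding is_kernel_def
proof (intro conjI allI ballI impI)
  fix T y assume "y \<in> Hom C T (Dom C f)" "f \<cdot> y = Zer C T (Cod C f)"
  then obtain x where x: "x \<in> Hom C T (Dom C k)" "k \<cdot> x = y" using assms(5) by blast
  then show "\<exists>!h. h \<in> Hom C T (Dom C k) \<and> k \<cdot> h = y"
    using mono_cancel[OF assms(1)] by metis
qed (use assms mono_arr in auto)

end

context abelian_category
begin

lemmas cokernelD = preadditive_category.kernelD[OF op_preadditive, unfolded op_unfold]

lemmas epi_zeroI = preadditive_category.mono_zeroI[OF op_preadditive, unfolded op_unfold]

lemmas epi_zeroD = preadditive_category.mono_zeroD[OF op_preadditive, unfolded op_unfold]

lemma cokernel_desc:
  assumes "is_cokernel C f q" "y \<in> Hom C (Cod C f) T" "y \<cdot> f = Zer C (Dom C f) T"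
  obtains x where "x \<in> Hom C (Cod C q) T" "x \<cdot> q = y"
  using preadditive_category.kernel_lift[OF op_preadditive, of f q y T] assms by auto

lemma cokernelI:
  assumes "is_epi C k" "f \<in> Arr C" "Cod C f = Dom C k" "k \<cdot> f = Zer C (Dom C f) (Cod C k)"
    "\<And>T y. y \<in> Hom C (Cod C f) T \<Longrightarrow> y \<cdot> f = Zer C (Dom C f) T \<Longrightarrow> \<exists>x \<in> Hom C (Cod C k) T. x \<cdot> k = y"
  shows "is_cokernel C f k"
  using preadditive_category.kernelI[OF op_preadditive, of k f] assms by (simp add: Bex_def conj_ac)

lemma sesD:
  assumes "ses C i p"
  shows "i \<in> Arr C" "p \<in> Arr C" "Cod C i = Dom C p" "p \<cdot> i = Zer C (Dom C i) (Cod C p)"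
    "is_mono C i" "is_epi C p"
  using kernelD[of p i] cokernelD[of i p] assms unfolding ses_def by auto

lemma ses_lift:
  assumes "ses C i p" "y \<in> Hom C T (Dom C p)" "p \<cdot> y = Zer C T (Cod C p)"
  obtains x where "x \<in> Hom C T (Dom C i)" "i \<cdot> x = y"
  using kernel_lift[of p i y T] assms unfolding ses_def by blast

lemma ses_desc:
  assumes "ses C i p" "y \<in> Hom C (Cod C i) T" "y \<cdot> i = Zer C (Dom C i) T"
  obtains x where "x \<in> Hom C (Cod C p) T" "x \<cdot> p = y"
  using cokernel_desc[of i p y T] assms unfolding ses_def by blast

lemma mono_cokernel_ses:
  assumes "is_mono C i" "is_cokernel C i p"
  shows "ses C i p"
proof -
  obtain g where g: "is_kernel C g i" using mono_normal assms(1) by blast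
  note [simp] = kernelD[OF g] cokernelD[OF assms(2)]
  obtain g' where g': "g' \<in> Hom C (Cod C p) (Cod C g)" "g' \<cdot> p = g"
    by (rule cokernel_desc[OF assms(2), of g "Cod C g"]) auto
  have "is_kernel C p i"
  proof (rule kernelI)
    fix T y assume y: "y \<in> Hom C T (Dom C p)" "p \<cdot> y = Zer C T (Cod C p)"
    have T: "T \<in> Obj C" using hom_obj y by blast
    have "g \<cdot> y = g' \<cdot> (p \<cdot> y)" using comp_eq_ext[OF g'(2), of y] y g'(1) by simp
    also have "\<dots> = Zer C T (Cod C g)" using y g' T by simp
    finally obtain x where "x \<in> Hom C T (Dom C i)" "i \<cdot> x = y"
      using kernel_lift[OF g, of y T] y by auto
    then show "\<exists>x \<in> Hom C T (Dom C i). i \<cdot> x = y" by blast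
  qed (use assms in simp_all)
  then show ?thesis using assms by (simp add: ses_def)
qed

lemma ex_ses_mono:
  assumes "is_mono C i"
  obtains p where "ses C i p"
  using mono_cokernel_ses[OF assms] ex_cokernel[OF mono_arr[OF assms]] by blast

end

context abelian_category
begin

lemmas epi_kernel_ses = abelian_category.mono_cokernel_ses[OF op_abelian, unfolded op_unfold]

lemma ex_ses_epi:
  assumes "is_epi C p"
  obtains i where "ses C i p"
  using epi_kernel_ses[OF assms] ex_kernel[OF epi_arr[OF assms]] by blast

text \<open>If \<open>z\<close> kills \<open>e\<close> and \<open>m\<close> is a kernel of \<open>z\<close>, then the monomorphism \<open>k \<cdot> m\<close> is a kernel of some \<open>t\<close>. As \<open>f\<close>
  factors through \<open>k \<cdot> m\<close>, it is killed by \<open>t\<close>, hence so is \<open>k\<close>. So \<open>m\<close> has a right inverse, and \<open>z = 0\<close>.\<close>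

lemma image_factor:
  assumes q: "is_cokernel C f q" and k: "is_kernel C q k"
  obtains e where "e \<in> Hom C (Dom C f) (Dom C k)" "is_epi C e" "k \<cdot> e = f"
proof -
  note [simp] = kernelD[OF k] cokernelD[OF q]
  obtain e where e: "e \<in> Hom C (Dom C f) (Dom C k)" "k \<cdot> e = f"
    by (rule kernel_lift[OF k, of f "Dom C f"]) auto
  have "is_epi C e"
  proof (rule epi_zeroI)
    fix T z assume z: "z \<in> Hom C (Cod C e) T" "z \<cdot> e = Zer C (Dom C e) T"
    note [simp] = e(1)[simplified] z(1)[simplified]
    have T: "T \<in> Obj C" using hom_obj z by blast
    obtain m where m: "is_kernel C z m" using ex_kernel[of z] by auto
    note [simp] = kernelD[OF m]
    obtain e' where e': "e' \<in> Hom C (Dom C f) (Dom C m)" "m \<cdot> e' = e"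
      by (rule kernel_lift[OF m, of e "Dom C f"]) (use z e in auto)
    note [simp] = e'(1)[simplified]
    have "is_mono C (k \<cdot> m)" by (rule mono_comp) (use z in auto)
    then obtain t where t: "is_kernel C t (k \<cdot> m)" using mono_normal by blast
    have t1: "t \<in> Arr C" "Dom C t = Dom C q" "t \<cdot> (k \<cdot> m) = Zer C (Dom C m) (Cod C t)"
      using kernelD[OF t] z by simp_all
    note [simp] = t1(1,2)
    have "t \<cdot> f = t \<cdot> (k \<cdot> (m \<cdot> e'))" by (simp only: e(2) e'(2))
    also have "\<dots> = (t \<cdot> (k \<cdot> m)) \<cdot> e'" using z by simp
    also have "\<dots> = Zer C (Dom C f) (Cod C t)" using t1 by simp
    finally obtain t' where t': "t' \<in> Hom C (Cod C q) (Cod C t)" "t' \<cdot> q = t"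
      using cokernel_desc[OF q, of t "Cod C t"] by auto
    have "t \<cdot> k = t' \<cdot> (q \<cdot> k)" using comp_eq_ext[OF t'(2), of k] t'(1) by simp
    also have "\<dots> = Zer C (Dom C k) (Cod C t)" using t' by simp
    finally obtain v where v: "v \<in> Hom C (Dom C k) (Dom C m)" "(k \<cdot> m) \<cdot> v = k"
      using kernel_lift[OF t, of k "Dom C k"] z by auto
    note [simp] = v(1)[simplified]
    have "k \<cdot> (m \<cdot> v) = k \<cdot> Ident C (Dom C k)" using v(2) z by simp
    then have mv: "m \<cdot> v = Ident C (Dom C k)"
      by (rule mono_cancel[OF kernelD(5)[OF k], of _ _ "Dom C k"]) (use z in auto)
    have "z = z \<cdot> (m \<cdot> v)" using mv z by simp
    also have "\<dots> = Zer C (Dom C k) T" using comp_eq_ext[OF kernelD(4)[OF m], of v] z T by simp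
    finally show "z = Zer C (Cod C e) T" by simp
  qed (use e in auto)
  then show ?thesis using that e by blast
qed

lemma ex_factor:
  assumes "f \<in> Hom C A B"
  obtains I e k where "e \<in> Hom C A I" "k \<in> Hom C I B" "is_epi C e" "is_mono C k" "k \<cdot> e = f"
proof -
  obtain q where q: "is_cokernel C f q" using ex_cokernel assms by auto
  obtain k where k: "is_kernel C q k" using ex_kernel cokernelD[OF q] by blast
  obtain e where e: "e \<in> Hom C (Dom C f) (Dom C k)" "is_epi C e" "k \<cdot> e = f"
    by (rule image_factor[OF q k])
  show ?thesis by (rule that[of e "Dom C k" k]) (use e kernelD[OF k] cokernelD[OF q] assms in auto)
qed

lemma mono_epi_iso:
  assumes "is_mono C f" "is_epi C f"
  obtains g where "g \<in> Hom C (Cod C f) (Dom C f)" "g \<cdot> f = Ident C (Dom C f)" "f \<cdot> g = Ident C (Cod C f)"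
proof -
  note [simp] = mono_arr[OF assms(1)]
  obtain i where i: "ses C i f" using ex_ses_epi assms(2) by blast
  note [simp] = sesD(1-4)[OF i]
  have "i = Zer C (Dom C i) (Dom C f)" by (rule mono_zeroD[OF assms(1)]) auto
  then have z: "Ident C (Dom C f) \<cdot> i = Zer C (Dom C i) (Dom C f)"
    using sesD(1,3)[OF i] by simp
  obtain g where g: "g \<in> Hom C (Cod C f) (Dom C f)" "g \<cdot> f = Ident C (Dom C f)"
    by (rule ses_desc[OF i, of "Ident C (Dom C f)" "Dom C f"]) (use z in auto)
  have "(f \<cdot> g) \<cdot> f = Ident C (Cod C f) \<cdot> f" using g by simp
  then have "f \<cdot> g = Ident C (Cod C f)"
    by (rule epi_cancel[OF assms(2)]) (use g in auto)
  then show ?thesis using that g by blast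
qed

subsection \<open>Biproducts\<close>

lemma biproductD:
  assumes "is_biproduct C A B P i j p q"
  shows "A \<in> Obj C" "B \<in> Obj C" "P \<in> Obj C" "i \<in> Hom C A P" "j \<in> Hom C B P" "p \<in> Hom C P A" "q \<in> Hom C P B"
    "p \<cdot> i = Ident C A" "q \<cdot> j = Ident C B" "q \<cdot> i = Zer C A B" "p \<cdot> j = Zer C B A"
    "(i \<cdot> p) \<boxplus> (j \<cdot> q) = Ident C P"
  using assms unfolding is_biproduct_def by blast+

lemma biproduct_sum:
  assumes b: "is_biproduct C A B P i j p q" and x: "x \<in> Hom C T P"
  shows "(i \<cdot> (p \<cdot> x)) \<boxplus> (j \<cdot> (q \<cdot> x)) = x"
proof -
  note [simp] = biproductD(4-11)[OF b, simplified] biproductD(1-3)[OF b] x[simplified]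
  have "((i \<cdot> p) \<boxplus> (j \<cdot> q)) \<cdot> x = ((i \<cdot> p) \<cdot> x) \<boxplus> ((j \<cdot> q) \<cdot> x)" by (rule plus_comp) auto
  then show ?thesis using biproductD(12)[OF b] by simp
qed

lemma biproduct_eqI:
  assumes b: "is_biproduct C A B P i j p q" and "x \<in> Hom C T P" "y \<in> Hom C T P"
    "p \<cdot> x = p \<cdot> y" "q \<cdot> x = q \<cdot> y"
  shows "x = y"
  by (metis assms biproduct_sum)

lemma biproduct_pair:
  assumes b: "is_biproduct C A B P i j p q" and x: "x \<in> Hom C T A" and y: "y \<in> Hom C T B"
  obtains z where "z \<in> Hom C T P" "p \<cdot> z = x" "q \<cdot> z = y" "z = (i \<cdot> x) \<boxplus> (j \<cdot> y)"
proof -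
  note [simp] = biproductD(4-7)[OF b, simplified] biproductD(1-3)[OF b] x[simplified] y[simplified]
  note e = biproductD(8-11)[OF b]
  have T: "T \<in> Obj C" using hom_obj x by blast
  let ?z = "(i \<cdot> x) \<boxplus> (j \<cdot> y)"
  have "p \<cdot> ?z = (p \<cdot> (i \<cdot> x)) \<boxplus> (p \<cdot> (j \<cdot> y))" by (rule comp_plus) auto
  then have 1: "p \<cdot> ?z = x" using comp_eq_ext[OF e(1), of x] comp_eq_ext[OF e(4), of y] T by simp
  have "q \<cdot> ?z = (q \<cdot> (i \<cdot> x)) \<boxplus> (q \<cdot> (j \<cdot> y))" by (rule comp_plus) auto
  then have 2: "q \<cdot> ?z = y" using comp_eq_ext[OF e(2), of y] comp_eq_ext[OF e(3), of x] T by simp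
  show ?thesis by (rule that[of ?z]) (use 1 2 in auto)
qed

end

context abelian_category
begin

lemma biproduct_co_eqI:
  assumes b: "is_biproduct C A B P i j p q" and "x \<in> Hom C P T" "y \<in> Hom C P T"
    "x \<cdot> i = y \<cdot> i" "x \<cdot> j = y \<cdot> j"
  shows "x = y"
  using abelian_category.biproduct_eqI[OF op_abelian, of A B P p q i j x T y] assms by (simp add: op_biproduct)

lemma biproduct_copair:
  assumes b: "is_biproduct C A B P i j p q" and x: "x \<in> Hom C A T" and y: "y \<in> Hom C B T"
  obtains z where "z \<in> Hom C P T" "z \<cdot> i = x" "z \<cdot> j = y" "z = (x \<cdot> p) \<boxplus> (y \<cdot> q)"
proof -
  obtain z where z: "z \<in> Hom (op_cat C) T P" "Comp (op_cat C) i z = x" "Comp (op_cat C) j z = y"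
    "z = (Comp (op_cat C) p x) \<boxplus>\<^bsub>op_cat C\<^esub> (Comp (op_cat C) q y)"
    by (rule abelian_category.biproduct_pair[OF op_abelian, of A B P p q i j x T y])
      (use assms in \<open>simp_all add: op_biproduct\<close>)
  show ?thesis by (rule that[of z]) (use z in simp_all)
qed

lemma ex_biproduct:
  assumes "A \<in> Obj C" "B \<in> Obj C"
  obtains P i j p q where "is_biproduct C A B P i j p q"
  using ex_direct_sum[OF assms] unfolding is_direct_sum_def by blast

lemma biproduct_ses:
  assumes b: "is_biproduct C A B P i j p q"
  shows "ses C i q"
proof -
  note [simp] = biproductD(4-11)[OF b, simplified] biproductD(1-3)[OF b]
  have "is_epi C q" by (rule epi_of_comp[of q j]) auto
  moreover have "is_mono C i" by (rule mono_of_comp[of p i]) auto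
  then have "is_kernel C q i"
  proof (rule kernelI)
    fix T y assume y: "y \<in> Hom C T (Dom C q)" "q \<cdot> y = Zer C T (Cod C q)"
    have T: "T \<in> Obj C" using hom_obj y by blast
    have "i \<cdot> (p \<cdot> y) = y" using biproduct_sum[OF b, of y T] y T by simp
    then show "\<exists>x \<in> Hom C T (Dom C i). i \<cdot> x = y" using y by (intro bexI[of _ "p \<cdot> y"]) auto
  qed auto
  ultimately show ?thesis by (rule epi_kernel_ses)
qed

lemma section_biproduct:
  assumes s: "ses C i p" and t: "t \<in> Hom C (Cod C p) (Dom C p)" "p \<cdot> t = Ident C (Cod C p)"
  obtains r where "is_biproduct C (Dom C i) (Cod C p) (Dom C p) i t r p"
proof -
  note [simp] = sesD(1-4)[OF s] t[simplified]
  let ?d = "Ident C (Dom C p) \<boxplus> neg (t \<cdot> p)"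
  have "p \<cdot> ?d = (p \<cdot> Ident C (Dom C p)) \<boxplus> (p \<cdot> neg (t \<cdot> p))" by (rule comp_plus) auto
  moreover have "p \<cdot> (t \<cdot> p) = p" using comp_eq_ext[OF t(2), of p] by simp
  ultimately have "p \<cdot> ?d = Zer C (Dom C p) (Cod C p)" by simp
  then obtain r where r: "r \<in> Hom C (Dom C p) (Dom C i)" "i \<cdot> r = ?d"
    by (rule ses_lift[OF s, of ?d "Dom C p", rotated]) auto
  note [simp] = r(1)[simplified]
  have "i \<cdot> (r \<cdot> i) = ?d \<cdot> i" using r(2) by (simp flip: comp_assoc)
  also have "\<dots> = (Ident C (Dom C p) \<cdot> i) \<boxplus> (neg (t \<cdot> p) \<cdot> i)" by (rule plus_comp) auto
  also have "\<dots> = i \<cdot> Ident C (Dom C i)" by simp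
  finally have ri: "r \<cdot> i = Ident C (Dom C i)"
    by (rule mono_cancel[OF sesD(5)[OF s]]) auto
  have "i \<cdot> (r \<cdot> t) = ?d \<cdot> t" using r(2) by (simp flip: comp_assoc)
  also have "\<dots> = (Ident C (Dom C p) \<cdot> t) \<boxplus> (neg (t \<cdot> p) \<cdot> t)" by (rule plus_comp) auto
  also have "\<dots> = i \<cdot> Zer C (Cod C p) (Dom C i)" by simp
  finally have rt: "r \<cdot> t = Zer C (Cod C p) (Dom C i)"
    by (rule mono_cancel[OF sesD(5)[OF s]]) auto
  have "(i \<cdot> r) \<boxplus> (t \<cdot> p) = (t \<cdot> p) \<boxplus> (neg (t \<cdot> p) \<boxplus> Ident C (Dom C p))"
    using r(2) plus_comm[of "?d" "t \<cdot> p"] plus_comm[of "Ident C (Dom C p)" "neg (t \<cdot> p)"] by simp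
  then have "(i \<cdot> r) \<boxplus> (t \<cdot> p) = Ident C (Dom C p)" by simp
  then have "is_biproduct C (Dom C i) (Cod C p) (Dom C p) i t r p"
    unfolding is_biproduct_def using ri rt by auto
  then show ?thesis by (rule that)
qed

lemma retraction_biproduct:
  assumes s: "ses C i p" and r: "r \<in> Hom C (Dom C p) (Dom C i)" "r \<cdot> i = Ident C (Dom C i)"
  obtains t where "is_biproduct C (Dom C i) (Cod C p) (Dom C p) i t r p"
proof -
  have "ses (op_cat C) p i" using s by simp
  then obtain t where "is_biproduct (op_cat C) (Dom (op_cat C) p) (Cod (op_cat C) i) (Dom (op_cat C) i) p r t i"
    by (rule abelian_category.section_biproduct[OF op_abelian]) (use s r sesD in auto)
  then have b: "is_biproduct C (Cod C p) (Dom C i) (Dom C p) t i p r"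
    using sesD[OF s] by (simp add: op_biproduct)
  have "is_biproduct C (Dom C i) (Cod C p) (Dom C p) i t r p"
    using b plus_comm[of "t \<cdot> p" "i \<cdot> r"] unfolding is_biproduct_def by auto
  then show ?thesis by (rule that)
qed

subsection \<open>Epimorphic covers and exactness\<close>

text \<open>Epimorphisms are stable under base change, in the form that allows chasing generalized
  elements: a morphism into the target lifts after passing to an epimorphic cover of its domain. The
  cover is the pullback, that is, the kernel of \<open>(g, - y)\<close> on the direct sum of the two domains.\<close>

lemma epi_cover:
  assumes g: "is_epi C g" and y: "y \<in> Hom C T (Cod C g)"
  obtains T' e x where "e \<in> Hom C T' T" "is_epi C e" "x \<in> Hom C T' (Dom C g)" "g \<cdot> x = y \<cdot> e"
proof -
  note [simp] = epi_arr[OF g] y[simplified]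
  have T: "T \<in> Obj C" using hom_obj y by blast
  obtain P i j p q where b: "is_biproduct C (Dom C g) T P i j p q" by (rule ex_biproduct[of "Dom C g" T]) (use T in auto)
  note [simp] = biproductD(4-11)[OF b, simplified] biproductD(1-3)[OF b]
  obtain c where c: "c \<in> Hom C P (Cod C g)" "c \<cdot> i = g" "c \<cdot> j = neg y"
    "c = (g \<cdot> p) \<boxplus> (neg y \<cdot> q)"
    by (rule biproduct_copair[OF b, of g "Cod C g" "neg y"]) auto
  have cepi: "is_epi C c" by (rule epi_of_comp[of c i]) (use c(1,2) g in auto)
  then obtain k where k: "ses C k c" using ex_ses_epi by blast
  note [simp] = sesD(1-4)[OF k] c(1)[simplified]
  have dk: "Cod C k = P" using sesD(3)[OF k] c(1) by simp
  note [simp] = dk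
  have epi: "is_epi C (q \<cdot> k)"
  proof (rule epi_zeroI)
    fix S z assume z: "z \<in> Hom C (Cod C (q \<cdot> k)) S" "z \<cdot> (q \<cdot> k) = Zer C (Dom C (q \<cdot> k)) S"
    note [simp] = z(1)[simplified]
    have S: "S \<in> Obj C" using hom_obj z by blast
    obtain h where h: "h \<in> Hom C (Cod C c) S" "h \<cdot> c = z \<cdot> q"
      by (rule ses_desc[OF k, of "z \<cdot> q" S]) (use z in auto)
    note [simp] = h(1)[simplified]
    have "h \<cdot> g = z \<cdot> (q \<cdot> i)" using comp_eq_ext[OF h(2), of i] c by simp
    then have "h \<cdot> g = Zer C (Dom C g) S" using S by simp
    then have h0: "h = Zer C (Cod C g) S" by (rule epi_zeroD[OF g, rotated]) auto
    have "z = z \<cdot> (q \<cdot> j)" by simp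
    also have "\<dots> = h \<cdot> (c \<cdot> j)" using comp_eq_ext[OF h(2), of j] by simp
    also have "\<dots> = Zer C T S" using h0 c S by simp
    finally show "z = Zer C (Cod C (q \<cdot> k)) S" by simp
  qed auto
  have "c \<cdot> k = ((g \<cdot> p) \<cdot> k) \<boxplus> ((neg y \<cdot> q) \<cdot> k)"
    unfolding c(4) by (rule plus_comp) auto
  then have "(g \<cdot> (p \<cdot> k)) \<boxplus> neg (y \<cdot> (q \<cdot> k)) = Zer C (Dom C k) (Cod C g)" by simp
  then have "g \<cdot> (p \<cdot> k) = y \<cdot> (q \<cdot> k)" using eq_iff_minus[of "g \<cdot> (p \<cdot> k)" "y \<cdot> (q \<cdot> k)"] by simp
  then show ?thesis using that[of "q \<cdot> k" "Dom C k" "p \<cdot> k"] epi by simp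
qed

end

text \<open>Exactness at the middle object, without reference to an image: whatever \<open>g\<close> kills is killed by
  every morphism that kills \<open>f\<close>. In this form it is visibly self-dual.\<close>

definition exact :: "('o, 'm, 'z) acat_scheme \<Rightarrow> 'm \<Rightarrow> 'm \<Rightarrow> bool"
  where "exact C f g \<longleftrightarrow> f \<in> Arr C \<and> g \<in> Arr C \<and> Cod C f = Dom C g \<and> g \<cdot> f = Zer C (Dom C f) (Cod C g) \<and>
    (\<forall>T S y z. y \<in> Hom C T (Dom C g) \<and> z \<in> Hom C (Dom C g) S \<and> g \<cdot> y = Zer C T (Cod C g) \<and>
      z \<cdot> f = Zer C (Dom C f) S \<longrightarrow> z \<cdot> y = Zer C T S)"
  for C (structure)

lemma exD:
  assumes "exact C f g" "y \<in> Hom C T (Dom C g)" "Comp C g y = Zer C T (Cod C g)" "z \<in> Hom C (Dom C g) S"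
    "Comp C z f = Zer C (Dom C f) S"
  shows "Comp C z y = Zer C T S"
  using assms unfolding exact_def by blast

lemma op_exact: "exact (op_cat C) g f \<longleftrightarrow> exact C f g"
proof (cases "Cod C f = Dom C g")
  case True
  show ?thesis unfolding exact_def op_hom op_simps True by blast
qed (auto simp: exact_def)

context abelian_category
begin

text \<open>The elementwise form of exactness: \<open>f\<close> is an epimorphism onto its image, so what \<open>g\<close> kills comes from
  the domain of \<open>f\<close> after passing to a cover.\<close>

lemma ex_cover:
  assumes f: "exact C f g" and y: "y \<in> Hom C T (Dom C g)" "g \<cdot> y = Zer C T (Cod C g)"
  obtains T' e x where "e \<in> Hom C T' T" "is_epi C e" "x \<in> Hom C T' (Dom C f)" "f \<cdot> x = y \<cdot> e"
proof -
  have [simp]: "f \<in> Arr C" "g \<in> Arr C" "Cod C f = Dom C g" using f by (simp_all add: exact_def)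
  obtain q where q: "is_cokernel C f q" using ex_cokernel[of f] by auto
  note [simp] = cokernelD[OF q]
  obtain k where k: "is_kernel C q k" using ex_kernel[of q] by auto
  note [simp] = kernelD[OF k] y(1)[simplified]
  obtain e where e: "e \<in> Hom C (Dom C f) (Dom C k)" "is_epi C e" "k \<cdot> e = f"
    by (rule image_factor[OF q k])
  note [simp] = e(1)[simplified]
  have qy: "q \<cdot> y = Zer C T (Cod C q)" by (rule exD[OF f y]) simp_all
  obtain u where u: "u \<in> Hom C T (Dom C k)" "k \<cdot> u = y"
    by (rule kernel_lift[OF k, of y T]) (use qy in auto)
  note [simp] = u(1)[simplified]
  obtain T' c x where c: "c \<in> Hom C T' T" "is_epi C c" "x \<in> Hom C T' (Dom C e)" "e \<cdot> x = u \<cdot> c"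
    by (rule epi_cover[OF e(2), of u T]) auto
  have "f \<cdot> x = k \<cdot> (e \<cdot> x)" using comp_eq_ext[OF e(3), of x] e(1) c(3) by simp
  also have "\<dots> = y \<cdot> c" using comp_eq_ext[OF u(2), of c] c(1,4) u(1) by simp
  finally show ?thesis using that c by auto
qed

lemma exI_cover:
  assumes "f \<in> Arr C" "g \<in> Arr C" "Cod C f = Dom C g" "g \<cdot> f = Zer C (Dom C f) (Cod C g)"
    and c: "\<And>T y. y \<in> Hom C T (Dom C g) \<Longrightarrow> g \<cdot> y = Zer C T (Cod C g) \<Longrightarrow>
      \<exists>T' e x. e \<in> Hom C T' T \<and> is_epi C e \<and> x \<in> Hom C T' (Dom C f) \<and> f \<cdot> x = y \<cdot> e"
  shows "exact C f g"
  unfolding exact_def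
proof (intro conjI allI impI)
  fix T S y z assume a: "y \<in> Hom C T (Dom C g) \<and> z \<in> Hom C (Dom C g) S \<and> g \<cdot> y = Zer C T (Cod C g) \<and>
    z \<cdot> f = Zer C (Dom C f) S"
  then have T: "T \<in> Obj C" and S: "S \<in> Obj C" using hom_obj by blast+
  from a obtain T' e x where e: "e \<in> Hom C T' T" "is_epi C e" "x \<in> Hom C T' (Dom C f)" "f \<cdot> x = y \<cdot> e"
    using c by blast
  have "(z \<cdot> y) \<cdot> e = z \<cdot> (y \<cdot> e)" using a e by simp
  also have "\<dots> = z \<cdot> (f \<cdot> x)" by (simp only: e(4))
  also have "\<dots> = Zer C T' S" using comp_eq_ext[of z f "Zer C (Dom C f) S" x] a e S assms(1-3) by simp
  finally show "z \<cdot> y = Zer C T S" using epi_zeroD[OF e(2), of "z \<cdot> y" S] a e by simp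
qed (use assms in auto)

text \<open>Tested on a kernel of \<open>g\<close> and a cokernel of \<open>f\<close>, \<open>exact\<close> says that the kernel of \<open>g\<close> is contained in
  the kernel of the cokernel of \<open>f\<close>, which is the image of \<open>f\<close>.\<close>

lemma exact_at_iff_ex:
  assumes fg: "f \<in> Arr C" "g \<in> Arr C"
  shows "exact_at C f g \<longleftrightarrow> exact C f g"
proof
  assume "exact_at C f g"
  then obtain k q where c: "Cod C f = Dom C g" and q: "is_cokernel C f q" and k: "is_kernel C q k" and kg: "is_kernel C g k"
    unfolding exact_at_def is_image_def by blast
  note [simp] = fg c kernelD[OF k] cokernelD[OF q] kernelD(4)[OF kg]
  obtain e where e: "e \<in> Hom C (Dom C f) (Dom C k)" "is_epi C e" "k \<cdot> e = f"
    by (rule image_factor[OF q k])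
  show "exact C f g"
  proof (rule exI_cover)
    have "g \<cdot> f = g \<cdot> (k \<cdot> e)" by (simp only: e(3))
    also have "\<dots> = Zer C (Dom C f) (Cod C g)"
      using comp_eq_ext[OF kernelD(4)[OF kg], of e] e(1) by simp
    finally show "g \<cdot> f = Zer C (Dom C f) (Cod C g)" .
    fix T y assume y: "y \<in> Hom C T (Dom C g)" "g \<cdot> y = Zer C T (Cod C g)"
    obtain u where u: "u \<in> Hom C T (Dom C k)" "k \<cdot> u = y"
      by (rule kernel_lift[OF kg, of y T]) (use y in auto)
    obtain T' c x where c: "c \<in> Hom C T' T" "is_epi C c" "x \<in> Hom C T' (Dom C e)" "e \<cdot> x = u \<cdot> c"
      by (rule epi_cover[OF e(2), of u T]) (use u e in auto)
    have "f \<cdot> x = k \<cdot> (e \<cdot> x)" using comp_eq_ext[OF e(3), of x] e(1) c(3) by simp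
    also have "\<dots> = y \<cdot> c" using comp_eq_ext[OF u(2), of c] c(1,4) u(1) by simp
    finally show "\<exists>T' e x. e \<in> Hom C T' T \<and> is_epi C e \<and> x \<in> Hom C T' (Dom C f) \<and> f \<cdot> x = y \<cdot> e"
      using c e by auto
  qed auto
next
  assume x: "exact C f g"
  then have [simp]: "Cod C f = Dom C g" "g \<cdot> f = Zer C (Dom C f) (Cod C g)" unfolding exact_def by auto
  obtain q where q: "is_cokernel C f q" using ex_cokernel fg by auto
  note [simp] = cokernelD[OF q] fg
  obtain k where k: "is_kernel C q k" using ex_kernel[of q] by auto
  note [simp] = kernelD[OF k]
  have gk: "g \<cdot> k = Zer C (Dom C k) (Cod C g)"
  proof -
    obtain w where w: "w \<in> Hom C (Cod C q) (Cod C g)" "w \<cdot> q = g"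
      by (rule cokernel_desc[OF q, of g "Cod C g"]) auto
    have "g \<cdot> k = w \<cdot> (q \<cdot> k)" using comp_eq_ext[OF w(2), of k] w(1) by simp
    then show ?thesis using w by simp
  qed
  have "is_kernel C g k"
  proof (rule kernelI)
    fix T y assume y: "y \<in> Hom C T (Dom C g)" "g \<cdot> y = Zer C T (Cod C g)"
    have "q \<cdot> y = Zer C T (Cod C q)" by (rule exD[OF x y]) simp_all
    then obtain x where "x \<in> Hom C T (Dom C k)" "k \<cdot> x = y"
      using kernel_lift[OF k, of y T] y(1) unfolding cokernelD(3)[OF q] \<open>Cod C f = Dom C g\<close> by blast
    then show "\<exists>x \<in> Hom C T (Dom C k). k \<cdot> x = y" by blast
  qed (use gk in auto)
  then show "exact_at C f g" unfolding exact_at_def is_image_def using q k by auto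
qed

end

section \<open>Pushouts of short exact sequences\<close>

context abelian_category
begin

text \<open>The pushout is the cokernel of \<open>(i, - g)\<close> into the direct sum. Its universal property is part of the
  conclusion, as existence and uniqueness of morphisms out of \<open>E\<close>.\<close>

lemma ses_pushout:
  assumes s: "ses C i p" and g: "g \<in> Hom C (Dom C i) N"
  obtains E i' p' h where "ses C i' p'" "i' \<in> Hom C N E" "p' \<in> Hom C E (Cod C p)" "h \<in> Hom C (Dom C p) E"
    "h \<cdot> i = i' \<cdot> g" "p' \<cdot> h = p"
    "\<forall>S b d. b \<in> Hom C (Dom C p) S \<and> d \<in> Hom C N S \<and> b \<cdot> i = d \<cdot> g \<longrightarrow> (\<exists>w \<in> Hom C E S. w \<cdot> h = b \<and> w \<cdot> i' = d)"
    "\<forall>S w w'. w \<in> Hom C E S \<and> w' \<in> Hom C E S \<and> w \<cdot> h = w' \<cdot> h \<and> w \<cdot> i' = w' \<cdot> i' \<longrightarrow> w = w'"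
proof -
  note [simp] = sesD(1-4)[OF s] g[simplified]
  have N: "N \<in> Obj C" using hom_obj g by blast
  obtain P i1 i2 p1 p2 where b: "is_biproduct C (Dom C p) N P i1 i2 p1 p2"
    by (rule ex_biproduct[of "Dom C p" N]) (use N in auto)
  note [simp] = biproductD(4-11)[OF b, simplified] biproductD(1-3)[OF b]
  obtain \<alpha> where \<alpha>: "\<alpha> \<in> Hom C (Dom C i) P" "p1 \<cdot> \<alpha> = i" "p2 \<cdot> \<alpha> = neg g" "\<alpha> = (i1 \<cdot> i) \<boxplus> (i2 \<cdot> neg g)"
    by (rule biproduct_pair[OF b, of i "Dom C i" "neg g"]) auto
  note [simp] = \<alpha>(1)[simplified]
  have "is_mono C \<alpha>" by (rule mono_of_comp[of p1]) (use \<alpha> sesD(5)[OF s] in auto)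
  then obtain c where c: "ses C \<alpha> c" using ex_ses_mono by blast
  have [simp]: "Dom C c = P" using sesD(3)[OF c] by simp
  note [simp] = sesD(1,2)[OF c]
  define E where "E = Cod C c"
  have [simp]: "Cod C c = E" by (simp add: E_def)
  have dual: "\<exists>w \<in> Hom C E S. w \<cdot> (c \<cdot> i1) = b \<and> w \<cdot> (c \<cdot> i2) = d"
    if a: "b \<in> Hom C (Dom C p) S" "d \<in> Hom C N S" "b \<cdot> i = d \<cdot> g" for S b d
  proof -
    note [simp] = a(1,2)[simplified]
    have S: "S \<in> Obj C" using hom_obj that by blast
    obtain w where w: "w \<in> Hom C P S" "w \<cdot> i1 = b" "w \<cdot> i2 = d" by (rule biproduct_copair[OF b a(1,2)])
    note [simp] = w(1)[simplified]
    have "w \<cdot> \<alpha> = (w \<cdot> (i1 \<cdot> i)) \<boxplus> (w \<cdot> (i2 \<cdot> neg g))" unfolding \<alpha>(4) by (rule comp_plus) auto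
    then have "w \<cdot> \<alpha> = Zer C (Dom C i) S"
      using comp_eq_ext[OF w(2), of i] comp_eq_ext[OF w(3), of g] a(3) by simp
    then obtain w' where w': "w' \<in> Hom C E S" "w' \<cdot> c = w"
      using ses_desc[OF c, of w S] by auto
    then have "w' \<cdot> (c \<cdot> i1) = b \<and> w' \<cdot> (c \<cdot> i2) = d"
      using comp_eq_ext[OF w'(2), of i1] comp_eq_ext[OF w'(2), of i2] w by simp
    then show ?thesis using w' by blast
  qed
  have joint: "w = w'" if a: "w \<in> Hom C E S" "w' \<in> Hom C E S" "w \<cdot> (c \<cdot> i1) = w' \<cdot> (c \<cdot> i1)" "w \<cdot> (c \<cdot> i2) = w' \<cdot> (c \<cdot> i2)" for S w w'
  proof -
    have "w \<cdot> c = w' \<cdot> c" by (rule biproduct_co_eqI[OF b, of _ S]) (use a in auto)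
    then show ?thesis by (rule epi_cancel[OF sesD(6)[OF c]]) (use a in auto)
  qed
  have "c \<cdot> \<alpha> = (c \<cdot> (i1 \<cdot> i)) \<boxplus> (c \<cdot> (i2 \<cdot> neg g))" unfolding \<alpha>(4) by (rule comp_plus) auto
  then have "(c \<cdot> (i1 \<cdot> i)) \<boxplus> neg (c \<cdot> (i2 \<cdot> g)) = Zer C (Dom C i) E" using sesD(4)[OF c] by simp
  then have sq: "c \<cdot> (i1 \<cdot> i) = c \<cdot> (i2 \<cdot> g)" using eq_iff_minus[of "c \<cdot> (i1 \<cdot> i)" "c \<cdot> (i2 \<cdot> g)"] by simp
  obtain p' where p': "p' \<in> Hom C E (Cod C p)" "p' \<cdot> (c \<cdot> i1) = p" "p' \<cdot> (c \<cdot> i2) = Zer C N (Cod C p)"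
  proof -
    have "\<exists>w \<in> Hom C E (Cod C p). w \<cdot> (c \<cdot> i1) = p \<and> w \<cdot> (c \<cdot> i2) = Zer C N (Cod C p)"
      by (rule dual) (use N in simp_all)
    then show ?thesis using that by blast
  qed
  note [simp] = p'(1)[simplified]
  have mono: "is_mono C (c \<cdot> i2)"
  proof (rule mono_zeroI)
    fix T y assume y: "y \<in> Hom C T (Dom C (c \<cdot> i2))" "(c \<cdot> i2) \<cdot> y = Zer C T (Cod C (c \<cdot> i2))"
    have T: "T \<in> Obj C" using hom_obj y by blast
    note [simp] = y(1)[simplified]
    obtain x where x: "x \<in> Hom C T (Dom C i)" "\<alpha> \<cdot> x = i2 \<cdot> y"
      by (rule ses_lift[OF c, of "i2 \<cdot> y" T]) (use y(2) in auto)
    have "i \<cdot> x = p1 \<cdot> (i2 \<cdot> y)" using comp_eq_ext[OF \<alpha>(2), of x] x by simp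
    also have "\<dots> = Zer C T (Cod C i)" using comp_eq_ext[OF biproductD(11)[OF b], of y] T by simp
    finally have "x = Zer C T (Dom C i)" using mono_zeroD[OF sesD(5)[OF s]] x by blast
    then have "i2 \<cdot> y = Zer C T P" using x T by simp
    then have "p2 \<cdot> (i2 \<cdot> y) = Zer C T N" using T by simp
    then show "y = Zer C T (Dom C (c \<cdot> i2))" using comp_eq_ext[OF biproductD(9)[OF b], of y] by simp
  qed auto
  have epi: "is_epi C p'" by (rule epi_of_comp[of p' "c \<cdot> i1"]) (use p' sesD(6)[OF s] in auto)
  have "is_cokernel C (c \<cdot> i2) p'"
  proof (rule cokernelI[OF epi])
    fix T y assume y: "y \<in> Hom C (Cod C (c \<cdot> i2)) T" "y \<cdot> (c \<cdot> i2) = Zer C (Dom C (c \<cdot> i2)) T"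
    have T: "T \<in> Obj C" using hom_obj y by blast
    note [simp] = y(1)[simplified]
    have "y \<cdot> (c \<cdot> (i1 \<cdot> i)) = (y \<cdot> (c \<cdot> i2)) \<cdot> g" using sq by simp
    also have "\<dots> = Zer C (Dom C i) T" using y(2) T comp_eq_ext[OF y(2), of g] by simp
    finally obtain x where x: "x \<in> Hom C (Cod C p) T" "x \<cdot> p = y \<cdot> (c \<cdot> i1)"
      using ses_desc[OF s, of "y \<cdot> (c \<cdot> i1)" T] by auto
    have "x \<cdot> p' = y"
    proof (rule joint[of _ T])
      show "(x \<cdot> p') \<cdot> (c \<cdot> i1) = y \<cdot> (c \<cdot> i1)" using x p' by simp
      show "(x \<cdot> p') \<cdot> (c \<cdot> i2) = y \<cdot> (c \<cdot> i2)" using x p' y T by simp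
    qed (use x in auto)
    then show "\<exists>x \<in> Hom C (Cod C p') T. x \<cdot> p' = y" using x by auto
  qed (use p' in auto)
  then have "ses C (c \<cdot> i2) p'" by (rule mono_cokernel_ses[OF mono])
  then show ?thesis
  proof (rule that[of "c \<cdot> i2" p' E "c \<cdot> i1"])
    show "(c \<cdot> i1) \<cdot> i = (c \<cdot> i2) \<cdot> g" using sq by simp
    show "\<forall>S b d. b \<in> Hom C (Dom C p) S \<and> d \<in> Hom C N S \<and> b \<cdot> i = d \<cdot> g \<longrightarrow>
      (\<exists>w \<in> Hom C E S. w \<cdot> (c \<cdot> i1) = b \<and> w \<cdot> (c \<cdot> i2) = d)" using dual by blast
    show "\<forall>S w w'. w \<in> Hom C E S \<and> w' \<in> Hom C E S \<and> w \<cdot> (c \<cdot> i1) = w' \<cdot> (c \<cdot> i1) \<and> w \<cdot> (c \<cdot> i2) = w' \<cdot> (c \<cdot> i2)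
      \<longrightarrow> w = w'" using joint by blast
  qed (use p' in simp_all)
qed

end

text \<open>\<open>ext1_zero C P B\<close> says that \<open>Ext\<^sup>1(P, B) = 0\<close>.\<close>

definition ext1_zero :: "('o, 'm, 'z) acat_scheme \<Rightarrow> 'o \<Rightarrow> 'o \<Rightarrow> bool"
  where "ext1_zero C P B \<longleftrightarrow> (\<forall>i p. ses C i p \<and> Dom C i = B \<and> Cod C p = P \<longrightarrow>
    (\<exists>s \<in> Hom C P (Dom C p). p \<cdot> s = Ident C P))"
  for C (structure)

context abelian_category
begin

lemma ext1_retraction:
  assumes "ext1_zero C P B" "ses C i p" "Dom C i = B" "Cod C p = P"
  obtains r where "r \<in> Hom C (Dom C p) B" "r \<cdot> i = Ident C B"
proof -
  obtain s where "s \<in> Hom C P (Dom C p)" "p \<cdot> s = Ident C P" using assms unfolding ext1_zero_def by blast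
  then obtain r where "is_biproduct C (Dom C i) (Cod C p) (Dom C p) i s r p"
    using section_biproduct[OF assms(2), of s] assms by blast
  from biproductD[OF this] that show ?thesis using assms by blast
qed

lemma ext1I_retraction:
  assumes "\<And>i p. ses C i p \<Longrightarrow> Dom C i = B \<Longrightarrow> Cod C p = P \<Longrightarrow> \<exists>r \<in> Hom C (Dom C p) B. r \<cdot> i = Ident C B"
  shows "ext1_zero C P B"
  unfolding ext1_zero_def
proof (intro allI impI, elim conjE)
  fix i p assume s: "ses C i p" "Dom C i = B" "Cod C p = P"
  then obtain r where "r \<in> Hom C (Dom C p) (Dom C i)" "r \<cdot> i = Ident C (Dom C i)" using assms by blast
  then obtain t where "is_biproduct C (Dom C i) (Cod C p) (Dom C p) i t r p"
    using retraction_biproduct[OF s(1), of r] by blast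
  from biproductD[OF this] show "\<exists>s \<in> Hom C P (Dom C p). p \<cdot> s = Ident C P" using s by blast
qed

end

lemma (in abelian_category) op_ext1_zero [simp]: "ext1_zero (op_cat C) P B \<longleftrightarrow> ext1_zero C B P"
proof
  assume v: "ext1_zero (op_cat C) P B"
  show "ext1_zero C B P"
  proof (rule ext1I_retraction)
    fix i p assume s: "ses C i p" "Dom C i = P" "Cod C p = B"
    then have "\<exists>r \<in> Hom C (Cod C i) P. r \<cdot> i = Ident C P"
      using v[unfolded ext1_zero_def op_unfold] by blast
    then show "\<exists>r \<in> Hom C (Dom C p) P. r \<cdot> i = Ident C P" using sesD(3)[OF s(1)] by simp
  qed
next
  assume v: "ext1_zero C B P"
  show "ext1_zero (op_cat C) P B"
    unfolding ext1_zero_def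
  proof (intro allI impI, elim conjE)
    fix i p assume s: "ses (op_cat C) i p" "Dom (op_cat C) i = B" "Cod (op_cat C) p = P"
    then have s': "ses C p i" "Cod C i = B" "Dom C p = P" by auto
    obtain r where "r \<in> Hom C (Dom C i) P" "r \<cdot> p = Ident C P"
      by (rule ext1_retraction[OF v s'(1)]) (use s' in auto)
    then show "\<exists>s \<in> Hom (op_cat C) P (Dom (op_cat C) p). Comp (op_cat C) p s = Ident (op_cat C) P"
      using sesD[OF s'(1)] by (auto simp: op_hom)
  qed
qed

context abelian_category
begin

text \<open>Push the sequence out along \<open>a\<close> and compose with a retraction of the result.\<close>

lemma ext1_ext:
  assumes v: "ext1_zero C (Cod C p) B" and s: "ses C i p" and a: "a \<in> Hom C (Dom C i) B"
  obtains e where "e \<in> Hom C (Dom C p) B" "e \<cdot> i = a"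
proof -
  obtain E i' p' h where h: "ses C i' p'" "i' \<in> Hom C B E" "p' \<in> Hom C E (Cod C p)" "h \<in> Hom C (Dom C p) E"
    "h \<cdot> i = i' \<cdot> a" "p' \<cdot> h = p"
    by (rule ses_pushout[OF s a])
  obtain r where r: "r \<in> Hom C E B" "r \<cdot> i' = Ident C B"
    using ext1_retraction[OF v h(1)] h by auto
  have "(r \<cdot> h) \<cdot> i = r \<cdot> (i' \<cdot> a)" using r h sesD[OF s] by simp
  also have "\<dots> = a" using comp_eq_ext[OF r(2), of a] r h a by simp
  finally show ?thesis using that[of "r \<cdot> h"] r h by simp
qed

end

context abelian_category
begin

lemma ext1_lift:
  assumes v: "ext1_zero C P (Dom C i)" and s: "ses C i p" and a: "a \<in> Hom C P (Cod C p)"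
  obtains e where "e \<in> Hom C P (Dom C p)" "p \<cdot> e = a"
  using abelian_category.ext1_ext[OF op_abelian, unfolded op_unfold op_ext1_zero, of P i p a] assms sesD(3)[OF s] by metis

text \<open>The end of the long exact sequence \<open>Hom(M, B) \<rightarrow> Hom(R, B) \<rightarrow> Ext\<^sup>1(E, B) \<rightarrow> Ext\<^sup>1(M, B)\<close> of \<open>0 \<rightarrow> R \<rightarrow> M \<rightarrow> E \<rightarrow> 0\<close>:
  the first map is onto and the last group is zero.\<close>

lemma ext1_of_extension:
  assumes s: "ses C i p" and v: "ext1_zero C (Dom C p) B"
    and x: "\<And>a. a \<in> Hom C (Dom C i) B \<Longrightarrow> \<exists>a' \<in> Hom C (Dom C p) B. a' \<cdot> i = a"
  shows "ext1_zero C (Cod C p) B"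
  unfolding ext1_zero_def
proof (intro allI impI, elim conjE)
  fix j q assume t: "ses C j q" "Dom C j = B" "Cod C q = Cod C p"
  note [simp] = sesD(1-4)[OF s] sesD(1-4)[OF t(1)] t(2,3)
  obtain v where v: "v \<in> Hom C (Dom C p) (Dom C q)" "q \<cdot> v = p"
    by (rule ext1_lift[OF _ t(1), of "Dom C p" p]) (use v in auto)
  note [simp] = v(1)[simplified]
  obtain a where a: "a \<in> Hom C (Dom C i) B" "j \<cdot> a = v \<cdot> i"
    by (rule ses_lift[OF t(1), of "v \<cdot> i" "Dom C i"]) (use comp_eq_ext[OF v(2), of i] in auto)
  obtain a' where a': "a' \<in> Hom C (Dom C p) B" "a' \<cdot> i = a" using x a by blast
  note [simp] = a(1)[simplified] a'(1)[simplified]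
  have "(v \<boxplus> neg (j \<cdot> a')) \<cdot> i = (v \<cdot> i) \<boxplus> (neg (j \<cdot> a') \<cdot> i)" by (rule plus_comp) auto
  then have "(v \<boxplus> neg (j \<cdot> a')) \<cdot> i = Zer C (Dom C i) (Dom C q)" using a(2) a'(2) by simp
  then obtain w where w: "w \<in> Hom C (Cod C p) (Dom C q)" "w \<cdot> p = v \<boxplus> neg (j \<cdot> a')"
    using ses_desc[OF s, of "v \<boxplus> neg (j \<cdot> a')" "Dom C q"] by auto
  note [simp] = w(1)[simplified]
  have "(q \<cdot> w) \<cdot> p = q \<cdot> (v \<boxplus> neg (j \<cdot> a'))" using w by simp
  also have "\<dots> = (q \<cdot> v) \<boxplus> (q \<cdot> neg (j \<cdot> a'))" by (rule comp_plus) auto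
  also have "\<dots> = Ident C (Cod C p) \<cdot> p" using comp_eq_ext[OF sesD(4)[OF t(1)], of a'] v by simp
  finally have "q \<cdot> w = Ident C (Cod C p)" by (rule epi_cancel[OF sesD(6)[OF s]]) auto
  then show "\<exists>s \<in> Hom C (Cod C p) (Dom C q). q \<cdot> s = Ident C (Cod C p)" using w by blast
qed

end

section \<open>Cosyzygies and the balance of extension groups\<close>

text \<open>\<open>csz C \<M> \<N> l B\<close>: there is an exact sequence \<open>0 \<rightarrow> N \<rightarrow> M\<^sub>1 \<rightarrow> \<dots> \<rightarrow> M\<^sub>l \<rightarrow> B \<rightarrow> 0\<close> with \<open>N \<in> \<N>\<close>
  and all \<open>M\<^sub>j \<in> \<M>\<close>. Syzygies are the cosyzygies of the opposite category.\<close>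

inductive csz :: "('o, 'm, 'z) acat_scheme \<Rightarrow> 'o set \<Rightarrow> 'o set \<Rightarrow> nat \<Rightarrow> 'o \<Rightarrow> bool"
  for C \<M> \<N> where
  base: "N \<in> \<N> \<Longrightarrow> csz C \<M> \<N> 0 N"
| step: "csz C \<M> \<N> l (Dom C j) \<Longrightarrow> ses C j q \<Longrightarrow> Cod C j \<in> \<M> \<Longrightarrow> csz C \<M> \<N> (Suc l) (Cod C q)"

lemma csz_mono: "csz C \<M> \<N> l B \<Longrightarrow> \<N> \<subseteq> \<N>' \<Longrightarrow> csz C \<M> \<N>' l B"
  by (induction rule: csz.induct) (auto intro: csz.intros)

lemma csz_cons:
  assumes "csz C \<M> {Cod C q} l B" "ses C j q" "Cod C j \<in> \<M>"
  shows "csz C \<M> {Dom C j} (Suc l) B"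
  using assms(1)
proof (induction rule: csz.induct)
  case (base N)
  then show ?case using assms(2,3) by (auto intro!: csz.step[of _ _ _ 0] csz.base)
qed (auto intro: csz.intros)

lemma csz_op_op [simp]: "csz (op_cat (op_cat C)) \<M> \<N> l B \<longleftrightarrow> csz C \<M> \<N> l B"
proof
  show "csz (op_cat (op_cat C)) \<M> \<N> l B \<Longrightarrow> csz C \<M> \<N> l B"
    by (induction rule: csz.induct) (auto intro: csz.intros)
  show "csz C \<M> \<N> l B \<Longrightarrow> csz (op_cat (op_cat C)) \<M> \<N> l B"
  proof (induction rule: csz.induct)
    case (step l j q)
    then show ?case using csz.step[of "op_cat (op_cat C)" \<M> \<N> l j q] by simp
  qed (auto intro: csz.intros)
qed

context abelian_category
begin

text \<open>Dimension shifting in both variables: \<open>Ext\<^sup>1(Z, B)\<close> with \<open>B\<close> a cosyzygy is traded for \<open>Ext\<^sup>1(Z', B')\<close> with one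
  cosyzygy step less and one syzygy step more. To see that an extension of \<open>Z\<close> by \<open>B\<close> splits, cover its
  middle term by an object of \<open>\<M>\<close>; the kernel of the composite onto \<open>Z\<close> is the syzygy \<open>Z'\<close>.\<close>

lemma ext1_balance:
  assumes gen: "generating C \<M>"
    and H1: "\<And>a Z N. csz (op_cat C) \<M> \<M> a Z \<Longrightarrow> a \<le> n \<Longrightarrow> N \<in> \<N> \<Longrightarrow> ext1_zero C Z N"
    and H2: "\<And>a Z N. csz (op_cat C) \<M> \<M> a Z \<Longrightarrow> a \<le> n \<Longrightarrow> N \<in> \<M> \<Longrightarrow> ext1_zero C Z N"
  shows "csz C \<M> \<N> b B \<Longrightarrow> csz (op_cat C) \<M> \<M> a Z \<Longrightarrow> a + b \<le> n \<Longrightarrow> ext1_zero C Z B"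
proof (induction arbitrary: a Z rule: csz.induct)
  case (base N)
  then show ?case using H1 by auto
next
  case (step l j q)
  show ?case
    unfolding ext1_zero_def
  proof (intro allI impI, elim conjE)
    fix i p assume s: "ses C i p" "Dom C i = Cod C q" "Cod C p = Z"
    note [simp] = sesD(1-4)[OF step.hyps(2)] sesD(1-4)[OF s(1)] s(2,3)
    have [simp]: "Z \<in> Obj C" using dom_cod_obj(2)[of p] by simp
    have "Dom C p \<in> Obj C" by simp
    then obtain Q e where Q: "Q \<in> \<M>" and e: "e \<in> Hom C Q (Dom C p)" "is_epi C e"
      using gen unfolding generating_def by blast
    note [simp] = e(1)[simplified]
    have [simp]: "Q \<in> Obj C" using hom_obj e(1) by blast
    have "is_epi C (p \<cdot> e)" by (rule epi_comp) (use e sesD(6)[OF s(1)] in auto)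
    then obtain k where k: "ses C k (p \<cdot> e)" using ex_ses_epi by blast
    note [simp] = sesD(1,2)[OF k]
    have ck [simp]: "Cod C k = Q" using sesD(3)[OF k] by simp
    have "csz (op_cat C) \<M> \<M> (Suc a) (Dom C k)"
      using csz.step[of "op_cat C" \<M> \<M> a "p \<cdot> e" k] step.prems k Q by simp
    then have v: "ext1_zero C (Dom C k) (Dom C j)" using step.IH step.prems by simp
    obtain u where u: "u \<in> Hom C (Dom C k) (Cod C q)" "i \<cdot> u = e \<cdot> k"
      by (rule ses_lift[OF s(1), of "e \<cdot> k" "Dom C k"]) (use sesD(4)[OF k] in auto)
    obtain w where w: "w \<in> Hom C (Dom C k) (Dom C q)" "q \<cdot> w = u"
      by (rule ext1_lift[OF v step.hyps(2)]) (use u in auto)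
    have "ext1_zero C (Cod C (p \<cdot> e)) (Cod C j)" using H2[of a Z "Cod C j"] step by simp
    then obtain w' where w': "w' \<in> Hom C Q (Cod C j)" "w' \<cdot> k = w"
      by (rule ext1_ext[OF _ k, of "Cod C j" w]) (use w in auto)
    note [simp] = w(1)[simplified] u(1)[simplified] w'(1)[simplified]
    let ?c = "i \<cdot> (q \<cdot> w')"
    have "?c \<cdot> k = e \<cdot> k" using w' w u by simp
    moreover have "(e \<boxplus> neg ?c) \<cdot> k = (e \<cdot> k) \<boxplus> (neg ?c \<cdot> k)" by (rule plus_comp) auto
    ultimately have "(e \<boxplus> neg ?c) \<cdot> k = Zer C (Dom C k) (Dom C p)" by simp
    then obtain t where t: "t \<in> Hom C Z (Dom C p)" "t \<cdot> (p \<cdot> e) = e \<boxplus> neg ?c"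
      using ses_desc[OF k, of "e \<boxplus> neg ?c" "Dom C p"] by auto
    note [simp] = t(1)[simplified]
    have "(p \<cdot> t) \<cdot> (p \<cdot> e) = p \<cdot> (e \<boxplus> neg ?c)" using t by simp
    also have "\<dots> = (p \<cdot> e) \<boxplus> (p \<cdot> neg ?c)" by (rule comp_plus) auto
    also have "\<dots> = Ident C Z \<cdot> (p \<cdot> e)" using comp_eq_ext[OF sesD(4)[OF s(1)], of "q \<cdot> w'"] by simp
    finally have "p \<cdot> t = Ident C Z" by (rule epi_cancel[OF sesD(6)[OF k]]) auto
    then show "\<exists>s \<in> Hom C Z (Dom C p). p \<cdot> s = Ident C Z" using t by blast
  qed
qed

end

section \<open>Exact sequences\<close>

text \<open>These are the elements of \<^const>\<open>yoneda_exts\<close> with the end terms left free, and with exactness in the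
  self-dual form.\<close>

definition exs :: "('o, 'm, 'z) acat_scheme \<Rightarrow> nat \<Rightarrow> (nat \<Rightarrow> 'o) \<Rightarrow> (nat \<Rightarrow> 'm) \<Rightarrow> bool"
  where "exs C n X f \<longleftrightarrow> is_sequ C n X f \<and> is_mono C (f 0) \<and> is_epi C (f n) \<and> (\<forall>i<n. exact C (f i) (f (Suc i)))"

lemma exsD:
  assumes "exs C n X f"
  shows "i \<le> Suc n \<Longrightarrow> X i \<in> Obj C" "i \<le> n \<Longrightarrow> f i \<in> Hom C (X i) (X (Suc i))" "is_mono C (f 0)" "is_epi C (f n)"
    "i < n \<Longrightarrow> exact C (f i) (f (Suc i))"
    "i < n \<Longrightarrow> Comp C (f (Suc i)) (f i) = Zer C (X i) (X (Suc (Suc i)))"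
proof -
  have 1: "\<And>i. i \<le> Suc n \<Longrightarrow> X i \<in> Obj C" "\<And>i. i \<le> n \<Longrightarrow> f i \<in> Hom C (X i) (X (Suc i))"
    "is_mono C (f 0)" "is_epi C (f n)" "\<And>i. i < n \<Longrightarrow> exact C (f i) (f (Suc i))"
    using assms unfolding exs_def is_sequ_def by blast+
  then show "i \<le> Suc n \<Longrightarrow> X i \<in> Obj C" "i \<le> n \<Longrightarrow> f i \<in> Hom C (X i) (X (Suc i))" "is_mono C (f 0)" "is_epi C (f n)"
    "i < n \<Longrightarrow> exact C (f i) (f (Suc i))" by blast+
  assume i: "i < n"
  have "f i \<in> Hom C (X i) (X (Suc i))" "f (Suc i) \<in> Hom C (X (Suc i)) (X (Suc (Suc i)))"
    using 1(2)[of i] 1(2)[of "Suc i"] i by linarith+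
  then show "Comp C (f (Suc i)) (f i) = Zer C (X i) (X (Suc (Suc i)))"
    using 1(5)[OF i] unfolding exact_def by simp
qed

text \<open>\<open>glue x y Y\<close> replaces the first entry of \<open>Y\<close> by the two entries \<open>x\<close>, \<open>y\<close>, and \<open>unglue\<close> goes the
  other way. This is how a sequence is composed with, and decomposed into, short exact ones.\<close>

definition glue :: "'a \<Rightarrow> 'a \<Rightarrow> (nat \<Rightarrow> 'a) \<Rightarrow> nat \<Rightarrow> 'a"
  where "glue x y Y i = (case i of 0 \<Rightarrow> x | Suc j \<Rightarrow> (case j of 0 \<Rightarrow> y | Suc k \<Rightarrow> Y (Suc k)))"

definition unglue :: "'a \<Rightarrow> (nat \<Rightarrow> 'a) \<Rightarrow> nat \<Rightarrow> 'a"
  where "unglue b X i = (case i of 0 \<Rightarrow> b | Suc k \<Rightarrow> X (Suc (Suc k)))"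

lemma glue_simps [simp]: "glue x y Y 0 = x" "glue x y Y (Suc 0) = y" "glue x y Y (Suc (Suc k)) = Y (Suc k)"
  by (simp_all add: glue_def)

lemma unglue_simps [simp]: "unglue b X 0 = b" "unglue b X (Suc k) = X (Suc (Suc k))"
  by (simp_all add: unglue_def)

context abelian_category
begin

lemma yoneda_exts_iff: "(X, f) \<in> yoneda_exts C n P N \<longleftrightarrow> exs C n X f \<and> X 0 = N \<and> X (Suc n) = P"
proof -
  have "exact_at C (f i) (f (Suc i)) = exact C (f i) (f (Suc i))" if "is_sequ C n X f" "i < n" for i
    using exact_at_iff_ex[of "f i" "f (Suc i)"] that unfolding is_sequ_def by simp
  then show ?thesis unfolding yoneda_exts_def exs_def by auto
qed

lemma exs_glue:
  assumes s: "ses C i p" and Y: "exs C n Y g" and e: "Cod C p = Y 0"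
  shows "exs C (Suc n) (glue (Dom C i) (Dom C p) Y) (glue i (g 0 \<cdot> p) g)"
proof -
  note [simp] = sesD(1-4)[OF s] e
  have g: "\<And>i. i \<le> n \<Longrightarrow> g i \<in> Arr C \<and> Dom C (g i) = Y i \<and> Cod C (g i) = Y (Suc i)"
    using exsD(2)[OF Y] by simp
  have Y': "\<And>i. i \<le> Suc n \<Longrightarrow> Y i \<in> Obj C" using exsD(1)[OF Y] by simp
  note [simp] = g[of 0, simplified]
  have 1: "is_sequ C (Suc n) (glue (Dom C i) (Dom C p) Y) (glue i (g 0 \<cdot> p) g)"
    unfolding is_sequ_def
  proof (intro conjI allI impI)
    fix k show "k \<le> Suc (Suc n) \<Longrightarrow> glue (Dom C i) (Dom C p) Y k \<in> Obj C"
      using Y' by (auto simp: glue_def split: nat.split)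
    show "k \<le> Suc n \<Longrightarrow> glue i (g 0 \<cdot> p) g k \<in> Hom C (glue (Dom C i) (Dom C p) Y k) (glue (Dom C i) (Dom C p) Y (Suc k))"
      using g by (auto simp: glue_def split: nat.split)
  qed
  have 2: "is_epi C (glue i (g 0 \<cdot> p) g (Suc n))"
  proof (cases n)
    case 0
    then show ?thesis using epi_comp[OF sesD(6)[OF s], of "g 0"] exsD(4)[OF Y] by simp
  qed (use exsD(4)[OF Y] in simp)
  have 3: "exact C i (g 0 \<cdot> p)"
    unfolding exact_def
  proof (intro conjI allI impI)
    show "(g 0 \<cdot> p) \<cdot> i = Zer C (Dom C i) (Cod C (g 0 \<cdot> p))" using Y'[of 0] by simp
    fix T S y z assume a: "y \<in> Hom C T (Dom C (g 0 \<cdot> p)) \<and> z \<in> Hom C (Dom C (g 0 \<cdot> p)) S \<and>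
      (g 0 \<cdot> p) \<cdot> y = Zer C T (Cod C (g 0 \<cdot> p)) \<and> z \<cdot> i = Zer C (Dom C i) S"
    then have TS: "T \<in> Obj C" "S \<in> Obj C" using hom_obj by blast+
    have "p \<cdot> y = Zer C T (Dom C (g 0))" by (rule mono_zeroD[OF exsD(3)[OF Y]]) (use a in auto)
    then obtain x where x: "x \<in> Hom C T (Dom C i)" "i \<cdot> x = y"
      using ses_lift[OF s, of y T] a by auto
    then show "z \<cdot> y = Zer C T S" using comp_eq_ext[of z i "Zer C (Dom C i) S" x] a TS by simp
  qed auto
  have 4: "exact C (g 0 \<cdot> p) (g (Suc 0))" if "0 < n"
    unfolding exact_def
  proof (intro conjI allI impI)
    have n: "Suc 0 \<le> n" using that by simp
    note x = exsD(5)[OF Y that]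
    note [simp] = g[OF n]
    show "g (Suc 0) \<cdot> (g 0 \<cdot> p) = Zer C (Dom C (g 0 \<cdot> p)) (Cod C (g (Suc 0)))"
      using comp_eq_ext[OF exsD(6)[OF Y that], of p] Y'[of 2] n by (simp add: numeral_2_eq_2)
    show "g 0 \<cdot> p \<in> Arr C" "g (Suc 0) \<in> Arr C" "Cod C (g 0 \<cdot> p) = Dom C (g (Suc 0))" by auto
    fix T S y z assume a: "y \<in> Hom C T (Dom C (g (Suc 0))) \<and> z \<in> Hom C (Dom C (g (Suc 0))) S \<and>
      g (Suc 0) \<cdot> y = Zer C T (Cod C (g (Suc 0))) \<and> z \<cdot> (g 0 \<cdot> p) = Zer C (Dom C (g 0 \<cdot> p)) S"
    then have "z \<cdot> g 0 = Zer C (Dom C (g 0)) S"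
      using epi_zeroD[OF sesD(6)[OF s], of "z \<cdot> g 0" S] by simp
    then show "z \<cdot> y = Zer C T S" using exD[OF x, of y T z S] a by blast
  qed
  have 5: "exact C (glue i (g 0 \<cdot> p) g k) (glue i (g 0 \<cdot> p) g (Suc k))" if k: "k < Suc n" for k
  proof (cases k)
    case (Suc j)
    then show ?thesis using 4 exsD(5)[OF Y, of j] k by (cases j) auto
  qed (use 3 in simp)
  show ?thesis unfolding exs_def using 1 2 5 sesD(5)[OF s] by simp
qed

lemma exs_unglue:
  assumes X: "exs C (Suc n) X f"
  obtains B p m where "ses C (f 0) p" "p \<in> Hom C (X 1) B" "m \<in> Hom C B (X 2)" "m \<cdot> p = f 1"
    "exs C n (unglue B X) (unglue m f)"
proof -
  have f: "\<And>i. i \<le> Suc n \<Longrightarrow> f i \<in> Arr C \<and> Dom C (f i) = X i \<and> Cod C (f i) = X (Suc i)"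
    using exsD(2)[OF X] by simp
  have X': "\<And>i. i \<le> Suc (Suc n) \<Longrightarrow> X i \<in> Obj C" using exsD(1)[OF X] by simp
  note [simp] = f[of 0, simplified] f[of 1, simplified] X'[of 0, simplified] X'[of "Suc 0", simplified] X'[of "Suc (Suc 0)", simplified]
  obtain p where s: "ses C (f 0) p" using ex_ses_mono exsD(3)[OF X] by blast
  have [simp]: "Dom C p = X (Suc 0)" "p \<in> Arr C" using sesD[OF s] by auto
  define B where "B = Cod C p"
  have B [simp]: "Cod C p = B" "B \<in> Obj C" using \<open>p \<in> Arr C\<close> by (auto simp: B_def simp del: \<open>p \<in> Arr C\<close>)
  have x0: "exact C (f 0) (f (Suc 0))" using exsD(5)[OF X, of 0] by simp
  obtain m where m: "m \<in> Hom C B (X 2)" "m \<cdot> p = f (Suc 0)"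
    by (rule ses_desc[OF s, of "f (Suc 0)" "X 2"]) (use exsD(6)[OF X, of 0] in \<open>auto simp: numeral_2_eq_2\<close>)
  have [simp]: "m \<in> Arr C" "Dom C m = B" "Cod C m = X (Suc (Suc 0))" using m by (auto simp: numeral_2_eq_2)
  have mono: "is_mono C m"
  proof (rule mono_zeroI)
    fix T y assume y: "y \<in> Hom C T (Dom C m)" "m \<cdot> y = Zer C T (Cod C m)"
    have T: "T \<in> Obj C" using hom_obj y by blast
    obtain T' e x where e: "e \<in> Hom C T' T" "is_epi C e" "x \<in> Hom C T' (Dom C p)" "p \<cdot> x = y \<cdot> e"
      by (rule epi_cover[OF sesD(6)[OF s], of y T]) (use y in auto)
    have T': "T' \<in> Obj C" using hom_obj e by blast
    have "f (Suc 0) \<cdot> x = m \<cdot> (y \<cdot> e)" using comp_eq_ext[OF m(2), of x] e by simp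
    also have "\<dots> = Zer C T' (Cod C m)" using comp_eq_ext[OF y(2), of e] y e T by simp
    finally have "p \<cdot> x = Zer C T' B" by (intro exD[OF x0, of x T' p B]) (use e sesD(4)[OF s] in auto)
    then show "y = Zer C T (Dom C m)" using epi_zeroD[OF e(2), of y B] e y by simp
  qed simp
  have epi: "is_epi C m" if "n = 0"
    by (rule epi_of_comp[of m p]) (use exsD(4)[OF X] that m in auto)
  have 1: "is_sequ C n (unglue B X) (unglue m f)"
    unfolding is_sequ_def
  proof (intro conjI allI impI)
    fix k show "k \<le> Suc n \<Longrightarrow> unglue B X k \<in> Obj C"
      using X' by (auto simp: unglue_def split: nat.split)
    show "k \<le> n \<Longrightarrow> unglue m f k \<in> Hom C (unglue B X k) (unglue B X (Suc k))"
      using f m by (auto simp: unglue_def numeral_2_eq_2 split: nat.split)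
  qed
  have 2: "exact C (unglue m f k) (unglue m f (Suc k))" if k: "k < n" for k
  proof (cases k)
    case 0
    then have n: "Suc (Suc 0) \<le> Suc n" using k by simp
    note [simp] = f[OF n]
    note x = exsD(5)[OF X, of "Suc 0"]
    have "(f (Suc (Suc 0)) \<cdot> m) \<cdot> p = Zer C (Dom C p) (X (Suc (Suc (Suc 0))))"
      using exsD(6)[OF X, of "Suc 0"] n m by simp
    then have z: "f (Suc (Suc 0)) \<cdot> m = Zer C B (X (Suc (Suc (Suc 0))))"
      using epi_zeroD[OF sesD(6)[OF s], of "f (Suc (Suc 0)) \<cdot> m"] by simp
    have "exact C m (f (Suc (Suc 0)))"
      unfolding exact_def
    proof (intro conjI allI impI)
      fix T S y z assume a: "y \<in> Hom C T (Dom C (f (Suc (Suc 0)))) \<and> z \<in> Hom C (Dom C (f (Suc (Suc 0)))) S \<and>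
        f (Suc (Suc 0)) \<cdot> y = Zer C T (Cod C (f (Suc (Suc 0)))) \<and> z \<cdot> m = Zer C (Dom C m) S"
      then have S: "S \<in> Obj C" using hom_obj by blast
      have "z \<cdot> f (Suc 0) = z \<cdot> (m \<cdot> p)" by (simp only: m(2))
      then have "z \<cdot> f (Suc 0) = Zer C (Dom C (f (Suc 0))) S"
        using a S comp_eq_ext[of z m "Zer C B S" p] by simp
      then show "z \<cdot> y = Zer C T S" using exD[OF x, of y T z S] a n by simp
    qed (use z in auto)
    then show ?thesis using 0 by simp
  qed (use exsD(5)[OF X, of "Suc k"] k in simp)
  have "exs C n (unglue B X) (unglue m f)"
    unfolding exs_def using 1 2 mono epi exsD(4)[OF X] by (cases n) auto
  then show ?thesis using that[of p B m] s m by simp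
qed

text \<open>Only the initial short exact sequence \<open>0 \<rightarrow> X\<^sub>0 \<rightarrow> X\<^sub>1 \<rightarrow> B \<rightarrow> 0\<close> is changed: it is pushed out along \<open>a\<close>.\<close>

lemma exs_pushout:
  assumes X: "exs C (Suc n) X f" and a: "a \<in> Hom C (X 0) N"
  obtains E u v h where "exs C (Suc n) (glue N E (\<lambda>i. X (Suc i))) (glue u v (\<lambda>i. f (Suc i)))"
    "u \<in> Hom C N E" "v \<in> Hom C E (X 2)" "h \<in> Hom C (X 1) E" "h \<cdot> f 0 = u \<cdot> a" "v \<cdot> h = f 1" "v \<cdot> u = Zer C N (X 2)"
    "\<forall>S b d. b \<in> Hom C (X 1) S \<and> d \<in> Hom C N S \<and> b \<cdot> f 0 = d \<cdot> a \<longrightarrow> (\<exists>w \<in> Hom C E S. w \<cdot> h = b \<and> w \<cdot> u = d)"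
    "\<forall>S w w'. w \<in> Hom C E S \<and> w' \<in> Hom C E S \<and> w \<cdot> h = w' \<cdot> h \<and> w \<cdot> u = w' \<cdot> u \<longrightarrow> w = w'"
proof -
  obtain B p m where p: "ses C (f 0) p" "p \<in> Hom C (X 1) B" "m \<in> Hom C B (X 2)" "m \<cdot> p = f 1"
    "exs C n (unglue B X) (unglue m f)"
    by (rule exs_unglue[OF X])
  have a': "a \<in> Hom C (Dom C (f 0)) N" using a exsD(2)[OF X, of 0] by simp
  have N: "N \<in> Obj C" using hom_obj a by blast
  obtain E u p' h where h: "ses C u p'" "u \<in> Hom C N E" "p' \<in> Hom C E (Cod C p)" "h \<in> Hom C (Dom C p) E"
    "h \<cdot> f 0 = u \<cdot> a" "p' \<cdot> h = p"
    and w: "\<forall>S b d. b \<in> Hom C (Dom C p) S \<and> d \<in> Hom C N S \<and> b \<cdot> f 0 = d \<cdot> a \<longrightarrow> (\<exists>w \<in> Hom C E S. w \<cdot> h = b \<and> w \<cdot> u = d)"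
    and j: "\<forall>S w w'. w \<in> Hom C E S \<and> w' \<in> Hom C E S \<and> w \<cdot> h = w' \<cdot> h \<and> w \<cdot> u = w' \<cdot> u \<longrightarrow> w = w'"
    by (rule ses_pushout[OF p(1) a'])
  have "exs C (Suc n) (glue (Dom C u) (Dom C p') (unglue B X)) (glue u (unglue m f 0 \<cdot> p') (unglue m f))"
    by (rule exs_glue[OF h(1) p(5)]) (use h p in simp)
  moreover have "glue (Dom C u) (Dom C p') (unglue B X) = glue N E (\<lambda>i. X (Suc i))"
    using h by (auto simp: glue_def fun_eq_iff split: nat.split)
  moreover have "glue u (unglue m f 0 \<cdot> p') (unglue m f) = glue u (m \<cdot> p') (\<lambda>i. f (Suc i))"
    by (auto simp: glue_def fun_eq_iff split: nat.split)
  ultimately have "exs C (Suc n) (glue N E (\<lambda>i. X (Suc i))) (glue u (m \<cdot> p') (\<lambda>i. f (Suc i)))" by simp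
  moreover have m: "m \<in> Arr C" "Dom C m = B" "Cod C m = X 2" and p': "p' \<in> Arr C" "Dom C p' = E" "Cod C p' = B"
    and d: "Dom C p = X 1" "h \<in> Arr C" "Dom C h = X 1" "Cod C h = E"
    using p(2,3) h(3,4) by auto
  moreover have "(m \<cdot> p') \<cdot> h = f 1" using m p' d p(4) h(6) by simp
  moreover have "(m \<cdot> p') \<cdot> u = Zer C N (X 2)"
  proof -
    have u: "u \<in> Arr C" "Dom C u = N" "Cod C u = E" using h(2) by auto
    have "p' \<cdot> u = Zer C N B" using sesD(4)[OF h(1)] u p' by simp
    then show ?thesis using m p' u N by simp
  qed
  moreover have "m \<cdot> p' \<in> Hom C E (X 2)" "h \<in> Hom C (X 1) E" using m p' d by auto
  ultimately show ?thesis using that[of E u "m \<cdot> p'" h] h(2,5) w j unfolding d(1) by blast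
qed

end

section \<open>Morphisms and duals of sequences\<close>

lemma ex_arrD:
  assumes "exact C f g"
  shows "f \<in> Arr C" "g \<in> Arr C" "Cod C f = Dom C g" "Comp C g f = Zer C (Dom C f) (Cod C g)"
  using assms unfolding exact_def by blast+

definition revs :: "nat \<Rightarrow> (nat \<Rightarrow> 'a) \<Rightarrow> nat \<Rightarrow> 'a"
  where "revs n X i = X (n - i)"

definition cmap :: "('o, 'm, 'z) acat_scheme \<Rightarrow> nat \<Rightarrow> (nat \<Rightarrow> 'o) \<Rightarrow> (nat \<Rightarrow> 'm) \<Rightarrow> (nat \<Rightarrow> 'o) \<Rightarrow> (nat \<Rightarrow> 'm) \<Rightarrow> (nat \<Rightarrow> 'm) \<Rightarrow> bool"
  where "cmap C n X f Y g \<phi> \<longleftrightarrow> (\<forall>i \<le> Suc n. \<phi> i \<in> Hom C (X i) (Y i)) \<and> (\<forall>i \<le> n. \<phi> (Suc i) \<cdot> f i = g i \<cdot> \<phi> i)"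
  for C (structure)

lemma cmapD:
  assumes "cmap C n X f Y g \<phi>"
  shows "i \<le> Suc n \<Longrightarrow> \<phi> i \<in> Hom C (X i) (Y i)" "i \<le> n \<Longrightarrow> Comp C (\<phi> (Suc i)) (f i) = Comp C (g i) (\<phi> i)"
  using assms unfolding cmap_def by blast+

lemma end_fixing_map_iff: "end_fixing_map C n (X, f) (Y, g) \<longleftrightarrow> X 0 = Y 0 \<and> X (Suc n) = Y (Suc n) \<and>
    (\<exists>\<phi>. cmap C n X f Y g \<phi> \<and> \<phi> 0 = Ident C (X 0) \<and> \<phi> (Suc n) = Ident C (X (Suc n)))"
  unfolding end_fixing_map_def cmap_def by auto

lemma exs_op_op [simp]: "exs (op_cat (op_cat C)) n X f \<longleftrightarrow> exs C n X f"
  unfolding exs_def is_sequ_def by (simp add: op_exact)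

lemma exs_revs:
  assumes "exs C n X f"
  shows "exs (op_cat C) n (revs (Suc n) X) (revs n f)"
  unfolding exs_def is_sequ_def
proof (intro conjI allI impI)
  fix i
  show "i \<le> Suc n \<Longrightarrow> revs (Suc n) X i \<in> Obj (op_cat C)" using exsD(1)[OF assms] by (simp add: revs_def)
  show "i \<le> n \<Longrightarrow> revs n f i \<in> Hom (op_cat C) (revs (Suc n) X i) (revs (Suc n) X (Suc i))"
    using exsD(2)[OF assms, of "n - i"] by (simp add: revs_def op_hom Suc_diff_le)
  show "i < n \<Longrightarrow> exact (op_cat C) (revs n f i) (revs n f (Suc i))"
    using exsD(5)[OF assms, of "n - Suc i"] by (simp add: revs_def op_exact Suc_diff_Suc)
qed (use exsD(3,4)[OF assms] in \<open>simp_all add: revs_def\<close>)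

lemma exs_revs':
  assumes "exs (op_cat C) n X f"
  shows "exs C n (revs (Suc n) X) (revs n f)"
  using exs_revs[OF assms] by simp

section \<open>Extensions that represent zero\<close>

text \<open>An exact sequence \<open>0 \<rightarrow> X\<^sub>0 \<rightarrow> \<dots> \<rightarrow> X\<^sub>n\<^sub>+\<^sub>2 \<rightarrow> 0\<close> represents zero in \<open>Ext\<close> iff some exact sequence
  \<open>0 \<rightarrow> W\<^sub>0 \<rightarrow> \<dots> \<rightarrow> W\<^sub>n\<^sub>+\<^sub>1 = X\<^sub>n\<^sub>+\<^sub>2 \<rightarrow> 0\<close> maps to its right part (\<open>rsplit\<close>), and dually iff its left part maps to an
  exact sequence starting at \<open>X\<^sub>0\<close> (\<open>lsplit\<close>). The first condition is visibly inherited along morphisms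
  of extensions, and the second one visibly passes back along them. Their equivalence makes both
  invariant under the zigzags that define Yoneda equivalence.\<close>

definition rsplit :: "('o, 'm, 'z) acat_scheme \<Rightarrow> nat \<Rightarrow> (nat \<Rightarrow> 'o) \<Rightarrow> (nat \<Rightarrow> 'm) \<Rightarrow> bool"
  where "rsplit C n X f \<longleftrightarrow> (\<exists>W w \<phi>. exs C n W w \<and> W (Suc n) = X (Suc (Suc n)) \<and>
    cmap C n W w (\<lambda>i. X (Suc i)) (\<lambda>i. f (Suc i)) \<phi> \<and> \<phi> (Suc n) = Ident C (X (Suc (Suc n))))"

definition lsplit :: "('o, 'm, 'z) acat_scheme \<Rightarrow> nat \<Rightarrow> (nat \<Rightarrow> 'o) \<Rightarrow> (nat \<Rightarrow> 'm) \<Rightarrow> bool"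
  where "lsplit C n X f \<longleftrightarrow> (\<exists>V v \<phi>. exs C n V v \<and> V 0 = X 0 \<and> cmap C n X f V v \<phi> \<and> \<phi> 0 = Ident C (X 0))"

lemma lsplit_op_rsplit:
  assumes "lsplit (op_cat C) n (revs (Suc (Suc n)) X) (revs (Suc n) f)"
  shows "rsplit C n X f"
proof -
  obtain V v \<phi> where V: "exs (op_cat C) n V v" "V 0 = X (Suc (Suc n))"
    "cmap (op_cat C) n (revs (Suc (Suc n)) X) (revs (Suc n) f) V v \<phi>" "\<phi> 0 = Ident C (X (Suc (Suc n)))"
    using assms unfolding lsplit_def by (auto simp: revs_def)
  have "cmap C n (revs (Suc n) V) (revs n v) (\<lambda>i. X (Suc i)) (\<lambda>i. f (Suc i)) (revs (Suc n) \<phi>)"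
    unfolding cmap_def
  proof (intro conjI allI impI)
    fix i
    show "i \<le> Suc n \<Longrightarrow> revs (Suc n) \<phi> i \<in> Hom C (revs (Suc n) V i) (X (Suc i))"
      using cmapD(1)[OF V(3), of "Suc n - i"] by (simp add: revs_def op_hom Suc_diff_le)
    assume "i \<le> n"
    then show "Comp C (revs (Suc n) \<phi> (Suc i)) (revs n v i) = Comp C (f (Suc i)) (revs (Suc n) \<phi> i)"
      using cmapD(2)[OF V(3), of "n - i"] by (simp add: revs_def Suc_diff_le)
  qed
  then show ?thesis unfolding rsplit_def using exs_revs'[OF V(1)] V(2,4)
    by (intro exI[of _ "revs (Suc n) V"] exI[of _ "revs n v"] exI[of _ "revs (Suc n) \<phi>"]) (simp add: revs_def)
qed

lemma lsplit_rsplit_op: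
  assumes "lsplit C n X f"
  shows "rsplit (op_cat C) n (revs (Suc (Suc n)) X) (revs (Suc n) f)"
proof -
  obtain V v \<phi> where V: "exs C n V v" "V 0 = X 0" "cmap C n X f V v \<phi>" "\<phi> 0 = Ident C (X 0)"
    using assms unfolding lsplit_def by blast
  have "cmap (op_cat C) n (revs (Suc n) V) (revs n v) (\<lambda>i. revs (Suc (Suc n)) X (Suc i)) (\<lambda>i. revs (Suc n) f (Suc i)) (revs (Suc n) \<phi>)"
    unfolding cmap_def
  proof (intro conjI allI impI)
    fix i
    show "i \<le> Suc n \<Longrightarrow> revs (Suc n) \<phi> i \<in> Hom (op_cat C) (revs (Suc n) V i) (revs (Suc (Suc n)) X (Suc i))"
      using cmapD(1)[OF V(3), of "Suc n - i"] by (simp add: revs_def op_hom Suc_diff_le)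
    assume "i \<le> n"
    then show "Comp (op_cat C) (revs (Suc n) \<phi> (Suc i)) (revs n v i) = Comp (op_cat C) (revs (Suc n) f (Suc i)) (revs (Suc n) \<phi> i)"
      using cmapD(2)[OF V(3), of "n - i"] by (simp add: revs_def Suc_diff_le)
  qed
  then show ?thesis unfolding rsplit_def using exs_revs[OF V(1)] V(2,4)
    by (intro exI[of _ "revs (Suc n) V"] exI[of _ "revs n v"] exI[of _ "revs (Suc n) \<phi>"]) (simp add: revs_def)
qed

context abelian_category
begin

lemma ex_lift:
  assumes "exact C f g" "is_mono C f" "y \<in> Hom C T (Dom C g)" "g \<cdot> y = Zer C T (Cod C g)"
  obtains x where "x \<in> Hom C T (Dom C f)" "f \<cdot> x = y"
proof -
  obtain q where q: "ses C f q" using ex_ses_mono assms(2) by blast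
  have "q \<cdot> y = Zer C T (Cod C q)"
    by (rule exD[OF assms(1,3,4)]) (use sesD[OF q] ex_arrD[OF assms(1)] in auto)
  moreover have "y \<in> Hom C T (Dom C q)" using assms(3) sesD(3)[OF q] ex_arrD(3)[OF assms(1)] by simp
  ultimately show ?thesis using ses_lift[OF q] that by blast
qed

lemma ex_mono_epi_ses:
  assumes "exact C f g" "is_mono C f" "is_epi C g"
  shows "ses C f g"
proof (rule epi_kernel_ses[OF assms(3)])
  show "is_kernel C g f"
  proof (rule kernelI[OF assms(2)])
    fix T y assume "y \<in> Hom C T (Dom C g)" "g \<cdot> y = Zer C T (Cod C g)"
    then show "\<exists>x \<in> Hom C T (Dom C f). f \<cdot> x = y" using ex_lift[OF assms(1,2)] by blast
  qed (use ex_arrD[OF assms(1)] in auto)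
qed

subsection \<open>The cone of a morphism of exact sequences\<close>

text \<open>Exactness of the cone at one place, by a chase of generalized elements; the last map \<open>v1\<close>
  enters only through its kernel, because the top end of the cone is truncated later.\<close>

lemma cone_ex:
  assumes b0: "is_biproduct C X0 W0 Va i0 j0 p0 q0" and b1: "is_biproduct C X1 W1 Vb i1 j1 p1 q1"
    and x: "exact C x0 x1" "x0 \<in> Hom C X0 X1" "x1 \<in> Hom C X1 X2"
    and w: "exact C w0 w1" "w0 \<in> Hom C W0 W1" "w1 \<in> Hom C W1 W2"
    and \<phi>: "\<phi>0 \<in> Hom C W0 X1" "\<phi>1 \<in> Hom C W1 X2" "x1 \<cdot> \<phi>0 = \<phi>1 \<cdot> w0"
    and v0: "v0 \<in> Hom C Va Vb" "p1 \<cdot> v0 = (x0 \<cdot> p0) \<boxplus> (\<phi>0 \<cdot> q0)" "q1 \<cdot> v0 = neg (w0 \<cdot> q0)"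
    and v1: "v1 \<in> Hom C Vb Z" "v1 \<cdot> v0 = Zer C Va Z"
      "\<And>T y. y \<in> Hom C T Vb \<Longrightarrow> v1 \<cdot> y = Zer C T Z \<Longrightarrow>
        w1 \<cdot> (q1 \<cdot> y) = Zer C T W2 \<and> (x1 \<cdot> (p1 \<cdot> y)) \<boxplus> (\<phi>1 \<cdot> (q1 \<cdot> y)) = Zer C T X2"
  shows "exact C v0 v1"
proof (rule exI_cover)
  note [simp] = x(2,3)[simplified] w(2,3)[simplified] \<phi>(1,2)[simplified] v0(1)[simplified] v1(1)[simplified]
    biproductD(4-7)[OF b0, simplified] biproductD(4-7)[OF b1, simplified] biproductD(1-3)[OF b0] biproductD(1-3)[OF b1]
  fix T y assume y: "y \<in> Hom C T (Dom C v1)" "v1 \<cdot> y = Zer C T (Cod C v1)"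
  note [simp] = y(1)[simplified]
  have k: "w1 \<cdot> (q1 \<cdot> y) = Zer C T W2" "(x1 \<cdot> (p1 \<cdot> y)) \<boxplus> (\<phi>1 \<cdot> (q1 \<cdot> y)) = Zer C T X2"
    using v1(3)[of y T] y(2) by simp_all
  obtain T' e b where e: "e \<in> Hom C T' T" "is_epi C e" "b \<in> Hom C T' (Dom C w0)" "w0 \<cdot> b = (q1 \<cdot> y) \<cdot> e"
    by (rule ex_cover[OF w(1), of "q1 \<cdot> y" T]) (use k in auto)
  note [simp] = e(1,3)[simplified]
  have T': "T' \<in> Obj C" and X2: "X2 \<in> Obj C" using hom_obj e(1) x(3) by blast+
  let ?c = "(p1 \<cdot> (y \<cdot> e)) \<boxplus> (\<phi>0 \<cdot> b)"
  have "x1 \<cdot> ?c = (x1 \<cdot> (p1 \<cdot> (y \<cdot> e))) \<boxplus> (x1 \<cdot> (\<phi>0 \<cdot> b))" by (rule comp_plus) auto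
  also have "x1 \<cdot> (\<phi>0 \<cdot> b) = \<phi>1 \<cdot> (q1 \<cdot> (y \<cdot> e))" using comp_eq_ext[OF \<phi>(3), of b] e(4) by simp
  also have "(x1 \<cdot> (p1 \<cdot> (y \<cdot> e))) \<boxplus> (\<phi>1 \<cdot> (q1 \<cdot> (y \<cdot> e))) = ((x1 \<cdot> (p1 \<cdot> y)) \<boxplus> (\<phi>1 \<cdot> (q1 \<cdot> y))) \<cdot> e"
    by (subst plus_comp) auto
  also have "\<dots> = Zer C T' X2" unfolding k(2) using X2 by simp
  finally obtain T'' e' a where e': "e' \<in> Hom C T'' T'" "is_epi C e'" "a \<in> Hom C T'' (Dom C x0)" "x0 \<cdot> a = ?c \<cdot> e'"
    using ex_cover[OF x(1), of ?c T'] by auto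
  note [simp] = e'(1,3)[simplified]
  obtain z where z: "z \<in> Hom C T'' Va" "p0 \<cdot> z = a" "q0 \<cdot> z = neg (b \<cdot> e')"
    "z = (i0 \<cdot> a) \<boxplus> (j0 \<cdot> neg (b \<cdot> e'))"
    by (rule biproduct_pair[OF b0, of a T'' "neg (b \<cdot> e')"]) auto
  note [simp] = z(1)[simplified]
  have "v0 \<cdot> z = y \<cdot> (e \<cdot> e')"
  proof (rule biproduct_eqI[OF b1, of _ T''])
    have "p1 \<cdot> (v0 \<cdot> z) = ((x0 \<cdot> p0) \<boxplus> (\<phi>0 \<cdot> q0)) \<cdot> z" using comp_eq_ext[OF v0(2), of z] by simp
    also have "\<dots> = (x0 \<cdot> a) \<boxplus> (\<phi>0 \<cdot> neg (b \<cdot> e'))" using z by (subst plus_comp) auto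
    also have "x0 \<cdot> a = (p1 \<cdot> (y \<cdot> (e \<cdot> e'))) \<boxplus> (\<phi>0 \<cdot> (b \<cdot> e'))" unfolding e'(4) by (subst plus_comp) auto
    also have "((p1 \<cdot> (y \<cdot> (e \<cdot> e'))) \<boxplus> (\<phi>0 \<cdot> (b \<cdot> e'))) \<boxplus> (\<phi>0 \<cdot> neg (b \<cdot> e'))
      = (p1 \<cdot> (y \<cdot> (e \<cdot> e'))) \<boxplus> ((\<phi>0 \<cdot> (b \<cdot> e')) \<boxplus> (\<phi>0 \<cdot> neg (b \<cdot> e')))" by (rule plus_assoc) auto
    also have "(\<phi>0 \<cdot> (b \<cdot> e')) \<boxplus> (\<phi>0 \<cdot> neg (b \<cdot> e')) = Zer C T'' X1" by simp
    finally show "p1 \<cdot> (v0 \<cdot> z) = p1 \<cdot> (y \<cdot> (e \<cdot> e'))" by simp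
    have "q1 \<cdot> (v0 \<cdot> z) = neg (w0 \<cdot> q0) \<cdot> z" using comp_eq_ext[OF v0(3), of z] by simp
    also have "\<dots> = w0 \<cdot> (b \<cdot> e')" using z by simp
    also have "\<dots> = q1 \<cdot> (y \<cdot> (e \<cdot> e'))" using comp_eq_ext[OF e(4), of e'] by simp
    finally show "q1 \<cdot> (v0 \<cdot> z) = q1 \<cdot> (y \<cdot> (e \<cdot> e'))" .
  qed auto
  moreover have "is_epi C (e \<cdot> e')" by (rule epi_comp) (use e e' in auto)
  ultimately show "\<exists>T' e x. e \<in> Hom C T' T \<and> is_epi C e \<and> x \<in> Hom C T' (Dom C v0) \<and> v0 \<cdot> x = y \<cdot> e"
    by (intro exI[of _ T''] exI[of _ "e \<cdot> e'"] exI[of _ z]) simp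
qed (use v0 v1 in auto)

text \<open>The cone of a morphism from \<open>W\<close> to the shifted sequence \<open>X\<close>, with the two top terms that are
  matched by the monomorphism \<open>\<phi>\<^sub>n\<^sub>+\<^sub>1\<close> cancelled.\<close>

lemma ex_cone:
  assumes X: "exs C (Suc n) X f" and W: "is_sequ C n W w" "is_mono C (w 0)" "\<And>i. i < n \<Longrightarrow> exact C (w i) (w (Suc i))"
    and \<phi>: "cmap C n W w (\<lambda>i. X (Suc i)) (\<lambda>i. f (Suc i)) \<phi>" "is_mono C (\<phi> (Suc n))"
  obtains V v I J P Q where "\<And>i. i \<le> n \<Longrightarrow> is_biproduct C (X i) (W i) (V i) (I i) (J i) (P i) (Q i)"
    "V (Suc n) = X (Suc n)" "is_sequ C n V v" "is_mono C (v 0)" "\<And>i. i < n \<Longrightarrow> exact C (v i) (v (Suc i))"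
    "\<And>i. i < n \<Longrightarrow> P (Suc i) \<cdot> v i = (f i \<cdot> P i) \<boxplus> (\<phi> i \<cdot> Q i)" "\<And>i. i < n \<Longrightarrow> Q (Suc i) \<cdot> v i = neg (w i \<cdot> Q i)"
    "v n = (f n \<cdot> P n) \<boxplus> (\<phi> n \<cdot> Q n)"
proof -
  have Xo: "\<And>i. i \<le> Suc (Suc n) \<Longrightarrow> X i \<in> Obj C" using exsD(1)[OF X] by simp
  have Wo: "\<And>i. i \<le> Suc n \<Longrightarrow> W i \<in> Obj C" using W(1) unfolding is_sequ_def by simp
  have f: "\<And>i. i \<le> Suc n \<Longrightarrow> f i \<in> Hom C (X i) (X (Suc i))" using exsD(2)[OF X] by simp
  have w: "\<And>i. i \<le> n \<Longrightarrow> w i \<in> Hom C (W i) (W (Suc i))" using W(1) unfolding is_sequ_def by simp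
  have p: "\<And>i. i \<le> Suc n \<Longrightarrow> \<phi> i \<in> Hom C (W i) (X (Suc i))" using cmapD(1)[OF \<phi>(1)] by simp
  have comm: "\<And>i. i \<le> n \<Longrightarrow> \<phi> (Suc i) \<cdot> w i = f (Suc i) \<cdot> \<phi> i" using cmapD(2)[OF \<phi>(1)] by simp
  have ff: "\<And>i. i \<le> n \<Longrightarrow> f (Suc i) \<cdot> f i = Zer C (X i) (X (Suc (Suc i)))" using exsD(6)[OF X] by simp
  have ww: "\<And>i. i < n \<Longrightarrow> w (Suc i) \<cdot> w i = Zer C (W i) (W (Suc (Suc i)))"
  proof -
    fix i assume "i < n"
    then show "w (Suc i) \<cdot> w i = Zer C (W i) (W (Suc (Suc i)))"
      using ex_arrD(4)[OF W(3)[of i]] w[of i] w[of "Suc i"] by simp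
  qed
  have "\<forall>i. \<exists>V I J P Q. i \<le> n \<longrightarrow> is_biproduct C (X i) (W i) V I J P Q"
    using Xo Wo ex_biproduct by (metis le_SucI)
  then obtain V' I J P Q where b': "\<And>i. i \<le> n \<Longrightarrow> is_biproduct C (X i) (W i) (V' i) (I i) (J i) (P i) (Q i)"
    by metis
  define V where "V i = (if i \<le> n then V' i else X i)" for i
  have b: "\<And>i. i \<le> n \<Longrightarrow> is_biproduct C (X i) (W i) (V i) (I i) (J i) (P i) (Q i)"
    using b' by (simp add: V_def)
  have bio: "\<And>i. i \<le> n \<Longrightarrow> P i \<in> Hom C (V i) (X i) \<and> Q i \<in> Hom C (V i) (W i) \<and> I i \<in> Hom C (X i) (V i) \<and>
    J i \<in> Hom C (W i) (V i) \<and> V i \<in> Obj C" using biproductD[OF b] by blast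
  define r where "r i = (f i \<cdot> P i) \<boxplus> (\<phi> i \<cdot> Q i)" for i
  have r: "r i \<in> Hom C (V i) (X (Suc i))" if "i \<le> n" for i
    using f[of i] p[of i] bio[of i] that unfolding r_def by simp
  define v where "v i = (if i < n then (I (Suc i) \<cdot> r i) \<boxplus> (J (Suc i) \<cdot> neg (w i \<cdot> Q i)) else r i)" for i
  have v: "v i \<in> Hom C (V i) (V (Suc i)) \<and> P (Suc i) \<cdot> v i = r i \<and> Q (Suc i) \<cdot> v i = neg (w i \<cdot> Q i)" if i: "i < n" for i
  proof -
    have "neg (w i \<cdot> Q i) \<in> Hom C (V i) (W (Suc i))" using w[of i] bio[of i] i by simp
    then obtain z where "z \<in> Hom C (V i) (V (Suc i))" "P (Suc i) \<cdot> z = r i" "Q (Suc i) \<cdot> z = neg (w i \<cdot> Q i)"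
      "z = (I (Suc i) \<cdot> r i) \<boxplus> (J (Suc i) \<cdot> neg (w i \<cdot> Q i))"
      using biproduct_pair[OF b[of "Suc i"] r[of i]] i by auto
    then show ?thesis using i by (simp add: v_def)
  qed
  have vn: "v n = r n" by (simp add: v_def)
  have Vn: "V (Suc n) = X (Suc n)" by (simp add: V_def)
  have vh: "v i \<in> Hom C (V i) (V (Suc i))" if "i \<le> n" for i
    using v[of i] r[of i] vn Vn that by (cases "i = n") auto
  \<comment> \<open>at the top place \<open>i = n\<close> the second component is absent from \<open>v i\<close>; there \<open>w i\<close> still kills \<open>Q i \<cdot> y\<close>
    because \<open>\<phi> (n + 1)\<close> is a monomorphism\<close>
  have kern: "w i \<cdot> (Q i \<cdot> y) = Zer C T (W (Suc i)) \<and> (f i \<cdot> (P i \<cdot> y)) \<boxplus> (\<phi> i \<cdot> (Q i \<cdot> y)) = Zer C T (X (Suc i))"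
    if i: "i \<le> n" and y: "y \<in> Hom C T (V i)" "v i \<cdot> y = Zer C T (V (Suc i))" for i T y
  proof -
    have i1: "i \<le> Suc n" "Suc i \<le> Suc n" using i by auto
    note [simp] = f[OF i1(1), simplified] f[OF i1(2), simplified] w[OF i, simplified] p[OF i1(1), simplified] p[OF i1(2), simplified]
      bio[OF i, simplified] y(1)[simplified]
    have T: "T \<in> Obj C" using hom_obj y by blast
    have ry: "r i \<cdot> y = (f i \<cdot> (P i \<cdot> y)) \<boxplus> (\<phi> i \<cdot> (Q i \<cdot> y))"
      unfolding r_def by (subst plus_comp) auto
    have Xi [simp]: "X (Suc i) \<in> Obj C" "X (Suc (Suc i)) \<in> Obj C" "W (Suc i) \<in> Obj C" using Xo Wo i by simp_all
    have r0: "r i \<cdot> y = Zer C T (X (Suc i))"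
    proof (cases "i = n")
      case False
      then have j: "Suc i \<le> n" using i by simp
      note [simp] = bio[OF j, simplified] vh[OF i, simplified]
      have "r i \<cdot> y = P (Suc i) \<cdot> (v i \<cdot> y)" using v[of i] False i comp_eq_ext[of "P (Suc i)" "v i" "r i" y] by simp
      then show ?thesis using y(2) T by simp
    qed (use y vn Vn in simp)
    have "w i \<cdot> (Q i \<cdot> y) = Zer C T (W (Suc i))"
    proof (cases "i = n")
      case False
      then have j: "Suc i \<le> n" using i by simp
      note [simp] = bio[OF j, simplified] vh[OF i, simplified]
      have "neg (w i \<cdot> Q i) \<cdot> y = Q (Suc i) \<cdot> (v i \<cdot> y)"
        using v[of i] False i comp_eq_ext[of "Q (Suc i)" "v i" "neg (w i \<cdot> Q i)" y] by simp
      then have "neg (w i \<cdot> (Q i \<cdot> y)) = Zer C T (W (Suc i))" using y(2) T by simp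
      then have "neg (neg (w i \<cdot> (Q i \<cdot> y))) = neg (Zer C T (W (Suc i)))" by simp
      then show ?thesis using T Wo[of "Suc i"] by simp
    next
      case True
      have "Zer C T (X (Suc (Suc i))) = f (Suc i) \<cdot> ((f i \<cdot> (P i \<cdot> y)) \<boxplus> (\<phi> i \<cdot> (Q i \<cdot> y)))"
        using r0 ry T Xo[of "Suc i"] by simp
      also have "\<dots> = (f (Suc i) \<cdot> (f i \<cdot> (P i \<cdot> y))) \<boxplus> (f (Suc i) \<cdot> (\<phi> i \<cdot> (Q i \<cdot> y)))" by (rule comp_plus) auto
      also have "f (Suc i) \<cdot> (f i \<cdot> (P i \<cdot> y)) = Zer C T (X (Suc (Suc i)))"
        using comp_eq_ext[OF ff[OF i], of "P i \<cdot> y"] Xo[of "Suc (Suc i)"] by simp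
      also have "f (Suc i) \<cdot> (\<phi> i \<cdot> (Q i \<cdot> y)) = \<phi> (Suc i) \<cdot> (w i \<cdot> (Q i \<cdot> y))"
        using comp_eq_ext[OF comm[OF i], of "Q i \<cdot> y"] by simp
      finally have "\<phi> (Suc i) \<cdot> (w i \<cdot> (Q i \<cdot> y)) = Zer C T (X (Suc (Suc i)))" by simp
      moreover have "is_mono C (\<phi> (Suc i))" using \<phi>(2) True by simp
      ultimately show ?thesis using mono_zeroD[of "\<phi> (Suc i)" "w i \<cdot> (Q i \<cdot> y)" T] by simp
    qed
    then show ?thesis using r0 ry by simp
  qed
  have rv: "r (Suc i) \<cdot> v i = Zer C (V i) (X (Suc (Suc i)))" if i: "i < n" for i
  proof -
    have i': "i \<le> n" "Suc i \<le> n" "i \<le> Suc n" "Suc i \<le> Suc n" using i by auto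
    note [simp] = f[OF i'(3), simplified] f[OF i'(4), simplified] w[OF i'(1), simplified] w[OF i'(2), simplified] p[OF i'(3), simplified] p[OF i'(4), simplified]
      bio[OF i'(1), simplified] bio[OF i'(2), simplified] vh[OF i'(1), simplified] Xo[of "Suc (Suc i)"]
    have "r (Suc i) \<cdot> v i = ((f (Suc i) \<cdot> P (Suc i)) \<cdot> v i) \<boxplus> ((\<phi> (Suc i) \<cdot> Q (Suc i)) \<cdot> v i)"
      unfolding r_def by (rule plus_comp) auto
    also have "(f (Suc i) \<cdot> P (Suc i)) \<cdot> v i = f (Suc i) \<cdot> r i" using v[OF i] by simp
    also have "f (Suc i) \<cdot> r i = (f (Suc i) \<cdot> (f i \<cdot> P i)) \<boxplus> (f (Suc i) \<cdot> (\<phi> i \<cdot> Q i))"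
      unfolding r_def by (rule comp_plus) auto
    also have "f (Suc i) \<cdot> (f i \<cdot> P i) = Zer C (V i) (X (Suc (Suc i)))" using comp_eq_ext[OF ff[OF i'(1)], of "P i"] i by simp
    also have "(\<phi> (Suc i) \<cdot> Q (Suc i)) \<cdot> v i = neg (\<phi> (Suc i) \<cdot> (w i \<cdot> Q i))" using v[OF i] by simp
    also have "f (Suc i) \<cdot> (\<phi> i \<cdot> Q i) = \<phi> (Suc i) \<cdot> (w i \<cdot> Q i)" using comp_eq_ext[OF comm[OF i'(1)], of "Q i"] by simp
    finally show ?thesis using i by simp
  qed
  have vv: "v (Suc i) \<cdot> v i = Zer C (V i) (V (Suc (Suc i)))" if i: "i < n" for i
  proof (cases "Suc i = n")
    case True
    then show ?thesis using rv[OF i] vn Vn by auto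
  next
    case False
    then have i': "i \<le> n" "Suc i \<le> n" "Suc i < n" "Suc (Suc i) \<le> n" using i by auto
    note [simp] = vh[OF i'(1), simplified] vh[OF i'(2), simplified] bio[OF i'(1), simplified] bio[OF i'(2), simplified] bio[OF i'(4), simplified]
      w[OF i'(1), simplified] w[OF i'(2), simplified] Xo[of "Suc (Suc i)"] Wo[of "Suc (Suc i)"]
    show ?thesis
    proof (rule biproduct_eqI[OF b[OF i'(4)], of _ "V i"])
      show "P (Suc (Suc i)) \<cdot> (v (Suc i) \<cdot> v i) = P (Suc (Suc i)) \<cdot> Zer C (V i) (V (Suc (Suc i)))"
        using rv[OF i] v[OF i'(3)] comp_eq_ext[of "P (Suc (Suc i))" "v (Suc i)" "r (Suc i)" "v i"] i' by simp
      have "neg (w (Suc i) \<cdot> Q (Suc i)) \<cdot> v i = w (Suc i) \<cdot> (w i \<cdot> Q i)" using v[OF i] by simp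
      also have "\<dots> = Zer C (V i) (W (Suc (Suc i)))" using comp_eq_ext[OF ww[OF i], of "Q i"] i' by simp
      finally have "neg (w (Suc i) \<cdot> Q (Suc i)) \<cdot> v i = Zer C (V i) (W (Suc (Suc i)))" .
      then show "Q (Suc (Suc i)) \<cdot> (v (Suc i) \<cdot> v i) = Q (Suc (Suc i)) \<cdot> Zer C (V i) (V (Suc (Suc i)))"
        using v[OF i'(3)] comp_eq_ext[of "Q (Suc (Suc i))" "v (Suc i)" "neg (w (Suc i) \<cdot> Q (Suc i))" "v i"] i' by simp
    qed (use i' in auto)
  qed
  have ex: "exact C (v i) (v (Suc i))" if i: "i < n" for i
  proof (rule cone_ex[OF b[of i] b[of "Suc i"] exsD(5)[OF X, of i] f[of i] f[of "Suc i"] W(3)[of i] w[of i] w[of "Suc i"]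
        p[of i] p[of "Suc i"]])
    show "f (Suc i) \<cdot> \<phi> i = \<phi> (Suc i) \<cdot> w i" using comm[of i] i by simp
    show "P (Suc i) \<cdot> v i = (f i \<cdot> P i) \<boxplus> (\<phi> i \<cdot> Q i)" using v[OF i] by (simp add: r_def)
  qed (use v[OF i] vh[of i] vh[of "Suc i"] vv[OF i] kern[of "Suc i"] i in \<open>simp_all del: hom_iff\<close>)
  have mono: "is_mono C (v 0)"
  proof (rule mono_zeroI)
    note [simp] = vh[of 0, simplified] bio[of 0, simplified] p[of 0, simplified] f[of 0, simplified] w[of 0, simplified]
      Xo[of 0, simplified] Xo[of "Suc 0", simplified] Wo[of 0, simplified]
    fix T y assume y: "y \<in> Hom C T (Dom C (v 0))" "v 0 \<cdot> y = Zer C T (Cod C (v 0))"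
    have T: "T \<in> Obj C" using hom_obj y by blast
    have k: "w 0 \<cdot> (Q 0 \<cdot> y) = Zer C T (W (Suc 0))" "(f 0 \<cdot> (P 0 \<cdot> y)) \<boxplus> (\<phi> 0 \<cdot> (Q 0 \<cdot> y)) = Zer C T (X (Suc 0))"
      using kern[of 0 y T] y by simp_all
    have q: "Q 0 \<cdot> y = Zer C T (W 0)" using mono_zeroD[OF W(2), of "Q 0 \<cdot> y" T] k(1) y by simp
    then have "f 0 \<cdot> (P 0 \<cdot> y) = Zer C T (X (Suc 0))" using k(2) y T by simp
    then have "P 0 \<cdot> y = Zer C T (X 0)" using mono_zeroD[OF exsD(3)[OF X], of "P 0 \<cdot> y" T] y by simp
    then show "y = Zer C T (Dom C (v 0))" using biproduct_eqI[OF b[of 0], of y T "Zer C T (V 0)"] q y T by simp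
  qed (use vh[of 0] in simp)
  show ?thesis
  proof (rule that[of V I J P Q v])
    show "is_sequ C n V v" unfolding is_sequ_def using vh bio Vn Xo by (auto simp del: hom_iff simp: le_Suc_eq)
    show "v n = (f n \<cdot> P n) \<boxplus> (\<phi> n \<cdot> Q n)" by (simp add: vn r_def)
  qed (use b Vn mono ex v r_def in \<open>auto simp del: hom_iff\<close>)
qed

end

lemma is_sequD:
  assumes "is_sequ C n X f"
  shows "i \<le> Suc n \<Longrightarrow> X i \<in> Obj C" "i \<le> n \<Longrightarrow> f i \<in> Hom C (X i) (X (Suc i))"
  using assms unfolding is_sequ_def by blast+

lemma exs_sequ: "exs C n X f \<Longrightarrow> is_sequ C n X f"
  by (simp add: exs_def)

context category
begin

lemma cmap_comp:
  assumes s: "is_sequ C n X f" "is_sequ C n Y g" "is_sequ C n Z h" and c: "cmap C n X f Y g \<phi>" "cmap C n Y g Z h \<psi>"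
  shows "cmap C n X f Z h (\<lambda>i. \<psi> i \<cdot> \<phi> i)"
  unfolding cmap_def
proof (intro conjI allI impI)
  fix i show "i \<le> Suc n \<Longrightarrow> \<psi> i \<cdot> \<phi> i \<in> Hom C (X i) (Z i)"
    using cmapD(1)[OF c(1), of i] cmapD(1)[OF c(2), of i] by simp
  assume i: "i \<le> n"
  then have i': "i \<le> Suc n" "Suc i \<le> Suc n" by auto
  note [simp] = is_sequD(2)[OF s(1) i, simplified] is_sequD(2)[OF s(2) i, simplified] is_sequD(2)[OF s(3) i, simplified]
    cmapD(1)[OF c(1) i'(1), simplified] cmapD(1)[OF c(2) i'(1), simplified] cmapD(1)[OF c(1) i'(2), simplified]
    cmapD(1)[OF c(2) i'(2), simplified]
  have "(\<psi> (Suc i) \<cdot> \<phi> (Suc i)) \<cdot> f i = \<psi> (Suc i) \<cdot> (g i \<cdot> \<phi> i)" using cmapD(2)[OF c(1) i] by simp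
  also have "\<dots> = (h i \<cdot> \<psi> i) \<cdot> \<phi> i" using comp_eq_ext[OF cmapD(2)[OF c(2) i], of "\<phi> i"] by simp
  finally show "(\<psi> (Suc i) \<cdot> \<phi> (Suc i)) \<cdot> f i = h i \<cdot> (\<psi> i \<cdot> \<phi> i)" by simp
qed

end

context abelian_category
begin

lemma ex_desc:
  assumes "exact C f g" "is_epi C g" "z \<in> Hom C (Dom C g) S" "z \<cdot> f = Zer C (Dom C f) S"
  obtains x where "x \<in> Hom C (Cod C g) S" "x \<cdot> g = z"
proof -
  have "z \<in> Hom C (Cod C f) S" using assms(3) ex_arrD(3)[OF assms(1)] by simp
  moreover have "exact (op_cat C) g f" using assms(1) by (simp add: op_exact)
  ultimately obtain x where "x \<in> Hom (op_cat C) S (Dom (op_cat C) g)" "Comp (op_cat C) g x = z"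
    using abelian_category.ex_lift[OF op_abelian, of g f z S] assms(2,4) by (auto simp: op_hom simp del: hom_iff)
  then show ?thesis using that by (simp add: op_hom)
qed

text \<open>For \<open>n = 0\<close> the sequence is an isomorphism \<open>X\<^sub>0 \<rightarrow> X\<^sub>1\<close>, and the constant sequence at \<open>N\<close> serves; otherwise push
  out.\<close>

lemma exs_pushforward:
  assumes X: "exs C n X f" and a: "a \<in> Hom C (X 0) N"
  obtains Y g \<theta> where "exs C n Y g" "Y 0 = N" "cmap C n X f Y g \<theta>" "\<theta> 0 = a"
proof (cases n)
  case 0
  have f: "f 0 \<in> Arr C" "Dom C (f 0) = X 0" "Cod C (f 0) = X (Suc 0)" using exsD(2)[OF X, of 0] by auto
  obtain k where k: "k \<in> Hom C (X (Suc 0)) (X 0)" "k \<cdot> f 0 = Ident C (X 0)"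
    using mono_epi_iso[OF exsD(3)[OF X]] exsD(4)[OF X] 0 f by auto
  have N: "N \<in> Obj C" using hom_obj a by blast
  have e: "exs C n (\<lambda>_. N) (\<lambda>_. Ident C N)" unfolding exs_def is_sequ_def using N 0 by simp
  have c: "cmap C n X f (\<lambda>_. N) (\<lambda>_. Ident C N) (\<lambda>i. if i = 0 then a else a \<cdot> k)"
    unfolding cmap_def using 0 a k f by (auto simp: le_Suc_eq)
  show ?thesis by (rule that[OF e _ c]) auto
next
  case (Suc m)
  then have X': "exs C (Suc m) X f" using X by simp
  obtain E u v h where E: "exs C (Suc m) (glue N E (\<lambda>i. X (Suc i))) (glue u v (\<lambda>i. f (Suc i)))"
    "u \<in> Hom C N E" "v \<in> Hom C E (X 2)" "h \<in> Hom C (X 1) E" "h \<cdot> f 0 = u \<cdot> a" "v \<cdot> h = f 1"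
    by (rule exs_pushout[OF X' a])
  have c: "cmap C n X f (glue N E (\<lambda>i. X (Suc i))) (glue u v (\<lambda>i. f (Suc i))) (glue a h (\<lambda>i. Ident C (X (Suc i))))"
    unfolding cmap_def
  proof (intro conjI allI impI)
    fix i show "i \<le> Suc n \<Longrightarrow> glue a h (\<lambda>i. Ident C (X (Suc i))) i \<in> Hom C (X i) (glue N E (\<lambda>i. X (Suc i)) i)"
      using a E(4) exsD(1)[OF X, of i] by (auto simp: glue_def split: nat.split)
    assume i: "i \<le> n"
    show "glue a h (\<lambda>i. Ident C (X (Suc i))) (Suc i) \<cdot> f i = glue u v (\<lambda>i. f (Suc i)) i \<cdot> glue a h (\<lambda>i. Ident C (X (Suc i))) i"
      using E(3,5,6) exsD(2)[OF X i] by (auto simp: glue_def numeral_2_eq_2 split: nat.split)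
  qed
  show ?thesis by (rule that[OF _ _ c]) (use E Suc in auto)
qed

text \<open>The cone of the morphism from \<open>W\<close> starts with \<open>X\<^sub>0 \<oplus> W\<^sub>0\<close> and receives the left part of \<open>X\<close> by the inclusions
  of the first summands. Pushing it out along the projection to \<open>X\<^sub>0\<close> gives a sequence that starts at \<open>X\<^sub>0\<close>.\<close>

lemma rsplit_imp_lsplit:
  assumes X: "exs C (Suc n) X f" and r: "rsplit C n X f"
  shows "lsplit C n X f"
proof -
  obtain W w \<phi> where W: "exs C n W w" "W (Suc n) = X (Suc (Suc n))"
    and \<phi>: "cmap C n W w (\<lambda>i. X (Suc i)) (\<lambda>i. f (Suc i)) \<phi>" "\<phi> (Suc n) = Ident C (X (Suc (Suc n)))"
    using r unfolding rsplit_def by blast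
  have Xo: "\<And>i. i \<le> Suc (Suc n) \<Longrightarrow> X i \<in> Obj C" using exsD(1)[OF X] by simp
  have mono: "is_mono C (\<phi> (Suc n))" using \<phi>(2) Xo by simp
  obtain V v I J P Q where b: "\<And>i. i \<le> n \<Longrightarrow> is_biproduct C (X i) (W i) (V i) (I i) (J i) (P i) (Q i)"
    and Vn: "V (Suc n) = X (Suc n)" and V: "is_sequ C n V v" "is_mono C (v 0)" "\<And>i. i < n \<Longrightarrow> exact C (v i) (v (Suc i))"
    and v: "\<And>i. i < n \<Longrightarrow> P (Suc i) \<cdot> v i = (f i \<cdot> P i) \<boxplus> (\<phi> i \<cdot> Q i)" "\<And>i. i < n \<Longrightarrow> Q (Suc i) \<cdot> v i = neg (w i \<cdot> Q i)"
    and vn: "v n = (f n \<cdot> P n) \<boxplus> (\<phi> n \<cdot> Q n)"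
    by (rule ex_cone[OF X exs_sequ[OF W(1)] exsD(3)[OF W(1)] exsD(5)[OF W(1)] \<phi>(1) mono]) blast+
  have bio: "\<And>i. i \<le> n \<Longrightarrow> P i \<in> Hom C (V i) (X i) \<and> Q i \<in> Hom C (V i) (W i) \<and> I i \<in> Hom C (X i) (V i) \<and>
    J i \<in> Hom C (W i) (V i) \<and> V i \<in> Obj C" using biproductD[OF b] by blast
  have vI: "((f i \<cdot> P i) \<boxplus> (\<phi> i \<cdot> Q i)) \<cdot> I i = f i" "((f i \<cdot> P i) \<boxplus> (\<phi> i \<cdot> Q i)) \<cdot> J i = \<phi> i" if i: "i \<le> n" for i
  proof -
    note [simp] = biproductD(4-11)[OF b[OF i], simplified] biproductD(1-3)[OF b[OF i]] exsD(2)[OF X le_SucI[OF i], simplified]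
      cmapD(1)[OF \<phi>(1) le_SucI[OF i], simplified]
    have o: "X (Suc i) \<in> Obj C" using Xo i by simp
    show "((f i \<cdot> P i) \<boxplus> (\<phi> i \<cdot> Q i)) \<cdot> I i = f i" using o by (subst plus_comp) auto
    show "((f i \<cdot> P i) \<boxplus> (\<phi> i \<cdot> Q i)) \<cdot> J i = \<phi> i" using o by (subst plus_comp) auto
  qed
  have epi: "is_epi C (v n)"
  proof (rule epi_zeroI)
    have n: "n \<le> n" "n \<le> Suc n" by auto
    note [simp] = bio[OF n(1), simplified] is_sequD(2)[OF V(1) n(1), simplified] Vn exsD(2)[OF X n(2), simplified]
      exsD(2)[OF X order_refl, simplified] cmapD(1)[OF \<phi>(1) n(2), simplified] exsD(2)[OF W(1) n(1), simplified]
    fix S z assume z: "z \<in> Hom C (Cod C (v n)) S" "z \<cdot> v n = Zer C (Dom C (v n)) S"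
    note [simp] = z(1)[simplified]
    have S: "S \<in> Obj C" using hom_obj z by blast
    have 1: "z \<cdot> f n = Zer C (X n) S"
      using comp_eq_ext[OF z(2), of "I n"] vI(1)[OF n(1)] vn S by simp
    have 2: "z \<cdot> \<phi> n = Zer C (W n) S"
      using comp_eq_ext[OF z(2), of "J n"] vI(2)[OF n(1)] vn S by simp
    obtain x where x: "x \<in> Hom C (X (Suc (Suc n))) S" "x \<cdot> f (Suc n) = z"
      using ex_desc[OF exsD(5)[OF X, of n] exsD(4)[OF X], of z S] 1 by auto
    note [simp] = x(1)[simplified]
    have "f (Suc n) \<cdot> \<phi> n = w n" using cmapD(2)[OF \<phi>(1) n(1)] \<phi>(2) W(2) by simp
    then have "x \<cdot> w n = z \<cdot> \<phi> n" using comp_eq_ext[OF x(2), of "\<phi> n"] by simp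
    then have "x = Zer C (W (Suc n)) S" using epi_zeroD[OF exsD(4)[OF W(1)], of x S] 2 W(2) by simp
    then have "x \<cdot> f (Suc n) = Zer C (X (Suc n)) S" using S W(2) by simp
    then show "z = Zer C (Cod C (v n)) S" using x(2) by simp
  qed (use is_sequD(2)[OF V(1), of n] in simp)
  have Vx: "exs C n V v" unfolding exs_def using V epi by blast
  define \<psi> where "\<psi> i = (if i \<le> n then I i else Ident C (X i))" for i
  have \<psi>: "cmap C n X f V v \<psi>"
    unfolding cmap_def
  proof (intro conjI allI impI)
    fix i show "i \<le> Suc n \<Longrightarrow> \<psi> i \<in> Hom C (X i) (V i)"
      using bio[of i] Vn Xo[of i] by (cases "i = Suc n") (auto simp: \<psi>_def)
    assume i: "i \<le> n"
    show "\<psi> (Suc i) \<cdot> f i = v i \<cdot> \<psi> i"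
    proof (cases "i = n")
      case True
      then show ?thesis using vI(1)[of n] vn exsD(2)[OF X, of n] Xo[of "Suc n"] by (simp add: \<psi>_def)
    next
      case False
      then have i': "i < n" "Suc i \<le> n" "i \<le> Suc n" using i by auto
      note [simp] = biproductD(4-11)[OF b[OF i], simplified] biproductD(4-11)[OF b[OF i'(2)], simplified]
        biproductD(1-3)[OF b[OF i]] biproductD(1-3)[OF b[OF i'(2)]] is_sequD(2)[OF V(1) i, simplified]
        exsD(2)[OF X i'(3), simplified] exsD(2)[OF W(1) i, simplified]
      have "I (Suc i) \<cdot> f i = v i \<cdot> I i"
      proof (rule biproduct_eqI[OF b[OF i'(2)], of _ "X i"])
        have "P (Suc i) \<cdot> (v i \<cdot> I i) = f i" using comp_eq_ext[OF v(1)[OF i'(1)], of "I i"] vI(1)[OF i] by simp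
        then show "P (Suc i) \<cdot> (I (Suc i) \<cdot> f i) = P (Suc i) \<cdot> (v i \<cdot> I i)"
          using comp_eq_ext[OF biproductD(8)[OF b[OF i'(2)]], of "f i"] by simp
        have "Q (Suc i) \<cdot> (v i \<cdot> I i) = Zer C (X i) (W (Suc i))"
          using comp_eq_ext[OF v(2)[OF i'(1)], of "I i"] by simp
        then show "Q (Suc i) \<cdot> (I (Suc i) \<cdot> f i) = Q (Suc i) \<cdot> (v i \<cdot> I i)"
          using comp_eq_ext[OF biproductD(10)[OF b[OF i'(2)]], of "f i"] by simp
      qed auto
      then show ?thesis using i' i by (simp add: \<psi>_def)
    qed
  qed
  have p0: "P 0 \<in> Hom C (V 0) (X 0)" using bio[of 0] by simp
  obtain Y g \<theta> where Y: "exs C n Y g" "Y 0 = X 0" "cmap C n V v Y g \<theta>" "\<theta> 0 = P 0"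
    by (rule exs_pushforward[OF Vx p0])
  have Xs: "is_sequ C n X f" using exs_sequ[OF X] unfolding is_sequ_def by simp
  have "cmap C n X f Y g (\<lambda>i. \<theta> i \<cdot> \<psi> i)"
    by (rule cmap_comp[OF Xs V(1) exs_sequ[OF Y(1)] \<psi> Y(3)])
  moreover have "\<theta> 0 \<cdot> \<psi> 0 = Ident C (X 0)" using biproductD(8)[OF b[of 0]] Y(4) by (simp add: \<psi>_def)
  ultimately show ?thesis unfolding lsplit_def using Y(1,2) by blast
qed

lemma lsplit_imp_rsplit:
  assumes X: "exs C (Suc n) X f" and l: "lsplit C n X f"
  shows "rsplit C n X f"
  by (rule lsplit_op_rsplit)
    (rule abelian_category.rsplit_imp_lsplit[OF op_abelian exs_revs[OF X] lsplit_rsplit_op[OF l]])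

lemma rsplit_forward:
  assumes X: "exs C (Suc n) X f" and Y: "exs C (Suc n) Y g" and e: "end_fixing_map C (Suc n) (X, f) (Y, g)"
    and r: "rsplit C n X f"
  shows "rsplit C n Y g"
proof -
  obtain \<psi> where \<psi>: "cmap C (Suc n) X f Y g \<psi>" "\<psi> (Suc (Suc n)) = Ident C (X (Suc (Suc n)))" "X (Suc (Suc n)) = Y (Suc (Suc n))"
    using e unfolding end_fixing_map_iff by blast
  obtain W w \<phi> where W: "exs C n W w" "W (Suc n) = X (Suc (Suc n))"
    and \<phi>: "cmap C n W w (\<lambda>i. X (Suc i)) (\<lambda>i. f (Suc i)) \<phi>" "\<phi> (Suc n) = Ident C (X (Suc (Suc n)))"
    using r unfolding rsplit_def by blast
  have s: "is_sequ C n (\<lambda>i. X (Suc i)) (\<lambda>i. f (Suc i))" "is_sequ C n (\<lambda>i. Y (Suc i)) (\<lambda>i. g (Suc i))"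
    using exs_sequ[OF X] exs_sequ[OF Y] unfolding is_sequ_def by simp_all
  have "cmap C n (\<lambda>i. X (Suc i)) (\<lambda>i. f (Suc i)) (\<lambda>i. Y (Suc i)) (\<lambda>i. g (Suc i)) (\<lambda>i. \<psi> (Suc i))"
    using \<psi>(1) unfolding cmap_def by (simp del: hom_iff)
  from cmap_comp[OF exs_sequ[OF W(1)] s \<phi>(1) this]
  show ?thesis unfolding rsplit_def using W \<psi>(2,3) \<phi>(2) exsD(1)[OF X, of "Suc (Suc n)"]
    by (intro exI[of _ W] exI[of _ w] exI[of _ "\<lambda>i. \<psi> (Suc i) \<cdot> \<phi> i"]) simp
qed

lemma rsplit_backward:
  assumes X: "exs C (Suc n) X f" and Y: "exs C (Suc n) Y g" and e: "end_fixing_map C (Suc n) (X, f) (Y, g)"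
    and r: "rsplit C n Y g"
  shows "rsplit C n X f"
proof (rule lsplit_imp_rsplit[OF X])
  obtain \<psi> where \<psi>: "cmap C (Suc n) X f Y g \<psi>" "\<psi> 0 = Ident C (X 0)" "X 0 = Y 0"
    using e unfolding end_fixing_map_iff by blast
  obtain V v \<phi> where V: "exs C n V v" "V 0 = Y 0" "cmap C n Y g V v \<phi>" "\<phi> 0 = Ident C (Y 0)"
    using rsplit_imp_lsplit[OF Y r] unfolding lsplit_def by blast
  have s: "is_sequ C n X f" "is_sequ C n Y g"
    using exs_sequ[OF X] exs_sequ[OF Y] unfolding is_sequ_def by simp_all
  have "cmap C n X f Y g \<psi>" using \<psi>(1) unfolding cmap_def by (simp del: hom_iff)
  from cmap_comp[OF s exs_sequ[OF V(1)] this V(3)]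
  show "lsplit C n X f" unfolding lsplit_def using V \<psi>(2,3) exsD(1)[OF X, of 0]
    by (intro exI[of _ V] exI[of _ v] exI[of _ "\<lambda>i. \<phi> i \<cdot> \<psi> i"]) simp
qed

text \<open>A retraction of the first map yields a section of \<open>X\<^sub>1 \<rightarrow> B = X\<^sub>1 / X\<^sub>0\<close>, so that \<open>0 \<rightarrow> B \<rightarrow> X\<^sub>2 \<rightarrow> \<dots>\<close> maps to the right
  part of \<open>X\<close>.\<close>

lemma rsplit_retraction:
  assumes X: "exs C (Suc n) X f" and r: "r \<in> Hom C (X 1) (X 0)" "r \<cdot> f 0 = Ident C (X 0)"
  shows "rsplit C n X f"
proof -
  obtain B p m where p: "ses C (f 0) p" "p \<in> Hom C (X 1) B" "m \<in> Hom C B (X 2)" "m \<cdot> p = f 1"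
    "exs C n (unglue B X) (unglue m f)" by (rule exs_unglue[OF X])
  have f0: "f 0 \<in> Hom C (X 0) (X 1)" using exsD(2)[OF X, of 0] by simp
  obtain s where b: "is_biproduct C (Dom C (f 0)) (Cod C p) (Dom C p) (f 0) s r p"
    by (rule retraction_biproduct[OF p(1), of r]) (use r f0 p in auto)
  note s = biproductD(5,9)[OF b]
  have "cmap C n (unglue B X) (unglue m f) (\<lambda>i. X (Suc i)) (\<lambda>i. f (Suc i)) (unglue s (\<lambda>i. Ident C (X i)))"
    unfolding cmap_def
  proof (intro conjI allI impI)
    fix i show "i \<le> Suc n \<Longrightarrow> unglue s (\<lambda>i. Ident C (X i)) i \<in> Hom C (unglue B X i) (X (Suc i))"
      using s(1) p(2) exsD(1)[OF X, of "Suc i"] by (cases i) auto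
    assume i: "i \<le> n"
    show "unglue s (\<lambda>i. Ident C (X i)) (Suc i) \<cdot> unglue m f i = f (Suc i) \<cdot> unglue s (\<lambda>i. Ident C (X i)) i"
    proof (cases i)
      case 0
      have "f 1 \<cdot> s = m \<cdot> (p \<cdot> s)" using comp_eq_ext[OF p(4), of s] p(2,3) s(1) by simp
      also have "\<dots> = m" using s(2) p(2,3) by simp
      finally show ?thesis using 0 p(3) by (simp add: numeral_2_eq_2)
    qed (use exsD(2)[OF X, of "Suc i"] i in simp)
  qed
  then show ?thesis unfolding rsplit_def using p(5)
    by (intro exI[of _ "unglue B X"] exI[of _ "unglue m f"] exI[of _ "unglue s (\<lambda>i. Ident C (X i))"]) simp
qed

text \<open>Vanishing of \<open>Ext\<close> gives a zigzag of morphisms of extensions from a trivial one to \<open>X\<close>. The trivial one is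
  split, and splitting is transported along the zigzag in both directions.\<close>

lemma Ext_vanishes_rsplit:
  assumes v: "Ext_vanishes C (Suc n) P N" and X: "exs C (Suc n) X f" "X 0 = N" "X (Suc (Suc n)) = P"
  shows "rsplit C n X f"
proof -
  have x: "(X, f) \<in> yoneda_exts C (Suc n) P N" using X yoneda_exts_iff[of X f "Suc n" P N] by simp
  then have "yoneda_rel C (Suc n) P N `` {(X, f)} = Ext_zero C (Suc n) P N"
    using quotientI[OF x, of "yoneda_rel C (Suc n) P N", folded Ext_def] unfolding v by simp
  moreover have "((X, f), (X, f)) \<in> yoneda_rel C (Suc n) P N" using x unfolding yoneda_rel_def by simp
  ultimately obtain \<tau> where t: "trivial_ext C (Suc n) P N \<tau>" "(\<tau>, (X, f)) \<in> yoneda_rel C (Suc n) P N"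
    unfolding Ext_zero_def by blast
  have base: "exs C (Suc n) (fst \<tau>) (snd \<tau>) \<and> rsplit C n (fst \<tau>) (snd \<tau>)"
  proof -
    obtain E g where \<tau>: "\<tau> = (E, g)" by force
    have E: "exs C (Suc n) E g" "E 0 = N" using t(1) yoneda_exts_iff unfolding trivial_ext_def \<tau> by simp_all
    have "\<exists>r \<in> Hom C (E 1) (E 0). r \<cdot> g 0 = Ident C (E 0)"
    proof (cases "n = 0")
      case True
      then obtain j p where "is_biproduct C N P (E 1) (g 0) j p (g 1)"
        using t(1) unfolding trivial_ext_def \<tau> by auto
      from biproductD[OF this] show ?thesis using E(2) by blast
    next
      case False
      then have "E 1 = N" "g 0 = Ident C N" using t(1) unfolding trivial_ext_def \<tau> by simp_all
      moreover have "N \<in> Obj C" using exsD(1)[OF E(1), of 0] E(2) by simp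
      ultimately show ?thesis using E(2) by (intro bexI[of _ "Ident C N"]) auto
    qed
    then show ?thesis using rsplit_retraction[OF E(1)] E(1) \<tau> by auto
  qed
  have "equivclp (\<lambda>\<alpha> \<beta>. \<alpha> \<in> yoneda_exts C (Suc n) P N \<and> \<beta> \<in> yoneda_exts C (Suc n) P N \<and>
      end_fixing_map C (Suc n) \<alpha> \<beta>) \<tau> (X, f)" using t(2) unfolding yoneda_rel_def by blast
  then have "exs C (Suc n) (fst (X, f)) (snd (X, f)) \<and> rsplit C n (fst (X, f)) (snd (X, f))"
  proof (induction rule: equivclp_induct)
    case base
    then show ?case using \<open>exs C (Suc n) (fst \<tau>) (snd \<tau>) \<and> rsplit C n (fst \<tau>) (snd \<tau>)\<close> .
  next
    case (step y z)
    obtain Y g Z h where yz: "y = (Y, g)" "z = (Z, h)" by force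
    have e: "exs C (Suc n) Y g" "exs C (Suc n) Z h" using step.hyps(2) yoneda_exts_iff unfolding yz by auto
    show ?case using step.hyps(2) step.IH rsplit_forward[OF e] rsplit_backward[OF e(2,1)] e unfolding yz by auto
  qed
  then show ?thesis by simp
qed

end

section \<open>Vanishing of higher extensions in terms of first extensions\<close>

lemma is_sequ_Suc: "is_sequ C (Suc n) X f \<Longrightarrow> is_sequ C n (\<lambda>i. X (Suc i)) (\<lambda>i. f (Suc i))"
  by (simp add: is_sequ_def del: hom_iff)

context abelian_category
begin

text \<open>One step of dimension shifting along \<open>0 \<rightarrow> B \<rightarrow> J \<rightarrow> B' \<rightarrow> 0\<close>, where \<open>X\<close> is an extension of \<open>B'\<close>. If the spliced
  extension of \<open>B\<close> splits by a sequence \<open>W\<close>, then the pushout of \<open>W\<close> along \<open>W\<^sub>0 \<rightarrow> J\<close> is an extension of \<open>J\<close>, which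
  splits by assumption and maps to the right part of \<open>X\<close>.\<close>

lemma rsplit_shift:
  assumes s: "ses C j q" and X: "exs C (Suc n) X f" "X 0 = Cod C q"
    and r: "rsplit C (Suc n) (glue (Dom C j) (Dom C q) X) (glue j (f 0 \<cdot> q) f)"
    and J: "\<And>V v. exs C (Suc n) V v \<Longrightarrow> V 0 = Dom C q \<Longrightarrow> V (Suc (Suc n)) = X (Suc (Suc n)) \<Longrightarrow> rsplit C n V v"
  shows "rsplit C n X f"
proof -
  note [simp] = sesD(1-4)[OF s]
  have f: "\<And>i. i \<le> Suc n \<Longrightarrow> f i \<in> Hom C (X i) (X (Suc i))" using exsD(2)[OF X(1)] by simp
  have Xo: "\<And>i. i \<le> Suc (Suc n) \<Longrightarrow> X i \<in> Obj C" using exsD(1)[OF X(1)] by simp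
  note [simp] = f[of 0, simplified] f[of "Suc 0", simplified]
  obtain W w \<phi> where W: "exs C (Suc n) W w" "W (Suc (Suc n)) = X (Suc (Suc n))"
    and \<phi>: "cmap C (Suc n) W w (\<lambda>i. glue (Dom C j) (Dom C q) X (Suc i)) (\<lambda>i. glue j (f 0 \<cdot> q) f (Suc i)) \<phi>"
      "\<phi> (Suc (Suc n)) = Ident C (X (Suc (Suc n)))"
    using r unfolding rsplit_def by auto
  have p0: "\<phi> 0 \<in> Hom C (W 0) (Dom C q)" using cmapD(1)[OF \<phi>(1), of 0] by simp
  have p: "\<phi> (Suc i) \<in> Hom C (W (Suc i)) (X (Suc i))" if "i \<le> Suc n" for i
    using cmapD(1)[OF \<phi>(1), of "Suc i"] that by simp
  have c0: "\<phi> (Suc 0) \<cdot> w 0 = (f 0 \<cdot> q) \<cdot> \<phi> 0" using cmapD(2)[OF \<phi>(1), of 0] by simp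
  have c: "\<phi> (Suc (Suc i)) \<cdot> w (Suc i) = f (Suc i) \<cdot> \<phi> (Suc i)" if "i \<le> n" for i
    using cmapD(2)[OF \<phi>(1), of "Suc i"] that by simp
  obtain E u v h where E: "exs C (Suc n) (glue (Dom C q) E (\<lambda>i. W (Suc i))) (glue u v (\<lambda>i. w (Suc i)))"
    "u \<in> Hom C (Dom C q) E" "v \<in> Hom C E (W 2)" "h \<in> Hom C (W 1) E" "h \<cdot> w 0 = u \<cdot> \<phi> 0" "v \<cdot> h = w 1"
    "v \<cdot> u = Zer C (Dom C q) (W 2)"
    and univ: "\<forall>S b d. b \<in> Hom C (W 1) S \<and> d \<in> Hom C (Dom C q) S \<and> b \<cdot> w 0 = d \<cdot> \<phi> 0 \<longrightarrow> (\<exists>w \<in> Hom C E S. w \<cdot> h = b \<and> w \<cdot> u = d)"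
    and joint: "\<forall>S w w'. w \<in> Hom C E S \<and> w' \<in> Hom C E S \<and> w \<cdot> h = w' \<cdot> h \<and> w \<cdot> u = w' \<cdot> u \<longrightarrow> w = w'"
    by (rule exs_pushout[OF W(1) p0])
  have 2: "(2::nat) = Suc (Suc 0)" by simp
  let ?V = "glue (Dom C q) E (\<lambda>i. W (Suc i))" and ?v = "glue u v (\<lambda>i. w (Suc i))"
  obtain z where z: "z \<in> Hom C E (X 1)" "z \<cdot> h = \<phi> 1" "z \<cdot> u = f 0 \<cdot> q"
    using univ p[of 0] c0 p0 X(2) by (metis One_nat_def comp_arr(1-3) comp_assoc f hom_iff le0 sesD(2)[OF s])
  have "rsplit C n ?V ?v" by (rule J[OF E(1)]) (use W(2) in simp_all)
  then obtain Y y \<psi> where Y: "exs C n Y y" "Y (Suc n) = W (Suc (Suc n))"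
    and \<psi>: "cmap C n Y y (\<lambda>i. ?V (Suc i)) (\<lambda>i. ?v (Suc i)) \<psi>" "\<psi> (Suc n) = Ident C (W (Suc (Suc n)))"
    unfolding rsplit_def by auto
  let ?\<theta> = "\<lambda>i. if i = 0 then z else \<phi> (Suc i)"
  have "cmap C n (\<lambda>i. ?V (Suc i)) (\<lambda>i. ?v (Suc i)) (\<lambda>i. X (Suc i)) (\<lambda>i. f (Suc i)) ?\<theta>"
    unfolding cmap_def
  proof (intro conjI allI impI)
    fix i show "i \<le> Suc n \<Longrightarrow> ?\<theta> i \<in> Hom C (?V (Suc i)) (X (Suc i))"
      using z(1) p[of i] by (cases i) auto
    assume i: "i \<le> n"
    show "?\<theta> (Suc i) \<cdot> ?v (Suc i) = f (Suc i) \<cdot> ?\<theta> i"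
    proof (cases i)
      case 0
      note [simp] = E(2-4)[simplified, unfolded 2] z(1)[simplified] p[of 0, simplified] p[of "Suc 0", simplified]
      have Xo2: "X (Suc (Suc 0)) \<in> Obj C" "W (Suc (Suc 0)) \<in> Obj C" using Xo[of 2] exsD(1)[OF W(1), of 2] by (simp_all add: 2)
      have "\<phi> (Suc (Suc 0)) \<cdot> v = f (Suc 0) \<cdot> z"
      proof (rule joint[rule_format], intro conjI)
        show "\<phi> (Suc (Suc 0)) \<cdot> v \<in> Hom C E (X (Suc (Suc 0)))" "f (Suc 0) \<cdot> z \<in> Hom C E (X (Suc (Suc 0)))" by simp_all
        show "(\<phi> (Suc (Suc 0)) \<cdot> v) \<cdot> h = (f (Suc 0) \<cdot> z) \<cdot> h"
          using E(6) z(2) c[of 0] by simp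
        have "f (Suc 0) \<cdot> (f 0 \<cdot> q) = Zer C (Dom C q) (X (Suc (Suc 0)))"
          using comp_eq_ext[OF exsD(6)[OF X(1), of 0], of q] X(2) Xo2 by simp
        then show "(\<phi> (Suc (Suc 0)) \<cdot> v) \<cdot> u = (f (Suc 0) \<cdot> z) \<cdot> u"
          using E(7) z(3) Xo2 by (simp add: 2)
      qed
      then show ?thesis using 0 by simp
    next
      case (Suc k)
      then show ?thesis using c[of "Suc k"] i by simp
    qed
  qed
  moreover have "is_sequ C n (\<lambda>i. ?V (Suc i)) (\<lambda>i. ?v (Suc i))" "is_sequ C n (\<lambda>i. X (Suc i)) (\<lambda>i. f (Suc i))"
    using is_sequ_Suc[OF exs_sequ[OF E(1)]] is_sequ_Suc[OF exs_sequ[OF X(1)]] .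
  ultimately have "cmap C n Y y (\<lambda>i. X (Suc i)) (\<lambda>i. f (Suc i)) (\<lambda>i. ?\<theta> i \<cdot> \<psi> i)"
    using cmap_comp[OF exs_sequ[OF Y(1)] _ _ \<psi>(1)] by blast
  then show ?thesis unfolding rsplit_def using Y W(2) \<phi>(2) \<psi>(2) Xo[of "Suc (Suc n)"]
    by (intro exI[of _ Y] exI[of _ y] exI[of _ "\<lambda>i. ?\<theta> i \<cdot> \<psi> i"]) simp
qed

lemma exs_one:
  assumes "ses C i p"
  shows "exs C (Suc 0) (glue (Dom C i) (Dom C p) (\<lambda>_. Cod C p)) (glue i p (\<lambda>_. Ident C (Cod C p)))"
proof -
  have "exs C 0 (\<lambda>_. Cod C p) (\<lambda>_. Ident C (Cod C p))"
    unfolding exs_def is_sequ_def using sesD[OF assms] by simp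
  from exs_glue[OF assms this] show ?thesis using sesD[OF assms] by simp
qed

lemma rsplit_one_section:
  assumes "rsplit C 0 X f" "exs C (Suc 0) X f"
  obtains s where "s \<in> Hom C (X 2) (X 1)" "f 1 \<cdot> s = Ident C (X 2)"
proof -
  obtain W w \<phi> where W: "exs C 0 W w" "W (Suc 0) = X 2"
    and \<phi>: "cmap C 0 W w (\<lambda>i. X (Suc i)) (\<lambda>i. f (Suc i)) \<phi>" "\<phi> (Suc 0) = Ident C (X 2)"
    using assms(1) unfolding rsplit_def by (auto simp: numeral_2_eq_2)
  note [simp] = exsD(2)[OF W(1), of 0, simplified] cmapD(1)[OF \<phi>(1), of 0, simplified] exsD(2)[OF assms(2), of 1, simplified]
  obtain k where k: "k \<in> Hom C (W 1) (W 0)" "w 0 \<cdot> k = Ident C (W 1)"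
    using mono_epi_iso[OF exsD(3,4)[OF W(1)]] by auto
  have "f 1 \<cdot> (\<phi> 0 \<cdot> k) = (\<phi> (Suc 0) \<cdot> w 0) \<cdot> k"
    using comp_eq_ext[OF cmapD(2)[OF \<phi>(1), of 0], of k] k(1) W(2) \<phi>(2) exsD(1)[OF assms(2), of 2] by (simp add: numeral_2_eq_2)
  also have "\<dots> = Ident C (X 2)"
    using k W(2) \<phi>(2) exsD(1)[OF assms(2), of 2] by (simp add: numeral_2_eq_2)
  finally show ?thesis using that[of "\<phi> 0 \<cdot> k"] k(1) W(2) by simp
qed

text \<open>Iterate the shift along the sequence that exhibits \<open>B\<close> as a cosyzygy. Each step costs one degree, so the
  induction proves that the extensions of \<open>B\<close> split in all degrees up to \<open>m - l\<close>; degree one is what is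
  wanted.\<close>

lemma ext1_cosyzygy:
  assumes v: "\<And>k N. 1 \<le> k \<Longrightarrow> k \<le> m \<Longrightarrow> N \<in> \<M> \<Longrightarrow> Ext_vanishes C k P N" and B: "csz C \<M> \<M> l B" "l < m"
  shows "ext1_zero C P B"
proof -
  have "rsplit C n X f" if "l + Suc n \<le> m" "exs C (Suc n) X f" "X 0 = B" "X (Suc (Suc n)) = P" for n X f
    using B(1) that
  proof (induction arbitrary: n X f rule: csz.induct)
    case (base N)
    then show ?case using Ext_vanishes_rsplit[OF v] by simp
  next
    case (step l j q)
    have e: "Cod C q = X 0" using step.prems(3) by simp
    have r: "rsplit C (Suc n) (glue (Dom C j) (Dom C q) X) (glue j (f 0 \<cdot> q) f)"
      by (rule step.IH[OF _ exs_glue[OF step.hyps(2) step.prems(2) e]]) (use step.prems in simp_all)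
    have J: "rsplit C n V w" if "exs C (Suc n) V w" "V 0 = Dom C q" "V (Suc (Suc n)) = X (Suc (Suc n))" for V w
    proof (rule Ext_vanishes_rsplit)
      show "Ext_vanishes C (Suc n) P (Dom C q)"
        by (rule v) (use step sesD(3)[OF step.hyps(2)] in simp_all)
    qed (use that step.prems in simp_all)
    show ?case using rsplit_shift[OF step.hyps(2) step.prems(2,3) r J] .
  qed
  then have r: "\<And>X f. exs C (Suc 0) X f \<Longrightarrow> X 0 = B \<Longrightarrow> X (Suc (Suc 0)) = P \<Longrightarrow> rsplit C 0 X f"
    using B(2) by simp
  show ?thesis
    unfolding ext1_zero_def
  proof (intro allI impI, elim conjE)
    fix i p assume s: "ses C i p" "Dom C i = B" "Cod C p = P"
    have "rsplit C 0 (glue (Dom C i) (Dom C p) (\<lambda>_. Cod C p)) (glue i p (\<lambda>_. Ident C (Cod C p)))"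
      by (rule r[OF exs_one[OF s(1)]]) (use s in simp_all)
    from rsplit_one_section[OF this exs_one[OF s(1)]]
    obtain t where "t \<in> Hom C (Cod C p) (Dom C p)" "p \<cdot> t = Ident C (Cod C p)"
      by (metis One_nat_def glue_simps(2,3) numeral_2_eq_2)
    then show "\<exists>s \<in> Hom C P (Dom C p). p \<cdot> s = Ident C P" using s(3) by blast
  qed
qed

text \<open>Embedding the first inner term \<open>X\<^sub>1\<close> into an object \<open>J\<close> and pushing out turns an extension of \<open>X\<^sub>0\<close> into
  one of the cokernel \<open>B\<close> of \<open>X\<^sub>0 \<rightarrow> J\<close> that is shorter by one; a morphism out of the shorter extension
  gives one out of the original extension.\<close>

lemma embed_step:
  assumes X: "exs C (Suc (Suc n)) X f" and j: "j \<in> Hom C (X 1) J" "is_mono C j"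
  obtains B q E u h z where "ses C (j \<cdot> f 0) q" "Dom C q = J" "Cod C q = B"
    "exs C (Suc n) (glue B E (\<lambda>i. X (Suc (Suc i)))) z"
    "h \<in> Hom C (X 2) E" "u \<in> Hom C B E" "h \<cdot> f 1 = u \<cdot> (q \<cdot> j)"
    "\<forall>S b c. b \<in> Hom C (X 2) S \<and> c \<in> Hom C B S \<and> b \<cdot> f 1 = c \<cdot> (q \<cdot> j) \<longrightarrow> (\<exists>w \<in> Hom C E S. w \<cdot> h = b \<and> w \<cdot> u = c)"
    "\<forall>S w w'. w \<in> Hom C E S \<and> w' \<in> Hom C E S \<and> w \<cdot> h = w' \<cdot> h \<and> w \<cdot> u = w' \<cdot> u \<longrightarrow> w = w'"
    "\<forall>Y g \<theta>. exs C (Suc n) Y g \<and> Y 0 = B \<and> cmap C (Suc n) (glue B E (\<lambda>i. X (Suc (Suc i)))) z Y g \<theta> \<and> \<theta> 0 = Ident C B \<longrightarrow>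
      exs C (Suc (Suc n)) (glue (X 0) J Y) (glue (j \<cdot> f 0) (g 0 \<cdot> q) g) \<and>
      cmap C (Suc (Suc n)) X f (glue (X 0) J Y) (glue (j \<cdot> f 0) (g 0 \<cdot> q) g)
        (glue (Ident C (X 0)) j (\<lambda>i. if i = 1 then \<theta> 1 \<cdot> h else \<theta> i))"
proof -
  have f: "\<And>i. i \<le> Suc (Suc n) \<Longrightarrow> f i \<in> Hom C (X i) (X (Suc i))" using exsD(2)[OF X] by simp
  have Xo: "\<And>i. i \<le> Suc (Suc (Suc n)) \<Longrightarrow> X i \<in> Obj C" using exsD(1)[OF X] by simp
  have 2: "(2::nat) = Suc (Suc 0)" by simp
  obtain D p m where p: "ses C (f 0) p" "p \<in> Hom C (X 1) D" "m \<in> Hom C D (X 2)" "m \<cdot> p = f 1"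
    "exs C (Suc n) (unglue D X) (unglue m f)" by (rule exs_unglue[OF X])
  note [simp] = f[of 0, simplified] f[of "Suc 0", simplified] p(2,3)[simplified, unfolded 2] j(1)[simplified]
    Xo[of 0, simplified] Xo[of "Suc 0", simplified] Xo[of "Suc (Suc 0)", simplified]
  have "is_mono C (j \<cdot> f 0)" by (rule mono_comp) (use j exsD(3)[OF X] in auto)
  then obtain q where q: "ses C (j \<cdot> f 0) q" using ex_ses_mono by blast
  have dq [simp]: "Dom C q = J" "q \<in> Arr C" using sesD[OF q] by auto
  define B where "B = Cod C q"
  have cq [simp]: "Cod C q = B" by (simp add: B_def)
  have B [simp]: "B \<in> Obj C" unfolding B_def by (rule dom_cod_obj) simp
  obtain b where b: "b \<in> Hom C D B" "b \<cdot> p = q \<cdot> j"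
    by (rule ses_desc[OF p(1), of "q \<cdot> j" B]) (use sesD(4)[OF q] in auto)
  have b0: "b \<in> Hom C (unglue D X 0) B" using b by simp
  obtain E u v h where E: "exs C (Suc n) (glue B E (\<lambda>i. unglue D X (Suc i))) (glue u v (\<lambda>i. unglue m f (Suc i)))"
    "u \<in> Hom C B E" "v \<in> Hom C E (unglue D X 2)" "h \<in> Hom C (unglue D X 1) E" "h \<cdot> unglue m f 0 = u \<cdot> b" "v \<cdot> h = unglue m f 1"
    and univ: "\<forall>S c d. c \<in> Hom C (unglue D X 1) S \<and> d \<in> Hom C B S \<and> c \<cdot> unglue m f 0 = d \<cdot> b \<longrightarrow> (\<exists>w \<in> Hom C E S. w \<cdot> h = c \<and> w \<cdot> u = d)"
    and joint: "\<forall>S w w'. w \<in> Hom C E S \<and> w' \<in> Hom C E S \<and> w \<cdot> h = w' \<cdot> h \<and> w \<cdot> u = w' \<cdot> u \<longrightarrow> w = w'"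
    by (rule exs_pushout[OF p(5) b0])
  let ?Z = "glue B E (\<lambda>i. X (Suc (Suc i)))" and ?z = "glue u v (\<lambda>i. unglue m f (Suc i))"
  note [simp] = E(2-4)[simplified, unfolded 2, simplified] b(1)[simplified]
  have hf: "h \<cdot> f 1 = u \<cdot> (q \<cdot> j)"
  proof -
    have "h \<cdot> f 1 = (h \<cdot> m) \<cdot> p" using p(4) by simp
    also have "\<dots> = u \<cdot> (b \<cdot> p)" using E(5) by simp
    finally show ?thesis using b(2) by simp
  qed
  have univ': "\<exists>w \<in> Hom C E S. w \<cdot> h = x \<and> w \<cdot> u = c"
    if a: "x \<in> Hom C (X 2) S" "c \<in> Hom C B S" "x \<cdot> f 1 = c \<cdot> (q \<cdot> j)" for S x c
  proof -
    note [simp] = a(1,2)[simplified, unfolded 2]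
    have "(x \<cdot> m) \<cdot> p = x \<cdot> f 1" using p(4) by simp
    also have "\<dots> = (c \<cdot> b) \<cdot> p" using a(3) b(2) by simp
    finally have "x \<cdot> m = c \<cdot> b" by (rule epi_cancel[OF sesD(6)[OF p(1)]]) auto
    then show ?thesis by (intro univ[rule_format] conjI) simp_all
  qed
  have Z: "exs C (Suc n) ?Z ?z" using E(1) by simp
  have lift: "exs C (Suc (Suc n)) (glue (X 0) J Y) (glue (j \<cdot> f 0) (g 0 \<cdot> q) g) \<and>
      cmap C (Suc (Suc n)) X f (glue (X 0) J Y) (glue (j \<cdot> f 0) (g 0 \<cdot> q) g)
        (glue (Ident C (X 0)) j (\<lambda>i. if i = 1 then \<theta> 1 \<cdot> h else \<theta> i))"
    if Y: "exs C (Suc n) Y g" "Y 0 = B" "cmap C (Suc n) ?Z ?z Y g \<theta>" "\<theta> 0 = Ident C B" for Y g \<theta>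
  proof
    show "exs C (Suc (Suc n)) (glue (X 0) J Y) (glue (j \<cdot> f 0) (g 0 \<cdot> q) g)"
      using exs_glue[OF q Y(1)] Y(2) by simp
    let ?t = "glue (Ident C (X 0)) j (\<lambda>i. if i = 1 then \<theta> 1 \<cdot> h else \<theta> i)"
    have t: "\<theta> (Suc i) \<in> Hom C (?Z (Suc i)) (Y (Suc i))" if "i \<le> Suc n" for i
      using cmapD(1)[OF Y(3), of "Suc i"] that by simp
    have g0: "g 0 \<in> Hom C B (Y (Suc 0))" "g (Suc 0) \<in> Hom C (Y (Suc 0)) (Y (Suc (Suc 0)))" using exsD(2)[OF Y(1)] Y(2) by simp_all
    note [simp] = t[of 0, simplified] g0[simplified]
    show "cmap C (Suc (Suc n)) X f (glue (X 0) J Y) (glue (j \<cdot> f 0) (g 0 \<cdot> q) g) ?t"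
      unfolding cmap_def
    proof (intro conjI allI impI)
      fix i show "i \<le> Suc (Suc (Suc n)) \<Longrightarrow> ?t i \<in> Hom C (X i) (glue (X 0) J Y i)"
        using t[of "i - 2"] by (auto simp: glue_def split: nat.split)
      assume i: "i \<le> Suc (Suc n)"
      consider "i = 0" | "i = Suc 0" | "i = Suc (Suc 0)" | k where "i = Suc (Suc (Suc k))" by (metis not0_implies_Suc)
      then show "?t (Suc i) \<cdot> f i = glue (j \<cdot> f 0) (g 0 \<cdot> q) g i \<cdot> ?t i"
      proof cases
        case 2
        have "\<theta> (Suc 0) \<cdot> u = g 0" using cmapD(2)[OF Y(3), of 0] Y(4) by simp
        then have "\<theta> (Suc 0) \<cdot> (u \<cdot> (q \<cdot> j)) = g 0 \<cdot> (q \<cdot> j)" using comp_eq_ext[of "\<theta> (Suc 0)" u "g 0" "q \<cdot> j"] by simp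
        then show ?thesis using 2 hf by simp
      next
        case 3
        have th: "\<theta> (Suc (Suc 0)) \<in> Hom C (X (Suc (Suc (Suc 0)))) (Y (Suc (Suc 0)))" using t[of "Suc 0"] by simp
        have vv: "v \<in> Hom C E (X (Suc (Suc (Suc 0))))" using E(3) by (simp add: numeral_2_eq_2)
        have "\<theta> (Suc (Suc 0)) \<cdot> f (Suc (Suc 0)) = (\<theta> (Suc (Suc 0)) \<cdot> v) \<cdot> h" using E(6) th vv by simp
        also have "\<theta> (Suc (Suc 0)) \<cdot> v = g (Suc 0) \<cdot> \<theta> (Suc 0)" using cmapD(2)[OF Y(3), of "Suc 0"] by simp
        finally show ?thesis using 3 by simp
      next
        case 4
        then show ?thesis using cmapD(2)[OF Y(3), of "Suc (Suc k)"] i by simp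
      qed simp
    qed
  qed
  show ?thesis
  proof (rule that[of q B E ?z h u])
    show "h \<in> Hom C (X 2) E" using E(4) by (simp add: 2)
  qed (use q cq dq Z hf E(2) univ' joint lift in blast)+
qed

text \<open>Iterate the preceding step with embeddings into objects of \<open>\<M>\<close>. What remains in the end is a short exact
  sequence that starts at an \<open>n\<close>-th cosyzygy of \<open>X\<^sub>0\<close>, and it splits by assumption.\<close>

lemma embed_extension:
  assumes cog: "cogenerating C \<M>"
  shows "exs C (Suc n) X f \<Longrightarrow> (\<And>B. csz C \<M> {X 0} n B \<Longrightarrow> ext1_zero C (X (Suc (Suc n))) B) \<Longrightarrow>
    \<exists>Y g \<theta> s. exs C (Suc n) Y g \<and> Y 0 = X 0 \<and> Y (Suc (Suc n)) = X (Suc (Suc n)) \<and> cmap C (Suc n) X f Y g \<theta> \<and>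
      \<theta> 0 = Ident C (X 0) \<and> \<theta> (Suc (Suc n)) = Ident C (X (Suc (Suc n))) \<and>
      s \<in> Hom C (Y (Suc (Suc n))) (Y (Suc n)) \<and> g (Suc n) \<cdot> s = Ident C (Y (Suc (Suc n)))"
proof (induction n arbitrary: X f)
  case 0
  note X = 0(1)
  have f: "f 0 \<in> Hom C (X 0) (X (Suc 0))" "f (Suc 0) \<in> Hom C (X (Suc 0)) (X (Suc (Suc 0)))" using exsD(2)[OF X] by simp_all
  have "ses C (f 0) (f (Suc 0))" using ex_mono_epi_ses[OF exsD(5)[OF X, of 0] exsD(3,4)[OF X]] by simp
  moreover have "ext1_zero C (X (Suc (Suc 0))) (X 0)" by (rule 0(2)) (rule csz.base, simp)
  ultimately obtain s where "s \<in> Hom C (X (Suc (Suc 0))) (X (Suc 0))" "f (Suc 0) \<cdot> s = Ident C (X (Suc (Suc 0)))"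
    using f unfolding ext1_zero_def by fastforce
  moreover have "cmap C (Suc 0) X f X f (\<lambda>i. Ident C (X i))"
    unfolding cmap_def using exsD(1,2)[OF X] by simp
  ultimately show ?case using X by blast
next
  case (Suc n)
  note X = Suc.prems(1)
  have X1: "X 1 \<in> Obj C" and X0: "X 0 \<in> Obj C" using exsD(1)[OF X] by simp_all
  obtain J j where J: "J \<in> \<M>" and j: "j \<in> Hom C (X 1) J" "is_mono C j"
    using cog X1 unfolding cogenerating_def by blast
  obtain B q E u h z where q: "ses C (j \<cdot> f 0) q" "Dom C q = J" "Cod C q = B"
    and Z: "exs C (Suc n) (glue B E (\<lambda>i. X (Suc (Suc i)))) z"
    and lift: "\<forall>Y g \<theta>. exs C (Suc n) Y g \<and> Y 0 = B \<and> cmap C (Suc n) (glue B E (\<lambda>i. X (Suc (Suc i)))) z Y g \<theta> \<and> \<theta> 0 = Ident C B \<longrightarrow>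
      exs C (Suc (Suc n)) (glue (X 0) J Y) (glue (j \<cdot> f 0) (g 0 \<cdot> q) g) \<and>
      cmap C (Suc (Suc n)) X f (glue (X 0) J Y) (glue (j \<cdot> f 0) (g 0 \<cdot> q) g)
        (glue (Ident C (X 0)) j (\<lambda>i. if i = 1 then \<theta> 1 \<cdot> h else \<theta> i))"
    by (rule embed_step[OF X j]) blast
  let ?Z = "glue B E (\<lambda>i. X (Suc (Suc i)))"
  have "ext1_zero C (?Z (Suc (Suc n))) B'" if "csz C \<M> {?Z 0} n B'" for B'
  proof -
    have "Dom C (j \<cdot> f 0) = X 0" using j exsD(2)[OF X, of 0] by simp
    moreover have "csz C \<M> {Dom C (j \<cdot> f 0)} (Suc n) B'"
      by (rule csz_cons[OF _ q(1)]) (use that J q sesD(3)[OF q(1)] in simp_all)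
    ultimately show ?thesis using Suc.prems(2)[of B'] by simp
  qed
  then obtain Y g \<theta> s where Y: "exs C (Suc n) Y g" "Y 0 = B" "Y (Suc (Suc n)) = X (Suc (Suc (Suc n)))" "cmap C (Suc n) ?Z z Y g \<theta>"
    "\<theta> 0 = Ident C B" "\<theta> (Suc (Suc n)) = Ident C (X (Suc (Suc (Suc n))))"
    and s: "s \<in> Hom C (Y (Suc (Suc n))) (Y (Suc n))" "g (Suc n) \<cdot> s = Ident C (Y (Suc (Suc n)))"
    using Suc.IH[OF Z] by auto
  have "exs C (Suc (Suc n)) (glue (X 0) J Y) (glue (j \<cdot> f 0) (g 0 \<cdot> q) g) \<and>
      cmap C (Suc (Suc n)) X f (glue (X 0) J Y) (glue (j \<cdot> f 0) (g 0 \<cdot> q) g)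
        (glue (Ident C (X 0)) j (\<lambda>i. if i = 1 then \<theta> 1 \<cdot> h else \<theta> i))"
    using lift Y(1,2,4,5) by blast
  then show ?case using Y(3,6) s
    by (intro exI[of _ "glue (X 0) J Y"] exI[of _ "glue (j \<cdot> f 0) (g 0 \<cdot> q) g"]
        exI[of _ "glue (Ident C (X 0)) j (\<lambda>i. if i = 1 then \<theta> 1 \<cdot> h else \<theta> i)"] exI[of _ s]) simp
qed

end

context abelian_category
begin

lemma zero_hom:
  assumes "zero_object C Z"
  shows "f \<in> Hom C A Z \<Longrightarrow> f = Zer C A Z" "f \<in> Hom C Z A \<Longrightarrow> f = Zer C Z A" "Z \<in> Obj C"
proof -
  show Z: "Z \<in> Obj C" using assms by (simp add: zero_object_def)
  show "f = Zer C A Z" if "f \<in> Hom C A Z"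
  proof -
    have A: "A \<in> Obj C" using hom_obj that by blast
    then have "\<exists>!f. f \<in> Hom C A Z" using assms unfolding zero_object_def by blast
    moreover have "Zer C A Z \<in> Hom C A Z" using A Z by simp
    ultimately show ?thesis using that by blast
  qed
  show "f = Zer C Z A" if "f \<in> Hom C Z A"
  proof -
    have A: "A \<in> Obj C" using hom_obj that by blast
    then have "\<exists>!f. f \<in> Hom C Z A" using assms unfolding zero_object_def by blast
    moreover have "Zer C Z A \<in> Hom C Z A" using A Z by simp
    ultimately show ?thesis using that by blast
  qed
qed

lemma ident_zero_ses:
  assumes Z: "zero_object C Z" and A: "A \<in> Obj C"
  shows "ses C (Ident C A) (Zer C A Z)"
proof -
  have Zo: "Z \<in> Obj C" using zero_hom(3)[OF Z] .
  have "is_epi C (Zer C A Z)"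
  proof (rule epi_zeroI)
    fix T z assume "z \<in> Hom C (Cod C (Zer C A Z)) T"
    then show "z = Zer C (Cod C (Zer C A Z)) T" using zero_hom(2)[OF Z, of z T] A Zo by simp
  qed (use A Zo in simp)
  then have "is_cokernel C (Ident C A) (Zer C A Z)"
  proof (rule cokernelI)
    fix T y assume y: "y \<in> Hom C (Cod C (Ident C A)) T" "y \<cdot> Ident C A = Zer C (Dom C (Ident C A)) T"
    have T: "T \<in> Obj C" using hom_obj y by blast
    then show "\<exists>x \<in> Hom C (Cod C (Zer C A Z)) T. x \<cdot> Zer C A Z = y"
      using y A Zo by (intro bexI[of _ "Zer C Z T"]) auto
  qed (use A Zo in auto)
  then show ?thesis using A by (intro mono_cokernel_ses) simp_all
qed

end

lemma (in abelian_category) zero_ident_ses: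
  assumes Z: "zero_object C Z" and A: "A \<in> Obj C"
  shows "ses C (Zer C Z A) (Ident C A)"
  using abelian_category.ident_zero_ses[OF op_abelian, of Z A] assms by simp

context abelian_category
begin

text \<open>The sequence \<open>0 \<rightarrow> \<dots> \<rightarrow> 0 \<rightarrow> Y = Y \<rightarrow> 0\<close>.\<close>

lemma ex_split_chain:
  assumes Z: "zero_object C Z" and Y: "Y \<in> Obj C"
  shows "\<exists>X f. exs C (Suc n) X f \<and> (\<forall>i < Suc n. X i = Z) \<and> X (Suc n) = Y \<and> X (Suc (Suc n)) = Y \<and> f (Suc n) = Ident C Y"
proof (induction n)
  case 0
  have [simp]: "Z \<in> Obj C" using zero_hom(3)[OF Z] .
  show ?case using exs_one[OF zero_ident_ses[OF Z Y]] Y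
    by (intro exI[of _ "glue Z Y (\<lambda>_. Y)"] exI[of _ "glue (Zer C Z Y) (Ident C Y) (\<lambda>_. Ident C Y)"]) simp
next
  case (Suc n)
  have Zo [simp]: "Z \<in> Obj C" using zero_hom(3)[OF Z] .
  obtain X f where X: "exs C (Suc n) X f" "\<forall>i < Suc n. X i = Z" "X (Suc n) = Y" "X (Suc (Suc n)) = Y" "f (Suc n) = Ident C Y"
    using Suc by blast
  have "exs C (Suc (Suc n)) (glue Z Z X) (glue (Ident C Z) (f 0 \<cdot> Zer C Z Z) f)"
    using exs_glue[OF ident_zero_ses[OF Z Zo] X(1)] X(2) by simp
  moreover have "\<forall>i < Suc (Suc n). glue Z Z X i = Z" using X(2) by (auto simp: glue_def split: nat.split)
  ultimately show ?case using X by (intro exI[of _ "glue Z Z X"] exI[of _ "glue (Ident C Z) (f 0 \<cdot> Zer C Z Z) f"]) simp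
qed

lemma ex_trivial_ext:
  assumes "P \<in> Obj C" "N \<in> Obj C"
  obtains E f where "trivial_ext C (Suc n) P N (E, f)"
proof (cases n)
  case 0
  obtain E i j p q where b: "is_biproduct C N P E i j p q" by (rule ex_biproduct[OF assms(2,1)])
  have "trivial_ext C (Suc n) P N (glue N E (\<lambda>_. P), glue i q (\<lambda>_. Ident C P))"
    using exs_one[OF biproduct_ses[OF b]] biproductD(4-7)[OF b] b 0
    unfolding trivial_ext_def by (auto simp: yoneda_exts_iff)
  then show ?thesis by (rule that)
next
  case (Suc m)
  obtain Z where Z: "zero_object C Z" using ex_zero_object by blast
  have [simp]: "Z \<in> Obj C" using zero_hom(3)[OF Z] .
  obtain X f where X: "exs C (Suc m) X f" "\<forall>i < Suc m. X i = Z" "X (Suc m) = P" "X (Suc (Suc m)) = P" "f (Suc m) = Ident C P"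
    using ex_split_chain[OF Z assms(1)] by blast
  let ?E = "glue N N X" and ?f = "glue (Ident C N) (f 0 \<cdot> Zer C N Z) f"
  have e: "exs C (Suc n) ?E ?f"
    using exs_glue[OF ident_zero_ses[OF Z assms(2)] X(1)] X(2) Suc assms by simp
  have f: "f i \<in> Hom C (X i) (X (Suc i))" if "i \<le> Suc m" for i using exsD(2)[OF X(1) that] .
  have "?f i = Zer C (?E i) (?E (Suc i))" if i: "1 \<le> i" "i < Suc n" for i
  proof (cases i)
    case (Suc k)
    show ?thesis
    proof (cases k)
      case 0
      then show ?thesis using Suc f[of 0] zero_hom(2)[OF Z, of "f 0" "X (Suc 0)"] X(2) assms exsD(1)[OF X(1), of "Suc 0"] by simp
    next
      case (Suc l)
      have "Suc l < Suc m" using i \<open>i = Suc k\<close> \<open>n = Suc m\<close> Suc by simp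
      then have "f (Suc l) \<in> Hom C Z (X (Suc (Suc l)))" using f[of "Suc l"] X(2) by (simp del: hom_iff)
      then have "f (Suc l) = Zer C Z (X (Suc (Suc l)))" by (rule zero_hom(2)[OF Z])
      then show ?thesis using \<open>i = Suc k\<close> Suc \<open>Suc l < Suc m\<close> X(2) by simp
    qed
  qed (use i in simp)
  moreover have "zero_object C (?E i)" if "1 < i" "i < Suc n" for i
    using that X(2) Z Suc by (auto simp: glue_def split: nat.split)
  ultimately have "trivial_ext C (Suc n) P N (?E, ?f)"
    unfolding trivial_ext_def using e Suc X by (auto simp: yoneda_exts_iff simp del: hom_iff)
  then show ?thesis by (rule that)
qed

text \<open>A trivial extension in degree \<open>\<ge> 2\<close> maps to \<open>Y\<close> by the first map of \<open>Y\<close>, by zeros, and by the section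
  of its last map; in degree one by the morphism out of the direct sum with these two components.\<close>

lemma trivial_ext_to_split:
  assumes t: "trivial_ext C (Suc n) P N (E, e)" and Y: "exs C (Suc n) Y g" "Y 0 = N" "Y (Suc (Suc n)) = P"
    and s: "s \<in> Hom C (Y (Suc (Suc n))) (Y (Suc n))" "g (Suc n) \<cdot> s = Ident C (Y (Suc (Suc n)))"
  shows "end_fixing_map C (Suc n) (E, e) (Y, g)"
proof -
  have E: "exs C (Suc n) E e" "E 0 = N" "E (Suc (Suc n)) = P"
    using t unfolding trivial_ext_def by (simp_all add: yoneda_exts_iff)
  have eo: "\<And>i. i \<le> Suc n \<Longrightarrow> e i \<in> Hom C (E i) (E (Suc i))" using exsD(2)[OF E(1)] by simp
  have go: "\<And>i. i \<le> Suc n \<Longrightarrow> g i \<in> Hom C (Y i) (Y (Suc i))" using exsD(2)[OF Y(1)] by simp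
  have Eo: "\<And>i. i \<le> Suc (Suc n) \<Longrightarrow> E i \<in> Obj C" using exsD(1)[OF E(1)] by simp
  have Yo: "\<And>i. i \<le> Suc (Suc n) \<Longrightarrow> Y i \<in> Obj C" using exsD(1)[OF Y(1)] by simp
  have NP: "N \<in> Obj C" "P \<in> Obj C" using Eo[of 0] Eo[of "Suc (Suc n)"] E by simp_all
  have "\<exists>\<phi>. cmap C (Suc n) E e Y g \<phi> \<and> \<phi> 0 = Ident C N \<and> \<phi> (Suc (Suc n)) = Ident C P"
  proof (cases n)
    case 0
    obtain j p where b: "is_biproduct C N P (E 1) (e 0) j p (e 1)"
      using t 0 unfolding trivial_ext_def by auto
    note [simp] = biproductD(4-11)[OF b, simplified]
    note [simp] = go[of 0, simplified] go[of "Suc 0", unfolded 0, simplified] s(1)[unfolded 0, simplified] Y(2) Y(3)[unfolded 0] NP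
    have g0: "g 0 \<in> Hom C N (Y (Suc 0))" and s': "s \<in> Hom C P (Y (Suc 0))" by simp_all
    obtain z where z: "z \<in> Hom C (E 1) (Y (Suc 0))" "z \<cdot> e 0 = g 0" "z \<cdot> j = s" "z = (g 0 \<cdot> p) \<boxplus> (s \<cdot> e 1)"
      by (rule biproduct_copair[OF b g0 s'])
    note [simp] = z(1)[simplified]
    have "e 1 = g 1 \<cdot> z"
    proof (rule biproduct_co_eqI[OF b, of _ P])
      have "g (Suc 0) \<cdot> g 0 = Zer C N P" using exsD(6)[OF Y(1), of 0] 0 by simp
      then show "e 1 \<cdot> e 0 = (g 1 \<cdot> z) \<cdot> e 0" using z(2) by simp
      show "e 1 \<cdot> j = (g 1 \<cdot> z) \<cdot> j" using z(3) s(2) 0 by simp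
    qed simp_all
    then have "cmap C (Suc n) E e Y g (glue (Ident C N) z (\<lambda>_. Ident C P))"
      unfolding cmap_def using 0 E z(2) by (auto simp: le_Suc_eq)
    then show ?thesis using 0 by (intro exI[of _ "glue (Ident C N) z (\<lambda>_. Ident C P)"]) simp
  next
    case (Suc m)
    have t': "E 1 = N" "e 0 = Ident C N" "E (Suc n) = P" "e (Suc n) = Ident C P"
      "\<And>i. 1 \<le> i \<Longrightarrow> i < Suc n \<Longrightarrow> e i = Zer C (E i) (E (Suc i))"
      using t Suc unfolding trivial_ext_def by auto
    define \<phi> where "\<phi> i = (if i = 0 then Ident C N else if i = 1 then g 0 else if i \<le> n then Zer C (E i) (Y i)
      else if i = Suc n then s else Ident C P)" for i
    have ph: "\<phi> i \<in> Hom C (E i) (Y i)" if i: "i \<le> Suc (Suc n)" for i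
    proof -
      consider "i = 0" | "i = 1" | "1 < i" "i \<le> n" | "i = Suc n" "n \<noteq> 0" | "i = Suc (Suc n)" using i Suc by linarith
      then show ?thesis
        by cases (use E Y NP t' go[of 0] s Eo[of i] Yo[of i] Suc in \<open>simp_all add: \<phi>_def\<close>)
    qed
    have "cmap C (Suc n) E e Y g \<phi>"
      unfolding cmap_def
    proof (intro conjI allI impI)
      fix i assume i: "i \<le> Suc n"
      then have i': "i \<le> Suc (Suc n)" "Suc i \<le> Suc (Suc n)" by auto
      show "\<phi> (Suc i) \<cdot> e i = g i \<cdot> \<phi> i"
      proof (cases "i = 0 \<or> i = Suc n")
        case True
        then show ?thesis
        proof
          assume "i = 0"
          then show ?thesis using t'(2) go[of 0] Y(2) NP by (simp add: \<phi>_def)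
        next
          assume "i = Suc n"
          then show ?thesis using t'(4) s NP Suc Y(3) by (simp add: \<phi>_def)
        qed
      next
        case False
        then have i1: "1 \<le> i" "i < Suc n" using i by auto
        note [simp] = ph[OF i'(1), simplified] ph[OF i'(2), simplified] go[OF i, simplified] Eo[OF i'(1)] Eo[OF i'(2)] Yo[OF i'(1)] Yo[OF i'(2)]
        have "\<phi> (Suc i) \<cdot> e i = Zer C (E i) (Y (Suc i))" using t'(5)[OF i1] by simp
        moreover have "g i \<cdot> \<phi> i = Zer C (E i) (Y (Suc i))"
        proof (cases "i = 1")
          case True
          then show ?thesis using exsD(6)[OF Y(1), of 0] t'(1) Y(2) by (simp add: \<phi>_def)
        next
          case False
          then have "\<phi> i = Zer C (E i) (Y i)" using i1 by (simp add: \<phi>_def)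
          then show ?thesis by simp
        qed
        ultimately show ?thesis by simp
      qed
    qed (use ph in blast)
    then show ?thesis using Suc by (intro exI[of _ \<phi>]) (simp add: \<phi>_def)
  qed
  then show ?thesis unfolding end_fixing_map_iff using E Y by simp
qed

text \<open>An arbitrary extension and a trivial one both map to the extension that \<open>embed_extension\<close> provides, so
  there is only one class.\<close>

lemma Ext_vanishes_cosyzygy:
  assumes cog: "cogenerating C \<M>" and PN: "P \<in> Obj C" "N \<in> Obj C" and v: "\<And>B. csz C \<M> {N} n B \<Longrightarrow> ext1_zero C P B"
  shows "Ext_vanishes C (Suc n) P N"
proof -
  let ?Y = "yoneda_exts C (Suc n) P N"
  let ?R = "\<lambda>\<alpha> \<beta>. \<alpha> \<in> ?Y \<and> \<beta> \<in> ?Y \<and> end_fixing_map C (Suc n) \<alpha> \<beta>"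
  obtain E e where t: "trivial_ext C (Suc n) P N (E, e)" by (rule ex_trivial_ext[OF PN])
  then have tY: "(E, e) \<in> ?Y" unfolding trivial_ext_def by simp
  have eq: "equivclp ?R (E, e) \<xi>" if "\<xi> \<in> ?Y" for \<xi>
  proof -
    obtain X f where \<xi>: "\<xi> = (X, f)" by force
    have X: "exs C (Suc n) X f" "X 0 = N" "X (Suc (Suc n)) = P" using that unfolding \<xi> yoneda_exts_iff by auto
    obtain Y g \<theta> s where Y: "exs C (Suc n) Y g" "Y 0 = X 0" "Y (Suc (Suc n)) = X (Suc (Suc n))" "cmap C (Suc n) X f Y g \<theta>"
      "\<theta> 0 = Ident C (X 0)" "\<theta> (Suc (Suc n)) = Ident C (X (Suc (Suc n)))"
      and s: "s \<in> Hom C (Y (Suc (Suc n))) (Y (Suc n))" "g (Suc n) \<cdot> s = Ident C (Y (Suc (Suc n)))"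
      using embed_extension[OF cog X(1)] v X by blast
    have yY: "(Y, g) \<in> ?Y" using Y X by (simp add: yoneda_exts_iff)
    have "end_fixing_map C (Suc n) (X, f) (Y, g)" unfolding end_fixing_map_iff using Y by auto
    moreover have "end_fixing_map C (Suc n) (E, e) (Y, g)"
      using trivial_ext_to_split[OF t Y(1) _ _ s] Y X by simp
    ultimately have R: "?R (E, e) (Y, g)" "?R (X, f) (Y, g)" using tY yY that \<xi> by auto
    have "equivclp ?R (E, e) (Y, g)" using R(1) by (rule r_into_equivclp)
    then show ?thesis unfolding \<xi> by (rule equivclp_into_equivclp) (use R(2) in blast)
  qed
  have rel: "yoneda_rel C (Suc n) P N = ?Y \<times> ?Y"
  proof -
    have "equivclp ?R \<xi> \<zeta>" if "\<xi> \<in> ?Y" "\<zeta> \<in> ?Y" for \<xi> \<zeta>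
      by (rule equivclp_trans[OF equivclp_sym[OF eq[OF that(1)]] eq[OF that(2)]])
    then show ?thesis unfolding yoneda_rel_def by blast
  qed
  have "{\<xi>. trivial_ext C (Suc n) P N \<xi>} \<inter> ?Y \<noteq> {}" using t tY by blast
  then have "Ext_zero C (Suc n) P N = ?Y" unfolding Ext_zero_def rel by blast
  moreover have "Ext C (Suc n) P N = {?Y}" unfolding Ext_def quotient_def rel using tY by auto
  ultimately show ?thesis by simp
qed

end

section \<open>The homological properties of cluster tilting subcategories\<close>

text \<open>The properties of a \<open>d\<close>-cluster tilting subcategory from which the theorem is derived, with \<open>Ext\<close> in
  degrees \<open>1, \<dots>, d - 1\<close> traded for \<open>Ext\<^sup>1\<close> with \<open>l\<close>-th cosyzygies and syzygies for \<open>l + 2 \<le> d\<close>. The list is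
  self-dual.\<close>

locale tilting = abelian_category +
  fixes \<M> :: "'a set" and d :: nat
  assumes d: "1 \<le> d"
    and M_obj: "\<M> \<subseteq> Obj C"
    and M_sum: "\<lbrakk>A \<in> \<M>; B \<in> \<M>; is_direct_sum C A B P\<rbrakk> \<Longrightarrow> P \<in> \<M>"
    and gen: "generating C \<M>"
    and cogen: "cogenerating C \<M>"
    and left_approx: "R \<in> Obj C \<Longrightarrow> \<exists>r. left_approximation C \<M> R r"
    and right_approx: "R \<in> Obj C \<Longrightarrow> \<exists>r. right_approximation C \<M> R r"
    and cosyzygy: "\<lbrakk>P \<in> \<M>; csz C \<M> \<M> l B; l + 2 \<le> d\<rbrakk> \<Longrightarrow> ext1_zero C P B"
    and syzygy: "\<lbrakk>N \<in> \<M>; csz (op_cat C) \<M> \<M> l Z; l + 2 \<le> d\<rbrakk> \<Longrightarrow> ext1_zero C Z N"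
    and M_left: "\<lbrakk>P \<in> Obj C; \<And>l B. csz C \<M> \<M> l B \<Longrightarrow> l + 2 \<le> d \<Longrightarrow> ext1_zero C P B\<rbrakk> \<Longrightarrow> P \<in> \<M>"
    and M_right: "\<lbrakk>N \<in> Obj C; \<And>l Z. csz (op_cat C) \<M> \<M> l Z \<Longrightarrow> l + 2 \<le> d \<Longrightarrow> ext1_zero C Z N\<rbrakk> \<Longrightarrow> N \<in> \<M>"

lemma op_generating [simp]: "generating (op_cat C) \<M> \<longleftrightarrow> cogenerating C \<M>"
  by (simp add: generating_def cogenerating_def op_hom)

lemma op_cogenerating [simp]: "cogenerating (op_cat C) \<M> \<longleftrightarrow> generating C \<M>"
  by (simp add: generating_def cogenerating_def op_hom)

lemma op_left_approximation [simp]: "left_approximation (op_cat C) \<M> R r \<longleftrightarrow> right_approximation C \<M> R r"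
  by (simp add: left_approximation_def right_approximation_def op_hom)

lemma op_right_approximation [simp]: "right_approximation (op_cat C) \<M> R r \<longleftrightarrow> left_approximation C \<M> R r"
  by (simp add: left_approximation_def right_approximation_def op_hom)

lemma (in tilting) op_tilting: "tilting (op_cat C) \<M> d"
proof (intro tilting.intro tilting_axioms.intro op_abelian)
  fix P l B assume "P \<in> \<M>" "csz (op_cat C) \<M> \<M> l B" "l + 2 \<le> d"
  then show "ext1_zero (op_cat C) P B" unfolding op_ext1_zero by (rule syzygy)
next
  fix N l Z assume "N \<in> \<M>" "csz (op_cat (op_cat C)) \<M> \<M> l Z" "l + 2 \<le> d"
  then show "ext1_zero (op_cat C) Z N" unfolding op_ext1_zero csz_op_op by (rule cosyzygy)
next
  fix P assume "P \<in> Obj (op_cat C)" "\<And>l B. csz (op_cat C) \<M> \<M> l B \<Longrightarrow> l + 2 \<le> d \<Longrightarrow> ext1_zero (op_cat C) P B"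
  then show "P \<in> \<M>" by (intro M_right) (simp_all only: op_ext1_zero op_simps)
next
  fix N assume "N \<in> Obj (op_cat C)" "\<And>l Z. csz (op_cat (op_cat C)) \<M> \<M> l Z \<Longrightarrow> l + 2 \<le> d \<Longrightarrow> ext1_zero (op_cat C) Z N"
  then show "N \<in> \<M>" by (intro M_left) (simp_all only: op_ext1_zero op_simps csz_op_op)
next
  fix A B P assume "A \<in> \<M>" "B \<in> \<M>" "is_direct_sum (op_cat C) A B P"
  then show "P \<in> \<M>" unfolding op_direct_sum by (rule M_sum)
next
  fix R assume "R \<in> Obj (op_cat C)"
  then show "\<exists>r. left_approximation (op_cat C) \<M> R r" "\<exists>r. right_approximation (op_cat C) \<M> R r"
    unfolding op_left_approximation op_right_approximation op_simps by (rule right_approx, rule left_approx)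
qed (simp_all only: d M_obj gen cogen op_generating op_cogenerating op_simps)

text \<open>In the definition of cluster tilting both conditions concern the same groups \<open>Ext\<^sup>i(P, N)\<close>, and the translation
  resolves the second argument by cosyzygies. The conditions on syzygies follow by \<open>ext1_balance\<close>, once in
  the opposite category and once in the given one.\<close>

lemma (in abelian_category) cluster_tilting_imp_tilting:
  assumes d: "1 \<le> d" and M: "cluster_tilting C d \<M>"
  shows "tilting C \<M> d"
proof -
  have sub: "subcategory C \<M>" and ff: "functorially_finite C \<M>" and gen: "generating C \<M>" and cog: "cogenerating C \<M>"
    and left: "\<M> = {X \<in> Obj C. \<forall>M \<in> \<M>. \<forall>i. 1 \<le> i \<and> i \<le> d - 1 \<longrightarrow> Ext_vanishes C i X M}"
    and right: "\<M> = {Y \<in> Obj C. \<forall>M \<in> \<M>. \<forall>i. 1 \<le> i \<and> i \<le> d - 1 \<longrightarrow> Ext_vanishes C i M Y}"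
    using M[unfolded cluster_tilting_def, THEN conjunct1] M[unfolded cluster_tilting_def, THEN conjunct2, THEN conjunct1]
      M[unfolded cluster_tilting_def, THEN conjunct2, THEN conjunct2, THEN conjunct1]
      M[unfolded cluster_tilting_def, THEN conjunct2, THEN conjunct2, THEN conjunct2, THEN conjunct1]
      M[unfolded cluster_tilting_def, THEN conjunct2, THEN conjunct2, THEN conjunct2, THEN conjunct2, THEN conjunct1]
      M[unfolded cluster_tilting_def, THEN conjunct2, THEN conjunct2, THEN conjunct2, THEN conjunct2, THEN conjunct2] by -
  have leftI: "X \<in> \<M>" if "X \<in> Obj C" "\<And>M i. M \<in> \<M> \<Longrightarrow> 1 \<le> i \<Longrightarrow> i \<le> d - 1 \<Longrightarrow> Ext_vanishes C i X M" for X
    by (subst left) (use that in blast)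
  have rightI: "X \<in> \<M>" if "X \<in> Obj C" "\<And>M i. M \<in> \<M> \<Longrightarrow> 1 \<le> i \<Longrightarrow> i \<le> d - 1 \<Longrightarrow> Ext_vanishes C i M X" for X
    by (subst right) (use that in blast)
  have Mo: "\<M> \<subseteq> Obj C" using sub unfolding subcategory_def by (rule conjunct1)
  have van: "Ext_vanishes C k P N" if "P \<in> \<M>" "N \<in> \<M>" "1 \<le> k" "k \<le> d - 1" for k P N
  proof -
    have "P \<in> {X \<in> Obj C. \<forall>M \<in> \<M>. \<forall>i. 1 \<le> i \<and> i \<le> d - 1 \<longrightarrow> Ext_vanishes C i X M}"
      using that(1) by (rule subst[OF left, of "\<lambda>S. P \<in> S"])
    then show ?thesis using that by blast
  qed
  have cos: "ext1_zero C P B" if "P \<in> \<M>" "csz C \<M> \<M> l B" "l + 2 \<le> d" for P l B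
    by (rule ext1_cosyzygy[OF van[OF that(1)] that(2), of "d - 1"]) (use that in auto)
  have syz: "ext1_zero C Z N" if N: "N \<in> \<M>" and Z: "csz (op_cat C) \<M> \<M> l Z" and l: "l + 2 \<le> d" for N l Z
  proof -
    have "ext1_zero (op_cat C) N Z"
    proof (rule abelian_category.ext1_balance[OF op_abelian, of \<M> "d - 2" \<M> l Z 0 N])
      show "csz (op_cat (op_cat C)) \<M> \<M> 0 N" using N by (auto intro: csz.base)
    qed (use cog cos Z l in auto)
    then show ?thesis by simp
  qed
  show ?thesis
  proof (intro tilting.intro tilting_axioms.intro abelian_category_axioms)
    show "P \<in> \<M>" if "A \<in> \<M>" "B \<in> \<M>" "is_direct_sum C A B P" for A B P
      using sub that unfolding subcategory_def by blast
    show "P \<in> \<M>" if P: "P \<in> Obj C" and v: "\<And>l B. csz C \<M> \<M> l B \<Longrightarrow> l + 2 \<le> d \<Longrightarrow> ext1_zero C P B" for P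
    proof -
      have "Ext_vanishes C i P N" if N: "N \<in> \<M>" and i: "1 \<le> i" "i \<le> d - 1" for N i
      proof -
        obtain k where k: "i = Suc k" using i by (cases i) auto
        show ?thesis unfolding k
        proof (rule Ext_vanishes_cosyzygy[OF cog P])
          show "N \<in> Obj C" using N Mo by blast
          show "ext1_zero C P B" if "csz C \<M> {N} k B" for B
            using v[OF csz_mono[OF that]] N i k by auto
        qed
      qed
      then show ?thesis by (rule leftI[OF P])
    qed
    show "N \<in> \<M>" if N: "N \<in> Obj C" and v: "\<And>l Z. csz (op_cat C) \<M> \<M> l Z \<Longrightarrow> l + 2 \<le> d \<Longrightarrow> ext1_zero C Z N" for N
    proof -
      have "Ext_vanishes C i P N" if P: "P \<in> \<M>" and i: "1 \<le> i" "i \<le> d - 1" for P i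
      proof -
        obtain k where k: "i = Suc k" using i by (cases i) auto
        show ?thesis unfolding k
        proof (rule Ext_vanishes_cosyzygy[OF cog _ N])
          show "P \<in> Obj C" using P Mo by blast
          show "ext1_zero C P B" if B: "csz C \<M> {N} k B" for B
          proof (rule ext1_balance[OF gen _ _ B, of "d - 2" 0 P])
            show "csz (op_cat C) \<M> \<M> 0 P" using P by (rule csz.base)
          qed (use v syz i k in auto)
        qed
      qed
      then show ?thesis by (rule rightI[OF N])
    qed
  qed (use d Mo gen cog ff cos syz in \<open>auto simp: functorially_finite_def\<close>)
qed

section \<open>Exact sequences in a cluster tilting subcategory\<close>

context tilting
begin

definition dext :: "(nat \<Rightarrow> 'a) \<Rightarrow> (nat \<Rightarrow> 'b) \<Rightarrow> bool"
  where "dext X f \<longleftrightarrow> exs C d X f \<and> (\<forall>i \<le> Suc d. X i \<in> \<M>)"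

text \<open>An exact sequence with terms in \<open>\<M>\<close> stays exact under \<open>Hom(P, -)\<close> for \<open>P \<in> \<M>\<close>: the obstructions are
  extensions of \<open>P\<close> by cosyzygies. The induction peels off the sequence from the left, so that the
  first term is only assumed to be a cosyzygy.\<close>

lemma exs_lift:
  "exs C n X f \<Longrightarrow> csz C \<M> \<M> l (X 0) \<Longrightarrow> l + n \<le> d \<Longrightarrow> (\<And>i. 1 \<le> i \<Longrightarrow> i \<le> n \<Longrightarrow> X i \<in> \<M>) \<Longrightarrow> P \<in> \<M> \<Longrightarrow> i < n \<Longrightarrow>
    y \<in> Hom C P (X (Suc i)) \<Longrightarrow> f (Suc i) \<cdot> y = Zer C P (X (Suc (Suc i))) \<Longrightarrow> \<exists>x \<in> Hom C P (X i). f i \<cdot> x = y"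
proof (induction n arbitrary: X f l i y)
  case (Suc n)
  note X = Suc.prems(1)
  obtain B p m where p: "ses C (f 0) p" "p \<in> Hom C (X 1) B" "m \<in> Hom C B (X 2)" "m \<cdot> p = f 1"
    "exs C n (unglue B X) (unglue m f)" by (rule exs_unglue[OF X])
  have f0: "f 0 \<in> Hom C (X 0) (X (Suc 0))" using exsD(2)[OF X, of 0] by simp
  have mono: "is_mono C m" using exsD(3)[OF p(5)] by simp
  note [simp] = f0[simplified] p(2,3)[simplified, unfolded numeral_2_eq_2]
  have P: "P \<in> Obj C" using Suc.prems(5) M_obj by blast
  show ?case
  proof (cases i)
    case 0
    note [simp] = Suc.prems(7)[unfolded 0, simplified]
    have "m \<cdot> (p \<cdot> y) = Zer C P (Cod C m)" using Suc.prems(8) 0 comp_eq_ext[OF p(4), of y] by simp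
    then have "p \<cdot> y = Zer C P B" using mono_zeroD[OF mono, of "p \<cdot> y" P] by simp
    then obtain x where "x \<in> Hom C P (X 0)" "f 0 \<cdot> x = y" using ses_lift[OF p(1), of y P] by auto
    then show ?thesis using 0 by blast
  next
    case (Suc k)
    have c: "csz C \<M> \<M> (Suc l) (unglue B X 0)"
      using csz.step[of C \<M> \<M> l "f 0" p] Suc.prems(2,4) p(1) by simp
    have "\<exists>x \<in> Hom C P (unglue B X k). unglue m f k \<cdot> x = y"
    proof (rule Suc.IH[OF p(5) c])
      show "unglue B X j \<in> \<M>" if "1 \<le> j" "j \<le> n" for j using Suc.prems(4)[of "Suc j"] that by (cases j) auto
    qed (use Suc.prems Suc in auto)
    then obtain x where x: "x \<in> Hom C P (unglue B X k)" "unglue m f k \<cdot> x = y" by blast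
    show ?thesis
    proof (cases k)
      case 0
      then have x': "x \<in> Hom C P B" "m \<cdot> x = y" using x by auto
      have "ext1_zero C P (Dom C (f 0))" using cosyzygy[OF Suc.prems(5,2)] Suc.prems(3,6) \<open>i = Suc k\<close> by simp
      then obtain z where z: "z \<in> Hom C P (X (Suc 0))" "p \<cdot> z = x"
        using ext1_lift[OF _ p(1), of P x] x'(1) by auto
      have "f 1 \<cdot> z = y" using comp_eq_ext[OF p(4), of z] z x' by simp
      then show ?thesis using z \<open>i = Suc k\<close> 0 by auto
    qed (use x \<open>i = Suc k\<close> in auto)
  qed
qed simp

lemma dext_lift:
  assumes X: "dext X f" and "P \<in> \<M>" "i < d" "y \<in> Hom C P (X (Suc i))" "f (Suc i) \<cdot> y = Zer C P (X (Suc (Suc i)))"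
  obtains x where "x \<in> Hom C P (X i)" "f i \<cdot> x = y"
  using exs_lift[of d X f 0 P i y] assms unfolding dext_def by (auto intro: csz.base simp del: hom_iff)

lemma dext_op:
  assumes "dext X f"
  shows "tilting.dext (op_cat C) \<M> d (revs (Suc d) X) (revs d f)"
  unfolding tilting.dext_def[OF op_tilting] using exs_revs assms by (auto simp: dext_def revs_def)

lemma dext_op':
  assumes "tilting.dext (op_cat C) \<M> d X f"
  shows "dext (revs (Suc d) X) (revs d f)"
  using exs_revs' assms unfolding tilting.dext_def[OF op_tilting] by (auto simp: dext_def revs_def)

end

context tilting
begin

text \<open>The dual of \<open>dext_lift\<close>; the place \<open>i\<close> becomes \<open>d - 1 - i\<close> in the reversed sequence.\<close>

lemma dext_extend:
  assumes X: "dext X f" and N: "N \<in> \<M>" and i: "i < d" and y: "y \<in> Hom C (X (Suc i)) N" "y \<cdot> f i = Zer C (X i) N"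
  obtains x where "x \<in> Hom C (X (Suc (Suc i))) N" "x \<cdot> f (Suc i) = y"
proof -
  let ?k = "d - Suc i"
  have k: "Suc d - Suc ?k = Suc i" "Suc d - Suc (Suc ?k) = i" "d - Suc ?k = i" "Suc d - ?k = Suc (Suc i)" "d - ?k = Suc i"
    using i by auto
  obtain x where "x \<in> Hom (op_cat C) N (revs (Suc d) X ?k)" "Comp (op_cat C) (revs d f ?k) x = y"
  proof (rule tilting.dext_lift[OF op_tilting dext_op[OF X] N, of ?k y])
    show "?k < d" using i by simp
    show "y \<in> Hom (op_cat C) N (revs (Suc d) X (Suc ?k))" unfolding revs_def k op_unfold by (rule y(1))
    show "Comp (op_cat C) (revs d f (Suc ?k)) y = Zer (op_cat C) N (revs (Suc d) X (Suc (Suc ?k)))"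
      unfolding revs_def k op_unfold by (rule y(2))
  qed
  then show ?thesis unfolding revs_def k op_unfold by (rule that)
qed

lemma dextD:
  assumes "dext X f"
  shows "exs C d X f" "i \<le> Suc d \<Longrightarrow> X i \<in> \<M>" "i \<le> Suc d \<Longrightarrow> X i \<in> Obj C" "i \<le> d \<Longrightarrow> f i \<in> Hom C (X i) (X (Suc i))"
    "is_mono C (f 0)" "is_epi C (f d)" "i < d \<Longrightarrow> f (Suc i) \<cdot> f i = Zer C (X i) (X (Suc (Suc i)))"
proof -
  have e: "exs C d X f" and M: "\<And>i. i \<le> Suc d \<Longrightarrow> X i \<in> \<M>" using assms unfolding dext_def by blast+
  show "exs C d X f" by (rule e)
  show "i \<le> Suc d \<Longrightarrow> X i \<in> \<M>" by (rule M)
  show "i \<le> Suc d \<Longrightarrow> X i \<in> Obj C" using M M_obj by blast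
  show "i \<le> d \<Longrightarrow> f i \<in> Hom C (X i) (X (Suc i))" by (rule exsD(2)[OF e])
  show "is_mono C (f 0)" "is_epi C (f d)" by (rule exsD(3,4)[OF e])+
  show "i < d \<Longrightarrow> f (Suc i) \<cdot> f i = Zer C (X i) (X (Suc (Suc i)))" by (rule exsD(6)[OF e])
qed

lemma kernel_hom_group:
  "kernel (hom_group C A B) (hom_group C D E) h = {g \<in> Hom C A B. h g = Zer C D E}"
  by (simp add: kernel_def hom_group_def)

text \<open>Exactness of the two sequences of \<open>Hom\<close> groups is what \<open>dext_lift\<close> and \<open>dext_extend\<close> provide, together
  with injectivity at the ends.\<close>

lemma dext_imp_d_extension:
  assumes X: "dext X f"
  shows "d_extension C \<M> d X f"
proof -
  have s: "is_sequ_in C \<M> d X f" using X unfolding dext_def exs_def is_sequ_in_def by blast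
  have A: "kernel (hom_group C (X (Suc i)) M) (hom_group C (X i) M) (\<lambda>g. g \<cdot> f i) = (\<lambda>g. g \<cdot> f (Suc i)) ` Hom C (X (Suc (Suc i))) M"
    if M: "M \<in> \<M>" and i: "i < d" for M i
    unfolding kernel_hom_group
  proof (intro equalityI subsetI)
    fix y assume "y \<in> {g \<in> Hom C (X (Suc i)) M. g \<cdot> f i = Zer C (X i) M}"
    then show "y \<in> (\<lambda>g. g \<cdot> f (Suc i)) ` Hom C (X (Suc (Suc i))) M" using dext_extend[OF X M i] by blast
  next
    fix y assume "y \<in> (\<lambda>g. g \<cdot> f (Suc i)) ` Hom C (X (Suc (Suc i))) M"
    then obtain g where g: "g \<in> Hom C (X (Suc (Suc i))) M" "y = g \<cdot> f (Suc i)" by blast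
    have fi: "f i \<in> Hom C (X i) (X (Suc i))" "f (Suc i) \<in> Hom C (X (Suc i)) (X (Suc (Suc i)))" "X i \<in> Obj C"
      using dextD(4)[OF X, of i] dextD(4)[OF X, of "Suc i"] dextD(3)[OF X, of i] i by simp_all
    then show "y \<in> {g \<in> Hom C (X (Suc i)) M. g \<cdot> f i = Zer C (X i) M}" using g dextD(7)[OF X i] by simp
  qed
  have B: "kernel (hom_group C M (X (Suc i))) (hom_group C M (X (Suc (Suc i)))) (\<lambda>g. f (Suc i) \<cdot> g) = (\<lambda>g. f i \<cdot> g) ` Hom C M (X i)"
    if M: "M \<in> \<M>" and i: "i < d" for M i
    unfolding kernel_hom_group
  proof (intro equalityI subsetI)
    fix y assume "y \<in> {g \<in> Hom C M (X (Suc i)). f (Suc i) \<cdot> g = Zer C M (X (Suc (Suc i)))}"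
    then show "y \<in> (\<lambda>g. f i \<cdot> g) ` Hom C M (X i)" using dext_lift[OF X M i] by blast
  next
    fix y assume "y \<in> (\<lambda>g. f i \<cdot> g) ` Hom C M (X i)"
    then obtain g where g: "g \<in> Hom C M (X i)" "y = f i \<cdot> g" by blast
    have fi: "f i \<in> Hom C (X i) (X (Suc i))" "f (Suc i) \<in> Hom C (X (Suc i)) (X (Suc (Suc i)))" "X (Suc (Suc i)) \<in> Obj C"
      using dextD(4)[OF X, of i] dextD(4)[OF X, of "Suc i"] dextD(3)[OF X, of "Suc (Suc i)"] i by simp_all
    then show "y \<in> {g \<in> Hom C M (X (Suc i)). f (Suc i) \<cdot> g = Zer C M (X (Suc (Suc i)))}"
      using g comp_eq_ext[OF dextD(7)[OF X i], of g] by simp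
  qed
  have I1: "inj_on (\<lambda>g. g \<cdot> f d) (Hom C (X (Suc d)) M)" for M
  proof (rule inj_onI)
    have fd: "Cod C (f d) = X (Suc d)" using dextD(4)[OF X, of d] by simp
    fix g h assume "g \<in> Hom C (X (Suc d)) M" "h \<in> Hom C (X (Suc d)) M" "g \<cdot> f d = h \<cdot> f d"
    then show "g = h" using epi_cancel[OF dextD(6)[OF X], of g h M] unfolding fd by blast
  qed
  have I2: "inj_on (\<lambda>g. f 0 \<cdot> g) (Hom C M (X 0))" for M
  proof (rule inj_onI)
    have f0: "Dom C (f 0) = X 0" using dextD(4)[OF X, of 0] by simp
    fix g h assume "g \<in> Hom C M (X 0)" "h \<in> Hom C M (X 0)" "f 0 \<cdot> g = f 0 \<cdot> h"
    then show "g = h" using mono_cancel[OF dextD(5)[OF X], of g h M] unfolding f0 by blast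
  qed
  have "d_cokernel C \<M> d X f"
    unfolding d_cokernel_def by (intro conjI ballI allI impI; rule s I1 A; assumption)
  moreover have "d_kernel C \<M> d X f"
    unfolding d_kernel_def by (intro conjI ballI allI impI; rule s I2 B; assumption)
  ultimately show ?thesis unfolding d_extension_def by (rule conjI)
qed

text \<open>Every object is covered by an object of \<open>\<M>\<close> and embeds into one, so exactness under \<open>Hom(M, -)\<close> and
  injectivity of \<open>Hom(-, M)\<close> at the right end, for \<open>M \<in> \<M>\<close>, suffice for exactness.\<close>

lemma d_extension_imp_dext:
  assumes D: "d_extension C \<M> d X f"
  shows "dext X f"
proof -
  have s: "is_sequ C d X f" "\<And>i. i \<le> Suc d \<Longrightarrow> X i \<in> \<M>"
    using D unfolding d_extension_def d_cokernel_def is_sequ_in_def by blast+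
  have inj: "inj_on (\<lambda>g. f 0 \<cdot> g) (Hom C M (X 0))" "inj_on (\<lambda>g. g \<cdot> f d) (Hom C (X (Suc d)) M)" if "M \<in> \<M>" for M
    using D that unfolding d_extension_def d_cokernel_def d_kernel_def by blast+
  have ker: "{g \<in> Hom C M (X (Suc i)). f (Suc i) \<cdot> g = Zer C M (X (Suc (Suc i)))} = (\<lambda>g. f i \<cdot> g) ` Hom C M (X i)"
    if "M \<in> \<M>" "i < d" for M i
    using D that unfolding d_extension_def d_kernel_def kernel_hom_group by blast
  have Xo: "X i \<in> Obj C" if "i \<le> Suc d" for i using s(2)[OF that] M_obj by blast
  have f: "\<And>i. i \<le> d \<Longrightarrow> f i \<in> Hom C (X i) (X (Suc i))" using is_sequD(2)[OF s(1)] by blast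
  have mono: "is_mono C (f 0)"
  proof (rule mono_zeroI)
    note [simp] = f[of 0, simplified] Xo[of 0, simplified] Xo[of "Suc 0", simplified]
    fix T x assume x: "x \<in> Hom C T (Dom C (f 0))" "f 0 \<cdot> x = Zer C T (Cod C (f 0))"
    have T: "T \<in> Obj C" using hom_obj x by blast
    obtain M e where M: "M \<in> \<M>" and e: "e \<in> Hom C M T" "is_epi C e" using gen T unfolding generating_def by blast
    have Mo: "M \<in> Obj C" using M M_obj by blast
    have "f 0 \<cdot> (x \<cdot> e) = f 0 \<cdot> Zer C M (X 0)" using comp_eq_ext[OF x(2), of e] x(1) e(1) Mo by simp
    then have "x \<cdot> e = Zer C M (X 0)" by (rule inj_onD[OF inj(1)[OF M]]) (use x e Mo in auto)
    then show "x = Zer C T (Dom C (f 0))" using epi_zeroD[OF e(2), of x "X 0"] x e by simp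
  qed (use f[of 0] in simp)
  have epi: "is_epi C (f d)"
  proof (rule epi_zeroI)
    note [simp] = f[of d, simplified] Xo[of d, simplified] Xo[of "Suc d", simplified]
    fix T x assume x: "x \<in> Hom C (Cod C (f d)) T" "x \<cdot> f d = Zer C (Dom C (f d)) T"
    have T: "T \<in> Obj C" using hom_obj x by blast
    obtain M e where M: "M \<in> \<M>" and e: "e \<in> Hom C T M" "is_mono C e" using cogen T unfolding cogenerating_def by blast
    have Mo: "M \<in> Obj C" using M M_obj by blast
    have "(e \<cdot> x) \<cdot> f d = Zer C (X (Suc d)) M \<cdot> f d" using x e Mo T by simp
    then have "e \<cdot> x = Zer C (X (Suc d)) M" by (rule inj_onD[OF inj(2)[OF M]]) (use x e Mo in auto)
    then show "x = Zer C (Cod C (f d)) T" using mono_zeroD[OF e(2), of x "X (Suc d)"] x e by simp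
  qed (use f[of d] in simp)
  have "exact C (f i) (f (Suc i))" if i: "i < d" for i
  proof (rule exI_cover)
    have i': "i \<le> d" "Suc i \<le> d" "i \<le> Suc d" using i by auto
    note [simp] = f[OF i'(1), simplified] f[OF i'(2), simplified] Xo[OF i'(3)]
    have "f i \<cdot> Ident C (X i) \<in> (\<lambda>g. f i \<cdot> g) ` Hom C (X i) (X i)" by (rule imageI) simp
    then have "f i \<in> {g \<in> Hom C (X i) (X (Suc i)). f (Suc i) \<cdot> g = Zer C (X i) (X (Suc (Suc i)))}"
      using ker[OF s(2)[OF i'(3)] i] by simp
    then show "f (Suc i) \<cdot> f i = Zer C (Dom C (f i)) (Cod C (f (Suc i)))" by simp
    fix T y assume y: "y \<in> Hom C T (Dom C (f (Suc i)))" "f (Suc i) \<cdot> y = Zer C T (Cod C (f (Suc i)))"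
    have T: "T \<in> Obj C" using hom_obj y by blast
    obtain M e where M: "M \<in> \<M>" and e: "e \<in> Hom C M T" "is_epi C e" using gen T unfolding generating_def by blast
    have "X (Suc (Suc i)) \<in> Obj C" using Xo[of "Suc (Suc i)"] i by simp
    then have "y \<cdot> e \<in> {g \<in> Hom C M (X (Suc i)). f (Suc i) \<cdot> g = Zer C M (X (Suc (Suc i)))}"
      using y e comp_eq_ext[OF y(2), of e] T by simp
    then have "y \<cdot> e \<in> (\<lambda>g. f i \<cdot> g) ` Hom C M (X i)" unfolding ker[OF M i] .
    then obtain x where "x \<in> Hom C M (X i)" "f i \<cdot> x = y \<cdot> e" by (elim imageE) metis
    moreover have "Dom C (f i) = X i" by simp
    ultimately show "\<exists>T' e x. e \<in> Hom C T' T \<and> is_epi C e \<and> x \<in> Hom C T' (Dom C (f i)) \<and> f i \<cdot> x = y \<cdot> e"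
      using e by metis
  qed (use f[of i] f[of "Suc i"] i in auto)
  then show ?thesis unfolding dext_def exs_def using s mono epi by blast
qed

end

section \<open>Pushouts of higher extensions\<close>

context abelian_category
begin

text \<open>In the construction of pushouts of extensions the objects \<open>E\<close> arise by a universal property, whereas the
  approximations that are taken of them refer to cokernels.\<close>

lemma pushout_cokernel:
  assumes b: "is_biproduct C X F A i1 i2 p1 p2" and f: "f \<in> Hom C R X" and k: "k \<in> Hom C R F"
    and h: "h \<in> Hom C X E" and u: "u \<in> Hom C F E" and sq: "h \<cdot> f = u \<cdot> k"
    and univ: "\<forall>S x y. x \<in> Hom C X S \<and> y \<in> Hom C F S \<and> x \<cdot> f = y \<cdot> k \<longrightarrow> (\<exists>w \<in> Hom C E S. w \<cdot> h = x \<and> w \<cdot> u = y)"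
    and joint: "\<forall>S w w'. w \<in> Hom C E S \<and> w' \<in> Hom C E S \<and> w \<cdot> h = w' \<cdot> h \<and> w \<cdot> u = w' \<cdot> u \<longrightarrow> w = w'"
  obtains \<alpha> \<beta> where "\<alpha> \<in> Hom C R A" "\<beta> \<in> Hom C A E" "p1 \<cdot> \<alpha> = f" "p2 \<cdot> \<alpha> = neg k" "is_cokernel C \<alpha> \<beta>"
proof -
  note [simp] = biproductD(4-11)[OF b, simplified] biproductD(1-3)[OF b] f[simplified] k[simplified] h[simplified] u[simplified]
  have o: "R \<in> Obj C" "E \<in> Obj C" using hom_obj f h by blast+
  obtain \<alpha> where \<alpha>: "\<alpha> \<in> Hom C R A" "p1 \<cdot> \<alpha> = f" "p2 \<cdot> \<alpha> = neg k" "\<alpha> = (i1 \<cdot> f) \<boxplus> (i2 \<cdot> neg k)"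
    by (rule biproduct_pair[OF b, of f R "neg k"]) auto
  obtain \<beta> where \<beta>: "\<beta> \<in> Hom C A E" "\<beta> \<cdot> i1 = h" "\<beta> \<cdot> i2 = u" "\<beta> = (h \<cdot> p1) \<boxplus> (u \<cdot> p2)"
    by (rule biproduct_copair[OF b h u])
  note [simp] = \<alpha>(1)[simplified] \<beta>(1)[simplified]
  have "\<beta> \<cdot> \<alpha> = ((h \<cdot> p1) \<cdot> \<alpha>) \<boxplus> ((u \<cdot> p2) \<cdot> \<alpha>)" unfolding \<beta>(4) by (rule plus_comp) auto
  then have \<beta>\<alpha>: "\<beta> \<cdot> \<alpha> = Zer C R E" using \<alpha>(2,3) sq by simp
  have epi: "is_epi C \<beta>"
  proof (rule epi_zeroI)
    fix T z assume z: "z \<in> Hom C (Cod C \<beta>) T" "z \<cdot> \<beta> = Zer C (Dom C \<beta>) T"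
    note [simp] = z(1)[simplified]
    have T: "T \<in> Obj C" using hom_obj z by blast
    show "z = Zer C (Cod C \<beta>) T"
    proof (rule joint[rule_format], intro conjI)
      show "z \<cdot> h = Zer C (Cod C \<beta>) T \<cdot> h" using comp_eq_ext[OF z(2), of i1] \<beta>(2) T by simp
      show "z \<cdot> u = Zer C (Cod C \<beta>) T \<cdot> u" using comp_eq_ext[OF z(2), of i2] \<beta>(3) T by simp
    qed (use T o in auto)
  qed simp
  have "is_cokernel C \<alpha> \<beta>"
  proof (rule cokernelI[OF epi])
    fix T y assume y: "y \<in> Hom C (Cod C \<alpha>) T" "y \<cdot> \<alpha> = Zer C (Dom C \<alpha>) T"
    note [simp] = y(1)[simplified]
    have T: "T \<in> Obj C" using hom_obj y by blast
    have "y \<cdot> \<alpha> = (y \<cdot> (i1 \<cdot> f)) \<boxplus> (y \<cdot> (i2 \<cdot> neg k))" unfolding \<alpha>(4) by (rule comp_plus) auto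
    then have "(y \<cdot> i1) \<cdot> f = (y \<cdot> i2) \<cdot> k" using y(2) eq_iff_minus[of "y \<cdot> (i1 \<cdot> f)" "y \<cdot> (i2 \<cdot> k)"] by simp
    then have "\<exists>w \<in> Hom C E T. w \<cdot> h = y \<cdot> i1 \<and> w \<cdot> u = y \<cdot> i2" by (intro univ[rule_format] conjI) simp_all
    then obtain w where w: "w \<in> Hom C E T" "w \<cdot> h = y \<cdot> i1" "w \<cdot> u = y \<cdot> i2" by blast
    note [simp] = w(1)[simplified]
    have "w \<cdot> \<beta> = y" by (rule biproduct_co_eqI[OF b, of _ T]) (use w \<beta> in auto)
    then show "\<exists>x \<in> Hom C (Cod C \<beta>) T. x \<cdot> \<beta> = y" using w(1) by auto
  qed (use \<beta>\<alpha> in auto)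
  then show ?thesis using that \<alpha> \<beta> by blast
qed

end

context tilting
begin

definition coker_into :: "'a set \<Rightarrow> 'a \<Rightarrow> bool"
  where "coker_into \<V> R \<longleftrightarrow> (\<exists>\<alpha> q. Dom C \<alpha> \<in> \<M> \<and> Cod C \<alpha> \<in> \<V> \<and> is_cokernel C \<alpha> q \<and> Cod C q = R)"

text \<open>The construction of pushouts stays inside \<open>\<V>\<close> under these conditions. They hold for \<open>\<V> = \<M>\<close>, and for a
  subcategory that is closed under \<open>d\<close>-quotients. The approximating object \<open>F\<close> lies in \<open>\<V>\<close>, but the morphisms
  that factor through it go to all of \<open>\<M>\<close>.\<close>

definition pushable :: "'a set \<Rightarrow> bool"
  where "pushable \<V> \<longleftrightarrow> \<V> \<subseteq> \<M> \<and> (\<forall>A \<in> \<V>. \<forall>B \<in> \<V>. \<forall>P. is_direct_sum C A B P \<longrightarrow> P \<in> \<V>) \<and>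
    (\<forall>R. coker_into \<V> R \<longrightarrow> (\<exists>F \<in> \<V>. \<exists>r \<in> Hom C R F. \<forall>N \<in> \<M>. \<forall>y \<in> Hom C R N. \<exists>z \<in> Hom C F N. z \<cdot> r = y)) \<and>
    (\<forall>R \<in> \<M>. coker_into \<V> R \<longrightarrow> R \<in> \<V>)"

text \<open>The vanishing that characterizes \<open>R \<in> \<M>\<close>, truncated: for \<open>m \<le> 1\<close> it holds for every \<open>R\<close>, and for \<open>m = d\<close> it says
  that \<open>R \<in> \<M>\<close>.\<close>

definition level :: "nat \<Rightarrow> 'a \<Rightarrow> bool"
  where "level m R \<longleftrightarrow> (\<forall>l B. csz C \<M> \<M> l B \<longrightarrow> l + 2 \<le> m \<longrightarrow> ext1_zero C R B)"

lemma pushable_M: "pushable \<M>"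
proof -
  have "\<exists>F \<in> \<M>. \<exists>r \<in> Hom C R F. \<forall>N \<in> \<M>. \<forall>y \<in> Hom C R N. \<exists>z \<in> Hom C F N. z \<cdot> r = y" if R: "coker_into \<M> R" for R
  proof -
    have "R \<in> Obj C" using R cokernelD(2) unfolding coker_into_def by (metis dom_cod_obj(2))
    then obtain r where "left_approximation C \<M> R r" using left_approx by blast
    then show ?thesis unfolding left_approximation_def by metis
  qed
  then show ?thesis unfolding pushable_def using M_sum by blast
qed

text \<open>Dimension shifting for \<open>0 \<rightarrow> R \<rightarrow> A \<rightarrow> E \<rightarrow> 0\<close>: a morphism from \<open>R\<close> to a cosyzygy \<open>B\<close> lifts, by the condition on
  \<open>R\<close>, to the object of \<open>\<M>\<close> of which \<open>B\<close> is a quotient, and from there it extends to \<open>A\<close>.\<close>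

lemma level_step:
  assumes s: "ses C \<alpha> \<beta>" and A: "Dom C \<beta> \<in> \<M>" and R: "level m (Dom C \<alpha>)" and m: "m < d"
    and x: "\<And>N a. N \<in> \<M> \<Longrightarrow> a \<in> Hom C (Dom C \<alpha>) N \<Longrightarrow> \<exists>a' \<in> Hom C (Dom C \<beta>) N. a' \<cdot> \<alpha> = a"
  shows "level (Suc m) (Cod C \<beta>)"
  unfolding level_def
proof (intro allI impI)
  fix l B assume B: "csz C \<M> \<M> l B" and l: "l + 2 \<le> Suc m"
  show "ext1_zero C (Cod C \<beta>) B"
  proof (rule ext1_of_extension[OF s])
    show "ext1_zero C (Dom C \<beta>) B" using cosyzygy[OF A B] l m by simp
    fix a assume a: "a \<in> Hom C (Dom C \<alpha>) B"
    from B show "\<exists>a' \<in> Hom C (Dom C \<beta>) B. a' \<cdot> \<alpha> = a"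
    proof cases
      case base
      then show ?thesis using x a by blast
    next
      case (step l' j q)
      note [simp] = sesD(1-4)[OF step(4)]
      have "ext1_zero C (Dom C \<alpha>) (Dom C j)" using R step l unfolding level_def by simp
      then obtain b where b: "b \<in> Hom C (Dom C \<alpha>) (Dom C q)" "q \<cdot> b = a"
        using ext1_lift[OF _ step(4), of "Dom C \<alpha>" a] a step by blast
      obtain b' where b': "b' \<in> Hom C (Dom C \<beta>) (Dom C q)" "b' \<cdot> \<alpha> = b"
        proof -
        have "Dom C q \<in> \<M>" using step(5) by simp
        then show ?thesis using x b(1) that by blast
      qed
      have "(q \<cdot> b') \<cdot> \<alpha> = a" using b b' sesD[OF s] by simp
      then show ?thesis using b' step by (intro bexI[of _ "q \<cdot> b'"]) auto
    qed
  qed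
qed

text \<open>The inner terms of an extension can be moved into \<open>\<V>\<close> by taking left approximations of one after
  the other. Each step replaces \<open>X\<^sub>2\<close> by the pushout \<open>E\<close> of \<open>X\<^sub>1 \<rightarrow> X\<^sub>2\<close> along the approximation \<open>X\<^sub>1 \<rightarrow> F\<close>. It satisfies the
  vanishing that characterizes \<open>\<M>\<close> in one more degree than \<open>X\<^sub>1\<close>, because it is the cokernel of a morphism
  from \<open>X\<^sub>1\<close> to an object of \<open>\<V>\<close> through which all morphisms to \<open>\<M>\<close> factor. At the last inner term the
  vanishing is complete, and the term lies in \<open>\<M>\<close> by itself.\<close>

lemma embed_approximations:
  assumes V: "pushable \<V>"
  shows "exs C (Suc n) X f \<Longrightarrow> level m (X 1) \<Longrightarrow> m + n = d \<Longrightarrow> coker_into \<V> (X 1) \<Longrightarrow> (\<And>i. 2 \<le> i \<Longrightarrow> i \<le> Suc n \<Longrightarrow> X i \<in> \<V>) \<Longrightarrow>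
    \<exists>Y g \<theta>. exs C (Suc n) Y g \<and> Y 0 = X 0 \<and> Y (Suc (Suc n)) = X (Suc (Suc n)) \<and> cmap C (Suc n) X f Y g \<theta> \<and>
      \<theta> 0 = Ident C (X 0) \<and> \<theta> (Suc (Suc n)) = Ident C (X (Suc (Suc n))) \<and> (\<forall>i. 1 \<le> i \<and> i \<le> Suc n \<longrightarrow> Y i \<in> \<V>)"
proof (induction n arbitrary: X f m)
  case 0
  note X = 0(1)
  have "X 1 \<in> \<M>" by (rule M_left) (use exsD(1)[OF X, of 1] 0(2,3) in \<open>auto simp: level_def\<close>)
  then have "X 1 \<in> \<V>" using V 0(4) unfolding pushable_def by blast
  moreover have "cmap C (Suc 0) X f X f (\<lambda>i. Ident C (X i))"
    unfolding cmap_def using exsD(1,2)[OF X] by simp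
  ultimately show ?case using X
    by (intro exI[of _ X] exI[of _ f] exI[of _ "\<lambda>i. Ident C (X i)"]) (auto simp: le_Suc_eq)
next
  case (Suc n)
  note X = Suc.prems(1)
  have VM: "\<V> \<subseteq> \<M>" using V unfolding pushable_def by blast
  have X1: "X 1 \<in> Obj C" and X0: "X 0 \<in> Obj C" using exsD(1)[OF X] by simp_all
  have X2: "X 2 \<in> \<V>" using Suc.prems(5)[of 2] by simp
  have f1: "f 1 \<in> Hom C (X 1) (X 2)" using exsD(2)[OF X, of 1] by (simp add: numeral_2_eq_2)
  have f0: "f 0 \<in> Hom C (X 0) (X 1)" using exsD(2)[OF X, of 0] by simp
  have f10: "f 1 \<cdot> f 0 = Zer C (X 0) (X 2)" using exsD(6)[OF X, of 0] by (simp add: numeral_2_eq_2)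
  obtain F r where F: "F \<in> \<V>" and r: "r \<in> Hom C (X 1) F"
    and ap: "\<And>N y. N \<in> \<M> \<Longrightarrow> y \<in> Hom C (X 1) N \<Longrightarrow> \<exists>z \<in> Hom C F N. z \<cdot> r = y"
    using V Suc.prems(4) unfolding pushable_def by blast
  note [simp] = f1[simplified] f0[simplified] r[simplified]
  have mono: "is_mono C r"
  proof -
    obtain N j where N: "N \<in> \<M>" "j \<in> Hom C (X 1) N" "is_mono C j" using cogen X1 unfolding cogenerating_def by blast
    then obtain z where z: "z \<in> Hom C F N" "z \<cdot> r = j" using ap by blast
    show ?thesis by (rule mono_of_comp[of z]) (use N z in auto)
  qed
  obtain B q E u h z where q: "ses C (r \<cdot> f 0) q" "Dom C q = F" "Cod C q = B"
    and Z: "exs C (Suc n) (glue B E (\<lambda>i. X (Suc (Suc i)))) z"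
    and h: "h \<in> Hom C (X 2) E" and u: "u \<in> Hom C B E" and sq: "h \<cdot> f 1 = u \<cdot> (q \<cdot> r)"
    and univ: "\<forall>S b c. b \<in> Hom C (X 2) S \<and> c \<in> Hom C B S \<and> b \<cdot> f 1 = c \<cdot> (q \<cdot> r) \<longrightarrow> (\<exists>w \<in> Hom C E S. w \<cdot> h = b \<and> w \<cdot> u = c)"
    and joint: "\<forall>S w w'. w \<in> Hom C E S \<and> w' \<in> Hom C E S \<and> w \<cdot> h = w' \<cdot> h \<and> w \<cdot> u = w' \<cdot> u \<longrightarrow> w = w'"
    and lift: "\<forall>Y g \<theta>. exs C (Suc n) Y g \<and> Y 0 = B \<and> cmap C (Suc n) (glue B E (\<lambda>i. X (Suc (Suc i)))) z Y g \<theta> \<and> \<theta> 0 = Ident C B \<longrightarrow>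
      exs C (Suc (Suc n)) (glue (X 0) F Y) (glue (r \<cdot> f 0) (g 0 \<cdot> q) g) \<and>
      cmap C (Suc (Suc n)) X f (glue (X 0) F Y) (glue (r \<cdot> f 0) (g 0 \<cdot> q) g)
        (glue (Ident C (X 0)) r (\<lambda>i. if i = 1 then \<theta> 1 \<cdot> h else \<theta> i))"
    by (rule embed_step[OF X r mono])
  note [simp] = q(2,3) sesD(2)[OF q(1)] h[simplified] u[simplified]
  let ?Z = "glue B E (\<lambda>i. X (Suc (Suc i)))"
  have uq: "u \<cdot> q \<in> Hom C F E" by simp
  \<comment> \<open>\<open>E\<close> is the pushout of \<open>X\<^sub>2\<close> and \<open>B = F / X\<^sub>0\<close> under \<open>X\<^sub>1 / X\<^sub>0\<close>, and therefore also that of \<open>X\<^sub>2\<close> and \<open>F\<close> under \<open>X\<^sub>1\<close>\<close>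
  have sq': "h \<cdot> f 1 = (u \<cdot> q) \<cdot> r" using sq by simp
  have univ': "\<forall>S x y. x \<in> Hom C (X 2) S \<and> y \<in> Hom C F S \<and> x \<cdot> f 1 = y \<cdot> r \<longrightarrow> (\<exists>w \<in> Hom C E S. w \<cdot> h = x \<and> w \<cdot> (u \<cdot> q) = y)"
  proof (intro allI impI, elim conjE)
    fix S x y assume a: "x \<in> Hom C (X 2) S" "y \<in> Hom C F S" "x \<cdot> f 1 = y \<cdot> r"
    note [simp] = a(1,2)[simplified]
    have S: "S \<in> Obj C" using hom_obj a by blast
    have "y \<cdot> (r \<cdot> f 0) = x \<cdot> (f 1 \<cdot> f 0)" using comp_eq_ext[OF a(3)[symmetric], of "f 0"] by simp
    then have "y \<cdot> (r \<cdot> f 0) = Zer C (X 0) S" using f10 X0 by simp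
    then obtain c where c: "c \<in> Hom C B S" "c \<cdot> q = y" using ses_desc[OF q(1), of y S] by auto
    note [simp] = c(1)[simplified]
    have "x \<cdot> f 1 = c \<cdot> (q \<cdot> r)" using a(3) comp_eq_ext[OF c(2), of r] by simp
    then obtain w where w: "w \<in> Hom C E S" "w \<cdot> h = x" "w \<cdot> u = c" using univ a(1) c(1) by blast
    then have "w \<cdot> (u \<cdot> q) = y" using comp_eq_ext[OF w(3), of q] c(2) by simp
    then show "\<exists>w \<in> Hom C E S. w \<cdot> h = x \<and> w \<cdot> (u \<cdot> q) = y" using w by blast
  qed
  have joint': "\<forall>S w w'. w \<in> Hom C E S \<and> w' \<in> Hom C E S \<and> w \<cdot> h = w' \<cdot> h \<and> w \<cdot> (u \<cdot> q) = w' \<cdot> (u \<cdot> q) \<longrightarrow> w = w'"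
  proof (intro allI impI, elim conjE)
    fix S w w' assume a: "w \<in> Hom C E S" "w' \<in> Hom C E S" "w \<cdot> h = w' \<cdot> h" "w \<cdot> (u \<cdot> q) = w' \<cdot> (u \<cdot> q)"
    have "(w \<cdot> u) \<cdot> q = (w' \<cdot> u) \<cdot> q" using a by simp
    then have "w \<cdot> u = w' \<cdot> u" by (rule epi_cancel[OF sesD(6)[OF q(1)]]) (use a in auto)
    then show "w = w'" using joint a by blast
  qed
  have "X 2 \<in> Obj C" "F \<in> Obj C" using hom_obj f1 r by blast+
  then obtain A i1 i2 p1 p2 where b: "is_biproduct C (X 2) F A i1 i2 p1 p2" by (rule ex_biproduct)
  note [simp] = biproductD(4-11)[OF b, simplified] biproductD(1-3)[OF b]
  have AV: "A \<in> \<V>" using V X2 F b unfolding pushable_def is_direct_sum_def by blast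
  obtain \<alpha> \<beta> where \<alpha>: "\<alpha> \<in> Hom C (X 1) A" "\<beta> \<in> Hom C A E" "p1 \<cdot> \<alpha> = f 1" "p2 \<cdot> \<alpha> = neg r" "is_cokernel C \<alpha> \<beta>"
    by (rule pushout_cokernel[OF b f1 r h uq sq' univ' joint'])
  note [simp] = \<alpha>(1,2)[simplified]
  have "is_mono C \<alpha>"
  proof (rule mono_zeroI)
    fix T x assume x: "x \<in> Hom C T (Dom C \<alpha>)" "\<alpha> \<cdot> x = Zer C T (Cod C \<alpha>)"
    have T: "T \<in> Obj C" using hom_obj x by blast
    have "neg r \<cdot> x = Zer C T F" using comp_eq_ext[OF \<alpha>(4), of x] x T by simp
    then have "neg (neg (r \<cdot> x)) = neg (Zer C T F)" using x by simp
    then have "r \<cdot> x = Zer C T F" using x T by simp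
    then show "x = Zer C T (Dom C \<alpha>)" using mono_zeroD[OF mono, of x T] x by simp
  qed simp
  then have s: "ses C \<alpha> \<beta>" using mono_cokernel_ses \<alpha>(5) by blast
  have lev: "level (Suc m) (Cod C \<beta>)"
  proof (rule level_step[OF s])
    show "level m (Dom C \<alpha>)" using Suc.prems(2) by simp
    show "m < d" using Suc.prems(3) by simp
    show "Dom C \<beta> \<in> \<M>" using AV VM by auto
    fix N a assume N: "N \<in> \<M>" and a: "a \<in> Hom C (Dom C \<alpha>) N"
    have "a \<in> Hom C (X 1) N" using a by simp
    then obtain t where t: "t \<in> Hom C F N" "t \<cdot> r = a" using ap[OF N] by blast
    have "(neg t \<cdot> p2) \<cdot> \<alpha> = a" using t \<alpha>(4) a by simp
    then show "\<exists>a' \<in> Hom C (Dom C \<beta>) N. a' \<cdot> \<alpha> = a" using t by (intro bexI[of _ "neg t \<cdot> p2"]) auto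
  qed
  \<comment> \<open>precompose with a cokernel map \<open>c\<close> onto \<open>X\<^sub>1\<close> to obtain a morphism that starts in \<open>\<M>\<close>\<close>
  have coker_E: "coker_into \<V> (Cod C \<beta>)"
  proof -
    obtain \<gamma> c where c: "Dom C \<gamma> \<in> \<M>" "Cod C \<gamma> \<in> \<V>" "is_cokernel C \<gamma> c" "Cod C c = X 1"
      using Suc.prems(4) unfolding coker_into_def by blast
    note [simp] = cokernelD(1-3)[OF c(3)] c(4)
    have epi: "is_epi C c" using cokernelD(5)[OF c(3)] .
    have "is_cokernel C (\<alpha> \<cdot> c) \<beta>"
    proof (rule cokernelI)
      show "is_epi C \<beta>" using sesD(6)[OF s] .
      show "\<beta> \<cdot> (\<alpha> \<cdot> c) = Zer C (Dom C (\<alpha> \<cdot> c)) (Cod C \<beta>)"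
        using comp_eq_ext[OF sesD(4)[OF s], of c] hom_obj[OF h] by simp
      fix T y assume y: "y \<in> Hom C (Cod C (\<alpha> \<cdot> c)) T" "y \<cdot> (\<alpha> \<cdot> c) = Zer C (Dom C (\<alpha> \<cdot> c)) T"
      then have "y \<cdot> \<alpha> = Zer C (Dom C \<alpha>) T" using epi_zeroD[OF epi, of "y \<cdot> \<alpha>" T] by simp
      moreover have "y \<in> Hom C (Cod C \<alpha>) T" using y(1) by simp
      ultimately show "\<exists>x \<in> Hom C (Cod C \<beta>) T. x \<cdot> \<beta> = y" using ses_desc[OF s] by blast
    qed simp_all
    then show ?thesis unfolding coker_into_def using c(1,2) VM AV
      by (intro exI[of _ "\<alpha> \<cdot> c"] exI[of _ \<beta>]) auto
  qed
  have "\<exists>Y g \<theta>. exs C (Suc n) Y g \<and> Y 0 = ?Z 0 \<and> Y (Suc (Suc n)) = ?Z (Suc (Suc n)) \<and> cmap C (Suc n) ?Z z Y g \<theta> \<and>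
      \<theta> 0 = Ident C (?Z 0) \<and> \<theta> (Suc (Suc n)) = Ident C (?Z (Suc (Suc n))) \<and> (\<forall>i. 1 \<le> i \<and> i \<le> Suc n \<longrightarrow> Y i \<in> \<V>)"
  proof (rule Suc.IH[OF Z])
    show "level (Suc m) (?Z 1)" using lev by simp
    show "Suc m + n = d" using Suc.prems(3) by simp
    show "coker_into \<V> (?Z 1)" using coker_E by simp
    show "?Z i \<in> \<V>" if "2 \<le> i" "i \<le> Suc n" for i
      using Suc.prems(5)[of "Suc i"] that by (auto simp: glue_def split: nat.split)
  qed
  then obtain Y g \<theta> where Y: "exs C (Suc n) Y g" "Y 0 = B" "Y (Suc (Suc n)) = X (Suc (Suc (Suc n)))" "cmap C (Suc n) ?Z z Y g \<theta>"
    "\<theta> 0 = Ident C B" "\<theta> (Suc (Suc n)) = Ident C (X (Suc (Suc (Suc n))))" "\<And>i. 1 \<le> i \<Longrightarrow> i \<le> Suc n \<Longrightarrow> Y i \<in> \<V>" by auto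
  have "exs C (Suc (Suc n)) (glue (X 0) F Y) (glue (r \<cdot> f 0) (g 0 \<cdot> q) g) \<and>
      cmap C (Suc (Suc n)) X f (glue (X 0) F Y) (glue (r \<cdot> f 0) (g 0 \<cdot> q) g)
        (glue (Ident C (X 0)) r (\<lambda>i. if i = 1 then \<theta> 1 \<cdot> h else \<theta> i))"
    using lift Y(1,2,4,5) by blast
  moreover have "glue (X 0) F Y i \<in> \<V>" if "1 \<le> i" "i \<le> Suc (Suc n)" for i
    using Y(7)[of "i - 1"] F that by (auto simp: glue_def split: nat.split)
  ultimately show ?case using Y(3,6)
    by (intro exI[of _ "glue (X 0) F Y"] exI[of _ "glue (r \<cdot> f 0) (g 0 \<cdot> q) g"]
        exI[of _ "glue (Ident C (X 0)) r (\<lambda>i. if i = 1 then \<theta> 1 \<cdot> h else \<theta> i)"]) simp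
qed

text \<open>The pushout \<open>E\<close> of \<open>X\<^sub>1\<close> and \<open>N\<close> under \<open>X\<^sub>0\<close> is the cokernel of a morphism from \<open>X\<^sub>0 \<in> \<M>\<close> to \<open>X\<^sub>1 \<oplus> N \<in> \<V>\<close> and need not lie in \<open>\<M>\<close>; the
  approximations of \<open>embed_approximations\<close> repair this at the expense of the later terms.\<close>

lemma dext_pushout:
  assumes V: "pushable \<V>" and X: "dext X f" "\<And>i. 1 \<le> i \<Longrightarrow> i \<le> d \<Longrightarrow> X i \<in> \<V>" and a: "a \<in> Hom C (X 0) N" and N: "N \<in> \<V>"
  obtains Y g \<theta> where "dext Y g" "Y 0 = N" "Y (Suc d) = X (Suc d)" "\<And>i. i \<le> d \<Longrightarrow> Y i \<in> \<V>" "cmap C d X f Y g \<theta>"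
    "\<theta> 0 = a" "\<theta> (Suc d) = Ident C (X (Suc d))"
proof -
  have VM: "\<V> \<subseteq> \<M>" using V unfolding pushable_def by blast
  obtain n where n: "d = Suc n" using d by (cases d) auto
  have Xe: "exs C (Suc n) X f" using X(1) n unfolding dext_def by simp
  have Xo: "\<And>i. i \<le> Suc d \<Longrightarrow> X i \<in> Obj C" using dextD(3)[OF X(1)] .
  have f0: "f 0 \<in> Hom C (X 0) (X 1)" using dextD(4)[OF X(1), of 0] by simp
  have No: "N \<in> Obj C" using hom_obj a by blast
  obtain E u v h where E: "exs C (Suc n) (glue N E (\<lambda>i. X (Suc i))) (glue u v (\<lambda>i. f (Suc i)))"
    "u \<in> Hom C N E" "v \<in> Hom C E (X 2)" "h \<in> Hom C (X 1) E" "h \<cdot> f 0 = u \<cdot> a" "v \<cdot> h = f 1" "v \<cdot> u = Zer C N (X 2)"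
    "\<forall>S b d. b \<in> Hom C (X 1) S \<and> d \<in> Hom C N S \<and> b \<cdot> f 0 = d \<cdot> a \<longrightarrow> (\<exists>w \<in> Hom C E S. w \<cdot> h = b \<and> w \<cdot> u = d)"
    "\<forall>S w w'. w \<in> Hom C E S \<and> w' \<in> Hom C E S \<and> w \<cdot> h = w' \<cdot> h \<and> w \<cdot> u = w' \<cdot> u \<longrightarrow> w = w'"
    by (rule exs_pushout[OF Xe a])
  let ?X = "glue N E (\<lambda>i. X (Suc i))" and ?f = "glue u v (\<lambda>i. f (Suc i))"
  have X1: "X 1 \<in> \<V>" using X(2)[of 1] n by simp
  have "X 1 \<in> Obj C" using Xo n by simp
  then obtain A i1 i2 p1 p2 where b: "is_biproduct C (X 1) N A i1 i2 p1 p2" by (rule ex_biproduct[OF _ No])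
  obtain \<alpha> \<beta> where \<alpha>: "\<alpha> \<in> Hom C (X 0) A" "\<beta> \<in> Hom C A E" "is_cokernel C \<alpha> \<beta>"
    by (rule pushout_cokernel[OF b f0 a E(4,2,5,8,9)])
  have "A \<in> \<V>" using V X1 N b unfolding pushable_def is_direct_sum_def by blast
  moreover have "X 0 \<in> \<M>" using dextD(2)[OF X(1), of 0] by simp
  ultimately have coker_into: "coker_into \<V> E" unfolding coker_into_def using \<alpha> by (intro exI[of _ \<alpha>] exI[of _ \<beta>]) simp
  have "\<exists>Y g \<theta>. exs C (Suc n) Y g \<and> Y 0 = ?X 0 \<and> Y (Suc (Suc n)) = ?X (Suc (Suc n)) \<and> cmap C (Suc n) ?X ?f Y g \<theta> \<and>
      \<theta> 0 = Ident C (?X 0) \<and> \<theta> (Suc (Suc n)) = Ident C (?X (Suc (Suc n))) \<and> (\<forall>i. 1 \<le> i \<and> i \<le> Suc n \<longrightarrow> Y i \<in> \<V>)"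
  proof (rule embed_approximations[OF V E(1)])
    show "level 1 (?X 1)" by (simp add: level_def)
    show "?X i \<in> \<V>" if "2 \<le> i" "i \<le> Suc n" for i
      using X(2)[of i] that n by (auto simp: glue_def split: nat.split)
  qed (use n coker_into in auto)
  then obtain Y g \<psi> where Y: "exs C d Y g" "Y 0 = N" "Y (Suc d) = X (Suc d)" "cmap C d ?X ?f Y g \<psi>"
    "\<psi> 0 = Ident C N" "\<psi> (Suc d) = Ident C (X (Suc d))" "\<And>i. 1 \<le> i \<Longrightarrow> i \<le> d \<Longrightarrow> Y i \<in> \<V>" using n by auto
  let ?t = "glue a h (\<lambda>i. Ident C (X (Suc i)))"
  have t: "cmap C d X f ?X ?f ?t"
    unfolding cmap_def
  proof (intro conjI allI impI)
    fix i show "i \<le> Suc d \<Longrightarrow> ?t i \<in> Hom C (X i) (?X i)"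
      using a E(4) Xo[of i] by (auto simp: glue_def split: nat.split)
    assume i: "i \<le> d"
    show "?t (Suc i) \<cdot> f i = ?f i \<cdot> ?t i"
      using E(3,5,6) dextD(4)[OF X(1) i] by (auto simp: glue_def numeral_2_eq_2 split: nat.split)
  qed
  have YV: "Y i \<in> \<V>" if "i \<le> d" for i using Y(2) Y(7)[of i] N that by (cases i) auto
  have YM: "Y i \<in> \<M>" if "i \<le> Suc d" for i
    using YV[of i] VM Y(3) dextD(2)[OF X(1), of "Suc d"] that by (cases "i = Suc d") auto
  have dY: "dext Y g" unfolding dext_def using Y(1) YM by blast
  have E1: "exs C d ?X ?f" using E(1) n by simp
  have "cmap C d X f Y g (\<lambda>i. \<psi> i \<cdot> ?t i)"
    by (rule cmap_comp[OF exs_sequ[OF dextD(1)[OF X(1)]] exs_sequ[OF E1] exs_sequ[OF Y(1)] t Y(4)])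
  moreover have "\<psi> 0 \<cdot> ?t 0 = a" using Y(5) a by simp
  moreover have "\<psi> (Suc d) \<cdot> ?t (Suc d) = Ident C (X (Suc d))" using Y(6) n Xo[of "Suc d"] by simp
  ultimately show ?thesis using that[OF dY Y(2,3) YV] by blast
qed

end

section \<open>Comparison of higher extensions\<close>

lemma cmap_revs:
  assumes "cmap C n X f Y g \<phi>"
  shows "cmap (op_cat C) n (revs (Suc n) Y) (revs n g) (revs (Suc n) X) (revs n f) (revs (Suc n) \<phi>)"
  unfolding cmap_def
proof (intro conjI allI impI)
  fix i
  show "i \<le> Suc n \<Longrightarrow> revs (Suc n) \<phi> i \<in> Hom (op_cat C) (revs (Suc n) Y i) (revs (Suc n) X i)"
    using cmapD(1)[OF assms, of "Suc n - i"] by (simp add: revs_def op_hom)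
  assume "i \<le> n"
  then show "Comp (op_cat C) (revs (Suc n) \<phi> (Suc i)) (revs n g i) = Comp (op_cat C) (revs n f i) (revs (Suc n) \<phi> i)"
    using cmapD(2)[OF assms, of "n - i"] by (simp add: revs_def Suc_diff_le)
qed

lemma cmap_op_revs:
  assumes "cmap (op_cat C) n (revs (Suc n) X) (revs n f) Y g \<phi>"
  shows "cmap C n (revs (Suc n) Y) (revs n g) X f (revs (Suc n) \<phi>)"
  unfolding cmap_def
proof (intro conjI allI impI)
  fix i
  show "i \<le> Suc n \<Longrightarrow> revs (Suc n) \<phi> i \<in> Hom C (revs (Suc n) Y i) (X i)"
    using cmapD(1)[OF assms, of "Suc n - i"] by (simp add: revs_def op_hom)
  assume "i \<le> n"
  then show "Comp C (revs (Suc n) \<phi> (Suc i)) (revs n g i) = Comp C (f i) (revs (Suc n) \<phi> i)"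
    using cmapD(2)[OF assms, of "n - i"] by (simp add: revs_def Suc_diff_le)
qed

lemma (in preadditive_category) cmap_minus:
  assumes s: "is_sequ C n X f" "is_sequ C n Y g" and c: "cmap C n X f Y g \<phi>" "cmap C n X f Y g \<psi>"
  shows "cmap C n X f Y g (\<lambda>i. \<phi> i \<boxplus> neg (\<psi> i))"
  unfolding cmap_def
proof (intro conjI allI impI)
  fix i show "i \<le> Suc n \<Longrightarrow> \<phi> i \<boxplus> neg (\<psi> i) \<in> Hom C (X i) (Y i)"
    using cmapD(1)[OF c(1), of i] cmapD(1)[OF c(2), of i] by simp
  assume i: "i \<le> n"
  then have i': "i \<le> Suc n" "Suc i \<le> Suc n" by auto
  note [simp] = is_sequD(2)[OF s(1) i, simplified] is_sequD(2)[OF s(2) i, simplified]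
    cmapD(1)[OF c(1) i'(1), simplified] cmapD(1)[OF c(2) i'(1), simplified] cmapD(1)[OF c(1) i'(2), simplified]
    cmapD(1)[OF c(2) i'(2), simplified]
  have "(\<phi> (Suc i) \<boxplus> neg (\<psi> (Suc i))) \<cdot> f i = (\<phi> (Suc i) \<cdot> f i) \<boxplus> neg (\<psi> (Suc i) \<cdot> f i)"
    by (subst plus_comp) auto
  also have "\<dots> = (g i \<cdot> \<phi> i) \<boxplus> neg (g i \<cdot> \<psi> i)" using cmapD(2)[OF c(1) i] cmapD(2)[OF c(2) i] by simp
  also have "\<dots> = g i \<cdot> (\<phi> i \<boxplus> neg (\<psi> i))" by (subst comp_plus) auto
  finally show "(\<phi> (Suc i) \<boxplus> neg (\<psi> (Suc i))) \<cdot> f i = g i \<cdot> (\<phi> i \<boxplus> neg (\<psi> i))" .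
qed

context tilting
begin

lemma dext_sequ: "dext X f \<Longrightarrow> is_sequ C d X f"
  using exs_sequ dextD(1) by blast

lemma dext_pullback:
  assumes X: "dext X f" and a: "a \<in> Hom C N (X (Suc d))" and N: "N \<in> \<M>"
  obtains Y g \<theta> where "dext Y g" "Y 0 = X 0" "Y (Suc d) = N" "cmap C d Y g X f \<theta>"
    "\<theta> (Suc d) = a" "\<theta> 0 = Ident C (X 0)"
proof -
  have a': "a \<in> Hom (op_cat C) (revs (Suc d) X 0) N" using a by (simp add: revs_def)
  have XM: "\<And>i. 1 \<le> i \<Longrightarrow> i \<le> d \<Longrightarrow> revs (Suc d) X i \<in> \<M>" using dextD(2)[OF X] by (simp add: revs_def)
  obtain Y g \<theta> where Y: "tilting.dext (op_cat C) \<M> d Y g" "Y 0 = N" "Y (Suc d) = revs (Suc d) X (Suc d)"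
    "cmap (op_cat C) d (revs (Suc d) X) (revs d f) Y g \<theta>" "\<theta> 0 = a" "\<theta> (Suc d) = Ident (op_cat C) (revs (Suc d) X (Suc d))"
    by (rule tilting.dext_pushout[OF op_tilting tilting.pushable_M[OF op_tilting] dext_op[OF X] XM a' N]) blast+
  show ?thesis
    by (rule that[OF dext_op'[OF Y(1)] _ _ cmap_op_revs[OF Y(4)]]) (use Y in \<open>simp_all add: revs_def\<close>)
qed

text \<open>A morphism of extensions factors at the left end iff it factors at the right end: both mean that the
  pushout class along \<open>\<theta> 0\<close>, which is the pullback class along \<open>\<theta> (d + 1)\<close>, vanishes. The factorization \<open>b\<close> is the
  start of a null homotopy, which is continued to the right since \<open>\<theta> (i + 1) - k i \<cdot> h\<close> kills \<open>g i\<close>.\<close>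

lemma factor_right:
  assumes G: "dext G g" and K: "dext K k" and c: "cmap C d G g K k \<theta>"
    and b: "b \<in> Hom C (G 1) (K 0)" "\<theta> 0 = b \<cdot> g 0"
  obtains h where "h \<in> Hom C (G (Suc d)) (K d)" "\<theta> (Suc d) = k d \<cdot> h"
proof -
  have "\<exists>h \<in> Hom C (G (Suc i)) (K i). \<theta> (Suc i) \<cdot> g i = k i \<cdot> (h \<cdot> g i)" if "i \<le> d" for i
    using that
  proof (induction i)
    case 0
    then show ?case using b cmapD(2)[OF c, of 0] by (intro bexI[of _ b]) auto
  next
    case (Suc i)
    then have i: "i < d" "i \<le> d" "Suc i \<le> d" "Suc i \<le> Suc d" "Suc (Suc i) \<le> Suc d" by auto
    obtain h where h: "h \<in> Hom C (G (Suc i)) (K i)" "\<theta> (Suc i) \<cdot> g i = k i \<cdot> (h \<cdot> g i)" using Suc i by blast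
    note [simp] = h(1)[simplified] dextD(4)[OF G i(2), simplified] dextD(4)[OF G i(3), simplified] dextD(4)[OF K i(2), simplified]
      dextD(4)[OF K i(3), simplified] cmapD(1)[OF c i(4), simplified] cmapD(1)[OF c i(5), simplified]
      dextD(3)[OF K i(4)] dextD(3)[OF K i(5)]
    let ?y = "\<theta> (Suc i) \<boxplus> neg (k i \<cdot> h)"
    have "?y \<cdot> g i = (\<theta> (Suc i) \<cdot> g i) \<boxplus> (neg (k i \<cdot> h) \<cdot> g i)" by (rule plus_comp) auto
    then have "?y \<cdot> g i = Zer C (G i) (K (Suc i))" using h(2) by simp
    moreover have "?y \<in> Hom C (G (Suc i)) (K (Suc i))" by simp
    ultimately obtain h' where h': "h' \<in> Hom C (G (Suc (Suc i))) (K (Suc i))" "h' \<cdot> g (Suc i) = ?y"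
      using dext_extend[OF G dextD(2)[OF K i(4)] i(1)] by blast
    have "k (Suc i) \<cdot> (h' \<cdot> g (Suc i)) = (k (Suc i) \<cdot> \<theta> (Suc i)) \<boxplus> (k (Suc i) \<cdot> neg (k i \<cdot> h))"
      unfolding h'(2) by (rule comp_plus) auto
    also have "k (Suc i) \<cdot> neg (k i \<cdot> h) = Zer C (G (Suc i)) (K (Suc (Suc i)))"
      using comp_eq_ext[OF dextD(7)[OF K i(1)], of h] dextD(3)[OF G i(4)] by simp
    finally have "\<theta> (Suc (Suc i)) \<cdot> g (Suc i) = k (Suc i) \<cdot> (h' \<cdot> g (Suc i))"
      using cmapD(2)[OF c i(3)] by simp
    then show ?case using h'(1) by blast
  qed
  then obtain h where h: "h \<in> Hom C (G (Suc d)) (K d)" "\<theta> (Suc d) \<cdot> g d = k d \<cdot> (h \<cdot> g d)" by blast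
  note [simp] = dextD(4)[OF G order_refl, simplified] dextD(4)[OF K order_refl, simplified] cmapD(1)[OF c order_refl, simplified] h(1)[simplified]
  have "\<theta> (Suc d) = k d \<cdot> h" by (rule epi_cancel[OF dextD(6)[OF G], of _ _ "K (Suc d)"]) (use h in auto)
  then show ?thesis using that h(1) by blast
qed

end

context tilting
begin

lemma factor_left:
  assumes G: "dext G g" and K: "dext K k" and c: "cmap C d G g K k \<theta>"
    and b: "b \<in> Hom C (G (Suc d)) (K d)" "\<theta> (Suc d) = k d \<cdot> b"
  obtains h where "h \<in> Hom C (G 1) (K 0)" "\<theta> 0 = h \<cdot> g 0"
proof -
  have k: "Suc d - 1 = d" "Suc d - 0 = Suc d" "d - 0 = d" "Suc d - Suc d = 0" "Suc d - d = 1" "d - d = 0" by simp_all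
  obtain h where "h \<in> Hom (op_cat C) (revs (Suc d) K (Suc d)) (revs (Suc d) G d)"
    "revs (Suc d) \<theta> (Suc d) = Comp (op_cat C) (revs d g d) h"
  proof (rule tilting.factor_right[OF op_tilting dext_op[OF K] dext_op[OF G] cmap_revs[OF c]])
    show "b \<in> Hom (op_cat C) (revs (Suc d) K 1) (revs (Suc d) G 0)" unfolding revs_def k op_unfold by (rule b(1))
    show "revs (Suc d) \<theta> 0 = Comp (op_cat C) b (revs d k 0)" unfolding revs_def k op_unfold by (rule b(2))
  qed
  then show ?thesis unfolding revs_def k op_unfold by (rule that)
qed

text \<open>A morphism \<open>\<theta>\<close> of extensions that is the identity at the right end behaves like a pushout as far as morphisms to
  \<open>N \<in> \<M>\<close> are concerned. Push \<open>D\<close> out along \<open>a\<close>. The composite with \<open>\<theta>\<close> factors at the left end by \<open>b\<close>, hence at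
  the right end. There it agrees with the morphism out of \<open>D\<close>, which therefore factors at the left end.\<close>

lemma extend_of_pushout:
  assumes G: "dext G g" and D: "dext D f" and c: "cmap C d G g D f \<theta>" "D (Suc d) = G (Suc d)" "\<theta> (Suc d) = Ident C (G (Suc d))"
    and a: "a \<in> Hom C (D 0) N" and b: "b \<in> Hom C (G 1) N" and N: "N \<in> \<M>" and ab: "a \<cdot> \<theta> 0 = b \<cdot> g 0"
  obtains a' where "a' \<in> Hom C (D 1) N" "a' \<cdot> f 0 = a"
proof -
  obtain Y y \<psi> where Y: "dext Y y" "Y 0 = N" "Y (Suc d) = D (Suc d)" "cmap C d D f Y y \<psi>" "\<psi> 0 = a" "\<psi> (Suc d) = Ident C (D (Suc d))"
    by (rule dext_pushout[OF pushable_M D dextD(2)[OF D] a N]) auto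
  have Go: "G (Suc d) \<in> Obj C" using dextD(3)[OF G] by blast
  have "cmap C d G g Y y (\<lambda>i. \<psi> i \<cdot> \<theta> i)"
    by (rule cmap_comp[OF dext_sequ[OF G] dext_sequ[OF D] dext_sequ[OF Y(1)] c(1) Y(4)])
  moreover have "b \<in> Hom C (G 1) (Y 0)" "\<psi> 0 \<cdot> \<theta> 0 = b \<cdot> g 0" using b ab Y by simp_all
  ultimately obtain h where h: "h \<in> Hom C (G (Suc d)) (Y d)" "\<psi> (Suc d) \<cdot> \<theta> (Suc d) = y d \<cdot> h"
    by (rule factor_right[OF G Y(1)])
  then have "h \<in> Hom C (D (Suc d)) (Y d)" "\<psi> (Suc d) = y d \<cdot> h" using Y(6) c Go by simp_all
  then obtain a' where "a' \<in> Hom C (D 1) (Y 0)" "\<psi> 0 = a' \<cdot> f 0"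
    by (rule factor_left[OF D Y(1,4)])
  then show ?thesis using that Y by simp
qed

text \<open>Dually, pull \<open>G\<close> back along \<open>a\<close>.\<close>

lemma lift_of_pullback:
  assumes G: "dext G g" and D: "dext D f" and c: "cmap C d G g D f \<theta>" "D 0 = G 0" "\<theta> 0 = Ident C (G 0)"
    and a: "a \<in> Hom C N (G (Suc d))" and b: "b \<in> Hom C N (D d)" and N: "N \<in> \<M>" and ab: "\<theta> (Suc d) \<cdot> a = f d \<cdot> b"
  obtains a' where "a' \<in> Hom C N (G d)" "g d \<cdot> a' = a"
proof -
  obtain Y y \<psi> where Y: "dext Y y" "Y 0 = G 0" "Y (Suc d) = N" "cmap C d Y y G g \<psi>" "\<psi> (Suc d) = a" "\<psi> 0 = Ident C (G 0)"
    by (rule dext_pullback[OF G a N])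
  have Go: "G 0 \<in> Obj C" using dextD(3)[OF G] by blast
  have "cmap C d Y y D f (\<lambda>i. \<theta> i \<cdot> \<psi> i)"
    by (rule cmap_comp[OF dext_sequ[OF Y(1)] dext_sequ[OF G] dext_sequ[OF D] Y(4) c(1)])
  moreover have "b \<in> Hom C (Y (Suc d)) (D d)" "\<theta> (Suc d) \<cdot> \<psi> (Suc d) = f d \<cdot> b" using b ab Y by simp_all
  ultimately obtain h where h: "h \<in> Hom C (Y 1) (D 0)" "\<theta> 0 \<cdot> \<psi> 0 = h \<cdot> y 0"
    by (rule factor_left[OF Y(1) D])
  then have "h \<in> Hom C (Y 1) (G 0)" "\<psi> 0 = h \<cdot> y 0" using Y(6) c Go by simp_all
  then obtain a' where "a' \<in> Hom C (Y (Suc d)) (G d)" "\<psi> (Suc d) = g d \<cdot> a'"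
    by (rule factor_right[OF Y(1) G Y(4)])
  then show ?thesis using that Y by simp
qed

end

lemma (in preadditive_category) cmap_extend_down:
  assumes G: "is_sequ C n G g" "\<And>i. i < n \<Longrightarrow> g (Suc i) \<cdot> g i = Zer C (G i) (G (Suc (Suc i)))" and K: "is_sequ C n K k"
    and lift: "\<And>i y. i < n \<Longrightarrow> y \<in> Hom C (G i) (K (Suc i)) \<Longrightarrow> k (Suc i) \<cdot> y = Zer C (G i) (K (Suc (Suc i))) \<Longrightarrow>
      \<exists>x \<in> Hom C (G i) (K i). k i \<cdot> x = y"
    and s: "s \<in> Hom C (G (Suc n)) (K (Suc n))" and t: "t \<in> Hom C (G n) (K n)" and st: "s \<cdot> g n = k n \<cdot> t"
  obtains c where "cmap C n G g K k c" "c (Suc n) = s" "c n = t"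
proof -
  have "\<exists>c. c (Suc n) = s \<and> c n = t \<and> (\<forall>i. n - m \<le> i \<and> i \<le> Suc n \<longrightarrow> c i \<in> Hom C (G i) (K i)) \<and>
    (\<forall>i. n - m \<le> i \<and> i \<le> n \<longrightarrow> c (Suc i) \<cdot> g i = k i \<cdot> c i)" if "m \<le> n" for m
    using that
  proof (induction m)
    case 0
    show ?case
    proof (intro exI[of _ "\<lambda>i. if i = n then t else s"] conjI allI impI)
      fix i show "n - 0 \<le> i \<and> i \<le> Suc n \<Longrightarrow> (if i = n then t else s) \<in> Hom C (G i) (K i)"
        using s t by (cases "i = n") (auto simp: le_Suc_eq)
      show "n - 0 \<le> i \<and> i \<le> n \<Longrightarrow> (if Suc i = n then t else s) \<cdot> g i = k i \<cdot> (if i = n then t else s)"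
        using st by auto
    qed auto
  next
    case (Suc m)
    then obtain c where c: "c (Suc n) = s" "c n = t" "\<And>i. n - m \<le> i \<Longrightarrow> i \<le> Suc n \<Longrightarrow> c i \<in> Hom C (G i) (K i)"
      "\<And>i. n - m \<le> i \<Longrightarrow> i \<le> n \<Longrightarrow> c (Suc i) \<cdot> g i = k i \<cdot> c i" by auto
    define j where "j = n - Suc m"
    have j: "Suc j = n - m" "j < n" "n - Suc m = j" "j \<le> n" "Suc j \<le> n" "Suc j \<le> Suc n" "Suc (Suc j) \<le> Suc n" using Suc(2) by (auto simp: j_def)
    have cj: "c (Suc j) \<in> Hom C (G (Suc j)) (K (Suc j))" "c (Suc (Suc j)) \<in> Hom C (G (Suc (Suc j))) (K (Suc (Suc j)))"
      "c (Suc (Suc j)) \<cdot> g (Suc j) = k (Suc j) \<cdot> c (Suc j)" using c(3,4)[of "Suc j"] c(3)[of "Suc (Suc j)"] j by auto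
    note [simp] = cj(1,2)[simplified] is_sequD(2)[OF G(1) j(4), simplified] is_sequD(2)[OF G(1) j(5), simplified]
      is_sequD(2)[OF K j(5), simplified]
    have Go: "G j \<in> Obj C" using is_sequD(1)[OF G(1), of j] j by simp
    have "k (Suc j) \<cdot> (c (Suc j) \<cdot> g j) = c (Suc (Suc j)) \<cdot> (g (Suc j) \<cdot> g j)"
      using comp_eq_ext[OF cj(3)[symmetric], of "g j"] by simp
    also have "\<dots> = Zer C (G j) (K (Suc (Suc j)))" using G(2)[OF j(2)] Go by simp
    finally obtain x where x: "x \<in> Hom C (G j) (K j)" "k j \<cdot> x = c (Suc j) \<cdot> g j"
      using lift[OF j(2), of "c (Suc j) \<cdot> g j"] by auto
    show ?case
    proof (intro exI[of _ "c(j := x)"] conjI allI impI)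
      show "(c(j := x)) (Suc n) = s" "(c(j := x)) n = t" using c(1,2) j by auto
      fix i
      show "n - Suc m \<le> i \<and> i \<le> Suc n \<Longrightarrow> (c(j := x)) i \<in> Hom C (G i) (K i)"
        using x(1) c(3)[of i] j by (cases "i = j") auto
      show "n - Suc m \<le> i \<and> i \<le> n \<Longrightarrow> (c(j := x)) (Suc i) \<cdot> g i = k i \<cdot> (c(j := x)) i"
        using x(2) c(4)[of i] j by (cases "i = j") auto
    qed
  qed
  from this[of n] obtain c where "c (Suc n) = s" "c n = t" "\<forall>i. i \<le> Suc n \<longrightarrow> c i \<in> Hom C (G i) (K i)"
    "\<forall>i. i \<le> n \<longrightarrow> c (Suc i) \<cdot> g i = k i \<cdot> c i" by auto
  then show ?thesis using that unfolding cmap_def by blast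
qed

context tilting
begin

lemma dext_cmap_down:
  assumes G: "dext G g" and K: "dext K k"
    and s: "s \<in> Hom C (G (Suc d)) (K (Suc d))" and t: "t \<in> Hom C (G d) (K d)" and st: "s \<cdot> g d = k d \<cdot> t"
  obtains c where "cmap C d G g K k c" "c (Suc d) = s" "c d = t"
proof (rule cmap_extend_down[OF dext_sequ[OF G] dextD(7)[OF G] dext_sequ[OF K] _ s t st])
  fix i y assume i: "i < d" "y \<in> Hom C (G i) (K (Suc i))" "k (Suc i) \<cdot> y = Zer C (G i) (K (Suc (Suc i)))"
  show "\<exists>x \<in> Hom C (G i) (K i). k i \<cdot> x = y"
    by (rule dext_lift[OF K _ i, of thesis for thesis]) (use dextD(2)[OF G, of i] i in auto)
qed (use that in blast)+

lemma dext_cmap_up: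
  assumes G: "dext G g" and K: "dext K k"
    and s: "s \<in> Hom C (G 0) (K 0)" and t: "t \<in> Hom C (G 1) (K 1)" and st: "t \<cdot> g 0 = k 0 \<cdot> s"
  obtains c where "cmap C d G g K k c" "c 0 = s" "c 1 = t"
proof -
  have k: "Suc d - 0 = Suc d" "d - 0 = d" "Suc d - Suc d = 0" "Suc d - d = 1" "d - d = 0" by simp_all
  obtain c where c: "cmap (op_cat C) d (revs (Suc d) K) (revs d k) (revs (Suc d) G) (revs d g) c" "c (Suc d) = s" "c d = t"
  proof (rule tilting.dext_cmap_down[OF op_tilting dext_op[OF K] dext_op[OF G]])
    show "s \<in> Hom (op_cat C) (revs (Suc d) K (Suc d)) (revs (Suc d) G (Suc d))" unfolding revs_def k op_unfold by (rule s)
    show "t \<in> Hom (op_cat C) (revs (Suc d) K d) (revs (Suc d) G d)" unfolding revs_def k op_unfold by (rule t)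
    show "Comp (op_cat C) s (revs d k d) = Comp (op_cat C) (revs d g d) t" unfolding revs_def k op_unfold by (rule st[symmetric])
  qed
  have "cmap C d (revs (Suc d) (revs (Suc d) G)) (revs d (revs d g)) K k (revs (Suc d) c)"
    by (rule cmap_op_revs[OF c(1)])
  then have "cmap C d G g K k (revs (Suc d) c)" unfolding cmap_def by (simp add: revs_def del: hom_iff)
  then show ?thesis by (rule that) (use c in \<open>simp_all add: revs_def\<close>)
qed

text \<open>Two extensions that are pushouts of a third one along the same morphism are equivalent. A first
  comparison morphism \<open>u\<close> need not be the identity at the right end, but it differs from it by a morphism
  that factors through the last map, which is then used to correct it.\<close>

lemma pushouts_equivalent:
  assumes G: "dext G g" and D: "dext D f" and K: "dext K k"
    and c: "cmap C d G g D f c" "c (Suc d) = Ident C (G (Suc d))" "D (Suc d) = G (Suc d)"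
    and \<kappa>: "cmap C d G g K k \<kappa>" "\<kappa> (Suc d) = Ident C (G (Suc d))" "K (Suc d) = G (Suc d)"
    and e: "D 0 = K 0" "c 0 = \<kappa> 0"
  shows "end_fixing_map C d (D, f) (K, k)"
proof -
  have d1: "d - 1 < d" "Suc (d - 1) = d" "d - 1 \<le> d" "d \<le> Suc d" "1 \<le> Suc d" using d by auto
  have [simp]: "Suc (d - Suc 0) = d" using d by simp
  have Y: "G (Suc d) \<in> Obj C" and X: "K 0 \<in> Obj C" using dextD(3)[OF G] dextD(3)[OF K] by blast+
  have k0: "k 0 \<in> Hom C (D 0) (K 1)" using dextD(4)[OF K, of 0] e by simp
  have \<kappa>1: "\<kappa> 1 \<in> Hom C (G 1) (K 1)" using cmapD(1)[OF \<kappa>(1) d1(5)] .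
  \<comment> \<open>both extensions are weak pushouts of \<open>G\<close> along the same morphism, which gives the first two components of \<open>u\<close>\<close>
  obtain u1 where u1: "u1 \<in> Hom C (D 1) (K 1)" "u1 \<cdot> f 0 = k 0"
  proof (rule extend_of_pushout[OF G D c(1,3,2) k0 \<kappa>1])
    show "K 1 \<in> \<M>" using dextD(2)[OF K d1(5)] .
    show "k 0 \<cdot> c 0 = \<kappa> 1 \<cdot> g 0" using cmapD(2)[OF \<kappa>(1), of 0] e by simp
  qed
  obtain u where u: "cmap C d D f K k u" "u 0 = Ident C (K 0)" "u 1 = u1"
    by (rule dext_cmap_up[OF D K, of "Ident C (K 0)" u1]) (use u1 k0 e X in auto)
  \<comment> \<open>this difference is zero at the left end, hence factors through the last map at the right end\<close>
  have "cmap C d G g K k (\<lambda>i. \<kappa> i \<boxplus> neg (u i \<cdot> c i))"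
    by (rule cmap_minus[OF dext_sequ[OF G] dext_sequ[OF K] \<kappa>(1) cmap_comp[OF dext_sequ[OF G] dext_sequ[OF D] dext_sequ[OF K] c(1) u(1)]])
  moreover have "Zer C (G 1) (K 0) \<in> Hom C (G 1) (K 0)" using X dextD(3)[OF G d1(5)] by simp
  moreover have "\<kappa> 0 \<boxplus> neg (u 0 \<cdot> c 0) = Zer C (G 1) (K 0) \<cdot> g 0"
    using u(2) e(2) cmapD(1)[OF \<kappa>(1), of 0] dextD(4)[OF G, of 0] X by simp
  ultimately obtain h where h: "h \<in> Hom C (G (Suc d)) (K d)" "\<kappa> (Suc d) \<boxplus> neg (u (Suc d) \<cdot> c (Suc d)) = k d \<cdot> h"
    by (rule factor_right[OF G K])
  note [simp] = dextD(4)[OF D order_refl, simplified] dextD(4)[OF D d1(3), simplified] dextD(4)[OF K order_refl, simplified]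
    dextD(4)[OF K d1(3), simplified] cmapD(1)[OF u(1) order_refl, simplified] cmapD(1)[OF u(1) d1(4), simplified] h(1)[simplified]
    c(3) \<kappa>(3)
  have h': "k d \<cdot> h = Ident C (G (Suc d)) \<boxplus> neg (u (Suc d))" using h(2) c(2) \<kappa>(2) by simp
  \<comment> \<open>only the last two components of \<open>u\<close> have to be corrected, as \<open>f d \<cdot> f (d - 1) = 0\<close>\<close>
  let ?v = "u d \<boxplus> (h \<cdot> f d)"
  have "?v \<cdot> f (d - 1) = (u d \<cdot> f (d - 1)) \<boxplus> ((h \<cdot> f d) \<cdot> f (d - 1))" by (rule plus_comp) auto
  also have "(h \<cdot> f d) \<cdot> f (d - 1) = Zer C (D (d - 1)) (K d)"
    using dextD(7)[OF D d1(1)] dextD(3)[OF D, of "d - 1"] d1(3) by simp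
  finally have v1: "?v \<cdot> f (d - 1) = k (d - 1) \<cdot> u (d - 1)" using cmapD(2)[OF u(1) d1(3)] by simp
  have "k d \<cdot> ?v = (k d \<cdot> u d) \<boxplus> (k d \<cdot> (h \<cdot> f d))" by (rule comp_plus) auto
  also have "k d \<cdot> (h \<cdot> f d) = (Ident C (G (Suc d)) \<boxplus> neg (u (Suc d))) \<cdot> f d" using comp_eq_ext[OF h', of "f d"] by simp
  also have "\<dots> = f d \<boxplus> neg (u (Suc d) \<cdot> f d)" using Y by (subst plus_comp) auto
  also have "k d \<cdot> u d = u (Suc d) \<cdot> f d" using cmapD(2)[OF u(1) order_refl] by simp
  also have "(u (Suc d) \<cdot> f d) \<boxplus> (f d \<boxplus> neg (u (Suc d) \<cdot> f d)) = f d \<boxplus> ((u (Suc d) \<cdot> f d) \<boxplus> neg (u (Suc d) \<cdot> f d))"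
    by (rule plus_lcomm) auto
  also have "\<dots> = f d" using Y by simp
  finally have v2: "k d \<cdot> ?v = f d" .
  define w where "w = u(d := ?v, Suc d := Ident C (G (Suc d)))"
  have w: "w i = u i" if "i < d" for i using that by (simp add: w_def)
  have wd: "w d = ?v" "w (Suc d) = Ident C (G (Suc d))" by (simp_all add: w_def)
  have "cmap C d D f K k w"
    unfolding cmap_def
  proof (intro conjI allI impI)
    fix i
    show "i \<le> Suc d \<Longrightarrow> w i \<in> Hom C (D i) (K i)"
      using w[of i] wd cmapD(1)[OF u(1), of i] Y by (cases "i < d") (auto simp: le_Suc_eq not_less)
    assume "i \<le> d"
    then consider "i = d" | "i = d - 1" | "Suc i < d" using d by linarith
    then show "w (Suc i) \<cdot> f i = k i \<cdot> w i"
    proof cases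
      case 1
      then show ?thesis using wd v2 Y by simp
    next
      case 2
      then show ?thesis using wd v1 w[of "d - 1"] d1 by simp
    next
      case 3
      then show ?thesis using w[of i] w[of "Suc i"] cmapD(2)[OF u(1), of i] by simp
    qed
  qed
  moreover have "w 0 = Ident C (D 0)" using w[of 0] u(2) e d by simp
  ultimately show ?thesis unfolding end_fixing_map_iff using e wd by auto
qed

text \<open>The factorization \<open>t\<close> and the identity of the right end are the top components of a morphism \<open>c\<close> from \<open>G\<close> to \<open>D\<close>.
  Both \<open>D\<close> and the pushout of \<open>G\<close> along \<open>c\<^sub>0\<close> that is formed inside \<open>\<U>\<close> are then pushouts of \<open>G\<close> along the same
  morphism.\<close>

lemma equivalent_to_terms_in:
  assumes U: "pushable \<U>" and D: "dext D f" "D 0 \<in> \<U>" "D (Suc d) \<in> \<U>"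
    and G: "dext G g" "\<And>i. 1 \<le> i \<Longrightarrow> i \<le> d \<Longrightarrow> G i \<in> \<U>" "G (Suc d) = D (Suc d)"
    and t: "t \<in> Hom C (G d) (D d)" "f d \<cdot> t = g d"
  shows "equiv_to_d_extension_with_terms_in C \<M> d \<U> D f"
proof -
  have Y: "D (Suc d) \<in> Obj C" using dextD(3)[OF D(1)] by blast
  have gd: "g d \<in> Hom C (G d) (D (Suc d))" using dextD(4)[OF G(1) order_refl] G(3) by simp
  obtain c where c: "cmap C d G g D f c" "c (Suc d) = Ident C (D (Suc d))" "c d = t"
    by (rule dext_cmap_down[OF G(1) D(1), of "Ident C (D (Suc d))" t]) (use Y t gd G(3) in auto)
  have c0: "c 0 \<in> Hom C (G 0) (D 0)" using cmapD(1)[OF c(1), of 0] by simp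
  obtain K k \<kappa> where K: "dext K k" "K 0 = D 0" "K (Suc d) = G (Suc d)" "\<And>i. i \<le> d \<Longrightarrow> K i \<in> \<U>"
    "cmap C d G g K k \<kappa>" "\<kappa> 0 = c 0" "\<kappa> (Suc d) = Ident C (G (Suc d))"
    by (rule dext_pushout[OF U G(1,2) c0 D(2)]) blast+
  have "end_fixing_map C d (D, f) (K, k)"
    by (rule pushouts_equivalent[OF G(1) D(1) K(1) c(1) _ _ K(5,7,3)]) (use c(2) G(3) K in simp_all)
  moreover have "K i \<in> \<U>" if "i \<le> Suc d" for i using K(3,4) D(3) G(3) that by (cases "i = Suc d") auto
  ultimately show ?thesis unfolding equiv_to_d_extension_with_terms_in_def
    using dext_imp_d_extension[OF K(1)] by blast
qed

end

section \<open>Decomposition into indecomposables\<close>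

context abelian_category
begin

text \<open>\<^const>\<open>finite_length\<close> with the length made explicit, in a form that allows induction on a composition series.\<close>

inductive clen :: "nat \<Rightarrow> 'a \<Rightarrow> bool"
  where
  zero: "zero_object C X \<Longrightarrow> clen 0 X"
| step: "clen n (Dom C m) \<Longrightarrow> ses C m q \<Longrightarrow> simple_object C (Cod C q) \<Longrightarrow> clen (Suc n) (Cod C m)"

lemma finite_length_clen:
  assumes "finite_length C X"
  obtains n where "clen n X"
proof -
  obtain n Z m where z: "zero_object C (Z 0)" "Z n = X"
    and s: "\<forall>i<n. m i \<in> Hom C (Z i) (Z (Suc i)) \<and> is_mono C (m i) \<and> (\<exists>q. is_cokernel C (m i) q \<and> simple_object C (Cod C q))"
    using assms unfolding finite_length_def by blast
  have "clen i (Z i)" if "i \<le> n" for i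
    using that
  proof (induction i)
    case (Suc i)
    obtain q where "ses C (m i) q" "simple_object C (Cod C q)" using s Suc.prems mono_cokernel_ses by (meson Suc_le_lessD)
    then show ?case using clen.step[of i "m i" q] Suc s by auto
  qed (use z in \<open>auto intro: clen.zero\<close>)
  then show ?thesis using that z(2) by blast
qed

lemma zero_objectI:
  assumes A: "A \<in> Obj C" and e: "Ident C A = Zer C A A"
  shows "zero_object C A"
  unfolding zero_object_def
proof (intro conjI ballI A)
  fix B assume B: "B \<in> Obj C"
  show "\<exists>!f. f \<in> Hom C A B"
  proof (rule ex1I[of _ "Zer C A B"])
    fix f assume "f \<in> Hom C A B"
    then show "f = Zer C A B" using comp_ident(1)[of f A] e A B by simp
  qed (use A B in simp)
  show "\<exists>!f. f \<in> Hom C B A"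
  proof (rule ex1I[of _ "Zer C B A"])
    fix f assume "f \<in> Hom C B A"
    then show "f = Zer C B A" using comp_ident(2)[of f A] e A B by simp
  qed (use A B in simp)
qed

text \<open>The image is a nonzero subobject of a simple object.\<close>

lemma to_simple_epi:
  assumes S: "simple_object C S" and u: "u \<in> Hom C A S" "u \<noteq> Zer C A S"
  shows "is_epi C u"
proof -
  obtain I e k where k: "e \<in> Hom C A I" "k \<in> Hom C I S" "is_epi C e" "is_mono C k" "k \<cdot> e = u"
    by (rule ex_factor[OF u(1)])
  have o: "A \<in> Obj C" "S \<in> Obj C" "I \<in> Obj C" using hom_obj u(1) k by blast+
  have "zero_object C I \<or> is_iso C k" using S k unfolding simple_object_def by auto
  then show ?thesis
  proof
    assume "zero_object C I"
    then have "e = Zer C A I" using zero_hom(1) k(1) by blast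
    then show ?thesis using k u(2) o by auto
  next
    assume "is_iso C k"
    then obtain g where g: "g \<in> Hom C S I" "k \<cdot> g = Ident C S" using k unfolding is_iso_def by auto
    have "is_epi C k" by (rule epi_of_comp[of k g]) (use g k o in auto)
    then show ?thesis using epi_comp[OF k(3), of k] k by auto
  qed
qed

text \<open>Compare the subobject \<open>A\<close> of \<open>X\<close> with the last simple quotient \<open>q : X \<rightarrow> S\<close>, whose kernel \<open>X'\<close> has the shorter
  series. Either \<open>A\<close> lies in \<open>X'\<close>, or \<open>A \<rightarrow> S\<close> is an epimorphism whose kernel is a subobject of \<open>X'\<close>. In the second
  case, if that kernel is all of \<open>X'\<close> then \<open>A\<close> is all of \<open>X\<close>.\<close>

lemma clen_subobject:
  "clen n X \<Longrightarrow> is_mono C m \<Longrightarrow> Cod C m = X \<Longrightarrow> \<exists>k \<le> n. clen k (Dom C m) \<and> (\<not> is_epi C m \<longrightarrow> k < n)"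
proof (induction arbitrary: m rule: clen.induct)
  case (zero X)
  have m: "m \<in> Arr C" using mono_arr zero.prems(1) .
  have "m = Zer C (Dom C m) X" using zero_hom(1)[OF zero.hyps] m zero.prems by simp
  moreover have "Dom C m \<in> Obj C" "X \<in> Obj C" using m zero.prems by auto
  ultimately have "Ident C (Dom C m) = Zer C (Dom C m) (Dom C m)"
    by (intro mono_zeroD[OF zero.prems(1)]) (use m zero.prems(2) in auto)
  then have "zero_object C (Dom C m)" using zero_objectI m by simp
  moreover have "is_epi C m"
  proof (rule epi_zeroI[OF m])
    fix T z assume "z \<in> Hom C (Cod C m) T"
    then show "z = Zer C (Cod C m) T" using zero_hom(2)[OF zero.hyps] zero.prems(2) by blast
  qed
  ultimately show ?case by (auto intro: clen.zero)
next
  case (step n j q)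
  have m: "m \<in> Arr C" using mono_arr step.prems(1) .
  note [simp] = m sesD(1-4)[OF step.hyps(2)] step.prems(2)
  have cj: "Cod C j = Dom C q" using sesD(3)[OF step.hyps(2)] .
  note [simp] = step.prems(2)[unfolded cj]
  show ?case
  proof (cases "q \<cdot> m = Zer C (Dom C m) (Cod C q)")
    case True
    obtain m' where m': "m' \<in> Hom C (Dom C m) (Dom C j)" "j \<cdot> m' = m"
      by (rule ses_lift[OF step.hyps(2), of m "Dom C m"]) (use True in auto)
    have "is_mono C m'" by (rule mono_of_comp[of j]) (use m' step.prems in auto)
    then obtain k where "k \<le> n" "clen k (Dom C m')" using step.IH[of m'] m' by auto
    then show ?thesis using m' by (intro exI[of _ k]) auto
  next
    case False
    have qm: "is_epi C (q \<cdot> m)" by (rule to_simple_epi[OF step.hyps(3) _ False]) simp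
    then obtain i where i: "ses C i (q \<cdot> m)" using ex_ses_epi by blast
    note [simp] = sesD(1-2)[OF i]
    have ci [simp]: "Cod C i = Dom C m" using sesD(3)[OF i] by simp
    have qmi: "q \<cdot> (m \<cdot> i) = Zer C (Dom C i) (Cod C q)" using sesD(4)[OF i] by simp
    obtain m' where m': "m' \<in> Hom C (Dom C i) (Dom C j)" "j \<cdot> m' = m \<cdot> i"
      by (rule ses_lift[OF step.hyps(2), of "m \<cdot> i" "Dom C i"]) (use qmi in auto)
    note [simp] = m'(1)[simplified]
    have "is_mono C (m \<cdot> i)" by (rule mono_comp) (use sesD(5)[OF i] step.prems in auto)
    then have "is_mono C (j \<cdot> m')" unfolding m'(2) .
    then have "is_mono C m'" by (rule mono_of_comp) simp_all
    then obtain k where k: "k \<le> n" "clen k (Dom C m')" "\<not> is_epi C m' \<longrightarrow> k < n" using step.IH[of m'] by auto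
    have "clen (Suc k) (Dom C m)" using clen.step[of k i "q \<cdot> m"] k i step.hyps(3) by simp
    moreover have "is_epi C m" if e: "is_epi C m'"
    proof (rule epi_zeroI[OF m])
      fix T z assume z: "z \<in> Hom C (Cod C m) T" "z \<cdot> m = Zer C (Dom C m) T"
      note [simp] = z(1)[simplified]
      have T: "T \<in> Obj C" using hom_obj z by blast
      have "(z \<cdot> j) \<cdot> m' = z \<cdot> (m \<cdot> i)" using m'(2) by simp
      also have "\<dots> = Zer C (Dom C i) T" using comp_eq_ext[OF z(2), of i] T by simp
      finally have "z \<cdot> j = Zer C (Dom C j) T" using epi_zeroD[OF e, of "z \<cdot> j" T] by simp
      then obtain w where w: "w \<in> Hom C (Cod C q) T" "w \<cdot> q = z" using ses_desc[OF step.hyps(2), of z T] by auto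
      have "w \<cdot> (q \<cdot> m) = Zer C (Dom C (q \<cdot> m)) T" using comp_eq_ext[OF w(2), of m] w z by simp
      then have "w = Zer C (Cod C q) T" using epi_zeroD[OF qm, of w T] w by simp
      then show "z = Zer C (Cod C m) T" using w T by simp
    qed
    ultimately show ?thesis using k by (intro exI[of _ "Suc k"]) auto
  qed
qed

lemma proper_summand:
  assumes b: "is_biproduct C A B X i j p q" and B: "\<not> zero_object C B"
  shows "is_mono C i" "\<not> is_epi C i"
proof -
  note [simp] = biproductD(4-11)[OF b, simplified] biproductD(1-3)[OF b]
  show "is_mono C i" by (rule mono_of_comp[of p]) auto
  show "\<not> is_epi C i"
  proof
    assume "is_epi C i"
    then have "q = Zer C X B" using epi_zeroD[of i q B] by simp
    then have "Ident C B = Zer C B B" using biproductD(9)[OF b] by simp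
    then show False using B zero_objectI by simp
  qed
qed

end

text \<open>The two summands in a nontrivial decomposition are proper subobjects, so they have shorter composition
  series.\<close>

lemma (in abelian_length_category) indecomposable_induct:
  assumes X: "X \<in> Obj C"
    and z: "\<And>X. zero_object C X \<Longrightarrow> Q X" and i: "\<And>X. indecomposable C X \<Longrightarrow> Q X"
    and s: "\<And>A B X. is_direct_sum C A B X \<Longrightarrow> Q A \<Longrightarrow> Q B \<Longrightarrow> Q X"
  shows "Q X"
proof -
  have "Q X" if "clen n X" "X \<in> Obj C" for n X
    using that
  proof (induction n arbitrary: X rule: less_induct)
    case (less n)
    show ?case
    proof (cases "zero_object C X \<or> indecomposable C X")
      case False
      then obtain A B where AB: "is_direct_sum C A B X" "\<not> zero_object C A" "\<not> zero_object C B"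
        using less.prems(2) unfolding indecomposable_def by blast
      obtain i j p q where b: "is_biproduct C A B X i j p q" using AB(1) unfolding is_direct_sum_def by blast
      have b': "is_biproduct C B A X j i q p"
        using b plus_comm[of "i \<cdot> p" "j \<cdot> q"] unfolding is_biproduct_def by auto
      have "Dom C i = A" "Cod C i = X" "Dom C j = B" "Cod C j = X" using biproductD(4,5)[OF b] by auto
      then obtain k l where "k < n" "clen k A" "l < n" "clen l B"
        using clen_subobject[OF less.prems(1) proper_summand(1)[OF b AB(3)]] proper_summand(2)[OF b AB(3)]
          clen_subobject[OF less.prems(1) proper_summand(1)[OF b' AB(2)]] proper_summand(2)[OF b' AB(2)] by blast
      then show ?thesis using less.IH s[OF AB(1)] biproductD(1,2)[OF b] by blast
    qed (use z i in blast)
  qed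
  then show ?thesis using finite_length_clen[OF finite_length[OF X]] X by blast
qed

section \<open>Closure under extensions\<close>

context abelian_category
begin

text \<open>Direct sums are the cones of zero morphisms, whence the sign of the second component.\<close>

lemma exs_direct_sum:
  assumes X: "exs C n X f" and W: "exs C n W w"
    and b: "\<And>i. i \<le> Suc n \<Longrightarrow> is_biproduct C (X i) (W i) (V i) (I i) (J i) (P i) (Q i)"
  obtains v where "exs C n V v" "\<And>i. i \<le> n \<Longrightarrow> v i \<cdot> I i = I (Suc i) \<cdot> f i" "\<And>i. i \<le> n \<Longrightarrow> v i \<cdot> J i = neg (J (Suc i) \<cdot> w i)"
proof -
  define v where "v i = (I (Suc i) \<cdot> (f i \<cdot> P i)) \<boxplus> (J (Suc i) \<cdot> neg (w i \<cdot> Q i))" for i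
  have v: "v i \<in> Hom C (V i) (V (Suc i)) \<and> P (Suc i) \<cdot> v i = f i \<cdot> P i \<and> Q (Suc i) \<cdot> v i = neg (w i \<cdot> Q i) \<and>
    v i \<cdot> I i = I (Suc i) \<cdot> f i \<and> v i \<cdot> J i = neg (J (Suc i) \<cdot> w i)" if i: "i \<le> n" for i
  proof -
    have i': "i \<le> Suc n" "Suc i \<le> Suc n" using i by auto
    note [simp] = exsD(2)[OF X i, simplified] exsD(2)[OF W i, simplified] biproductD(4-11)[OF b[OF i'(1)], simplified]
      biproductD(4-11)[OF b[OF i'(2)], simplified] biproductD(1-3)[OF b[OF i'(1)]] biproductD(1-3)[OF b[OF i'(2)]]
    have "f i \<cdot> P i \<in> Hom C (V i) (X (Suc i))" "neg (w i \<cdot> Q i) \<in> Hom C (V i) (W (Suc i))" by simp_all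
    then obtain z where z: "z \<in> Hom C (V i) (V (Suc i))" "P (Suc i) \<cdot> z = f i \<cdot> P i" "Q (Suc i) \<cdot> z = neg (w i \<cdot> Q i)"
      "z = v i" unfolding v_def by (rule biproduct_pair[OF b[OF i'(2)]])
    have "v i \<cdot> I i = I (Suc i) \<cdot> f i" unfolding v_def by (subst plus_comp) auto
    moreover have "v i \<cdot> J i = neg (J (Suc i) \<cdot> w i)" unfolding v_def by (subst plus_comp) auto
    ultimately show ?thesis using z by simp
  qed
  have vh: "v i \<in> Hom C (V i) (V (Suc i))" if "i \<le> n" for i using v[OF that] by blast
  have ex: "exact C (v i) (v (Suc i))" if i: "i < n" for i
  proof -
    have i': "i \<le> n" "Suc i \<le> n" "i \<le> Suc n" "Suc i \<le> Suc n" "Suc (Suc i) \<le> Suc n" using i by auto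
    note [simp] = exsD(2)[OF X i'(1), simplified] exsD(2)[OF W i'(1), simplified] exsD(2)[OF X i'(2), simplified] exsD(2)[OF W i'(2), simplified]
      biproductD(4-7)[OF b[OF i'(3)], simplified] biproductD(4-7)[OF b[OF i'(4)], simplified] biproductD(4-7)[OF b[OF i'(5)], simplified]
      biproductD(1-3)[OF b[OF i'(3)]] biproductD(1-3)[OF b[OF i'(4)]] biproductD(1-3)[OF b[OF i'(5)]]
      vh[OF i'(1), simplified] vh[OF i'(2), simplified]
    have z: "v (Suc i) \<cdot> v i = Zer C (V i) (V (Suc (Suc i)))"
    proof (rule biproduct_eqI[OF b[OF i'(5)], of _ "V i"])
      have "P (Suc (Suc i)) \<cdot> (v (Suc i) \<cdot> v i) = f (Suc i) \<cdot> (f i \<cdot> P i)"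
        using comp_eq_ext[of "P (Suc (Suc i))" "v (Suc i)" "f (Suc i) \<cdot> P (Suc i)" "v i"] v[OF i'(1)] v[OF i'(2)] by simp
      also have "\<dots> = Zer C (V i) (X (Suc (Suc i)))" using comp_eq_ext[OF exsD(6)[OF X i], of "P i"] by simp
      finally show "P (Suc (Suc i)) \<cdot> (v (Suc i) \<cdot> v i) = P (Suc (Suc i)) \<cdot> Zer C (V i) (V (Suc (Suc i)))" by simp
      have "Q (Suc (Suc i)) \<cdot> (v (Suc i) \<cdot> v i) = w (Suc i) \<cdot> (w i \<cdot> Q i)"
        using comp_eq_ext[of "Q (Suc (Suc i))" "v (Suc i)" "neg (w (Suc i) \<cdot> Q (Suc i))" "v i"] v[OF i'(1)] v[OF i'(2)] by simp
      also have "\<dots> = Zer C (V i) (W (Suc (Suc i)))" using comp_eq_ext[OF exsD(6)[OF W i], of "Q i"] by simp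
      finally show "Q (Suc (Suc i)) \<cdot> (v (Suc i) \<cdot> v i) = Q (Suc (Suc i)) \<cdot> Zer C (V i) (V (Suc (Suc i)))" by simp
    qed auto
    show ?thesis
    proof (rule cone_ex[OF b[OF i'(3)] b[OF i'(4)] exsD(5)[OF X i] exsD(2)[OF X i'(1)] exsD(2)[OF X i'(2)]
          exsD(5)[OF W i] exsD(2)[OF W i'(1)] exsD(2)[OF W i'(2)], of "Zer C (W i) (X (Suc i))" "Zer C (W (Suc i)) (X (Suc (Suc i)))"])
      fix T y assume y: "y \<in> Hom C T (V (Suc i))" "v (Suc i) \<cdot> y = Zer C T (V (Suc (Suc i)))"
      note [simp] = y(1)[simplified]
      have T: "T \<in> Obj C" using hom_obj y by blast
      have "f (Suc i) \<cdot> (P (Suc i) \<cdot> y) = Zer C T (X (Suc (Suc i)))"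
        using comp_eq_ext[of "P (Suc (Suc i))" "v (Suc i)" "f (Suc i) \<cdot> P (Suc i)" y] v[OF i'(2)] y(2) T by simp
      moreover have "neg (w (Suc i) \<cdot> (Q (Suc i) \<cdot> y)) = Zer C T (W (Suc (Suc i)))"
        using comp_eq_ext[of "Q (Suc (Suc i))" "v (Suc i)" "neg (w (Suc i) \<cdot> Q (Suc i))" y] v[OF i'(2)] y(2) T by simp
      then have "neg (neg (w (Suc i) \<cdot> (Q (Suc i) \<cdot> y))) = neg (Zer C T (W (Suc (Suc i))))" by simp
      ultimately show "w (Suc i) \<cdot> (Q (Suc i) \<cdot> y) = Zer C T (W (Suc (Suc i))) \<and>
        (f (Suc i) \<cdot> (P (Suc i) \<cdot> y)) \<boxplus> (Zer C (W (Suc i)) (X (Suc (Suc i))) \<cdot> (Q (Suc i) \<cdot> y)) = Zer C T (X (Suc (Suc i)))"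
        using T by simp
    qed (use v[OF i'(1)] z in auto)
  qed
  have z: "0 \<le> n" "0 \<le> Suc n" "Suc 0 \<le> Suc n" "n \<le> n" "n \<le> Suc n" "Suc n \<le> Suc n" by auto
  have mono: "is_mono C (v 0)"
  proof (rule mono_zeroI)
    note [simp] = exsD(2)[OF X z(1), simplified] exsD(2)[OF W z(1), simplified] biproductD(4-7)[OF b[OF z(2)], simplified]
      biproductD(4-7)[OF b[OF z(3)], simplified] biproductD(1-3)[OF b[OF z(2)]] biproductD(1-3)[OF b[OF z(3)]] vh[OF z(1), simplified]
    fix T y assume y: "y \<in> Hom C T (Dom C (v 0))" "v 0 \<cdot> y = Zer C T (Cod C (v 0))"
    have T: "T \<in> Obj C" using hom_obj y by blast
    note [simp] = y(1)[simplified]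
    have "f 0 \<cdot> (P 0 \<cdot> y) = Zer C T (X (Suc 0))"
      using comp_eq_ext[of "P (Suc 0)" "v 0" "f 0 \<cdot> P 0" y] v[OF z(1)] y(2) T by simp
    then have 1: "P 0 \<cdot> y = Zer C T (X 0)" using mono_zeroD[OF exsD(3)[OF X], of "P 0 \<cdot> y" T] by simp
    have "neg (w 0 \<cdot> (Q 0 \<cdot> y)) = Zer C T (W (Suc 0))"
      using comp_eq_ext[of "Q (Suc 0)" "v 0" "neg (w 0 \<cdot> Q 0)" y] v[OF z(1)] y(2) T by simp
    then have "neg (neg (w 0 \<cdot> (Q 0 \<cdot> y))) = neg (Zer C T (W (Suc 0)))" by simp
    then have "w 0 \<cdot> (Q 0 \<cdot> y) = Zer C T (W (Suc 0))" using T by simp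
    then have 2: "Q 0 \<cdot> y = Zer C T (W 0)" using mono_zeroD[OF exsD(3)[OF W], of "Q 0 \<cdot> y" T] by simp
    show "y = Zer C T (Dom C (v 0))" using biproduct_eqI[OF b[OF z(2)], of y T "Zer C T (V 0)"] 1 2 T by simp
  qed (use vh[OF z(1)] in simp)
  have epi: "is_epi C (v n)"
  proof (rule epi_zeroI)
    note [simp] = exsD(2)[OF X z(4), simplified] exsD(2)[OF W z(4), simplified] biproductD(4-7)[OF b[OF z(5)], simplified]
      biproductD(4-7)[OF b[OF z(6)], simplified] biproductD(1-3)[OF b[OF z(5)]] biproductD(1-3)[OF b[OF z(6)]] vh[OF z(4), simplified]
    fix T y assume y: "y \<in> Hom C (Cod C (v n)) T" "y \<cdot> v n = Zer C (Dom C (v n)) T"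
    have T: "T \<in> Obj C" using hom_obj y by blast
    note [simp] = y(1)[simplified]
    have "(y \<cdot> I (Suc n)) \<cdot> f n = Zer C (X n) T" using comp_eq_ext[OF y(2), of "I n"] v[OF z(4)] T by simp
    then have 1: "y \<cdot> I (Suc n) = Zer C (X (Suc n)) T" using epi_zeroD[OF exsD(4)[OF X], of "y \<cdot> I (Suc n)" T] by simp
    have "neg (y \<cdot> (J (Suc n) \<cdot> w n)) = Zer C (W n) T" using comp_eq_ext[OF y(2), of "J n"] v[OF z(4)] T by simp
    then have "neg (neg (y \<cdot> (J (Suc n) \<cdot> w n))) = neg (Zer C (W n) T)" by simp
    then have "(y \<cdot> J (Suc n)) \<cdot> w n = Zer C (W n) T" using T by simp
    then have 2: "y \<cdot> J (Suc n) = Zer C (W (Suc n)) T" using epi_zeroD[OF exsD(4)[OF W], of "y \<cdot> J (Suc n)" T] by simp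
    show "y = Zer C (Cod C (v n)) T" using biproduct_co_eqI[OF b[OF z(6)], of y T "Zer C (V (Suc n)) T"] 1 2 T by simp
  qed (use vh[OF z(4)] in simp)
  have "is_sequ C n V v" unfolding is_sequ_def using vh biproductD(3)[OF b] by blast
  then have "exs C n V v" unfolding exs_def using mono epi ex by blast
  then show ?thesis using that v by blast
qed

end

context tilting
begin

text \<open>The first map of a \<open>d\<close>-cokernel of \<open>\<alpha>\<close> induces a left approximation of the cokernel of \<open>\<alpha>\<close>: exactness under
  \<open>Hom(-, N)\<close> at the second place says that every morphism to \<open>N \<in> \<M>\<close> that kills \<open>\<alpha>\<close> factors through it. If the
  cokernel itself lies in \<open>\<M>\<close>, then its identity factors too, so it is a summand of an object of \<open>\<U>\<close>.\<close>

lemma pushable_d_quotients: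
  assumes U: "subcategory C \<U>" "\<U> \<subseteq> \<M>" and q: "closed_under_d_quotients C \<M> d \<U>"
  shows "pushable \<U>"
proof -
  have app: "\<exists>F \<in> \<U>. \<exists>r \<in> Hom C R F. \<forall>N \<in> \<M>. \<forall>y \<in> Hom C R N. \<exists>z \<in> Hom C F N. z \<cdot> r = y" if R: "coker_into \<U> R" for R
  proof -
    obtain \<alpha> c where \<alpha>: "Dom C \<alpha> \<in> \<M>" "Cod C \<alpha> \<in> \<U>" "is_cokernel C \<alpha> c" "Cod C c = R" using R unfolding coker_into_def by blast
    note [simp] = cokernelD(1-3)[OF \<alpha>(3)] \<alpha>(4)
    have "\<alpha> \<in> Hom C (Dom C \<alpha>) (Cod C \<alpha>)" by simp
    then obtain X g where X: "X 0 = Dom C \<alpha>" "X 1 = Cod C \<alpha>" "g 0 = \<alpha>" "d_cokernel C \<M> d X g"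
      and XU: "\<forall>i. 1 \<le> i \<and> i \<le> d \<longrightarrow> X (Suc i) \<in> \<U>"
      using q \<alpha>(1,2) unfolding closed_under_d_quotients_def by blast
    have s: "is_sequ C d X g" using X(4) unfolding d_cokernel_def is_sequ_in_def by blast
    have ker: "{h \<in> Hom C (X (Suc 0)) N. h \<cdot> g 0 = Zer C (X 0) N} = (\<lambda>h. h \<cdot> g (Suc 0)) ` Hom C (X (Suc (Suc 0))) N"
      if "N \<in> \<M>" for N
    proof -
      have "0 < d" using d by simp
      then show ?thesis using X(4) that unfolding d_cokernel_def kernel_hom_group by blast
    qed
    have F: "X (Suc 1) \<in> \<U>" using XU d by blast
    then have FM: "X (Suc (Suc 0)) \<in> \<M>" using U(2) by auto
    have Fo: "X (Suc (Suc 0)) \<in> Obj C" using FM M_obj by blast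
    have g1: "g (Suc 0) \<in> Hom C (X (Suc 0)) (X (Suc (Suc 0)))" using is_sequD(2)[OF s, of "Suc 0"] d by simp
    have "Ident C (X (Suc (Suc 0))) \<cdot> g (Suc 0) \<in> (\<lambda>h. h \<cdot> g (Suc 0)) ` Hom C (X (Suc (Suc 0))) (X (Suc (Suc 0)))"
      by (rule imageI) (use Fo in simp)
    then have "g (Suc 0) \<in> {h \<in> Hom C (X (Suc 0)) (X (Suc (Suc 0))). h \<cdot> g 0 = Zer C (X 0) (X (Suc (Suc 0)))}"
      unfolding ker[OF FM] using g1 by simp
    then obtain r where r: "r \<in> Hom C R (X (Suc (Suc 0)))" "r \<cdot> c = g (Suc 0)"
      using cokernel_desc[OF \<alpha>(3), of "g (Suc 0)" "X (Suc (Suc 0))"] X by auto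
    note [simp] = r(1)[simplified]
    have "\<exists>z \<in> Hom C (X (Suc (Suc 0))) N. z \<cdot> r = y" if N: "N \<in> \<M>" and y: "y \<in> Hom C R N" for N y
    proof -
      note [simp] = y[simplified]
      have No: "N \<in> Obj C" using hom_obj y by blast
      have "y \<cdot> c \<in> {h \<in> Hom C (X (Suc 0)) N. h \<cdot> g 0 = Zer C (X 0) N}"
        using X cokernelD(4)[OF \<alpha>(3)] No by simp
      then have "y \<cdot> c \<in> (\<lambda>h. h \<cdot> g (Suc 0)) ` Hom C (X (Suc (Suc 0))) N" unfolding ker[OF N] .
      then obtain z where z: "z \<in> Hom C (X (Suc (Suc 0))) N" "z \<cdot> g (Suc 0) = y \<cdot> c" by (elim imageE) metis
      have "(z \<cdot> r) \<cdot> c = y \<cdot> c" using z r(2) by simp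
      then have "z \<cdot> r = y" by (rule epi_cancel[OF cokernelD(5)[OF \<alpha>(3)]]) (use z in auto)
      then show ?thesis using z(1) by blast
    qed
    moreover have "X (Suc (Suc 0)) \<in> \<U>" using F by simp
    ultimately show ?thesis using r(1) by blast
  qed
  moreover have "R \<in> \<U>" if R: "R \<in> \<M>" "coker_into \<U> R" for R
  proof -
    have Ro: "R \<in> Obj C" using R M_obj by blast
    obtain F r where F: "F \<in> \<U>" and r: "r \<in> Hom C R F"
      and a: "\<forall>N \<in> \<M>. \<forall>y \<in> Hom C R N. \<exists>z \<in> Hom C F N. z \<cdot> r = y" using app[OF R(2)] by blast
    have "Ident C R \<in> Hom C R R" using Ro by simp
    then obtain z where z: "z \<in> Hom C F R" "z \<cdot> r = Ident C R" using a R(1) by blast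
    have "is_mono C r" by (rule mono_of_comp[of z]) (use z r Ro in auto)
    then obtain p where p: "ses C r p" using ex_ses_mono by blast
    obtain t where "is_biproduct C (Dom C r) (Cod C p) (Dom C p) r t z p"
      by (rule retraction_biproduct[OF p, of z]) (use z r sesD[OF p] in auto)
    then have "is_direct_sum C R (Cod C p) F" using r sesD(3)[OF p] unfolding is_direct_sum_def by auto
    then show ?thesis using U(1) F unfolding subcategory_def by blast
  qed
  moreover have "\<forall>A \<in> \<U>. \<forall>B \<in> \<U>. \<forall>P. is_direct_sum C A B P \<longrightarrow> P \<in> \<U>" using U(1) unfolding subcategory_def by blast
  ultimately show ?thesis unfolding pushable_def using U(2) by blast
qed

definition closed_at :: "'a set \<Rightarrow> 'a \<Rightarrow> 'a \<Rightarrow> bool"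
  where "closed_at \<U> X Y \<longleftrightarrow> (\<forall>D f. dext D f \<and> D 0 = X \<and> D (Suc d) = Y \<longrightarrow>
    equiv_to_d_extension_with_terms_in C \<M> d \<U> D f)"

text \<open>If one end is zero then the last map of the extension has a section, and the extension \<open>0 \<rightarrow> \<dots> \<rightarrow> 0 \<rightarrow> Y = Y \<rightarrow> 0\<close>
  satisfies the criterion.\<close>

lemma closed_at_zero:
  assumes U: "pushable \<U>" and X: "X \<in> \<U>" "Y \<in> \<U>" and Z: "\<And>Z. zero_object C Z \<Longrightarrow> Z \<in> \<U>"
    and z: "zero_object C X \<or> zero_object C Y"
  shows "closed_at \<U> X Y"
  unfolding closed_at_def
proof (intro allI impI, elim conjE)
  fix D f assume D: "dext D f" "D 0 = X" "D (Suc d) = Y"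
  have UM: "\<U> \<subseteq> \<M>" using U unfolding pushable_def by blast
  obtain n where n: "d = Suc n" using d by (cases d) auto
  have o: "D i \<in> Obj C" if "i \<le> Suc d" for i using dextD(3)[OF D(1) that] .
  have Yo: "Y \<in> Obj C" using o[of "Suc d"] D by simp
  have fd: "f d \<in> Hom C (D d) Y" using dextD(4)[OF D(1) order_refl] D by simp
  have "\<exists>t \<in> Hom C Y (D d). f d \<cdot> t = Ident C Y"
    using z
  proof
    assume zX: "zero_object C X"
    have "cmap C d D f D f (\<lambda>i. Ident C (D i))"
      unfolding cmap_def using o dextD(4)[OF D(1)] by simp
    moreover have "Zer C (D 1) (D 0) \<in> Hom C (D 1) (D 0)" using o by simp
    moreover have "Ident C (D 0) = Zer C (D 1) (D 0) \<cdot> f 0"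
    proof -
      have "Ident C X = Zer C X X" using zero_hom(1)[OF zX, of "Ident C X" X] zero_hom(3)[OF zX] by simp
      then show ?thesis using D dextD(4)[OF D(1), of 0] o[of 0] by simp
    qed
    ultimately obtain h where "h \<in> Hom C (D (Suc d)) (D d)" "Ident C (D (Suc d)) = f d \<cdot> h"
      by (rule factor_right[OF D(1) D(1)])
    then show ?thesis using D by auto
  next
    assume zY: "zero_object C Y"
    have "Ident C Y = Zer C Y Y" using zero_hom(1)[OF zY, of "Ident C Y" Y] Yo by simp
    then show ?thesis using fd o[of d] Yo by (intro bexI[of _ "Zer C Y (D d)"]) simp_all
  qed
  then obtain t where t: "t \<in> Hom C Y (D d)" "f d \<cdot> t = Ident C Y" by blast
  obtain O' where O': "zero_object C O'" using ex_zero_object by blast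
  obtain G g where G: "exs C (Suc n) G g" "\<forall>i < Suc n. G i = O'" "G (Suc n) = Y" "G (Suc (Suc n)) = Y" "g (Suc n) = Ident C Y"
    using ex_split_chain[OF O' Yo] by blast
  have GU: "G i \<in> \<U>" if i: "i \<le> Suc d" for i
  proof -
    consider "i < Suc n" | "i = Suc n" | "i = Suc (Suc n)" using i n by linarith
    then show ?thesis by cases (use G Z[OF O'] X in auto)
  qed
  have dG: "dext G g" unfolding dext_def using G(1) GU UM n by blast
  show "equiv_to_d_extension_with_terms_in C \<M> d \<U> D f"
    by (rule equivalent_to_terms_in[OF U D(1) _ _ dG, of t]) (use D X GU G t n in auto)
qed

text \<open>Besides the replacement \<open>G\<close> of the pullback by an extension with terms in \<open>\<U>\<close>, the conclusion records that the last
  map of \<open>G\<close> is still a weak pullback of that of \<open>D\<close>, for morphisms that start in \<open>\<M>\<close>.\<close>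

lemma closed_at_pullback:
  assumes c: "closed_at \<U> (D 0) Y'" and D: "dext D f" and y: "y \<in> Hom C Y' (D (Suc d))" and Y': "Y' \<in> \<M>"
  obtains G g t where "dext G g" "\<And>i. i \<le> Suc d \<Longrightarrow> G i \<in> \<U>" "G 0 = D 0" "G (Suc d) = Y'"
    "t \<in> Hom C (G d) (D d)" "f d \<cdot> t = y \<cdot> g d"
    "\<And>N a b. N \<in> \<M> \<Longrightarrow> a \<in> Hom C N Y' \<Longrightarrow> b \<in> Hom C N (D d) \<Longrightarrow> y \<cdot> a = f d \<cdot> b \<Longrightarrow> \<exists>a' \<in> Hom C N (G d). g d \<cdot> a' = a"
proof -
  obtain E e \<theta> where E: "dext E e" "E 0 = D 0" "E (Suc d) = Y'" "cmap C d E e D f \<theta>" "\<theta> (Suc d) = y" "\<theta> 0 = Ident C (D 0)"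
    by (rule dext_pullback[OF D y Y'])
  have "equiv_to_d_extension_with_terms_in C \<M> d \<U> E e" using c E unfolding closed_at_def by blast
  then obtain G g where G: "d_extension C \<M> d G g" "\<forall>i \<le> Suc d. G i \<in> \<U>" "end_fixing_map C d (E, e) (G, g)"
    unfolding equiv_to_d_extension_with_terms_in_def by blast
  have Gd: "dext G g" by (rule d_extension_imp_dext[OF G(1)])
  obtain \<psi> where \<psi>: "cmap C d E e G g \<psi>" "\<psi> 0 = Ident C (E 0)" "\<psi> (Suc d) = Ident C (E (Suc d))" "E 0 = G 0" "E (Suc d) = G (Suc d)"
    using G(3) unfolding end_fixing_map_iff by blast
  have dd: "d \<le> Suc d" by simp
  note [simp] = dextD(4)[OF E(1) order_refl, simplified] dextD(4)[OF D order_refl, simplified] dextD(4)[OF Gd order_refl, simplified]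
    cmapD(1)[OF \<psi>(1) dd, simplified] cmapD(1)[OF E(4) dd, simplified] E(3) y[simplified]
  have GY: "G (Suc d) = Y'" using \<psi>(5) E(3) by simp
  note [simp] = GY
  have o: "Y' \<in> Obj C" "G d \<in> Obj C" using hom_obj[OF y] dextD(3)[OF Gd dd] by simp_all
  \<comment> \<open>the equivalence goes from \<open>E\<close> to \<open>G\<close>; its top inner component is reversed up to composition with the last maps\<close>
  obtain a' where a': "a' \<in> Hom C (G d) (E d)" "e d \<cdot> a' = g d"
    by (rule lift_of_pullback[OF E(1) Gd \<psi>(1), of "g d" "G d" "Ident C (G d)"])
      (use \<psi> o dextD(2)[OF Gd dd] in auto)
  note [simp] = a'(1)[simplified]
  have E\<theta>: "f d \<cdot> \<theta> d = y \<cdot> e d" using cmapD(2)[OF E(4) order_refl] E(5) by simp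
  have t: "f d \<cdot> (\<theta> d \<cdot> a') = y \<cdot> g d" using comp_eq_ext[OF E\<theta>, of a'] a'(2) by simp
  have \<psi>e: "g d \<cdot> \<psi> d = e d" using cmapD(2)[OF \<psi>(1) order_refl] \<psi>(3) by simp
  have w: "\<exists>a'' \<in> Hom C N (G d). g d \<cdot> a'' = a"
    if N: "N \<in> \<M>" "a \<in> Hom C N Y'" "b \<in> Hom C N (D d)" "y \<cdot> a = f d \<cdot> b" for N a b
  proof -
    obtain a0 where a0: "a0 \<in> Hom C N (E d)" "e d \<cdot> a0 = a"
      by (rule lift_of_pullback[OF E(1) D E(4), of a N b]) (use E N in auto)
    have "g d \<cdot> (\<psi> d \<cdot> a0) = a" using comp_eq_ext[OF \<psi>e, of a0] a0 by simp
    then show ?thesis using a0(1) by (intro bexI[of _ "\<psi> d \<cdot> a0"]) auto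
  qed
  show ?thesis
    by (rule that[OF Gd _ _ GY _ t w]) (use G(2) \<psi>(4) E(2) in auto)
qed

text \<open>The direct sum of the two pulled back extensions serves in the criterion.\<close>

lemma closed_at_sum_right:
  assumes U: "pushable \<U>" and X: "X \<in> \<U>" and Y: "Y1 \<in> \<U>" "Y2 \<in> \<U>" "is_direct_sum C Y1 Y2 Y"
    and c: "closed_at \<U> X Y1" "closed_at \<U> X Y2"
  shows "closed_at \<U> X Y"
  unfolding closed_at_def
proof (intro allI impI, elim conjE)
  fix D f assume D: "dext D f" "D 0 = X" "D (Suc d) = Y"
  have UM: "\<U> \<subseteq> \<M>" and Us: "\<And>A B P. A \<in> \<U> \<Longrightarrow> B \<in> \<U> \<Longrightarrow> is_direct_sum C A B P \<Longrightarrow> P \<in> \<U>"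
    using U unfolding pushable_def by blast+
  obtain i1 i2 p1 p2 where b: "is_biproduct C Y1 Y2 Y i1 i2 p1 p2" using Y(3) unfolding is_direct_sum_def by blast
  have YU: "Y \<in> \<U>" using Us Y by blast
  have i1: "i1 \<in> Hom C Y1 (D (Suc d))" and i2: "i2 \<in> Hom C Y2 (D (Suc d))" using biproductD(4,5)[OF b] D(3) by simp_all
  obtain G g t where G: "dext G g" "\<And>i. i \<le> Suc d \<Longrightarrow> G i \<in> \<U>" "G (Suc d) = Y1" "t \<in> Hom C (G d) (D d)" "f d \<cdot> t = i1 \<cdot> g d"
    by (rule closed_at_pullback[of \<U> D Y1 f i1]) (use c(1) D i1 Y UM in auto)
  obtain H h s where H: "dext H h" "\<And>i. i \<le> Suc d \<Longrightarrow> H i \<in> \<U>" "H (Suc d) = Y2" "s \<in> Hom C (H d) (D d)" "f d \<cdot> s = i2 \<cdot> h d"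
    by (rule closed_at_pullback[of \<U> D Y2 f i2]) (use c(2) D i2 Y UM in auto)
  have "\<forall>i. \<exists>V I J P Q. i \<le> d \<longrightarrow> is_biproduct C (G i) (H i) V I J P Q"
    using dextD(3)[OF G(1)] dextD(3)[OF H(1)] ex_biproduct by (metis le_SucI)
  then obtain V I J P Q where b0: "\<And>i. i \<le> d \<Longrightarrow> is_biproduct C (G i) (H i) (V i) (I i) (J i) (P i) (Q i)" by metis
  let ?V = "V(Suc d := Y)" and ?I = "I(Suc d := i1)" and ?J = "J(Suc d := i2)" and ?P = "P(Suc d := p1)" and ?Q = "Q(Suc d := p2)"
  have b1: "is_biproduct C (G i) (H i) (?V i) (?I i) (?J i) (?P i) (?Q i)" if "i \<le> Suc d" for i
    using b0[of i] b G(3) H(3) that by (cases "i = Suc d") auto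
  obtain v where v: "exs C d ?V v" "\<And>i. i \<le> d \<Longrightarrow> v i \<cdot> ?I i = ?I (Suc i) \<cdot> g i" "\<And>i. i \<le> d \<Longrightarrow> v i \<cdot> ?J i = neg (?J (Suc i) \<cdot> h i)"
    by (rule exs_direct_sum[OF dextD(1)[OF G(1)] dextD(1)[OF H(1)] b1]) blast+
  have VU: "?V i \<in> \<U>" if "i \<le> Suc d" for i
    using Us[OF G(2)[OF that] H(2)[OF that]] b1[OF that] unfolding is_direct_sum_def by blast
  have VU': "V i \<in> \<U>" if "i \<le> d" for i using VU[of i] that by simp
  have dV: "dext ?V v" unfolding dext_def using v(1) VU UM by blast
  note bd = b0[OF order_refl]
  note [simp] = biproductD(4-7)[OF bd, simplified] dextD(4)[OF D(1) order_refl, simplified] D(3) G(4)[simplified] H(4)[simplified]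
    biproductD(4-7)[OF b, simplified] dextD(4)[OF G(1) order_refl, simplified] dextD(4)[OF H(1) order_refl, simplified] G(3) H(3)
  have s': "neg s \<in> Hom C (H d) (D d)" by simp
  obtain z where z: "z \<in> Hom C (V d) (D d)" "z \<cdot> I d = t" "z \<cdot> J d = neg s" "z = (t \<cdot> P d) \<boxplus> (neg s \<cdot> Q d)"
    by (rule biproduct_copair[OF bd G(4) s'])
  note [simp] = z(1)[simplified]
  have vd: "v d \<in> Hom C (V d) Y" using dextD(4)[OF dV order_refl] by simp
  have "f d \<cdot> z = v d"
  proof (rule biproduct_co_eqI[OF bd, of _ Y])
    show "(f d \<cdot> z) \<cdot> I d = v d \<cdot> I d" using z(2) v(2)[OF order_refl] G(5) by simp
    show "(f d \<cdot> z) \<cdot> J d = v d \<cdot> J d" using z(3) v(3)[OF order_refl] H(5) by simp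
  qed (use vd in auto)
  then show "equiv_to_d_extension_with_terms_in C \<M> d \<U> D f"
    by (intro equivalent_to_terms_in[OF U D(1) _ _ dV, of z]) (use D X YU VU' z(1) in auto)
qed

text \<open>Let \<open>A\<close> and \<open>B\<close> be the pushouts of \<open>D\<close> along the two projections, \<open>E\<close> the replacement of \<open>B\<close> by terms in \<open>\<U>\<close>, and
  \<open>F\<close> that of the pullback of \<open>A\<close> along \<open>E\<^sub>d \<rightarrow> Y\<close>. The composite \<open>F\<^sub>d \<rightarrow> E\<^sub>d \<rightarrow> Y\<close> annihilates both components of the
  class of \<open>D\<close>, and it is the last map of a cone over \<open>F\<close> and \<open>E\<close>. Closure at \<open>X\<^sub>1\<close> is used for the right end
  \<open>E\<^sub>d\<close>, which is why all right ends are treated at once.\<close>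

lemma closed_at_sum_left:
  assumes U: "pushable \<U>" and X: "X1 \<in> \<U>" "X2 \<in> \<U>" "is_direct_sum C X1 X2 X"
    and c: "\<And>Y. Y \<in> \<U> \<Longrightarrow> closed_at \<U> X1 Y" "\<And>Y. Y \<in> \<U> \<Longrightarrow> closed_at \<U> X2 Y" and Y: "Y \<in> \<U>"
  shows "closed_at \<U> X Y"
  unfolding closed_at_def
proof (intro allI impI, elim conjE)
  fix D f assume D: "dext D f" "D 0 = X" "D (Suc d) = Y"
  have UM: "\<U> \<subseteq> \<M>" and Us: "\<And>A B P. A \<in> \<U> \<Longrightarrow> B \<in> \<U> \<Longrightarrow> is_direct_sum C A B P \<Longrightarrow> P \<in> \<U>"
    using U unfolding pushable_def by blast+
  obtain n where n: "d = Suc n" using d by (cases d) auto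
  obtain i1 i2 p1 p2 where b: "is_biproduct C X1 X2 X i1 i2 p1 p2" using X(3) unfolding is_direct_sum_def by blast
  have XU: "X \<in> \<U>" using Us X by blast
  have p1: "p1 \<in> Hom C (D 0) X1" and p2: "p2 \<in> Hom C (D 0) X2" using biproductD(6,7)[OF b] D(2) by simp_all
  have Yo: "Y \<in> Obj C" using dextD(3)[OF D(1) order_refl] D(3) by simp
  obtain A \<alpha> \<mu> where A: "dext A \<alpha>" "A 0 = X1" "A (Suc d) = Y" "cmap C d D f A \<alpha> \<mu>" "\<mu> 0 = p1" "\<mu> (Suc d) = Ident C Y"
    by (rule dext_pushout[OF pushable_M D(1) dextD(2)[OF D(1)] p1]) (use X UM D in auto)
  obtain B \<beta> \<nu> where B: "dext B \<beta>" "B 0 = X2" "B (Suc d) = Y" "cmap C d D f B \<beta> \<nu>" "\<nu> 0 = p2" "\<nu> (Suc d) = Ident C Y"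
    by (rule dext_pushout[OF pushable_M D(1) dextD(2)[OF D(1)] p2]) (use X UM D in auto)
  obtain E e s where E: "dext E e" "\<And>i. i \<le> Suc d \<Longrightarrow> E i \<in> \<U>" "E (Suc d) = Y" "s \<in> Hom C (E d) (B d)" "\<beta> d \<cdot> s = Ident C Y \<cdot> e d"
    by (rule closed_at_pullback[of \<U> B Y \<beta> "Ident C Y"]) (use c(2)[OF Y] B Y UM Yo in auto)
  have dd: "d \<le> Suc d" by simp
  have ed: "e d \<in> Hom C (E d) Y" using dextD(4)[OF E(1) order_refl] E(3) by simp
  have EdU: "E d \<in> \<U>" using E(2) by simp
  obtain F g t where F: "dext F g" "\<And>i. i \<le> Suc d \<Longrightarrow> F i \<in> \<U>" "F (Suc d) = E d" "t \<in> Hom C (F d) (A d)" "\<alpha> d \<cdot> t = e d \<cdot> g d"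
    and wp: "\<And>N a b. N \<in> \<M> \<Longrightarrow> a \<in> Hom C N (E d) \<Longrightarrow> b \<in> Hom C N (A d) \<Longrightarrow> e d \<cdot> a = \<alpha> d \<cdot> b \<Longrightarrow> \<exists>a' \<in> Hom C N (F d). g d \<cdot> a' = a"
    by (rule closed_at_pullback[of \<U> A "E d" \<alpha> "e d"]) (use c(1)[OF EdU] A EdU UM ed in auto)
  have Fo: "F i \<in> Obj C" "E i \<in> Obj C" "A i \<in> Obj C" if "i \<le> Suc d" for i
    using dextD(3)[OF F(1) that] dextD(3)[OF E(1) that] dextD(3)[OF A(1) that] by simp_all
  have gd: "g d \<in> Hom C (F d) (E d)" using dextD(4)[OF F(1) order_refl] F(3) by simp
  note [simp] = ed[simplified] gd[simplified]
  \<comment> \<open>the pullback \<open>W\<close> of \<open>D\<close> along the composite splits: both components of its morphism to \<open>D\<close> factor at the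
    right end, hence at the left end, and the two factorizations are added up there\<close>
  let ?a = "e d \<cdot> g d"
  have "\<exists>r \<in> Hom C (F d) (D d). f d \<cdot> r = ?a"
  proof -
    have a: "?a \<in> Hom C (F d) (D (Suc d))" using D(3) by simp
    have FM: "F d \<in> \<M>" using F(2)[OF dd] UM by blast
    obtain W w \<psi> where W: "dext W w" "W 0 = D 0" "W (Suc d) = F d" "cmap C d W w D f \<psi>" "\<psi> (Suc d) = ?a" "\<psi> 0 = Ident C (D 0)"
      by (rule dext_pullback[OF D(1) a FM])
    note [simp] = dextD(4)[OF W(1), of 0, simplified] W(2)
    have Xo: "D 0 \<in> Obj C" using dextD(3)[OF D(1), of 0] by simp
    have "t \<in> Hom C (W (Suc d)) (A d)" "\<mu> (Suc d) \<cdot> \<psi> (Suc d) = \<alpha> d \<cdot> t" using F W A by simp_all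
    then obtain h1 where h1: "h1 \<in> Hom C (W 1) (A 0)" "\<mu> 0 \<cdot> \<psi> 0 = h1 \<cdot> w 0"
      by (rule factor_left[OF W(1) A(1) cmap_comp[OF dext_sequ[OF W(1)] dext_sequ[OF D(1)] dext_sequ[OF A(1)] W(4) A(4)]])
    have "\<beta> d \<cdot> (s \<cdot> g d) = ?a"
      using comp_eq_ext[OF E(5), of "g d"] E(4) dextD(4)[OF B(1) order_refl] Yo by simp
    then have "s \<cdot> g d \<in> Hom C (W (Suc d)) (B d)" "\<nu> (Suc d) \<cdot> \<psi> (Suc d) = \<beta> d \<cdot> (s \<cdot> g d)" using W B E(4) by simp_all
    then obtain h2 where h2: "h2 \<in> Hom C (W 1) (B 0)" "\<nu> 0 \<cdot> \<psi> 0 = h2 \<cdot> w 0"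
      by (rule factor_left[OF W(1) B(1) cmap_comp[OF dext_sequ[OF W(1)] dext_sequ[OF D(1)] dext_sequ[OF B(1)] W(4) B(4)]])
    note [simp] = h1(1)[simplified] h2(1)[simplified] A(2) B(2) D(2) biproductD(4-7)[OF b, simplified]
    have h12: "h1 \<cdot> w 0 = p1" "h2 \<cdot> w 0 = p2" using h1(2) h2(2) A(5) B(5) W(6) by simp_all
    have "((i1 \<cdot> h1) \<boxplus> (i2 \<cdot> h2)) \<cdot> w 0 = (i1 \<cdot> p1) \<boxplus> (i2 \<cdot> p2)" using h12 by (subst plus_comp) auto
    then have "\<psi> 0 = ((i1 \<cdot> h1) \<boxplus> (i2 \<cdot> h2)) \<cdot> w 0" using W(6) biproductD(12)[OF b] by simp
    moreover have "(i1 \<cdot> h1) \<boxplus> (i2 \<cdot> h2) \<in> Hom C (W 1) (D 0)" by simp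
    ultimately obtain r where "r \<in> Hom C (W (Suc d)) (D d)" "\<psi> (Suc d) = f d \<cdot> r"
      using factor_right[OF W(1) D(1) W(4)] by blast
    then show ?thesis using W by auto
  qed
  then obtain r where r: "r \<in> Hom C (F d) (D d)" "f d \<cdot> r = ?a" by blast
  \<comment> \<open>a morphism from \<open>E\<close>, without its last term \<open>Y\<close>, to the right part of \<open>F\<close>; its top component is the identity
    of \<open>E\<^sub>d\<close>, and the next one exists as \<open>F\<^sub>d\<close> is a weak pullback\<close>
  have nn: "n \<le> d" "n \<le> Suc d" "n < d" using n by auto
  have en: "e n \<in> Hom C (E n) (E d)" using dextD(4)[OF E(1) nn(1)] n by simp
  have een: "e d \<cdot> e n = Zer C (E n) Y" using dextD(7)[OF E(1) nn(3)] n E(3) by simp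
  obtain s' where s': "s' \<in> Hom C (E n) (F d)" "g d \<cdot> s' = e n"
  proof -
    have "e d \<cdot> e n = \<alpha> d \<cdot> Zer C (E n) (A d)" using een dextD(4)[OF A(1) order_refl] A(3) Fo[OF nn(2)] by simp
    moreover have "E n \<in> \<M>" using E(2)[OF nn(2)] UM by blast
    moreover have "Zer C (E n) (A d) \<in> Hom C (E n) (A d)" using Fo[OF nn(2)] Fo[OF dd] by simp
    ultimately show ?thesis using wp en that by blast
  qed
  have Es: "is_sequ C n E e" using dext_sequ[OF E(1)] n unfolding is_sequ_def by simp
  have Fs: "is_sequ C n (\<lambda>i. F (Suc i)) (\<lambda>i. g (Suc i))" using is_sequ_Suc dext_sequ[OF F(1)] n by simp
  obtain \<phi> where \<phi>: "cmap C n E e (\<lambda>i. F (Suc i)) (\<lambda>i. g (Suc i)) \<phi>" "\<phi> (Suc n) = Ident C (E d)" "\<phi> n = s'"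
  proof (rule cmap_extend_down[OF Es _ Fs])
    show "e (Suc i) \<cdot> e i = Zer C (E i) (E (Suc (Suc i)))" if "i < n" for i using dextD(7)[OF E(1), of i] that n by simp
    show "\<exists>x \<in> Hom C (E i) (F (Suc i)). g (Suc i) \<cdot> x = y"
      if i: "i < n" and y: "y \<in> Hom C (E i) (F (Suc (Suc i)))" "g (Suc (Suc i)) \<cdot> y = Zer C (E i) (F (Suc (Suc (Suc i))))" for i y
    proof -
      have EM: "E i \<in> \<M>" using dextD(2)[OF E(1), of i] i n by simp
      have "Suc i < d" using i n by simp
      from dext_lift[OF F(1) EM this y] show ?thesis by blast
    qed
    show "Ident C (E d) \<in> Hom C (E (Suc n)) (F (Suc (Suc n)))" using n F(3) Fo[OF dd] by simp
    show "s' \<in> Hom C (E n) (F (Suc n))" using s' n by simp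
    show "Ident C (E d) \<cdot> e n = g (Suc n) \<cdot> s'" using s' n en by simp
  qed
  have Fe: "exs C (Suc n) F g" using dextD(1)[OF F(1)] n by simp
  have mono: "is_mono C (\<phi> (Suc n))" using \<phi>(2) Fo[OF dd] by simp
  have Eex: "\<And>i. i < n \<Longrightarrow> exact C (e i) (e (Suc i))" using exsD(5)[OF dextD(1)[OF E(1)]] n by simp
  obtain V v I J P Q where bV: "\<And>i. i \<le> n \<Longrightarrow> is_biproduct C (F i) (E i) (V i) (I i) (J i) (P i) (Q i)"
    and Vn: "V (Suc n) = F (Suc n)" and V: "is_sequ C n V v" "is_mono C (v 0)" "\<And>i. i < n \<Longrightarrow> exact C (v i) (v (Suc i))"
    and vn: "v n = (g n \<cdot> P n) \<boxplus> (\<phi> n \<cdot> Q n)"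
    by (rule ex_cone[OF Fe Es dextD(5)[OF E(1)] Eex \<phi>(1) mono]) blast+
  \<comment> \<open>the cone with the two copies of \<open>E\<^sub>d\<close> cancelled, prolonged by the composite to \<open>Y\<close>\<close>
  let ?G = "V(Suc d := Y)" and ?g = "v(d := ?a)"
  note bn = bV[OF order_refl]
  have gn: "g n \<in> Hom C (F n) (F d)" using dextD(4)[OF F(1) nn(1)] n by simp
  have vh: "v n \<in> Hom C (V n) (F d)" using is_sequD(2)[OF V(1) order_refl] Vn n by simp
  note [simp] = biproductD(4-7)[OF bn, simplified] biproductD(1-3)[OF bn] gn[simplified] vh[simplified] s'(1)[simplified] \<phi>(3) en[simplified]
  have ggn: "g d \<cdot> g n = Zer C (F n) (E d)" using dextD(7)[OF F(1) nn(3)] n F(3) by simp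
  have "g d \<cdot> v n = (g d \<cdot> (g n \<cdot> P n)) \<boxplus> (g d \<cdot> (s' \<cdot> Q n))" unfolding vn \<phi>(3) by (rule comp_plus) auto
  also have "g d \<cdot> (g n \<cdot> P n) = Zer C (V n) (E d)" using comp_eq_ext[OF ggn, of "P n"] Fo[OF dd] by simp
  also have "g d \<cdot> (s' \<cdot> Q n) = e n \<cdot> Q n" using comp_eq_ext[OF s'(2), of "Q n"] by simp
  finally have gv: "g d \<cdot> v n = e n \<cdot> Q n" by simp
  have top: "exact C (v n) ?a"
  proof (rule exI_cover)
    have "e d \<cdot> (g d \<cdot> v n) = Zer C (V n) Y" unfolding gv using comp_eq_ext[OF een, of "Q n"] Yo by simp
    then show "?a \<cdot> v n = Zer C (Dom C (v n)) (Cod C ?a)" by simp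
    fix T y assume y: "y \<in> Hom C T (Dom C ?a)" "?a \<cdot> y = Zer C T (Cod C ?a)"
    note [simp] = y(1)[simplified]
    have T: "T \<in> Obj C" using hom_obj y by blast
    have x1: "exact C (e n) (e d)" using exsD(5)[OF dextD(1)[OF E(1)] nn(3)] n by simp
    obtain T1 c1 x where x: "c1 \<in> Hom C T1 T" "is_epi C c1" "x \<in> Hom C T1 (Dom C (e n))" "e n \<cdot> x = (g d \<cdot> y) \<cdot> c1"
      by (rule ex_cover[OF x1, of "g d \<cdot> y" T]) (use y(2) in auto)
    note [simp] = x(1,3)[simplified]
    have T1: "T1 \<in> Obj C" using hom_obj x(1) by blast
    let ?z = "(y \<cdot> c1) \<boxplus> neg (s' \<cdot> x)"
    have "g d \<cdot> ?z = (g d \<cdot> (y \<cdot> c1)) \<boxplus> (g d \<cdot> neg (s' \<cdot> x))" by (rule comp_plus) auto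
    moreover have "g d \<cdot> (s' \<cdot> x) = g d \<cdot> (y \<cdot> c1)" using comp_eq_ext[OF s'(2), of x] x(4) by simp
    ultimately have gz: "g d \<cdot> ?z = Zer C T1 (E d)" by simp
    have x2: "exact C (g n) (g d)" using exsD(5)[OF dextD(1)[OF F(1)] nn(3)] n by simp
    obtain T2 c2 x' where x': "c2 \<in> Hom C T2 T1" "is_epi C c2" "x' \<in> Hom C T2 (Dom C (g n))" "g n \<cdot> x' = ?z \<cdot> c2"
      by (rule ex_cover[OF x2, of ?z T1]) (use gz in auto)
    note [simp] = x'(1,3)[simplified]
    obtain u where u: "u \<in> Hom C T2 (V n)" "P n \<cdot> u = x'" "Q n \<cdot> u = x \<cdot> c2" "u = (I n \<cdot> x') \<boxplus> (J n \<cdot> (x \<cdot> c2))"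
      by (rule biproduct_pair[OF bn, of x' T2 "x \<cdot> c2"]) auto
    note [simp] = u(1)[simplified]
    have "v n \<cdot> u = ((g n \<cdot> P n) \<cdot> u) \<boxplus> ((s' \<cdot> Q n) \<cdot> u)" unfolding vn \<phi>(3) by (rule plus_comp) auto
    also have "\<dots> = (?z \<cdot> c2) \<boxplus> (s' \<cdot> (x \<cdot> c2))" using u x'(4) by simp
    also have "?z \<cdot> c2 = (y \<cdot> (c1 \<cdot> c2)) \<boxplus> neg (s' \<cdot> (x \<cdot> c2))" by (subst plus_comp) auto
    also have "((y \<cdot> (c1 \<cdot> c2)) \<boxplus> neg (s' \<cdot> (x \<cdot> c2))) \<boxplus> (s' \<cdot> (x \<cdot> c2)) =
      (y \<cdot> (c1 \<cdot> c2)) \<boxplus> (neg (s' \<cdot> (x \<cdot> c2)) \<boxplus> (s' \<cdot> (x \<cdot> c2)))" by (rule plus_assoc) auto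
    also have "\<dots> = y \<cdot> (c1 \<cdot> c2)" by simp
    finally have "v n \<cdot> u = y \<cdot> (c1 \<cdot> c2)" .
    moreover have "is_epi C (c1 \<cdot> c2)" by (rule epi_comp) (use x x' in auto)
    ultimately show "\<exists>T' e x. e \<in> Hom C T' T \<and> is_epi C e \<and> x \<in> Hom C T' (Dom C (v n)) \<and> v n \<cdot> x = y \<cdot> e"
      by (intro exI[of _ T2] exI[of _ "c1 \<cdot> c2"] exI[of _ u]) simp
  qed auto
  have Gs: "is_sequ C d ?G ?g"
    unfolding is_sequ_def
  proof (intro conjI allI impI)
    fix i
    show "i \<le> Suc d \<Longrightarrow> ?G i \<in> Obj C" using is_sequD(1)[OF V(1), of i] Yo n by (cases "i = Suc d") auto
    show "?g i \<in> Hom C (?G i) (?G (Suc i))" if i: "i \<le> d"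
    proof (cases "i = d")
      case True
      have "V d = F d" using Vn n by simp
      moreover have "?a \<in> Hom C (F d) Y" by simp
      ultimately show ?thesis using True by simp
    next
      case False
      then have "i \<le> n" using i n by simp
      then show ?thesis using is_sequD(2)[OF V(1), of i] n False by simp
    qed
  qed
  have Gex: "exact C (?g i) (?g (Suc i))" if "i < d" for i
    using V(3)[of i] top that n by (cases "i = n") auto
  have "is_epi C ?a"
  proof (rule epi_comp)
    show "is_epi C (g d)" "is_epi C (e d)" using dextD(6) F(1) E(1) by blast+
  qed simp
  then have Ge: "exs C d ?G ?g" unfolding exs_def using Gs Gex V(2) n by simp
  have GU: "?G i \<in> \<U>" if i: "i \<le> Suc d" for i
  proof -
    consider "i \<le> n" | "i = Suc n" | "i = Suc d" using i n by linarith
    then show ?thesis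
    proof cases
      case 1
      then have "is_direct_sum C (F i) (E i) (V i)" using bV[of i] unfolding is_direct_sum_def by blast
      moreover have "F i \<in> \<U>" "E i \<in> \<U>" using F(2) E(2) 1 nn by simp_all
      ultimately have "V i \<in> \<U>" using Us by blast
      moreover have "i \<noteq> Suc d" using 1 nn by simp
      ultimately show ?thesis by simp
    next
      case 2
      then show ?thesis using Vn F(2)[of "Suc n"] n by simp
    next
      case 3
      then show ?thesis using Y by simp
    qed
  qed
  have dG: "dext ?G ?g" unfolding dext_def using Ge GU UM by blast
  have Vd: "V d = F d" using Vn n by simp
  show "equiv_to_d_extension_with_terms_in C \<M> d \<U> D f"
  proof (rule equivalent_to_terms_in[OF U D(1) _ _ dG, of r])
    show "?G i \<in> \<U>" if "1 \<le> i" "i \<le> d" for i by (rule GU) (use that in simp)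
    show "r \<in> Hom C (?G d) (D d)" using r(1) Vd by simp
    show "f d \<cdot> r = ?g d" using r(2) by simp
  qed (use D XU Y in simp_all)
qed

end

theorem theorem1p3:
  fixes \<A> :: "('o, 'm, 'z) acat_scheme"
    and d :: nat
    and \<M> \<U> :: "'o set"
  assumes "d \<ge> 1"
    and "abelian_length_category \<A>"
    and "cluster_tilting \<A> d \<M>"
    and "subcategory \<A> \<U>"
    and "\<U> \<subseteq> \<M>"
    and "closed_under_d_extensions_indec_ends \<A> \<M> d \<U>"
    and "closed_under_d_quotients \<A> \<M> d \<U>"
  shows "closed_under_d_extensions \<A> \<M> d \<U>"
proof -
  interpret abelian_length_category \<A> by fact
  interpret tilting \<A> \<M> d by (rule cluster_tilting_imp_tilting) fact+
  have U: "pushable \<U>" by (rule pushable_d_quotients) fact+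
  have Uo: "\<U> \<subseteq> Obj \<A>" and Uz: "\<And>Z. zero_object \<A> Z \<Longrightarrow> Z \<in> \<U>"
    and Us: "\<And>A B P. is_direct_sum \<A> A B P \<Longrightarrow> P \<in> \<U> \<Longrightarrow> A \<in> \<U> \<and> B \<in> \<U>"
    using assms(4) unfolding subcategory_def by blast+
  \<comment> \<open>the right end is decomposed first: decomposing the left end uses closure for all right ends in \<open>\<U>\<close>\<close>
  have indec: "closed_at \<U> X Y" if "indecomposable \<A> X" "X \<in> \<U>" "Y \<in> \<U>" for X Y
  proof -
    have "Y \<in> Obj \<A>" using that(3) Uo by blast
    then have "Y \<in> \<U> \<longrightarrow> closed_at \<U> X Y"
    proof (rule indecomposable_induct[where Q = "\<lambda>Y. Y \<in> \<U> \<longrightarrow> closed_at \<U> X Y"])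
      fix Y assume "zero_object \<A> Y"
      then show "Y \<in> \<U> \<longrightarrow> closed_at \<U> X Y" using closed_at_zero[OF U that(2)] Uz by blast
    next
      fix Y assume "indecomposable \<A> Y"
      then show "Y \<in> \<U> \<longrightarrow> closed_at \<U> X Y"
        using assms(6) that(1,2) dext_imp_d_extension
        unfolding closed_at_def closed_under_d_extensions_indec_ends_def by blast
    next
      fix Y1 Y2 Y assume "is_direct_sum \<A> Y1 Y2 Y" "Y1 \<in> \<U> \<longrightarrow> closed_at \<U> X Y1" "Y2 \<in> \<U> \<longrightarrow> closed_at \<U> X Y2"
      then show "Y \<in> \<U> \<longrightarrow> closed_at \<U> X Y" using closed_at_sum_right[OF U that(2)] Us by blast
    qed
    then show ?thesis using that by blast
  qed
  have all: "closed_at \<U> X Y" if "X \<in> \<U>" "Y \<in> \<U>" for X Y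
  proof -
    have "X \<in> Obj \<A>" using that Uo by blast
    then have "X \<in> \<U> \<longrightarrow> (\<forall>Y \<in> \<U>. closed_at \<U> X Y)"
    proof (rule indecomposable_induct[where Q = "\<lambda>X. X \<in> \<U> \<longrightarrow> (\<forall>Y \<in> \<U>. closed_at \<U> X Y)"])
      fix X assume "zero_object \<A> X"
      then show "X \<in> \<U> \<longrightarrow> (\<forall>Y \<in> \<U>. closed_at \<U> X Y)" using closed_at_zero[OF U] Uz by blast
    next
      fix X assume "indecomposable \<A> X"
      then show "X \<in> \<U> \<longrightarrow> (\<forall>Y \<in> \<U>. closed_at \<U> X Y)" using indec by blast
    next
      fix X1 X2 X assume "is_direct_sum \<A> X1 X2 X" "X1 \<in> \<U> \<longrightarrow> (\<forall>Y \<in> \<U>. closed_at \<U> X1 Y)"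
        "X2 \<in> \<U> \<longrightarrow> (\<forall>Y \<in> \<U>. closed_at \<U> X2 Y)"
      then show "X \<in> \<U> \<longrightarrow> (\<forall>Y \<in> \<U>. closed_at \<U> X Y)" using closed_at_sum_left[OF U] Us by blast
    qed
    then show ?thesis using that by blast
  qed
  show ?thesis
    unfolding closed_under_d_extensions_def
    using all d_extension_imp_dext unfolding closed_at_def by blast
qed

end
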